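(* Let $\mu>0$, $\nu>0$, $\alpha>1/2$, $f\in V^{\alpha-1}$, and let $\mathcal{Y}^\mu_\alpha=L_2(-\mu,0,V^{1+\alpha})\times V^\alpha$. For $t\ge0$ let $S(t):\mathcal{Y}^\mu_\alpha\to\mathcal{Y}^\mu_\alpha$ be given by $S(t)(\phi,u_0)=(u^\mu_t,u^\mu(t))$, where $u^\mu$ is the weak solution of the 3D Navier-Stokes equations with constant delay $\mu$ corresponding to $(\phi,u_0)$ (as defined in the context) and $u^\mu_t(s)=u^\mu(t+s)$, $s\in(-\mu,0)$. Then, for every $t\ge0$, $S(t)$ is continuous on $\mathcal{Y}^\mu_\alpha$.
   Context: Function spaces. Fix $L>0$ and let $\mathbb{T}^3_L$ be the three-dimensional torus of side length $L$. For $s\in\mathbb{R}$, $V^s$ is the space of real $L$-periodic divergence-free vector fields (distributions) $u=\sum_{\zeta}e^{i(x,\zeta)}\hat u(\zeta)$, $\zeta\in\frac{2\pi}{L}\mathbb{Z}^3$, with $\hat u(0)=0$, $\hat u(-\zeta)=\overline{\hat u(\zeta)}$, and finite norm $\|u\|_s=\big(L^3\sum_{\zeta\neq0}|\zeta|^{2s}|\hat u(\zeta)|^2\big)^{1/2}$. $(\cdot,\cdot)$ is the scalar product of $V^0$ (the $L_2$ scalar product). The Stokes operator is $A=-\Delta$, so $\|u\|_s=\|A^{s/2}u\|_0$. $V^{-s}$ is the dual of $V^s$, and $\langle\cdot,\cdot\rangle$ denotes the duality pairing between $V^s$ and $V^{-s}$ (extending $(\cdot,\cdot)$) for any $s$.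 Nonlinearity. $b(u,v,w)=\sum_{i,j=1}^3\int_{\mathbb{T}^3_L}u_j\frac{\partial v_i}{\partial x_j}w_i\,dx$, extended by continuity from trigonometric polynomials to $V^{s_1}\times V^{s_2+1}\times V^{s_3}$ whenever either $s_i+s_j\ge0$ for $i\ne j$ and $s_1+s_2+s_3>3/2$, or $s_i+s_j>0$ for $i\neq j$ and $s_1+s_2+s_3\ge3/2$. $B:V^{s_1}\times V^{s_2+1}\to V^{-s_3}$ is defined by $\langle B(u,v),w\rangle=b(u,v,w)$. Weak solution of the delay equation. The equation is $u'(t)+\nu Au(t)+B(u(t-\mu),u(t))=f$ for $t\ge0$, with $u(t)=\phi(t)$ for $t\in[-\mu,0)$ and $u(0)=u_0$. For $T>0$, a weak solution on $[-\mu,T]$ is a function $u^\mu\in L_2(-\mu,T,V^{1+\alpha})$ with $u^\mu(0)=u_0$, $u^\mu(t)=\phi(t)$ for (almost all) $t\in[-\mu,0)$, such that for every $v\in V^{\alpha+1}$ and every test function $\varphi\in C_0^\infty([0,T])$ (smooth, compactly supported in $(0,T)$), $$-\int_0^T\langle u^\mu(r),v\rangle\varphi'(r)\,dr+\nu\int_0^T\langle A^{1/2}u^\mu(r),A^{1/2}v\rangle\varphi(r)\,dr+\int_0^T\langle B(u^\mu(r-\mu),u^\mu(r)),v\rangle\varphi(r)\,dr=\int_0^T\langle f,v\rangle\varphi(r)\,dr.$$ For every $T>0$ such a weak solution exists and is unique, and its restriction to $[0,T]$ has a representative in $C([0,T],V^\alpha)$, which is the one used to define $u^\mu(t)$ pointwise;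 thus $u^\mu$ is defined on $[-\mu,\infty)$. $\mathcal{Y}^\mu_\alpha$ carries the product Hilbert space topology. *)

theory Defs
  imports "HOL-Analysis.Analysis"
begin

text \<open>A periodic vector distribution is identified with its family of Fourier coefficients.
  The index \<open>k\<close> stands for the frequency \<open>\<zeta> = (2 \<pi> / L) k\<close>.\<close>

type_synonym field = "int^3 \<Rightarrow> complex^3"

definition freq :: "real \<Rightarrow> int^3 \<Rightarrow> real^3" where
  "freq L k = (\<chi> i. 2 * pi / L * of_int (k $ i))"

definition solenoidal :: "real \<Rightarrow> field set" where
  "solenoidal L = {u. u 0 = 0 \<and>
     (\<forall>k i. u (- k) $ i = cnj (u k $ i)) \<and>
     (\<forall>k. (\<Sum>i\<in>UNIV. complex_of_real (freq L k $ i) * u k $ i) = 0)}"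

definition Vsp :: "real \<Rightarrow> real \<Rightarrow> field set" where
  "Vsp L s = {u \<in> solenoidal L.
     (\<lambda>k. norm (freq L k) powr (2 * s) * (norm (u k))\<^sup>2) summable_on (- {0})}"

definition vnorm :: "real \<Rightarrow> real \<Rightarrow> field \<Rightarrow> real" where
  "vnorm L s u =
     sqrt (L ^ 3 * (\<Sum>\<^sub>\<infinity>k\<in>- {0}. norm (freq L k) powr (2 * s) * (norm (u k))\<^sup>2))"

definition vdist :: "real \<Rightarrow> real \<Rightarrow> field \<Rightarrow> field \<Rightarrow> real" where
  "vdist L s u v = vnorm L s (\<lambda>k. u k - v k)"

text \<open>Duality pairing of \<open>V\<^sup>s\<close> and \<open>V\<^sup>-\<^sup>s\<close>. On \<open>complex^3\<close> the library's \<open>\<bullet>\<close> is the real part of the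
  Hermitian product, so by Parseval this extends the \<open>L\<^sub>2\<close> scalar product of real fields.\<close>

definition pairing :: "real \<Rightarrow> field \<Rightarrow> field \<Rightarrow> real" where
  "pairing L u v = L ^ 3 * (\<Sum>\<^sub>\<infinity>k. u k \<bullet> v k)"

text \<open>The power \<open>A\<^sup>\<sigma>\<close> of the Stokes operator \<open>A = - \<Delta>\<close>, which has the symbol \<open>\<bar>\<zeta>\<bar>\<^sup>2\<close>.\<close>

definition stokes_pow :: "real \<Rightarrow> real \<Rightarrow> field \<Rightarrow> field" where
  "stokes_pow L \<sigma> u = (\<lambda>k. (norm (freq L k) powr (2 * \<sigma>)) *\<^sub>R u k)"

definition trig_polys :: "real \<Rightarrow> field set" where
  "trig_polys L = {u \<in> solenoidal L. finite {k. u k \<noteq> 0}}"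

text \<open>The value at \<open>x\<close> of a trigonometric polynomial. For members of \<open>solenoidal L\<close> the sum is
  already real.\<close>

definition trig_eval :: "real \<Rightarrow> field \<Rightarrow> real^3 \<Rightarrow> real^3" where
  "trig_eval L u x =
     (\<chi> i. Re (\<Sum>k | u k \<noteq> 0. exp (\<i> * complex_of_real (x \<bullet> freq L k)) * u k $ i))"

definition b_trig :: "real \<Rightarrow> field \<Rightarrow> field \<Rightarrow> field \<Rightarrow> real" where
  "b_trig L u v w = (\<Sum>i\<in>UNIV. \<Sum>j\<in>UNIV.
     integral (cbox 0 (\<chi> _. L)) (\<lambda>x.
       trig_eval L u x $ j
       * frechet_derivative (\<lambda>y. trig_eval L v y $ i) (at x) (axis j 1)
       * trig_eval L w x $ i))"

text \<open>Extension by continuity of \<open>b\<close> to \<open>V\<^sup>s\<^sup>1 \<times> V\<^sup>s\<^sup>2\<^sup>+\<^sup>1 \<times> V\<^sup>s\<^sup>3\<close>; meaningful for admissible exponents,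
  where the value does not depend on their choice.\<close>

definition b_form :: "real \<Rightarrow> real \<Rightarrow> real \<Rightarrow> real \<Rightarrow> field \<Rightarrow> field \<Rightarrow> field \<Rightarrow> real" where
  "b_form L s1 s2 s3 u v w = (THE \<beta>. \<forall>us vs ws.
     (\<forall>n. us n \<in> trig_polys L \<and> vs n \<in> trig_polys L \<and> ws n \<in> trig_polys L) \<longrightarrow>
     (\<lambda>n. vdist L s1 (us n) u) \<longlonglongrightarrow> 0 \<longrightarrow>
     (\<lambda>n. vdist L (s2 + 1) (vs n) v) \<longlonglongrightarrow> 0 \<longrightarrow>
     (\<lambda>n. vdist L s3 (ws n) w) \<longlonglongrightarrow> 0 \<longrightarrow>
     (\<lambda>n. b_trig L (us n) (vs n) (ws n)) \<longlonglongrightarrow> \<beta>)"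

text \<open>Bochner spaces \<open>L\<^sub>2(a,b,V\<^sup>s)\<close>. Since \<open>V\<^sup>s\<close> is a set depending on \<open>s\<close> rather than a type, strong
  measurability is written out: almost everywhere limit in \<open>V\<^sup>s\<close> of \<open>V\<^sup>s\<close>-valued simple functions.
  Only the values on \<open>(a,b)\<close> matter.\<close>

definition strongly_measurable ::
    "real \<Rightarrow> real \<Rightarrow> real \<Rightarrow> real \<Rightarrow> (real \<Rightarrow> field) \<Rightarrow> bool" where
  "strongly_measurable L s a b u \<longleftrightarrow>
     (AE t in lebesgue_on {a<..<b}. u t \<in> Vsp L s) \<and>
     (\<exists>g. (\<forall>n::nat. simple_function (lebesgue_on {a<..<b}) (g n) \<and> (\<forall>t\<in>{a<..<b}. g n t \<in> Vsp L s)) \<and>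
          (AE t in lebesgue_on {a<..<b}. (\<lambda>n. vdist L s (g n t) (u t)) \<longlonglongrightarrow> 0))"

definition L2_fun :: "real \<Rightarrow> real \<Rightarrow> real \<Rightarrow> real \<Rightarrow> (real \<Rightarrow> field) set" where
  "L2_fun L s a b = {u. strongly_measurable L s a b u \<and>
     integrable (lebesgue_on {a<..<b}) (\<lambda>t. (vnorm L s (u t))\<^sup>2)}"

definition L2_rel :: "real \<Rightarrow> real \<Rightarrow> real \<Rightarrow> real \<Rightarrow> ((real \<Rightarrow> field) \<times> (real \<Rightarrow> field)) set" where
  "L2_rel L s a b = {(u, v). u \<in> L2_fun L s a b \<and> v \<in> L2_fun L s a b \<and>
     (AE t in lebesgue_on {a<..<b}. u t = v t)}"

definition L2_space :: "real \<Rightarrow> real \<Rightarrow> real \<Rightarrow> real \<Rightarrow> (real \<Rightarrow> field) set set" where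
  "L2_space L s a b = L2_fun L s a b // L2_rel L s a b"

definition rep :: "(real \<Rightarrow> field) set \<Rightarrow> real \<Rightarrow> field" where
  "rep \<Phi> = (SOME \<phi>. \<phi> \<in> \<Phi>)"

definition L2_dist ::
    "real \<Rightarrow> real \<Rightarrow> real \<Rightarrow> real \<Rightarrow> (real \<Rightarrow> field) set \<Rightarrow> (real \<Rightarrow> field) set \<Rightarrow> real" where
  "L2_dist L s a b \<Phi> \<Psi> =
     sqrt (LINT t|lebesgue_on {a<..<b}. (vdist L s (rep \<Phi> t) (rep \<Psi> t))\<^sup>2)"

type_synonym state = "(real \<Rightarrow> field) set \<times> field"

definition Y_space :: "real \<Rightarrow> real \<Rightarrow> real \<Rightarrow> state set" where
  "Y_space L \<mu> \<alpha> = L2_space L (1 + \<alpha>) (- \<mu>) 0 \<times> Vsp L \<alpha>"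

definition Y_dist :: "real \<Rightarrow> real \<Rightarrow> real \<Rightarrow> state \<Rightarrow> state \<Rightarrow> real" where
  "Y_dist L \<mu> \<alpha> y z =
     sqrt ((L2_dist L (1 + \<alpha>) (- \<mu>) 0 (fst y) (fst z))\<^sup>2 + (vdist L \<alpha> (snd y) (snd z))\<^sup>2)"

definition Y_topology :: "real \<Rightarrow> real \<Rightarrow> real \<Rightarrow> state topology" where
  "Y_topology L \<mu> \<alpha> = Metric_space.mtopology (Y_space L \<mu> \<alpha>) (Y_dist L \<mu> \<alpha>)"

text \<open>\<open>C\<^sub>0\<^sup>\<infinity>\<close> functions with compact support in \<open>(0,T)\<close>, extended by zero to the real line.\<close>

definition test_functions :: "real \<Rightarrow> (real \<Rightarrow> real) set" where
  "test_functions T = {\<psi>. (\<forall>n. (deriv ^^ n) \<psi> differentiable_on UNIV) \<and>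
     compact (closure {x. \<psi> x \<noteq> 0}) \<and> closure {x. \<psi> x \<noteq> 0} \<subseteq> {0<..<T}}"

text \<open>In the third integral, \<open>b_form\<close> is \<open>\<langle>B(u(r - \<mu>),u(r)),v\<rangle>\<close> with all three arguments in
  \<open>V\<^sup>1\<^sup>+\<^sup>\<alpha>\<close>.\<close>

definition weak_solution_upto ::
    "real \<Rightarrow> real \<Rightarrow> real \<Rightarrow> real \<Rightarrow> field \<Rightarrow> (real \<Rightarrow> field) \<Rightarrow> field \<Rightarrow> real \<Rightarrow> (real \<Rightarrow> field) \<Rightarrow> bool"
  where
  "weak_solution_upto L \<mu> \<nu> \<alpha> f \<phi> u0 T u \<longleftrightarrow>
     u \<in> L2_fun L (1 + \<alpha>) (- \<mu>) T \<and>
     u 0 = u0 \<and>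
     (AE t in lebesgue_on {- \<mu><..<0}. u t = \<phi> t) \<and>
     (\<forall>v\<in>Vsp L (\<alpha> + 1). \<forall>\<psi>\<in>test_functions T.
        - (LINT r|lebesgue_on {0<..<T}. pairing L (u r) v * deriv \<psi> r)
        + \<nu> * (LINT r|lebesgue_on {0<..<T}.
                 pairing L (stokes_pow L (1/2) (u r)) (stokes_pow L (1/2) v) * \<psi> r)
        + (LINT r|lebesgue_on {0<..<T}.
             b_form L (1 + \<alpha>) \<alpha> (1 + \<alpha>) (u (r - \<mu>)) (u r) v * \<psi> r)
        = (LINT r|lebesgue_on {0<..<T}. pairing L f v * \<psi> r))"

text \<open>The solution on \<open>[-\<mu>,\<infinity>)\<close>, taken in its representative that is continuous from \<open>[0,\<infinity>)\<close> to
  \<open>V\<^sup>\<alpha>\<close>.\<close>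

definition weak_solution ::
    "real \<Rightarrow> real \<Rightarrow> real \<Rightarrow> real \<Rightarrow> field \<Rightarrow> (real \<Rightarrow> field) \<Rightarrow> field \<Rightarrow> (real \<Rightarrow> field) \<Rightarrow> bool"
  where
  "weak_solution L \<mu> \<nu> \<alpha> f \<phi> u0 u \<longleftrightarrow>
     (\<forall>T>0. weak_solution_upto L \<mu> \<nu> \<alpha> f \<phi> u0 T u) \<and>
     (\<forall>t\<ge>0. u t \<in> Vsp L \<alpha> \<and> ((\<lambda>r. vdist L \<alpha> (u r) (u t)) \<longlongrightarrow> 0) (at t within {0..}))"

text \<open>Two solutions may differ on a null set of \<open>[-\<mu>,0)\<close> and arbitrarily before \<open>-\<mu>\<close>, so it is the
  resulting state, not the function \<open>u\<close>, that is uniquely determined.\<close>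

definition solution_map ::
    "real \<Rightarrow> real \<Rightarrow> real \<Rightarrow> real \<Rightarrow> field \<Rightarrow> real \<Rightarrow> state \<Rightarrow> state" where
  "solution_map L \<mu> \<nu> \<alpha> f t y = (THE z. \<exists>u.
     weak_solution L \<mu> \<nu> \<alpha> f (rep (fst y)) (snd y) u \<and>
     z = (L2_rel L (1 + \<alpha>) (- \<mu>) 0 `` {\<lambda>s. u (t + s)}, u t))"

end

theory Submission imports Defs begin

text \<open>In Fourier variables the equation is a coupled system of scalar linear equations with rates
  \<open>\<nu> \<bar>\<zeta>\<bar>\<^sup>2\<close>, and a weak solution is the same thing as a mild one: testing with a single pair of modes
  gives Duhamel's formula for each coefficient, and conversely. The estimate
  \<open>\<parallel>B(w,u)\<parallel>\<^sub>\<alpha>\<^sub>-\<^sub>1 \<le> C \<parallel>w\<parallel>\<^sub>1\<^sub>+\<^sub>\<alpha> \<parallel>u\<parallel>\<^sub>\<alpha>\<close> makes the equation with a prescribed drift \<open>w\<close> in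
  \<open>L\<^sub>2(0,T,V\<^sup>1\<^sup>+\<^sup>\<alpha>)\<close> solvable by iteration, and Gronwall's inequality with the integrable weight
  \<open>\<parallel>w\<parallel>\<^sup>2\<close> gives a bound for the difference of two solutions by the differences of the data and of the
  drifts, in \<open>C([0,T],V\<^sup>\<alpha>) \<inter> L\<^sub>2(0,T,V\<^sup>1\<^sup>+\<^sup>\<alpha>)\<close>. On each interval of length \<open>\<mu>\<close> the delayed field is known
  from the previous one, so existence, uniqueness and local Lipschitz dependence on the initial state
  follow interval by interval.\<close>

text \<open>\<open>solution_map\<close> and \<open>b_form\<close> are description operators, and the
  topology comes from a distance between chosen representatives, so continuity can only be
  approached after existence, uniqueness, density of trigonometric polynomials and the metric
  axioms. Energies are extended nonnegative sums; Tonelli, Fatou and Gronwall then apply before any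
  finiteness is known. The condition \<alpha> > 1/2 makes
  \<open>|\<zeta>| powr (- 2 - 2 * \<alpha>)\<close> summable over a three-dimensional lattice. This
  places the nonlinear term at exponent \<alpha> - 1, from where the heat semigroup recovers both
  the supremum bound at \<alpha> and the square-integrable bound at 1 + \<alpha>. The drift enters
  Gronwall through its own energy, which has no bound uniform over all states. Hence only nearby
  states are compared: within unit \<open>diff_energy\<close> the drift of the perturbed solution is
  controlled by that of the reference solution, and the Lipschitz constant depends on the reference
  state. Bochner classes are replaced by Borel trajectories that are solenoidal at every time, so
  that measurability can be argued coefficient by coefficient.\<close>

definition wave :: "real \<Rightarrow> int^3 \<Rightarrow> real" where
  "wave L k = norm (freq L k)"

text \<open>The squared norm of exponent s without the volume factor \<open>L ^ 3\<close>, valued in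
  \<open>ennreal\<close> so that divergence is a value. Summing over all k is harmless:
  \<open>0 powr x = 0\<close>, hence the zero mode has weight 0 for every s, also a negative
  one.\<close>

definition en :: "real \<Rightarrow> real \<Rightarrow> field \<Rightarrow> ennreal" where
  "en L s u = (\<integral>\<^sup>+k. ennreal (wave L k powr (2 * s) * (norm (u k))\<^sup>2) \<partial>count_space UNIV)"

section \<open>Moduli of the lattice frequencies\<close>

lemma freq_zero [simp]: "freq L 0 = 0"
  by (simp add: freq_def vec_eq_iff)

lemma freq_minus: "freq L (- k) = - freq L k"
  by (simp add: freq_def vec_eq_iff)

lemma freq_add: "freq L (j + k) = freq L j + freq L k"
  by (simp add: freq_def vec_eq_iff algebra_simps)

lemma freq_diff: "freq L (j - k) = freq L j - freq L k"
  by (simp add: freq_def vec_eq_iff algebra_simps)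

lemma wave_zero [simp]: "wave L 0 = 0"
  by (simp add: wave_def)

lemma wave_nonneg [simp]: "wave L k \<ge> 0"
  by (simp add: wave_def)

lemma wave_minus [simp]: "wave L (- k) = wave L k"
  by (simp add: wave_def freq_minus)

lemma wave_triangle: "wave L k \<le> wave L (k - j) + wave L j"
  unfolding wave_def freq_diff by (metis diff_add_cancel norm_triangle_ineq)

lemma wave_component: "L > 0 \<Longrightarrow> 2 * pi / L * \<bar>of_int (k $ i)\<bar> \<le> wave L k"
  using component_le_norm_cart[of "freq L k" i] by (simp add: wave_def freq_def abs_mult)

text \<open>Spectral gap: a nonzero integer vector has a component of modulus at least one. All
  comparisons between exponents rest on it.\<close>

lemma wave_ge:
  assumes "L > 0" "k \<noteq> 0"
  shows "2 * pi / L \<le> wave L k"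
proof -
  obtain i where "k $ i \<noteq> 0"
    using assms(2) by (auto simp: vec_eq_iff)
  then have "(1::real) \<le> \<bar>of_int (k $ i)\<bar>"
    by linarith
  then have "2 * pi / L * 1 \<le> 2 * pi / L * \<bar>of_int (k $ i)\<bar>"
    using assms by (intro mult_left_mono) auto
  then show ?thesis
    using wave_component[OF assms(1), of k i] by simp
qed

lemma wave_pos: "L > 0 \<Longrightarrow> k \<noteq> 0 \<Longrightarrow> 0 < wave L k"
  using wave_ge[of L k] by (smt (verit) divide_pos_pos pi_gt_zero)

lemma wave_eq_0_iff: "L > 0 \<Longrightarrow> wave L k = 0 \<longleftrightarrow> k = 0"
  using wave_pos[of L k] by fastforce

section \<open>Infinite sums as integrals over counting measure, and energies\<close>

lemma summable_on_iff_nn_integral: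
  fixes f :: "'a \<Rightarrow> real"
  assumes "\<And>x. x \<in> A \<Longrightarrow> 0 \<le> f x"
  shows "f summable_on A \<longleftrightarrow> (\<integral>\<^sup>+x. ennreal (f x) \<partial>count_space A) < \<infinity>"
proof -
  have "f summable_on A \<longleftrightarrow> (\<lambda>x. norm (f x)) summable_on A"
    using assms by (intro summable_on_cong) auto
  also have "\<dots> \<longleftrightarrow> integrable (count_space A) f"
    using abs_summable_equivalent[of f A] by (simp only: abs_summable_on_def)
  also have "\<dots> \<longleftrightarrow> (\<integral>\<^sup>+x. ennreal (norm (f x)) \<partial>count_space A) < \<infinity>"
    by (simp add: integrable_iff_bounded)
  also have "(\<integral>\<^sup>+x. ennreal (norm (f x)) \<partial>count_space A) = (\<integral>\<^sup>+x. ennreal (f x) \<partial>count_space A)"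
    using assms by (intro nn_integral_cong) auto
  finally show ?thesis .
qed

lemma infsum_nn_integral:
  fixes f :: "'a \<Rightarrow> real"
  assumes "\<And>x. x \<in> A \<Longrightarrow> 0 \<le> f x" "f summable_on A"
  shows "ennreal (infsum f A) = (\<integral>\<^sup>+x. ennreal (f x) \<partial>count_space A)"
proof -
  have "(\<lambda>x. norm (f x)) summable_on A"
    using assms summable_on_cong[of A "\<lambda>x. norm (f x)" f] by auto
  then have int: "integrable (count_space A) f"
    using abs_summable_equivalent[of f A] by (simp only: abs_summable_on_def)
  have "infsum f A = integral\<^sup>L (count_space A) f"
    using infsetsum_infsum[of f A] int by (simp add: infsetsum_def abs_summable_on_def)
  then show ?thesis
    using nn_integral_eq_integral[OF int] assms by (auto simp: AE_count_space)
qed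

lemma infsum_eq_integral:
  fixes f :: "'a \<Rightarrow> real"
  assumes "integrable (count_space A) f"
  shows "infsum f A = integral\<^sup>L (count_space A) f"
  using infsetsum_infsum[of f A] assms by (simp add: infsetsum_def abs_summable_on_def)

lemma en_eq_punctured:
  "en L s u = (\<integral>\<^sup>+k. ennreal (norm (freq L k) powr (2 * s) * (norm (u k))\<^sup>2) \<partial>count_space (- {0}))"
  unfolding en_def
  by (subst nn_integral_count_space_indicator) (auto intro!: nn_integral_cong simp: wave_def indicator_def)

lemma Vsp_iff: "u \<in> Vsp L s \<longleftrightarrow> u \<in> solenoidal L \<and> en L s u < \<infinity>"
  unfolding Vsp_def en_eq_punctured by (subst summable_on_iff_nn_integral [symmetric]) auto

lemma vnorm_nonneg [simp]: "L > 0 \<Longrightarrow> 0 \<le> vnorm L s u"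
  unfolding vnorm_def by (auto intro!: infsum_nonneg mult_nonneg_nonneg)

lemma vnorm_squared:
  assumes "L > 0" "en L s u < \<infinity>"
  shows "ennreal ((vnorm L s u)\<^sup>2) = ennreal (L ^ 3) * en L s u"
proof -
  let ?f = "\<lambda>k. norm (freq L k) powr (2 * s) * (norm (u k))\<^sup>2"
  have sm: "?f summable_on - {0}"
    using assms by (subst summable_on_iff_nn_integral) (auto simp: en_eq_punctured)
  have nn: "0 \<le> infsum ?f (- {0})"
    by (intro infsum_nonneg) auto
  have "(vnorm L s u)\<^sup>2 = L ^ 3 * infsum ?f (- {0})"
    unfolding vnorm_def using nn assms(1) by simp
  then have "ennreal ((vnorm L s u)\<^sup>2) = ennreal (L ^ 3) * ennreal (infsum ?f (- {0}))"
    using nn assms(1) by (simp add: ennreal_mult)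
  then show ?thesis
    using infsum_nn_integral[OF _ sm] by (simp add: en_eq_punctured)
qed

lemma ennreal_two_power_ineq:
  fixes x y z :: real
  assumes "0 \<le> x" "x \<le> y + z"
  shows "x\<^sup>2 \<le> 2 * y\<^sup>2 + 2 * z\<^sup>2"
proof -
  have "x\<^sup>2 \<le> (y + z)\<^sup>2"
    using assms by (intro power_mono) auto
  also have "\<dots> \<le> 2 * y\<^sup>2 + 2 * z\<^sup>2"
    using zero_le_power2[of "y - z"] by (simp add: power2_sum power2_diff algebra_simps)
  finally show ?thesis .
qed

text \<open>The factors come from
  \<open>(y + z)\<^sup>2 \<le> 2 * y\<^sup>2 + 2 * z\<^sup>2\<close>. As a crude substitute for the
  triangle inequality it costs constants but works for infinite energies too. The hypothesis on
  norms alone covers sums, differences and majorants.\<close>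

lemma en_add_le: 
  assumes "\<And>k. norm (u k) \<le> norm (v k) + norm (w k)"
  shows "en L s u \<le> 2 * en L s v + 2 * en L s w"
proof -
  have "en L s u \<le> (\<integral>\<^sup>+k. 2 * ennreal (wave L k powr (2 * s) * (norm (v k))\<^sup>2)
      + 2 * ennreal (wave L k powr (2 * s) * (norm (w k))\<^sup>2) \<partial>count_space UNIV)"
    unfolding en_def
  proof (intro nn_integral_mono)
    fix k
    have "wave L k powr (2 * s) * (norm (u k))\<^sup>2
      \<le> wave L k powr (2 * s) * (2 * (norm (v k))\<^sup>2 + 2 * (norm (w k))\<^sup>2)"
      by (intro mult_left_mono ennreal_two_power_ineq assms) auto
    also have "\<dots> = 2 * (wave L k powr (2 * s) * (norm (v k))\<^sup>2) + 2 * (wave L k powr (2 * s) * (norm (w k))\<^sup>2)"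
      by (simp add: algebra_simps)
    finally have "ennreal (wave L k powr (2 * s) * (norm (u k))\<^sup>2) \<le>
      ennreal (2 * (wave L k powr (2 * s) * (norm (v k))\<^sup>2) + 2 * (wave L k powr (2 * s) * (norm (w k))\<^sup>2))"
      by (rule ennreal_leI)
    also have "\<dots> = 2 * ennreal (wave L k powr (2 * s) * (norm (v k))\<^sup>2)
      + 2 * ennreal (wave L k powr (2 * s) * (norm (w k))\<^sup>2)"
      by (simp add: ennreal_plus ennreal_mult)
    finally show "ennreal (wave L k powr (2 * s) * (norm (u k))\<^sup>2) \<le> 2 * ennreal (wave L k powr (2 * s) * (norm (v k))\<^sup>2)
      + 2 * ennreal (wave L k powr (2 * s) * (norm (w k))\<^sup>2)" .
  qed
  also have "\<dots> = 2 * en L s v + 2 * en L s w"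
    unfolding en_def by (subst nn_integral_add) (auto simp: nn_integral_cmult)
  finally show ?thesis .
qed

lemma en_mono:
  assumes "\<And>k. norm (u k) \<le> norm (v k)"
  shows "en L s u \<le> en L s v"
  unfolding en_def
  by (intro nn_integral_mono ennreal_leI mult_left_mono power_mono assms) auto

lemma en_cong_norm: "(\<And>k. norm (u k) = norm (v k)) \<Longrightarrow> en L s u = en L s v"
  by (simp add: en_def)

lemma en_zero_iff:
  assumes "L > 0"
  shows "en L s u = 0 \<longleftrightarrow> (\<forall>k. k \<noteq> 0 \<longrightarrow> u k = 0)"
proof -
  have "en L s u = 0 \<longleftrightarrow> (\<forall>k. ennreal (wave L k powr (2 * s) * (norm (u k))\<^sup>2) = 0)"
    unfolding en_def by (subst nn_integral_0_iff) (auto simp: null_sets_count_space emeasure_count_space_eq_0)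
  also have "\<dots> \<longleftrightarrow> (\<forall>k. k \<noteq> 0 \<longrightarrow> u k = 0)"
  proof -
    have "ennreal (wave L k powr (2 * s) * (norm (u k))\<^sup>2) = 0 \<longleftrightarrow> (k \<noteq> 0 \<longrightarrow> u k = 0)" for k
      using wave_eq_0_iff[OF assms, of k] wave_nonneg[of L k] by (auto simp: ennreal_eq_0_iff mult_le_0_iff)
    then show ?thesis by simp
  qed
  finally show ?thesis .
qed

lemma en_mode_le:
  fixes u :: field
  shows "ennreal (wave L k powr (2 * s) * (norm (u k))\<^sup>2) \<le> en L s u"
  unfolding en_def by (rule nn_integral_ge_point) simp

text \<open>The constant is the spectral gap raised to the nonpositive power
  \<open>2 * (s - t)\<close>; it dominates the same power of every nonzero frequency.\<close>

lemma en_exponent_mono: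
  assumes "L > 0" "s \<le> t"
  shows "\<exists>C\<ge>0. \<forall>u. en L s u \<le> ennreal C * en L t u"
proof (intro exI conjI allI)
  let ?C = "(2 * pi / L) powr (2 * (s - t))"
  show "0 \<le> ?C" by simp
  fix u :: field
  have "wave L k powr (2 * s) \<le> ?C * wave L k powr (2 * t)" for k
  proof (cases "k = 0")
    case False
    have p: "0 < 2 * pi / L" using assms by simp
    have "wave L k powr (2 * s) = wave L k powr (2 * (s - t)) * wave L k powr (2 * t)"
      by (simp add: powr_add[symmetric] algebra_simps)
    also have "wave L k powr (2 * (s - t)) \<le> ?C"
      using wave_ge[OF assms(1) False] p assms by (intro powr_mono2') auto
    finally show ?thesis
      by (simp add: mult_right_mono)
  qed auto
  then have "wave L k powr (2 * s) * (norm (u k))\<^sup>2 \<le> ?C * (wave L k powr (2 * t) * (norm (u k))\<^sup>2)" for k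
    unfolding mult.assoc[symmetric] by (intro mult_right_mono) auto
  then have "en L s u \<le> (\<integral>\<^sup>+k. ennreal ?C * ennreal (wave L k powr (2 * t) * (norm (u k))\<^sup>2) \<partial>count_space UNIV)"
    unfolding en_def by (intro nn_integral_mono) (simp add: ennreal_mult[symmetric])
  then show "en L s u \<le> ennreal ?C * en L t u"
    by (simp add: en_def nn_integral_cmult)
qed

section \<open>Summability over the dual lattice\<close>

lemma nn_integral_int_powr_finite:
  assumes "q > 1"
  shows "(\<integral>\<^sup>+n. ennreal ((1 + \<bar>real_of_int n\<bar>) powr (- q)) \<partial>count_space UNIV) < \<infinity>"
proof -
  let ?f = "\<lambda>n::int. ennreal ((1 + \<bar>real_of_int n\<bar>) powr (- q))"
  have nat: "(\<integral>\<^sup>+n. ?f (int n) \<partial>count_space UNIV) < \<infinity>"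
  proof -
    have "summable (\<lambda>n. real (Suc n) powr (- q))"
      using assms by (subst summable_Suc_iff) (simp add: summable_real_powr_iff)
    then have "(\<lambda>n. real (Suc n) powr (- q)) summable_on UNIV"
      by (intro norm_summable_imp_summable_on) auto
    then have "(\<integral>\<^sup>+n. ennreal (real (Suc n) powr (- q)) \<partial>count_space UNIV) < \<infinity>"
      by (subst (asm) summable_on_iff_nn_integral) auto
    then show ?thesis
      by (simp add: add.commute)
  qed
  have "(\<integral>\<^sup>+n. ?f n \<partial>count_space UNIV)
      \<le> (\<integral>\<^sup>+n. ?f n * indicator (range int) n + ?f n * indicator (range (\<lambda>n. - int n)) n \<partial>count_space UNIV)"
  proof (intro nn_integral_mono)
    fix n :: int
    have "n \<in> range int \<or> n \<in> range (\<lambda>n. - int n)"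
      by (cases n rule: int_cases2) auto
    then show "?f n \<le> ?f n * indicator (range int) n + ?f n * indicator (range (\<lambda>n. - int n)) n"
      by (auto simp: indicator_def)
  qed
  also have "\<dots> = (\<integral>\<^sup>+n. ?f n \<partial>count_space (range int)) + (\<integral>\<^sup>+n. ?f n \<partial>count_space (range (\<lambda>n. - int n)))"
    by (subst nn_integral_add) (auto simp: nn_integral_count_space_indicator)
  also have "(\<integral>\<^sup>+n. ?f n \<partial>count_space (range int)) = (\<integral>\<^sup>+n. ?f (int n) \<partial>count_space UNIV)"
    by (rule nn_integral_bij_count_space[symmetric]) (auto simp: bij_betw_def inj_on_def)
  also have "(\<integral>\<^sup>+n. ?f n \<partial>count_space (range (\<lambda>n. - int n))) = (\<integral>\<^sup>+n. ?f (- int n) \<partial>count_space UNIV)"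
    by (rule nn_integral_bij_count_space[symmetric]) (auto simp: bij_betw_def inj_on_def)
  also have "(\<integral>\<^sup>+n. ?f (int n) \<partial>count_space UNIV) + (\<integral>\<^sup>+n. ?f (- int n) \<partial>count_space UNIV) < \<infinity>"
    using nat by simp
  finally show ?thesis .
qed

lemma nn_integral_int3:
  fixes g :: "int \<Rightarrow> ennreal"
  shows "(\<integral>\<^sup>+k. (\<Prod>i\<in>UNIV. g ((k::int^3) $ i)) \<partial>count_space UNIV) = (\<integral>\<^sup>+n. g n \<partial>count_space UNIV) ^ 3"
proof -
  let ?h = "\<lambda>(a, b, c). vector [a, b, c] :: int^3"
  have bij: "bij_betw ?h UNIV UNIV"
    by (intro bij_betw_byWitness[where f' = "\<lambda>k. (k $ 1, k $ 2, k $ 3)"])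
       (auto simp: vec_eq_iff forall_3)
  have "(\<integral>\<^sup>+k. (\<Prod>i\<in>UNIV. g ((k::int^3) $ i)) \<partial>count_space UNIV)
     = (\<integral>\<^sup>+p. (\<Prod>i\<in>UNIV. g (?h p $ i)) \<partial>count_space UNIV)"
    by (rule nn_integral_bij_count_space[OF bij, symmetric])
  also have "\<dots> = (\<integral>\<^sup>+(a, b, c). g a * (g b * g c) \<partial>count_space UNIV)"
    unfolding UNIV_3 by (intro nn_integral_cong) (simp add: mult.assoc split: prod.split)
  also have "\<dots> = (\<integral>\<^sup>+a. \<integral>\<^sup>+b. \<integral>\<^sup>+c. g a * (g b * g c) \<partial>count_space UNIV \<partial>count_space UNIV \<partial>count_space UNIV)"
  proof -
    have "(\<integral>\<^sup>+(a, b, c). g a * (g b * g c) \<partial>count_space UNIV)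
      = (\<integral>\<^sup>+a. \<integral>\<^sup>+p. (case (a, p) of (a, b, c) \<Rightarrow> g a * (g b * g c)) \<partial>count_space UNIV \<partial>count_space UNIV)"
      by (rule nn_integral_fst_count_space[symmetric])
    also have "\<dots> = (\<integral>\<^sup>+a. \<integral>\<^sup>+b. \<integral>\<^sup>+c. (case (b, c) of (b, c) \<Rightarrow> g a * (g b * g c)) \<partial>count_space UNIV \<partial>count_space UNIV \<partial>count_space UNIV)"
      by (intro nn_integral_cong, subst nn_integral_fst_count_space) simp
    finally show ?thesis by simp
  qed
  also have "\<dots> = (\<integral>\<^sup>+n. g n \<partial>count_space UNIV) ^ 3"
    by (simp add: nn_integral_cmult nn_integral_multc power3_eq_cube mult.assoc)
  finally show ?thesis .
qed

text \<open>The modulus dominates every coordinate, so the exponent p can be shared equally among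
  the three coordinates. What remains is a product of one-dimensional series with exponent
  \<open>p / 3 > 1\<close>.\<close>

lemma lattice_sum_finite:
  assumes "L > 0" "p > 3"
  shows "(\<integral>\<^sup>+k. ennreal (wave L k powr (- p)) \<partial>count_space UNIV) < \<infinity>"
proof -
  let ?c = "pi / L"
  let ?g = "\<lambda>n::int. ennreal ((1 + \<bar>real_of_int n\<bar>) powr (- (p / 3)))"
  have c: "?c > 0" using assms by simp
  have "ennreal (wave L k powr (- p)) \<le> ennreal (?c powr (- p)) * (\<Prod>i\<in>UNIV. ?g (k $ i))" for k :: "int^3"
  proof (cases "k = 0")
    case False
    \<comment> \<open>The average of the spectral gap and of the coordinate bound: it supplies the
      summand 1, which keeps the factor positive when the coordinate vanishes, and halves the
      constant \<open>2 * pi / L\<close>.\<close>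
    have le: "?c * (1 + \<bar>of_int (k $ i)\<bar>) \<le> wave L k" for i
    proof -
      have "?c * (1 + \<bar>of_int (k $ i)\<bar>) = (2 * pi / L + 2 * pi / L * \<bar>of_int (k $ i)\<bar>) / 2"
        by (simp add: distrib_left add_divide_distrib)
      moreover have "(a + b) / 2 \<le> c" if "a \<le> c" "b \<le> c" for a b c :: real
        using that by simp
      ultimately show ?thesis
        using wave_ge[OF assms(1) False] wave_component[OF assms(1), of k i] by metis
    qed
    have "wave L k powr (- p) = (\<Prod>i\<in>(UNIV::3 set). wave L k powr (- (p / 3)))"
      using wave_pos[OF assms(1) False] by (simp add: powr_realpow[symmetric] powr_powr)
    also have "\<dots> \<le> (\<Prod>i\<in>(UNIV::3 set). (?c * (1 + \<bar>of_int (k $ i)\<bar>)) powr (- (p / 3)))"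
      using c assms le by (intro prod_mono conjI powr_mono2') auto
    also have "\<dots> = ?c powr (- p) * (\<Prod>i\<in>(UNIV::3 set). (1 + \<bar>of_int (k $ i)\<bar>) powr (- (p / 3)))"
    proof -
      have "(?c * (1 + \<bar>of_int (k $ i)\<bar>)) powr (- (p / 3)) = ?c powr (- (p / 3)) * (1 + \<bar>of_int (k $ i)\<bar>) powr (- (p / 3))" for i
        using c by (intro powr_mult)
      moreover have "(\<Prod>i\<in>(UNIV::3 set). ?c powr (- (p / 3))) = ?c powr (- p)"
        using c powr_power[of "pi / L" "- (p / 3)" 3] assms by simp
      ultimately show ?thesis
        by (simp only: prod.distrib)
    qed
    finally show ?thesis
      by (subst prod_ennreal) (auto simp: ennreal_mult[symmetric] prod_nonneg intro!: ennreal_leI)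
  qed simp
  then have "(\<integral>\<^sup>+k. ennreal (wave L k powr (- p)) \<partial>count_space UNIV)
     \<le> (\<integral>\<^sup>+k. ennreal (?c powr (- p)) * (\<Prod>i\<in>UNIV. ?g ((k::int^3) $ i)) \<partial>count_space UNIV)"
    by (intro nn_integral_mono)
  also have "\<dots> = ennreal (?c powr (- p)) * (\<integral>\<^sup>+n. ?g n \<partial>count_space UNIV) ^ 3"
    using nn_integral_int3[of ?g] by (simp add: nn_integral_cmult)
  also have "\<dots> < \<infinity>"
    using nn_integral_int_powr_finite[of "p / 3"] assms
    by (simp add: ennreal_mult_less_top power_less_top_ennreal)
  finally show ?thesis .
qed

text \<open>The output frequency is at most twice the larger input frequency, so its weight can be
  charged to \<open>x = |k - j|\<close> or to \<open>y = |j|\<close>. Charged to y it cancels the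
  weight of v and leaves a pure power of x; charged to x it leaves a mixed product that
  \<open>prod\<close> reduces to pure powers.\<close>

lemma convolution_kernel:
  assumes "L > 0" "\<alpha> > 0" "j \<noteq> 0" "j \<noteq> k"
  shows "wave L k powr (2 * \<alpha>) * (wave L (k - j) powr (- 2 - 2 * \<alpha>) * wave L j powr (- 2 * \<alpha>))
     \<le> 2 powr (2 * \<alpha>) * (2 * wave L (k - j) powr (- 2 - 2 * \<alpha>) + wave L j powr (- 2 - 2 * \<alpha>))"
proof -
  define x y where "x = wave L (k - j)" and "y = wave L j"
  have pos: "x > 0" "y > 0"
    using wave_pos[OF assms(1)] assms by (auto simp: x_def y_def)
  \<comment> \<open>With negative exponents, replacing the larger of x and y by the smaller one
    increases the product.\<close>
  have prod: "x powr (- 2) * y powr (- 2 * \<alpha>) \<le> x powr (- 2 - 2 * \<alpha>) + y powr (- 2 - 2 * \<alpha>)"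
  proof (cases "x \<le> y")
    case True
    then have "x powr (- 2) * y powr (- 2 * \<alpha>) \<le> x powr (- 2) * x powr (- 2 * \<alpha>)"
      using pos assms by (intro mult_left_mono powr_mono2') auto
    then show ?thesis by (smt (verit) powr_add powr_ge_zero)
  next
    case False
    then have "x powr (- 2) * y powr (- 2 * \<alpha>) \<le> y powr (- 2) * y powr (- 2 * \<alpha>)"
      using pos assms by (intro mult_right_mono powr_mono2') auto
    then show ?thesis by (smt (verit) powr_add powr_ge_zero)
  qed
  have "wave L k powr (2 * \<alpha>) \<le> (2 * max x y) powr (2 * \<alpha>)"
    using wave_triangle[of L k j] assms by (intro powr_mono2) (auto simp: x_def y_def)
  also have "\<dots> \<le> 2 powr (2 * \<alpha>) * (x powr (2 * \<alpha>) + y powr (2 * \<alpha>))"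
    using pos by (auto simp: powr_mult max_def)
  finally have "wave L k powr (2 * \<alpha>) * (x powr (- 2 - 2 * \<alpha>) * y powr (- 2 * \<alpha>))
    \<le> 2 powr (2 * \<alpha>) * (x powr (2 * \<alpha>) + y powr (2 * \<alpha>)) * (x powr (- 2 - 2 * \<alpha>) * y powr (- 2 * \<alpha>))"
    by (intro mult_right_mono) auto
  also have "\<dots> = 2 powr (2 * \<alpha>) * ((x powr (2 * \<alpha>) * x powr (- 2 - 2 * \<alpha>)) * y powr (- 2 * \<alpha>)
      + (y powr (2 * \<alpha>) * y powr (- 2 * \<alpha>)) * x powr (- 2 - 2 * \<alpha>))"
    by (simp only: algebra_simps)
  also have "x powr (2 * \<alpha>) * x powr (- 2 - 2 * \<alpha>) = x powr (- 2)"
    by (simp add: powr_add[symmetric])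
  also have "y powr (2 * \<alpha>) * y powr (- 2 * \<alpha>) = 1"
    using pos by (simp add: powr_add[symmetric])
  also have "2 powr (2 * \<alpha>) * (x powr (- 2) * y powr (- 2 * \<alpha>) + 1 * x powr (- 2 - 2 * \<alpha>))
     \<le> 2 powr (2 * \<alpha>) * (2 * x powr (- 2 - 2 * \<alpha>) + y powr (- 2 - 2 * \<alpha>))"
    using prod by (intro mult_left_mono) auto
  finally show ?thesis by (simp add: x_def y_def)
qed

lemma nn_integral_reflect:
  fixes f :: "int^3 \<Rightarrow> ennreal"
  shows "(\<integral>\<^sup>+j. f (k - j) \<partial>count_space UNIV) = (\<integral>\<^sup>+j. f j \<partial>count_space UNIV)"
  by (rule nn_integral_bij_count_space)
     (auto intro!: bij_betw_byWitness[where f' = "\<lambda>j. k - j"])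

lemma nn_integral_translate:
  fixes f :: "int^3 \<Rightarrow> ennreal"
  shows "(\<integral>\<^sup>+k. f (k - j) \<partial>count_space UNIV) = (\<integral>\<^sup>+k. f k \<partial>count_space UNIV)"
  by (rule nn_integral_bij_count_space)
     (auto intro!: bij_betw_byWitness[where f' = "\<lambda>k. k + j"])

text \<open>The single use of Cauchy--Schwarz splits off the kernel of \<open>convolution_kernel\<close>, whose
  sum over \<open>j\<close> is bounded uniformly in \<open>k\<close>; this is where \<open>1 + \<alpha> > 3/2\<close> enters.\<close>

lemma convolution_estimate:
  assumes L: "L > 0" and \<alpha>: "\<alpha> > 1/2"
  shows "\<exists>C\<ge>0. \<forall>u v. u 0 = 0 \<longrightarrow> v 0 = 0 \<longrightarrow>
    (\<integral>\<^sup>+k. ennreal (wave L k powr (2 * \<alpha>)) * (\<integral>\<^sup>+j. ennreal (norm (u (k - j)) * norm (v j)) \<partial>count_space UNIV)\<^sup>2 \<partial>count_space UNIV)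
     \<le> ennreal C * (en L (1 + \<alpha>) u * en L \<alpha> v)"
proof -
  define S where "S = (\<integral>\<^sup>+k. ennreal (wave L k powr (- 2 - 2 * \<alpha>)) \<partial>count_space UNIV)"
  have S: "S < \<infinity>"
    using lattice_sum_finite[OF L, of "2 + 2 * \<alpha>"] \<alpha> by (simp add: S_def)
  define C where "C = ennreal (2 powr (2 * \<alpha>)) * (3 * S)"
  have "C < \<infinity>"
    using S by (simp add: C_def ennreal_mult_less_top)
  then have C: "C = ennreal (enn2real C)"
    by simp
  \<comment> \<open>The inverse weights of the two norms. Multiplying and dividing by them writes
    the product of coefficients as \<open>kap k j * \<theta> j\<close>, where the squares of
    \<theta> add up to a convolution of energy densities.\<close>
  define kap where "kap k j = wave L (k - j) powr (- (1 + \<alpha>)) * wave L j powr (- \<alpha>)" for k j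
  have kap: "ennreal (wave L k powr (2 * \<alpha>)) * (\<integral>\<^sup>+j. (ennreal (kap k j))\<^sup>2 \<partial>count_space UNIV) \<le> C" for k
  proof -
    have "ennreal (wave L k powr (2 * \<alpha>)) * (\<integral>\<^sup>+j. (ennreal (kap k j))\<^sup>2 \<partial>count_space UNIV)
      = (\<integral>\<^sup>+j. ennreal (wave L k powr (2 * \<alpha>)) * (ennreal (kap k j))\<^sup>2 \<partial>count_space UNIV)"
      by (simp add: nn_integral_cmult)
    also have "\<dots> \<le> (\<integral>\<^sup>+j. ennreal (2 powr (2 * \<alpha>)) * (2 * ennreal (wave L (k - j) powr (- 2 - 2 * \<alpha>)) + ennreal (wave L j powr (- 2 - 2 * \<alpha>))) \<partial>count_space UNIV)"
    proof (intro nn_integral_mono)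
      fix j
      have *: "(kap k j)\<^sup>2 = wave L (k - j) powr (- 2 - 2 * \<alpha>) * wave L j powr (- 2 * \<alpha>)"
        by (simp add: kap_def power_mult_distrib power2_eq_square[of "_ powr _"] powr_add[symmetric])
      show "ennreal (wave L k powr (2 * \<alpha>)) * (ennreal (kap k j))\<^sup>2 \<le> ennreal (2 powr (2 * \<alpha>)) * (2 * ennreal (wave L (k - j) powr (- 2 - 2 * \<alpha>)) + ennreal (wave L j powr (- 2 - 2 * \<alpha>)))"
      \<comment> \<open>At these two indices one of the weights is a power of 0 and therefore 0, so
        the kernel bound is only required where both input frequencies are nonzero.\<close>
      proof (cases "j = 0 \<or> j = k")
        case True
        then have "kap k j = 0" by (auto simp: kap_def)
        then show ?thesis by simp
      next
        case False
        have "ennreal (wave L k powr (2 * \<alpha>)) * (ennreal (kap k j))\<^sup>2 = ennreal (wave L k powr (2 * \<alpha>) * (kap k j)\<^sup>2)"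
          using ennreal_power[of "kap k j" 2] by (simp add: ennreal_mult kap_def)
        also have "\<dots> \<le> ennreal (2 powr (2 * \<alpha>) * (2 * wave L (k - j) powr (- 2 - 2 * \<alpha>) + wave L j powr (- 2 - 2 * \<alpha>)))"
          unfolding * using convolution_kernel[OF L, of \<alpha> j k] False \<alpha> by (intro ennreal_leI) auto
        finally show ?thesis
          by (simp add: ennreal_mult ennreal_plus)
      qed
    qed
    also have "\<dots> = ennreal (2 powr (2 * \<alpha>)) * (2 * S + S)"
      unfolding S_def using nn_integral_reflect[of "\<lambda>j. ennreal (wave L j powr (- 2 - 2 * \<alpha>))" k]
      by (simp add: nn_integral_cmult nn_integral_add)
    also have "2 * S + S = 3 * S"
      by (metis one_add_one distrib_right mult_1 numeral_plus_one semiring_norm(5) add.commute)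
    finally show ?thesis by (simp add: C_def)
  qed
  have "(\<integral>\<^sup>+k. ennreal (wave L k powr (2 * \<alpha>)) * (\<integral>\<^sup>+j. ennreal (norm (u (k - j)) * norm (v j)) \<partial>count_space UNIV)\<^sup>2 \<partial>count_space UNIV)
     \<le> C * (en L (1 + \<alpha>) u * en L \<alpha> v)" if u0: "u 0 = 0" and v0: "v 0 = 0" for u v
  proof -
    define A where "A k = ennreal (wave L k powr (2 * (1 + \<alpha>)) * (norm (u k))\<^sup>2)" for k
    define B where "B k = ennreal (wave L k powr (2 * \<alpha>) * (norm (v k))\<^sup>2)" for k
    have "ennreal (wave L k powr (2 * \<alpha>)) * (\<integral>\<^sup>+j. ennreal (norm (u (k - j)) * norm (v j)) \<partial>count_space UNIV)\<^sup>2
       \<le> C * (\<integral>\<^sup>+j. A (k - j) * B j \<partial>count_space UNIV)" for k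
    proof -
      define \<theta> where "\<theta> j = wave L (k - j) powr (1 + \<alpha>) * norm (u (k - j)) * (wave L j powr \<alpha> * norm (v j))" for j
      have \<theta>0: "\<theta> j \<ge> 0" for j by (simp add: \<theta>_def)
      have *: "norm (u (k - j)) * norm (v j) = kap k j * \<theta> j" for j
      proof (cases "j = 0 \<or> j = k")
        case True
        then show ?thesis using u0 v0 by (auto simp: \<theta>_def)
      next
        case False
        then have "wave L (k - j) \<noteq> 0" "wave L j \<noteq> 0"
          using wave_eq_0_iff[OF L] by auto
        then show ?thesis
          using powr_minus[of "wave L (k - j)" "1 + \<alpha>"] powr_minus[of "wave L j" "\<alpha>"]
          by (simp add: kap_def \<theta>_def field_simps)
      qed
      have "(\<integral>\<^sup>+j. ennreal (norm (u (k - j)) * norm (v j)) \<partial>count_space UNIV)\<^sup>2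
        = (\<integral>\<^sup>+j. ennreal (kap k j) * ennreal (\<theta> j) \<partial>count_space UNIV)\<^sup>2"
        unfolding * by (simp add: ennreal_mult kap_def \<theta>0)
      also have "\<dots> \<le> (\<integral>\<^sup>+j. (ennreal (kap k j))\<^sup>2 \<partial>count_space UNIV) * (\<integral>\<^sup>+j. (ennreal (\<theta> j))\<^sup>2 \<partial>count_space UNIV)"
        by (rule Cauchy_Schwarz_nn_integral) auto
      also have "(\<integral>\<^sup>+j. (ennreal (\<theta> j))\<^sup>2 \<partial>count_space UNIV) = (\<integral>\<^sup>+j. A (k - j) * B j \<partial>count_space UNIV)"
      proof (intro nn_integral_cong)
        fix j
        have "(\<theta> j)\<^sup>2 = (wave L (k - j) powr (2 * (1 + \<alpha>)) * (norm (u (k - j)))\<^sup>2) * (wave L j powr (2 * \<alpha>) * (norm (v j))\<^sup>2)"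
          by (simp add: \<theta>_def power_mult_distrib power2_eq_square[of "_ powr _"] powr_add[symmetric])
        then show "(ennreal (\<theta> j))\<^sup>2 = A (k - j) * B j"
          by (simp add: A_def B_def ennreal_mult[symmetric] ennreal_power \<theta>0)
      qed
      finally have "ennreal (wave L k powr (2 * \<alpha>)) * (\<integral>\<^sup>+j. ennreal (norm (u (k - j)) * norm (v j)) \<partial>count_space UNIV)\<^sup>2
        \<le> ennreal (wave L k powr (2 * \<alpha>)) * ((\<integral>\<^sup>+j. (ennreal (kap k j))\<^sup>2 \<partial>count_space UNIV) * (\<integral>\<^sup>+j. A (k - j) * B j \<partial>count_space UNIV))"
        by (rule mult_left_mono) simp
      also have "\<dots> \<le> C * (\<integral>\<^sup>+j. A (k - j) * B j \<partial>count_space UNIV)"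
        unfolding mult.assoc[symmetric] by (rule mult_right_mono[OF kap]) simp
      finally show ?thesis .
    qed
    then have "(\<integral>\<^sup>+k. ennreal (wave L k powr (2 * \<alpha>)) * (\<integral>\<^sup>+j. ennreal (norm (u (k - j)) * norm (v j)) \<partial>count_space UNIV)\<^sup>2 \<partial>count_space UNIV)
       \<le> (\<integral>\<^sup>+k. C * (\<integral>\<^sup>+j. A (k - j) * B j \<partial>count_space UNIV) \<partial>count_space UNIV)"
      by (intro nn_integral_mono)
    also have "\<dots> = C * (\<integral>\<^sup>+k. \<integral>\<^sup>+j. A (k - j) * B j \<partial>count_space UNIV \<partial>count_space UNIV)"
      by (simp add: nn_integral_cmult)
    \<comment> \<open>Exchanging the two sums decouples the convolution: by translation invariance
      its total is the product of the two energies.\<close>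
    also have "(\<integral>\<^sup>+k. \<integral>\<^sup>+j. A (k - j) * B j \<partial>count_space UNIV \<partial>count_space UNIV)
      = (\<integral>\<^sup>+j. \<integral>\<^sup>+k. A (k - j) * B j \<partial>count_space UNIV \<partial>count_space UNIV)"
      by (rule nn_integral_count_space_nn_integral) auto
    also have "\<dots> = (\<integral>\<^sup>+k. A k \<partial>count_space UNIV) * (\<integral>\<^sup>+k. B k \<partial>count_space UNIV)"
      by (simp add: nn_integral_multc nn_integral_translate[of A] nn_integral_cmult)
    finally show ?thesis by (simp add: A_def B_def en_def)
  qed
  then show ?thesis
    using C by (intro exI[of _ "enn2real C"]) auto
qed

section \<open>The nonlinearity in Fourier variables\<close>

text \<open>The symbol of the divergence at frequency k, up to the factor \<open>\<i>\<close>. It is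
  bilinear without conjugation, unlike \<open>\<bullet>\<close>.\<close>

definition zdot :: "real \<Rightarrow> int^3 \<Rightarrow> complex^3 \<Rightarrow> complex" where
  "zdot L k c = (\<Sum>i\<in>UNIV. complex_of_real (freq L k $ i) * c $ i)"

definition vcnj :: "complex^3 \<Rightarrow> complex^3" where
  "vcnj c = (\<chi> i. cnj (c $ i))"

text \<open>The symbol of the Leray projector, the identity minus the orthogonal projection onto the
  frequency direction. At \<open>k = 0\<close> the division by zero yields the identity.\<close>

definition leray :: "real \<Rightarrow> int^3 \<Rightarrow> complex^3 \<Rightarrow> complex^3" where
  "leray L k c = c - (zdot L k c / complex_of_real ((wave L k)\<^sup>2)) *s (\<chi> i. complex_of_real (freq L k $ i))"

text \<open>For divergence-free \<open>u\<close> the convection term \<open>(u \<cdot> \<nabla>) v\<close> equals the divergence of \<open>v \<otimes> u\<close>, so the frequency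
  of the output (and not of \<open>v\<close>) may be taken as the derivative's symbol.\<close>

definition Bf :: "real \<Rightarrow> field \<Rightarrow> field \<Rightarrow> field" where
  "Bf L u v k = (LINT j|count_space UNIV. (\<i> * zdot L k (u (k - j))) *s v j)"

text \<open>Projecting leaves every pairing with a divergence-free field unchanged and turns the
  nonlinear term into a solenoidal field, so that Duhamel's formula does not leave the solenoidal
  class.\<close>

definition NB :: "real \<Rightarrow> field \<Rightarrow> field \<Rightarrow> field" where
  "NB L u v k = leray L k (Bf L u v k)"

lemma solenoidal_iff:
  "u \<in> solenoidal L \<longleftrightarrow> u 0 = 0 \<and> (\<forall>k. u (- k) = vcnj (u k)) \<and> (\<forall>k. zdot L k (u k) = 0)"
  by (auto simp: solenoidal_def vcnj_def zdot_def vec_eq_iff)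

lemma norm_vec_smult: "norm (a *s (x :: complex^3)) = norm a * norm x"
  by (simp add: norm_vec_def L2_set_def norm_mult power_mult_distrib sum_distrib_left[symmetric] real_sqrt_mult)

lemma bounded_linear_vec_smult_left: "bounded_linear (\<lambda>a. a *s (x :: complex^3))"
  by (rule bounded_linear_intro[where K = "norm x"])
     (auto simp: norm_vec_smult vec_eq_iff algebra_simps)

lemma norm_zdot: "norm (zdot L k c) \<le> wave L k * norm c"
proof -
  have "norm (zdot L k c) \<le> (\<Sum>i\<in>UNIV. \<bar>freq L k $ i\<bar> * \<bar>norm (c $ i)\<bar>)"
    unfolding zdot_def by (rule order_trans[OF norm_sum]) (simp add: norm_mult)
  also have "\<dots> \<le> L2_set (\<lambda>i. freq L k $ i) UNIV * L2_set (\<lambda>i. norm (c $ i)) UNIV"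
    by (rule L2_set_mult_ineq)
  also have "\<dots> = wave L k * norm c"
    by (simp add: wave_def norm_vec_def L2_set_def)
  finally show ?thesis .
qed

lemma bounded_linear_zdot: "bounded_linear (zdot L k)"
proof (rule bounded_linear_intro[where K = "wave L k"])
  show "zdot L k (x + y) = zdot L k x + zdot L k y" for x y
    by (simp add: zdot_def algebra_simps sum.distrib)
  show "zdot L k (r *\<^sub>R x) = r *\<^sub>R zdot L k x" for r x
    by (simp add: zdot_def scaleR_sum_right)
  show "norm (zdot L k x) \<le> norm x * wave L k" for x
    using norm_zdot[of L k x] by (simp add: mult.commute)
qed

lemma bounded_linear_vcnj: "bounded_linear vcnj"
  by (rule bounded_linear_intro[where K = 1])
     (auto simp: vcnj_def vec_eq_iff norm_vec_def L2_set_def)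

lemma bounded_linear_leray_aux: "bounded_linear (leray L k)"
proof -
  have "bounded_linear (\<lambda>c. zdot L k c * inverse (complex_of_real ((wave L k)\<^sup>2)))"
    by (intro bounded_linear_mult_const bounded_linear_zdot)
  then have "bounded_linear (\<lambda>c. zdot L k c / complex_of_real ((wave L k)\<^sup>2))"
    by (simp only: divide_inverse)
  then have "bounded_linear (\<lambda>c. c - (zdot L k c / complex_of_real ((wave L k)\<^sup>2)) *s (\<chi> i. complex_of_real (freq L k $ i)))"
    by (intro bounded_linear_sub bounded_linear_ident bounded_linear_compose[OF bounded_linear_vec_smult_left])
  then show ?thesis
    unfolding leray_def[abs_def] .
qed

lemmas bounded_linear_leray = bounded_linear_leray_aux

lemma zdot_add: "zdot L k (a + b) = zdot L k a + zdot L k b"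
  by (simp add: zdot_def algebra_simps sum.distrib)

lemma zdot_diff: "zdot L k (a - b) = zdot L k a - zdot L k b"
  by (simp add: zdot_def algebra_simps sum_subtractf)

lemma zdot_smult: "zdot L k (a *s b) = a * zdot L k b"
  by (simp add: zdot_def algebra_simps sum_distrib_left)

lemma zdot_zero [simp]: "zdot L k 0 = 0" "zdot L 0 c = 0"
  by (simp_all add: zdot_def)

lemma zdot_freq: "zdot L k (\<chi> i. complex_of_real (freq L k $ i)) = complex_of_real ((wave L k)\<^sup>2)"
proof -
  have "(wave L k)\<^sup>2 = (\<Sum>i\<in>UNIV. freq L k $ i * freq L k $ i)"
    unfolding wave_def power2_norm_eq_inner by (simp add: inner_vec_def)
  then show ?thesis by (simp add: zdot_def)
qed

lemma zdot_minus_freq: "zdot L (- k) c = - zdot L k c"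
  by (simp add: zdot_def freq_minus sum_negf)

lemma zdot_vcnj: "zdot L k (vcnj c) = cnj (zdot L k c)"
  by (simp add: zdot_def vcnj_def)

lemma zdot_freq_diff: "zdot L (k - j) c = zdot L k c - zdot L j c"
  by (simp add: zdot_def freq_diff algebra_simps sum_subtractf)

lemma zdot_leray:
  assumes "L > 0"
  shows "zdot L k (leray L k c) = 0"
proof (cases "k = 0")
  case False
  then have "wave L k \<noteq> 0" using wave_eq_0_iff[OF assms] by simp
  then show ?thesis
    unfolding leray_def zdot_diff zdot_smult zdot_freq by simp
qed simp

lemma leray_eq: "zdot L k c = 0 \<Longrightarrow> leray L k c = c"
  by (simp add: leray_def)

text \<open>Orthogonality of gradients and divergence-free fields, mode by mode. The frequency
  vector is real, so conjugation only affects the scalar and the coefficient of d.\<close>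

lemma inner_freq_eq_0:
  assumes "zdot L k d = 0"
  shows "(a *s (\<chi> i. complex_of_real (freq L k $ i))) \<bullet> d = 0"
proof -
  have "(a *s (\<chi> i. complex_of_real (freq L k $ i))) \<bullet> d = Re (cnj a * zdot L k d)"
    by (simp add: inner_vec_def inner_complex_def zdot_def sum_distrib_left algebra_simps sum.distrib sum_subtractf)
  then show ?thesis using assms by simp
qed

lemma inner_leray_left: "zdot L k d = 0 \<Longrightarrow> leray L k c \<bullet> d = c \<bullet> d"
  by (simp add: leray_def inner_diff_left inner_freq_eq_0)

text \<open>The projector is symmetric and its range is divergence-free, so the squared norm of the
  projection is its inner product with c; Cauchy-Schwarz then cancels one factor.\<close>

lemma norm_leray:
  assumes "L > 0"
  shows "norm (leray L k c) \<le> norm c"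
proof -
  have "(norm (leray L k c))\<^sup>2 = c \<bullet> leray L k c"
    unfolding power2_norm_eq_inner by (intro inner_leray_left zdot_leray assms)
  also have "\<dots> \<le> norm c * norm (leray L k c)"
    by (rule norm_cauchy_schwarz)
  finally show ?thesis
    by (cases "norm (leray L k c) = 0") (simp_all add: power2_eq_square)
qed

lemma vcnj_smult: "vcnj (a *s b) = cnj a *s vcnj b"
  by (simp add: vcnj_def vec_eq_iff)

lemma leray_vcnj: "leray L (- k) (vcnj c) = vcnj (leray L k c)"
  unfolding leray_def zdot_minus_freq zdot_vcnj by (simp add: vcnj_def vec_eq_iff freq_minus)

lemma integrable_count_space_iff:
  fixes f :: "'a \<Rightarrow> 'b::{banach, second_countable_topology}"
  shows "integrable (count_space UNIV) f \<longleftrightarrow> (\<integral>\<^sup>+x. ennreal (norm (f x)) \<partial>count_space UNIV) < \<infinity>"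
  by (simp add: integrable_iff_bounded)

text \<open>Integrability can be dispensed with by convention: the Bochner integral of a
  nonintegrable function is 0.\<close>

lemma ennreal_norm_integral_le:
  fixes f :: "'a \<Rightarrow> 'b::{banach, second_countable_topology}"
  shows "ennreal (norm (integral\<^sup>L M f)) \<le> (\<integral>\<^sup>+x. ennreal (norm (f x)) \<partial>M)"
proof (cases "integrable M f")
  case True
  then show ?thesis by (rule integral_norm_bound_ennreal)
qed (simp add: not_integrable_integral_eq)

text \<open>A single term of the finite sum in \<open>convolution_estimate\<close>. For
  \<open>k \<noteq> 0\<close> its weight is positive and can be cancelled.\<close>

lemma conv_nonneg_finite:
  assumes L: "L > 0" and \<alpha>: "\<alpha> > 1/2" and u0: "u 0 = 0" "v 0 = 0"
    and fin: "en L (1 + \<alpha>) u < \<infinity>" "en L \<alpha> v < \<infinity>" and k: "k \<noteq> 0"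
  shows "(\<integral>\<^sup>+j. ennreal (norm (u (k - j)) * norm (v j)) \<partial>count_space UNIV) < \<infinity>"
proof -
  obtain C where "C \<ge> 0" and C: "(\<integral>\<^sup>+k. ennreal (wave L k powr (2 * \<alpha>)) * (\<integral>\<^sup>+j. ennreal (norm (u (k - j)) * norm (v j)) \<partial>count_space UNIV)\<^sup>2 \<partial>count_space UNIV)
     \<le> ennreal C * (en L (1 + \<alpha>) u * en L \<alpha> v)"
    using convolution_estimate[OF L \<alpha>] u0 by blast
  let ?I = "\<integral>\<^sup>+j. ennreal (norm (u (k - j)) * norm (v j)) \<partial>count_space UNIV"
  have "ennreal (wave L k powr (2 * \<alpha>)) * ?I\<^sup>2
    \<le> (\<integral>\<^sup>+k. ennreal (wave L k powr (2 * \<alpha>)) * (\<integral>\<^sup>+j. ennreal (norm (u (k - j)) * norm (v j)) \<partial>count_space UNIV)\<^sup>2 \<partial>count_space UNIV)"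
    by (rule nn_integral_ge_point) simp
  also note C
  also have "ennreal C * (en L (1 + \<alpha>) u * en L \<alpha> v) < \<infinity>"
    using fin by (simp add: ennreal_mult_less_top)
  finally have "ennreal (wave L k powr (2 * \<alpha>)) * ?I\<^sup>2 < \<infinity>" .
  moreover have "wave L k powr (2 * \<alpha>) > 0"
    using wave_pos[OF L k] by simp
  ultimately show ?thesis
    by (auto simp: ennreal_mult_less_top power_less_top_ennreal)
qed

lemma Bf_integrand_le:
  fixes u v :: field
  shows "norm ((\<i> * zdot L k (u (k - j))) *s v j) \<le> wave L k * (norm (u (k - j)) * norm (v j))"
  using mult_right_mono[OF norm_zdot[of L k "u (k - j)"], of "norm (v j)"]
  unfolding norm_vec_smult norm_mult by (simp add: mult.assoc)

lemma Bf_integrable: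
  assumes L: "L > 0" and \<alpha>: "\<alpha> > 1/2" and u0: "u 0 = 0" "v 0 = 0"
    and fin: "en L (1 + \<alpha>) u < \<infinity>" "en L \<alpha> v < \<infinity>"
  shows "integrable (count_space UNIV) (\<lambda>j. (\<i> * zdot L k (u (k - j))) *s v j)"
proof (cases "k = 0")
  case False
  have "(\<integral>\<^sup>+j. ennreal (norm ((\<i> * zdot L k (u (k - j))) *s v j)) \<partial>count_space UNIV)
     \<le> (\<integral>\<^sup>+j. ennreal (wave L k) * ennreal (norm (u (k - j)) * norm (v j)) \<partial>count_space UNIV)"
    by (intro nn_integral_mono) (simp add: ennreal_mult[symmetric] Bf_integrand_le ennreal_leI)
  also have "\<dots> = ennreal (wave L k) * (\<integral>\<^sup>+j. ennreal (norm (u (k - j)) * norm (v j)) \<partial>count_space UNIV)"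
    by (simp add: nn_integral_cmult)
  also have "\<dots> < \<infinity>"
    using conv_nonneg_finite[OF assms False] by (simp add: ennreal_mult_less_top)
  finally show ?thesis
    by (simp add: integrable_count_space_iff)
qed simp

lemma Bf_zero [simp]: "Bf L u v 0 = 0"
  by (simp add: Bf_def)

text \<open>Additivity is not automatic, because a divergent Bochner integral is 0 by convention;
  the finite energies guarantee that both convolutions converge.\<close>

lemma Bf_diff_right:
  assumes L: "L > 0" and \<alpha>: "\<alpha> > 1/2" and u0: "u 0 = 0" "v 0 = 0" "w 0 = 0"
    and fin: "en L (1 + \<alpha>) u < \<infinity>" "en L \<alpha> v < \<infinity>" "en L \<alpha> w < \<infinity>"
  shows "Bf L u (\<lambda>k. v k - w k) k = Bf L u v k - Bf L u w k"
proof -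
  have *: "(\<i> * zdot L k (u (k - j))) *s (v j - w j) = (\<i> * zdot L k (u (k - j))) *s v j - (\<i> * zdot L k (u (k - j))) *s w j" for j
    by (simp add: vec_eq_iff algebra_simps)
  show ?thesis
    unfolding Bf_def * by (intro Bochner_Integration.integral_diff Bf_integrable[OF L \<alpha>] assms)
qed

lemma Bf_diff_left:
  assumes L: "L > 0" and \<alpha>: "\<alpha> > 1/2" and u0: "u 0 = 0" "v 0 = 0" "w 0 = 0"
    and fin: "en L (1 + \<alpha>) u < \<infinity>" "en L (1 + \<alpha>) v < \<infinity>" "en L \<alpha> w < \<infinity>"
  shows "Bf L (\<lambda>k. u k - v k) w k = Bf L u w k - Bf L v w k"
proof -
  have *: "(\<i> * zdot L k (u (k - j) - v (k - j))) *s w j = (\<i> * zdot L k (u (k - j))) *s w j - (\<i> * zdot L k (v (k - j))) *s w j" for j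
    by (simp add: vec_eq_iff algebra_simps zdot_diff)
  show ?thesis
    unfolding Bf_def * by (intro Bochner_Integration.integral_diff Bf_integrable[OF L \<alpha>] assms)
qed

lemma NB_diff_right:
  assumes "L > 0" "\<alpha> > 1/2" "u 0 = 0" "v 0 = 0" "w 0 = 0"
    "en L (1 + \<alpha>) u < \<infinity>" "en L \<alpha> v < \<infinity>" "en L \<alpha> w < \<infinity>"
  shows "NB L u (\<lambda>k. v k - w k) k = NB L u v k - NB L u w k"
  unfolding NB_def Bf_diff_right[OF assms]
  by (rule bounded_linear.linear[OF bounded_linear_leray, THEN linear_diff])

lemma NB_diff_left:
  assumes "L > 0" "\<alpha> > 1/2" "u 0 = 0" "v 0 = 0" "w 0 = 0"
    "en L (1 + \<alpha>) u < \<infinity>" "en L (1 + \<alpha>) v < \<infinity>" "en L \<alpha> w < \<infinity>"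
  shows "NB L (\<lambda>k. u k - v k) w k = NB L u w k - NB L v w k"
  unfolding NB_def Bf_diff_left[OF assms]
  by (rule bounded_linear.linear[OF bounded_linear_leray, THEN linear_diff])

text \<open>The outer derivative contributes one factor \<open>wave L k\<close>, and its square
  raises the weight of exponent \<alpha> - 1 to that of exponent \<alpha>. What is left is the
  convolution of the moduli.\<close>

lemma en_Bf_le:
  assumes L: "L > 0" and \<alpha>: "\<alpha> > 1/2"
  shows "\<exists>C\<ge>0. \<forall>u v. u 0 = 0 \<longrightarrow> v 0 = 0 \<longrightarrow> en L (\<alpha> - 1) (Bf L u v) \<le> ennreal C * (en L (1 + \<alpha>) u * en L \<alpha> v)"
proof -
  obtain C where "C \<ge> 0" and C: "\<And>u v. u 0 = 0 \<Longrightarrow> v 0 = 0 \<Longrightarrow> (\<integral>\<^sup>+k. ennreal (wave L k powr (2 * \<alpha>)) * (\<integral>\<^sup>+j. ennreal (norm (u (k - j)) * norm (v j)) \<partial>count_space UNIV)\<^sup>2 \<partial>count_space UNIV)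
     \<le> ennreal C * (en L (1 + \<alpha>) u * en L \<alpha> v)"
    using convolution_estimate[OF L \<alpha>] by blast
  have "en L (\<alpha> - 1) (Bf L u v) \<le> ennreal C * (en L (1 + \<alpha>) u * en L \<alpha> v)" if "u 0 = 0" "v 0 = 0" for u v
  proof -
    have "en L (\<alpha> - 1) (Bf L u v) \<le> (\<integral>\<^sup>+k. ennreal (wave L k powr (2 * \<alpha>)) * (\<integral>\<^sup>+j. ennreal (norm (u (k - j)) * norm (v j)) \<partial>count_space UNIV)\<^sup>2 \<partial>count_space UNIV)"
      unfolding en_def
    proof (intro nn_integral_mono)
      fix k
      let ?I = "\<integral>\<^sup>+j. ennreal (norm (u (k - j)) * norm (v j)) \<partial>count_space UNIV"
      have "ennreal (norm (Bf L u v k)) \<le> (\<integral>\<^sup>+j. ennreal (norm ((\<i> * zdot L k (u (k - j))) *s v j)) \<partial>count_space UNIV)"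
        unfolding Bf_def by (rule ennreal_norm_integral_le)
      also have "\<dots> \<le> (\<integral>\<^sup>+j. ennreal (wave L k) * ennreal (norm (u (k - j)) * norm (v j)) \<partial>count_space UNIV)"
        by (intro nn_integral_mono) (simp add: ennreal_mult[symmetric] Bf_integrand_le ennreal_leI)
      also have "\<dots> = ennreal (wave L k) * ?I"
        by (simp add: nn_integral_cmult)
      finally have "(ennreal (norm (Bf L u v k)))\<^sup>2 \<le> (ennreal (wave L k) * ?I)\<^sup>2"
        by (intro power_mono) auto
      then have "ennreal (wave L k powr (2 * (\<alpha> - 1))) * (ennreal (norm (Bf L u v k)))\<^sup>2
         \<le> ennreal (wave L k powr (2 * (\<alpha> - 1))) * (ennreal (wave L k) * ?I)\<^sup>2"
        by (intro mult_left_mono) auto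
      also have "\<dots> = ennreal (wave L k powr (2 * (\<alpha> - 1)) * (wave L k)\<^sup>2) * ?I\<^sup>2"
        by (simp add: power_mult_distrib ennreal_mult ennreal_power mult.assoc)
      also have "wave L k powr (2 * (\<alpha> - 1)) * (wave L k)\<^sup>2 = wave L k powr (2 * \<alpha>)"
      proof (cases "k = 0")
        case False
        then have "(wave L k)\<^sup>2 = wave L k powr 2"
          using wave_pos[OF L False] by (simp add: powr_numeral)
        then show ?thesis by (simp only: powr_add[symmetric]) simp
      qed simp
      finally show "ennreal (wave L k powr (2 * (\<alpha> - 1)) * (norm (Bf L u v k))\<^sup>2)
         \<le> ennreal (wave L k powr (2 * \<alpha>)) * ?I\<^sup>2"
        by (simp add: ennreal_mult ennreal_power)
    qed
    also have "\<dots> \<le> ennreal C * (en L (1 + \<alpha>) u * en L \<alpha> v)"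
      using C that by blast
    finally show ?thesis .
  qed
  then show ?thesis using \<open>C \<ge> 0\<close> by blast
qed

lemma norm_NB_le: "L > 0 \<Longrightarrow> norm (NB L u v k) \<le> norm (Bf L u v k)"
  by (simp add: NB_def norm_leray)

lemma en_NB_le:
  assumes L: "L > 0" and \<alpha>: "\<alpha> > 1/2"
  shows "\<exists>C\<ge>0. \<forall>u v. u 0 = 0 \<longrightarrow> v 0 = 0 \<longrightarrow> en L (\<alpha> - 1) (NB L u v) \<le> ennreal C * (en L (1 + \<alpha>) u * en L \<alpha> v)"
  using en_Bf_le[OF assms] en_mono[of "NB L _ _" "Bf L _ _", OF norm_NB_le[OF L]]
  by (meson order_trans)

lemma vcnj_vcnj [simp]: "vcnj (vcnj c) = c"
  by (simp add: vcnj_def vec_eq_iff)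

text \<open>Conjugation is an involution and preserves integrability in both directions, so in the
  nonintegrable case both sides are 0.\<close>

lemma vcnj_integral: 
  fixes f :: "'a \<Rightarrow> complex^3"
  shows "vcnj (integral\<^sup>L M f) = (LINT x|M. vcnj (f x))"
proof (cases "integrable M f")
  case True
  then show ?thesis by (rule integral_bounded_linear[OF bounded_linear_vcnj, symmetric])
next
  case False
  have "\<not> integrable M (\<lambda>x. vcnj (f x))"
  proof
    assume "integrable M (\<lambda>x. vcnj (f x))"
    then have "integrable M (\<lambda>x. vcnj (vcnj (f x)))"
      by (rule integrable_bounded_linear[OF bounded_linear_vcnj])
    then show False using False by simp
  qed
  then show ?thesis using False
    by (simp add: not_integrable_integral_eq vcnj_def vec_eq_iff)
qed

lemma Bf_minus:
  assumes "u \<in> solenoidal L" "v \<in> solenoidal L"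
  shows "Bf L u v (- k) = vcnj (Bf L u v k)"
proof -
  have bij: "bij (uminus :: int^3 \<Rightarrow> int^3)"
    by (intro bij_betw_byWitness[where f' = uminus]) auto
  have "Bf L u v (- k) = (LINT j|count_space UNIV. (\<i> * zdot L (- k) (u (- k - (- j)))) *s v (- j))"
    unfolding Bf_def by (rule integral_bij_count_space[OF bij, symmetric])
  also have "\<dots> = (LINT j|count_space UNIV. vcnj ((\<i> * zdot L k (u (k - j))) *s v j))"
  proof (rule Bochner_Integration.integral_cong[OF refl])
    fix j
    have "u (- k - (- j)) = vcnj (u (k - j))" "v (- j) = vcnj (v j)"
      using assms unfolding solenoidal_iff by (metis minus_diff_eq minus_diff_commute diff_minus_eq_add uminus_add_conv_diff)+
    then show "(\<i> * zdot L (- k) (u (- k - (- j)))) *s v (- j) = vcnj ((\<i> * zdot L k (u (k - j))) *s v j)"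
      by (simp add: vcnj_smult zdot_minus_freq zdot_vcnj)
  qed
  finally show ?thesis by (simp add: Bf_def vcnj_integral)
qed

lemma NB_solenoidal:
  assumes "L > 0" "u \<in> solenoidal L" "v \<in> solenoidal L"
  shows "NB L u v \<in> solenoidal L"
  unfolding solenoidal_iff
  using assms by (auto simp: NB_def zdot_leray Bf_minus leray_vcnj leray_eq)

section \<open>Measurable dependence of the nonlinear term on time\<close>

lemma sum_measurable:
  fixes f :: "'a::countable \<Rightarrow> 'b \<Rightarrow> 'c::{banach, second_countable_topology}"
  assumes "\<And>j. f j \<in> borel_measurable N"
  shows "(\<lambda>x. LINT j|count_space UNIV. f j x) \<in> borel_measurable N"
proof -
  interpret sigma_finite_measure "count_space (UNIV :: 'a set)"
    by (rule sigma_finite_measure_count_space_countable) simp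
  show ?thesis
  proof (rule borel_measurable_lebesgue_integral)
    show "(\<lambda>(x, j). f j x) \<in> borel_measurable (N \<Otimes>\<^sub>M count_space UNIV)"
      unfolding case_prod_unfold
      by (rule measurable_compose_countable[where f = "\<lambda>j p. f j (fst p)", OF measurable_compose[OF measurable_fst assms] measurable_snd])
  qed
qed

lemma measurable_bounded_linear:
  assumes "bounded_linear h" "f \<in> borel_measurable M"
  shows "(\<lambda>x. h (f x)) \<in> borel_measurable M"
  using assms borel_measurable_continuous_onI[of h] linear_continuous_on[OF assms(1)]
  by (intro measurable_compose[OF assms(2)]) (auto simp: continuous_on_eq_continuous_at bounded_linear.continuous)

lemma NB_measurable:
  assumes "\<And>k. (\<lambda>t. u t k) \<in> borel_measurable M" "\<And>k. (\<lambda>t. v t k) \<in> borel_measurable M"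
  shows "(\<lambda>t. NB L (u t) (v t) k) \<in> borel_measurable M"
proof -
  have "(\<lambda>t. (\<i> * zdot L k (u t (k - j))) *s v t j) \<in> borel_measurable M" for j
  proof -
    have *: "c *s x = (\<chi> i. c * x $ i)" for c and x :: "complex^3"
      by (simp add: vec_eq_iff)
    have z: "(\<lambda>t. zdot L k (u t (k - j))) \<in> borel_measurable M"
      by (rule measurable_bounded_linear[OF bounded_linear_zdot assms(1)])
    have c: "(\<lambda>t. v t j $ i) \<in> borel_measurable M" for i
      by (rule measurable_bounded_linear[OF bounded_linear_vec_nth assms(2)])
    \<comment> \<open>The vector is rebuilt from its components by the fixed bounded linear maps
      sending a scalar a to \<open>a *s axis i 1\<close>, so that measurability reduces to that of
      scalar products.\<close>
    have "(\<lambda>t. \<Sum>i\<in>UNIV. ((\<i> * zdot L k (u t (k - j))) * v t j $ i) *s axis i 1 :: complex^3) \<in> borel_measurable M"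
      using z c by (intro borel_measurable_sum measurable_bounded_linear[OF bounded_linear_vec_smult_left] borel_measurable_times) auto
    moreover have "(\<Sum>i\<in>UNIV. ((\<i> * zdot L k (u t (k - j))) * v t j $ i) *s axis i 1) = (\<i> * zdot L k (u t (k - j))) *s v t j" for t
      by (simp add: vec_eq_iff axis_def if_distrib sum.delta cong: if_cong)
    ultimately show ?thesis by simp
  qed
  then show ?thesis
    unfolding NB_def Bf_def by (intro measurable_bounded_linear[OF bounded_linear_leray] sum_measurable)
qed

section \<open>The duality pairing\<close>

text \<open>Cauchy-Schwarz with the weights \<open>wave L k powr s\<close> and
  \<open>wave L k powr (- s)\<close>. Their product is 1 except at the zero frequency, where it is
  0; there one of the two coefficients has to vanish.\<close>

lemma pairing_summable:
  assumes L: "L > 0" and z: "x 0 = 0 \<or> y 0 = 0"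
  shows "(\<integral>\<^sup>+k. ennreal (norm (x k) * norm (y k)) \<partial>count_space UNIV)\<^sup>2 \<le> en L s x * en L (- s) y"
proof -
  have *: "norm (x k) * norm (y k) = (wave L k powr s * norm (x k)) * (wave L k powr (- s) * norm (y k))" for k
  proof (cases "k = 0")
    case False
    then have "wave L k powr s * wave L k powr (- s) = 1"
      using wave_pos[OF L False] by (simp add: powr_add[symmetric])
    then show ?thesis by (metis mult.assoc mult.commute mult.left_neutral)
  qed (use z in auto)
  have sq: "(ennreal (wave L k powr s * norm (x k)))\<^sup>2 = ennreal (wave L k powr (2 * s) * (norm (x k))\<^sup>2)" for k s and x :: field
    by (simp add: ennreal_power power_mult_distrib power2_eq_square[of "_ powr _"] powr_add[symmetric])
  have "(\<integral>\<^sup>+k. ennreal (norm (x k) * norm (y k)) \<partial>count_space UNIV)\<^sup>2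
    = (\<integral>\<^sup>+k. ennreal (wave L k powr s * norm (x k)) * ennreal (wave L k powr (- s) * norm (y k)) \<partial>count_space UNIV)\<^sup>2"
    unfolding * by (simp add: ennreal_mult)
  also have "\<dots> \<le> (\<integral>\<^sup>+k. (ennreal (wave L k powr s * norm (x k)))\<^sup>2 \<partial>count_space UNIV) * (\<integral>\<^sup>+k. (ennreal (wave L k powr (- s) * norm (y k)))\<^sup>2 \<partial>count_space UNIV)"
    by (rule Cauchy_Schwarz_nn_integral) auto
  finally show ?thesis unfolding sq en_def .
qed

lemma pairing_integrable:
  assumes L: "L > 0" and z: "x 0 = 0 \<or> y 0 = 0" and fin: "en L s x < \<infinity>" "en L (- s) y < \<infinity>"
  shows "integrable (count_space UNIV) (\<lambda>k. x k \<bullet> y k)"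
proof -
  have "(\<integral>\<^sup>+k. ennreal (norm (x k \<bullet> y k)) \<partial>count_space UNIV) \<le> (\<integral>\<^sup>+k. ennreal (norm (x k) * norm (y k)) \<partial>count_space UNIV)"
    by (intro nn_integral_mono ennreal_leI) (simp add: Cauchy_Schwarz_ineq2)
  moreover have "(\<integral>\<^sup>+k. ennreal (norm (x k) * norm (y k)) \<partial>count_space UNIV)\<^sup>2 < \<infinity>"
    using pairing_summable[of L x y s, OF L z] fin by (auto simp: ennreal_mult_less_top elim!: le_less_trans)
  ultimately show ?thesis
    by (auto simp: integrable_count_space_iff power_less_top_ennreal elim!: le_less_trans)
qed

lemma pairing_eq_integral:
  assumes L: "L > 0" and z: "x 0 = 0 \<or> y 0 = 0" and fin: "en L s x < \<infinity>" "en L (- s) y < \<infinity>"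
  shows "pairing L x y = L ^ 3 * (LINT k|count_space UNIV. x k \<bullet> y k)"
  unfolding pairing_def by (simp add: infsum_eq_integral pairing_integrable[OF assms])

lemma pairing_bound:
  assumes L: "L > 0" and z: "x 0 = 0 \<or> y 0 = 0" and fin: "en L s x < \<infinity>" "en L (- s) y < \<infinity>"
  shows "(ennreal \<bar>pairing L x y\<bar>)\<^sup>2 \<le> ennreal (L ^ 6) * (en L s x * en L (- s) y)"
proof -
  have "ennreal \<bar>pairing L x y\<bar> = ennreal (L ^ 3) * ennreal (norm (LINT k|count_space UNIV. x k \<bullet> y k))"
    unfolding pairing_eq_integral[OF assms] using L by (simp add: abs_mult ennreal_mult)
  also have "\<dots> \<le> ennreal (L ^ 3) * (\<integral>\<^sup>+k. ennreal (norm (x k \<bullet> y k)) \<partial>count_space UNIV)"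
    by (intro mult_left_mono ennreal_norm_integral_le) auto
  also have "\<dots> \<le> ennreal (L ^ 3) * (\<integral>\<^sup>+k. ennreal (norm (x k) * norm (y k)) \<partial>count_space UNIV)"
    by (intro mult_left_mono nn_integral_mono ennreal_leI) (simp_all add: Cauchy_Schwarz_ineq2)
  finally have "(ennreal \<bar>pairing L x y\<bar>)\<^sup>2 \<le> (ennreal (L ^ 3) * (\<integral>\<^sup>+k. ennreal (norm (x k) * norm (y k)) \<partial>count_space UNIV))\<^sup>2"
    by (intro power_mono) auto
  also have "\<dots> = ennreal (L ^ 6) * (\<integral>\<^sup>+k. ennreal (norm (x k) * norm (y k)) \<partial>count_space UNIV)\<^sup>2"
    using L by (simp add: power_mult_distrib ennreal_power)
  also have "\<dots> \<le> ennreal (L ^ 6) * (en L s x * en L (- s) y)"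
    by (intro mult_left_mono pairing_summable[of L x y s, OF L z]) auto
  finally show ?thesis .
qed

section \<open>Trigonometric polynomials\<close>

definition wexp :: "real \<Rightarrow> int^3 \<Rightarrow> real^3 \<Rightarrow> complex" where
  "wexp L k x = exp (\<i> * complex_of_real (x \<bullet> freq L k))"

lemma wexp_add: "wexp L (j + k) x = wexp L j x * wexp L k x"
  by (simp add: wexp_def freq_add inner_add_right algebra_simps exp_add)

lemma wexp_minus: "wexp L (- k) x = cnj (wexp L k x)"
  by (simp add: wexp_def freq_minus exp_cnj)

text \<open>Conjugation exchanges the terms of k and -k, so the sum is its own conjugate. This is
  why taking \<open>Re\<close> in \<open>trig_eval\<close> loses nothing.\<close>

lemma wexp_real_sum:
  assumes S: "finite S" "uminus ` S = S" and c: "\<And>k. c (- k) = cnj (c k)"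
  shows "(\<Sum>k\<in>S. wexp L k x * c k) \<in> \<real>"
proof -
  have "cnj (\<Sum>k\<in>S. wexp L k x * c k) = (\<Sum>k\<in>S. wexp L (- k) x * c (- k))"
    by (simp add: wexp_minus c)
  also have "\<dots> = (\<Sum>k\<in>uminus ` S. wexp L k x * c k)"
    by (subst sum.reindex) (auto simp: inj_on_def)
  finally show ?thesis
    using S by (simp add: Reals_cnj_iff)
qed

lemma integral_lborel_prod:
  fixes f :: "'a::euclidean_space \<Rightarrow> real \<Rightarrow> complex"
  assumes "\<And>b. b \<in> Basis \<Longrightarrow> integrable lborel (f b)"
  shows "(LINT x|lborel. (\<Prod>b\<in>Basis. f b (x \<bullet> b))) = (\<Prod>b\<in>Basis. (LINT x|lborel. f b x))"
proof -
  interpret product_sigma_finite "\<lambda>_::'a. lborel :: real measure" ..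
  have [measurable]: "f b \<in> borel_measurable borel" if "b \<in> Basis" for b
    using borel_measurable_integrable[OF assms[OF that]] by simp
  have "(LINT x|lborel. (\<Prod>b\<in>Basis. f b (x \<bullet> b)))
    = (LINT g|(\<Pi>\<^sub>M b\<in>Basis. lborel). (\<Prod>b\<in>Basis. f b ((\<Sum>b\<in>Basis. g b *\<^sub>R b) \<bullet> b)))"
    by (subst lborel_eq, subst integral_distr) auto
  also have "\<dots> = (LINT g|(\<Pi>\<^sub>M b\<in>Basis. lborel). (\<Prod>b\<in>Basis. f b (g b)))"
    by simp
  also have "\<dots> = (\<Prod>b\<in>Basis. (LINT x|lborel. f b x))"
    by (rule product_integral_prod) (auto intro: assms)
  finally show ?thesis .
qed

lemma integral_exp_period:
  fixes m :: int
  assumes L: "L > 0"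
  shows "(LINT t|lborel. indicator {0..L} t *\<^sub>R exp (\<i> * complex_of_real (t * (2 * pi / L * m)))) = (if m = 0 then complex_of_real L else 0)"
proof (cases "m = 0")
  case True
  then show ?thesis using L by (simp add: scaleR_conv_of_real)
next
  case False
  define c where "c = \<i> * complex_of_real (2 * pi / L * m)"
  have c: "c \<noteq> 0" using False L by (simp add: c_def)
  have "(LINT t|lborel. indicator {0..L} t *\<^sub>R exp (\<i> * complex_of_real (t * (2 * pi / L * m)))) = exp (c * complex_of_real L) / c - exp (c * complex_of_real 0) / c"
  proof -
    have "((\<lambda>t. exp (c * complex_of_real t) / c) has_vector_derivative exp (\<i> * complex_of_real (t * (2 * pi / L * m)))) (at t within {0..L})" for t
    proof -
      have "((\<lambda>z. exp (c * z) / c) has_field_derivative exp (c * complex_of_real t)) (at (complex_of_real t))"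
        using c by (auto intro!: derivative_eq_intros)
      then have "((\<lambda>t. exp (c * complex_of_real t) / c) has_vector_derivative exp (c * complex_of_real t)) (at t within {0..L})"
        by (rule has_vector_derivative_real_field)
      moreover have "c * complex_of_real t = \<i> * complex_of_real (t * (2 * pi / L * m))"
        by (simp add: c_def)
      ultimately show ?thesis by simp
    qed
    note deriv = this
    have "continuous_on {0..L} (\<lambda>t. exp (\<i> * complex_of_real (t * (2 * pi / L * m))))"
      by (intro continuous_intros)
    with deriv show ?thesis
      using L by (intro integral_FTC_Icc) simp_all
  qed
  also have "exp (c * L) = 1"
  proof -
    have "c * L = \<i> * (of_int m * (of_real pi * 2))"
      using L by (simp add: c_def)
    then show ?thesis using exp_integer_2pi[of "of_int m"]
      by (simp add: mult.commute mult.left_commute)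
  qed
  finally show ?thesis using False by simp
qed

text \<open>Orthogonality of the characters. Both the indicator of the cube and the exponential
  factor over the coordinates, and a coordinate with nonzero integer frequency integrates to 0 over
  a full period.\<close>

lemma integral_wexp:
  assumes L: "L > 0"
  shows "integral (cbox 0 (\<chi> _. L)) (wexp L k) = (if k = 0 then complex_of_real (L ^ 3) else 0)"
proof -
  let ?h = "\<lambda>b t. indicator {0..L} t *\<^sub>R exp (\<i> * complex_of_real (t * (freq L k \<bullet> b)))"
  have int: "integrable lborel (?h b)" for b :: "real^3"
  proof -
    have "set_integrable lborel {0..L} (\<lambda>t. exp (\<i> * complex_of_real (t * (freq L k \<bullet> b))))"
      by (intro borel_integrable_atLeastAtMost') (auto intro!: continuous_intros)
    then show ?thesis by (simp add: set_integrable_def)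
  qed
  have box: "(\<lambda>x. \<Prod>b\<in>Basis. ?h b (x \<bullet> b)) = (\<lambda>x. indicator (cbox 0 (\<chi> _. L)) x *\<^sub>R wexp L k x)"
  proof
    fix x :: "real^3"
    have "(\<Prod>b\<in>Basis. ?h b (x \<bullet> b)) = (\<Prod>b\<in>Basis. complex_of_real (indicator {0..L} (x \<bullet> b))) * (\<Prod>b\<in>Basis. exp (\<i> * complex_of_real ((x \<bullet> b) * (freq L k \<bullet> b))))"
      by (simp only: scaleR_conv_of_real prod.distrib)
    also have "(\<Prod>b\<in>Basis. exp (\<i> * complex_of_real ((x \<bullet> b) * (freq L k \<bullet> b)))) = wexp L k x"
      unfolding wexp_def euclidean_inner[of x "freq L k"] by (simp add: exp_sum sum_distrib_left)
    also have "(\<Prod>b\<in>Basis. complex_of_real (indicator {0..L} (x \<bullet> b))) = complex_of_real (indicator (cbox 0 (\<chi> _. L)) x)"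
    proof (cases "x \<in> cbox 0 (\<chi> _. L)")
      case True
      then have "x \<bullet> b \<in> {0..L}" if "b \<in> Basis" for b
        using that by (auto simp: mem_box_cart Basis_vec_def inner_axis)
      then show ?thesis using True by simp
    next
      case False
      then obtain i where "x $ i \<notin> {0..L}"
        by (auto simp: mem_box_cart)
      then have "complex_of_real (indicator {0..L} (x \<bullet> axis i 1)) = 0" "axis i 1 \<in> (Basis :: (real^3) set)"
        by (auto simp: inner_axis)
      then show ?thesis using False by (auto intro!: prod_zero)
    qed
    finally show "(\<Prod>b\<in>Basis. ?h b (x \<bullet> b)) = indicator (cbox 0 (\<chi> _. L)) x *\<^sub>R wexp L k x"
      by (simp add: scaleR_conv_of_real)
  qed
  have "integral (cbox 0 (\<chi> _. L)) (wexp L k) = (LINT x|lborel. indicator (cbox 0 (\<chi> _. L)) x *\<^sub>R wexp L k x)"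
  proof -
    have "set_integrable lborel (cbox 0 (\<chi> _. L)) (wexp L k)"
      unfolding set_integrable_def
      by (intro borel_integrable_compact) (auto simp: wexp_def[abs_def] intro!: continuous_intros)
    from set_borel_integral_eq_integral(2)[OF this] show ?thesis
      by (simp add: set_lebesgue_integral_def)
  qed
  also have "\<dots> = (\<Prod>b\<in>Basis. (LINT t|lborel. ?h b t))"
    unfolding box[symmetric] by (rule integral_lborel_prod[OF int])
  also have "\<dots> = (\<Prod>i\<in>UNIV. (LINT t|lborel. ?h (axis i 1) t))"
  proof -
    have B: "(Basis :: (real^3) set) = (\<lambda>i. axis i 1) ` UNIV"
      by (auto simp: Basis_vec_def)
    have inj: "inj (\<lambda>i::3. axis i (1::real))"
      by (auto simp: inj_on_def axis_eq_axis)
    show ?thesis unfolding B prod.reindex[OF inj] comp_def ..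
  qed
  also have "\<dots> = (\<Prod>i\<in>UNIV. if k $ i = 0 then complex_of_real L else 0)"
    using integral_exp_period[OF L] by (intro prod.cong refl) (simp only: inner_axis freq_def vec_lambda_beta inner_real_def mult_1_right)
  also have "\<dots> = (if k = 0 then complex_of_real (L ^ 3) else 0)"
    by (auto simp: vec_eq_iff prod_zero_iff)
  finally show ?thesis .
qed

lemma sum_mult3:
  fixes f g h :: "'a \<Rightarrow> complex"
  shows "(\<Sum>a\<in>A. f a) * (\<Sum>b\<in>B. g b) * (\<Sum>c\<in>C. h c) = (\<Sum>a\<in>A. \<Sum>b\<in>B. \<Sum>c\<in>C. f a * g b * h c)"
  unfolding mult.assoc sum_product[of g B h C] by (subst sum_distrib_right) (simp only: sum_distrib_left)

lemma sum_swap3: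
  "(\<Sum>a\<in>A. \<Sum>b\<in>B. \<Sum>c\<in>C. f a b c) = (\<Sum>c\<in>C. \<Sum>b\<in>B. \<Sum>a\<in>A. f a b c)"
proof -
  have "(\<Sum>a\<in>A. \<Sum>b\<in>B. \<Sum>c\<in>C. f a b c) = (\<Sum>a\<in>A. \<Sum>c\<in>C. \<Sum>b\<in>B. f a b c)"
    by (intro sum.cong refl sum.swap)
  also have "\<dots> = (\<Sum>c\<in>C. \<Sum>a\<in>A. \<Sum>b\<in>B. f a b c)"
    by (rule sum.swap)
  also have "\<dots> = (\<Sum>c\<in>C. \<Sum>b\<in>B. \<Sum>a\<in>A. f a b c)"
    by (intro sum.cong refl sum.swap)
  finally show ?thesis .
qed

lemma sum_swap4:
  "(\<Sum>a\<in>A. \<Sum>b\<in>B. \<Sum>c\<in>C. \<Sum>d\<in>D. f a b c d) = (\<Sum>c\<in>C. \<Sum>d\<in>D. \<Sum>a\<in>A. \<Sum>b\<in>B. f a b c d)"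
proof -
  have "(\<Sum>a\<in>A. \<Sum>b\<in>B. \<Sum>c\<in>C. \<Sum>d\<in>D. f a b c d) = (\<Sum>a\<in>A. \<Sum>c\<in>C. \<Sum>d\<in>D. \<Sum>b\<in>B. f a b c d)"
    by (intro sum.cong refl, subst sum.swap) (intro sum.cong refl sum.swap)
  also have "\<dots> = (\<Sum>c\<in>C. \<Sum>a\<in>A. \<Sum>d\<in>D. \<Sum>b\<in>B. f a b c d)"
    by (rule sum.swap)
  also have "\<dots> = (\<Sum>c\<in>C. \<Sum>d\<in>D. \<Sum>a\<in>A. \<Sum>b\<in>B. f a b c d)"
    by (intro sum.cong refl sum.swap)
  finally show ?thesis .
qed

lemma trig_polys_support:
  assumes "u \<in> trig_polys L"
  shows "finite {k. u k \<noteq> 0}" "uminus ` {k. u k \<noteq> 0} = {k. u k \<noteq> 0}" "u (- k) $ i = cnj (u k $ i)"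
proof -
  show "finite {k. u k \<noteq> 0}"
    using assms by (simp add: trig_polys_def)
  have *: "u (- k) = vcnj (u k)" for k
    using assms by (simp add: trig_polys_def solenoidal_iff)
  then show "u (- k) $ i = cnj (u k $ i)"
    by (simp add: vcnj_def)
  have "u (- k) \<noteq> 0 \<longleftrightarrow> u k \<noteq> 0" for k
    unfolding * by (simp add: vcnj_def vec_eq_iff)
  then show "uminus ` {k. u k \<noteq> 0} = {k. u k \<noteq> 0}"
    by (auto simp: image_iff) (metis minus_minus)
qed

lemma trig_eval_complex:
  assumes "u \<in> trig_polys L"
  shows "complex_of_real (trig_eval L u x $ i) = (\<Sum>k | u k \<noteq> 0. wexp L k x * u k $ i)"
proof -
  have "(\<Sum>k | u k \<noteq> 0. wexp L k x * u k $ i) \<in> \<real>"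
    using trig_polys_support[OF assms] by (intro wexp_real_sum)
  then show ?thesis
    unfolding trig_eval_def wexp_def vec_lambda_beta by (rule of_real_Re)
qed

lemma trig_eval_derivative_complex:
  assumes "u \<in> trig_polys L"
  shows "complex_of_real (frechet_derivative (\<lambda>y. trig_eval L u y $ i) (at x) (axis j 1))
     = (\<Sum>k | u k \<noteq> 0. wexp L k x * (\<i> * complex_of_real (freq L k $ j) * u k $ i))"
proof -
  let ?D = "\<lambda>h. Re (\<Sum>k | u k \<noteq> 0. wexp L k x * (\<i> * complex_of_real (h \<bullet> freq L k)) * u k $ i)"
  have "((\<lambda>y. trig_eval L u y $ i) has_derivative ?D) (at x)"
  proof -
    have "(wexp L k has_derivative (\<lambda>h. wexp L k x * (\<i> * complex_of_real (h \<bullet> freq L k)))) (at x)" for k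
    proof -
      have "bounded_linear (\<lambda>h. \<i> * complex_of_real (h \<bullet> freq L k))"
        by (intro bounded_linear_const_mult bounded_linear_compose[OF bounded_linear_of_real] bounded_linear_inner_left)
      then have "((\<lambda>h. \<i> * complex_of_real (h \<bullet> freq L k)) has_derivative (\<lambda>h. \<i> * complex_of_real (h \<bullet> freq L k))) (at x)"
        by (rule bounded_linear_imp_has_derivative)
      from has_derivative_compose[OF this DERIV_exp[unfolded has_field_derivative_def]] show ?thesis
        by (simp add: wexp_def[abs_def])
    qed
    then have "((\<lambda>y. Re (\<Sum>k | u k \<noteq> 0. wexp L k y * u k $ i)) has_derivative ?D) (at x)"
      by (intro bounded_linear.has_derivative[OF bounded_linear_Re] has_derivative_sum
          bounded_linear.has_derivative[OF bounded_linear_mult_left])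
    then show ?thesis
      unfolding trig_eval_def vec_lambda_beta wexp_def .
  qed
  then have "frechet_derivative (\<lambda>y. trig_eval L u y $ i) (at x) (axis j 1) = ?D (axis j 1)"
    by (rule fun_cong[OF frechet_derivative_at[symmetric]])
  also have "\<dots> = Re (\<Sum>k | u k \<noteq> 0. wexp L k x * (\<i> * complex_of_real (freq L k $ j) * u k $ i))"
    by (simp only: inner_axis' mult.assoc mult_1_left inner_real_def)
  finally have *: "frechet_derivative (\<lambda>y. trig_eval L u y $ i) (at x) (axis j 1) = \<dots>" .
  have "(\<Sum>k | u k \<noteq> 0. wexp L k x * (\<i> * complex_of_real (freq L k $ j) * u k $ i)) \<in> \<real>"
    using trig_polys_support[OF assms] by (intro wexp_real_sum) (auto simp: freq_minus)
  then show ?thesis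
    unfolding * by (rule of_real_Re)
qed

text \<open>The third factor is real and may be replaced by its conjugate, which carries the
  frequency -c. Expanding the product and integrating then leaves only the triads with
  \<open>a + b = c\<close>.\<close>

lemma b_trig_component:
  assumes L: "L > 0" and uvw: "u \<in> trig_polys L" "v \<in> trig_polys L" "w \<in> trig_polys L"
  shows "complex_of_real (integral (cbox 0 (\<chi> _. L)) (\<lambda>x. trig_eval L u x $ j
       * frechet_derivative (\<lambda>y. trig_eval L v y $ i) (at x) (axis j 1) * trig_eval L w x $ i))
   = (\<Sum>a | u a \<noteq> 0. \<Sum>b | v b \<noteq> 0. \<Sum>c | w c \<noteq> 0.
       (if a + b = c then complex_of_real (L ^ 3) else 0) * (u a $ j * (\<i> * complex_of_real (freq L b $ j) * v b $ i) * cnj (w c $ i)))"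
proof -
  let ?F = "\<lambda>x. trig_eval L u x $ j
       * frechet_derivative (\<lambda>y. trig_eval L v y $ i) (at x) (axis j 1) * trig_eval L w x $ i"
  let ?c = "\<lambda>a b c. u a $ j * (\<i> * complex_of_real (freq L b $ j) * v b $ i) * cnj (w c $ i)"
  let ?G = "\<lambda>x. \<Sum>a | u a \<noteq> 0. \<Sum>b | v b \<noteq> 0. \<Sum>c | w c \<noteq> 0. wexp L (a + b - c) x * ?c a b c"
  have FG: "complex_of_real (?F x) = ?G x" for x
  proof -
    have "complex_of_real (trig_eval L w x $ i) = cnj (complex_of_real (trig_eval L w x $ i))"
      by simp
    also have "\<dots> = (\<Sum>c | w c \<noteq> 0. wexp L (- c) x * cnj (w c $ i))"
      unfolding trig_eval_complex[OF uvw(3)] by (simp add: wexp_minus)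
    finally have w: "complex_of_real (trig_eval L w x $ i) = \<dots>" .
    have "complex_of_real (?F x) = (\<Sum>a | u a \<noteq> 0. wexp L a x * u a $ j)
       * (\<Sum>b | v b \<noteq> 0. wexp L b x * (\<i> * complex_of_real (freq L b $ j) * v b $ i)) * (\<Sum>c | w c \<noteq> 0. wexp L (- c) x * cnj (w c $ i))"
      unfolding of_real_mult w trig_eval_complex[OF uvw(1)] trig_eval_derivative_complex[OF uvw(2)] ..
    also have "\<dots> = ?G x"
      unfolding sum_mult3
      by (intro sum.cong refl) (simp add: wexp_add diff_conv_add_uminus algebra_simps del: add_uminus_conv_diff)
    finally show ?thesis .
  qed
  have int1: "wexp L k integrable_on cbox 0 (\<chi> _. L)" for k
    by (intro integrable_continuous) (auto simp: wexp_def[abs_def] intro!: continuous_intros)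
  have G_int: "?G integrable_on cbox 0 (\<chi> _. L)"
    using trig_polys_support(1)[OF uvw(1)] trig_polys_support(1)[OF uvw(2)] trig_polys_support(1)[OF uvw(3)]
    by (intro integrable_sum integrable_on_mult_left int1) auto
  have "integral (cbox 0 (\<chi> _. L)) ?F = integral (cbox 0 (\<chi> _. L)) (Re \<circ> ?G)"
    by (rule integral_cong) (simp add: FG[symmetric])
  also have "\<dots> = Re (integral (cbox 0 (\<chi> _. L)) ?G)"
    by (rule integral_linear[OF G_int bounded_linear_Re])
  finally have re: "integral (cbox 0 (\<chi> _. L)) ?F = Re (integral (cbox 0 (\<chi> _. L)) ?G)" .
  have "Im \<circ> ?G = (\<lambda>x. 0)"
    unfolding comp_def FG[symmetric] by simp
  then have "Im (integral (cbox 0 (\<chi> _. L)) ?G) = 0"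
    unfolding integral_linear[OF G_int bounded_linear_Im, symmetric] by simp
  then have "complex_of_real (integral (cbox 0 (\<chi> _. L)) ?F) = integral (cbox 0 (\<chi> _. L)) ?G"
    unfolding re by (simp add: complex_eq_iff)
  also have "\<dots> = (\<Sum>a | u a \<noteq> 0. \<Sum>b | v b \<noteq> 0. \<Sum>c | w c \<noteq> 0. integral (cbox 0 (\<chi> _. L)) (wexp L (a + b - c)) * ?c a b c)"
    using trig_polys_support(1)[OF uvw(1)] trig_polys_support(1)[OF uvw(2)] trig_polys_support(1)[OF uvw(3)]
    by (intro integral_unique has_integral_sum has_integral_mult_left integrable_integral int1) auto
  finally show ?thesis
    by (simp add: integral_wexp[OF L])
qed

lemma pairing_finite:
  assumes "finite C" "\<And>k. k \<notin> C \<Longrightarrow> w k = 0"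
  shows "pairing L x w = L ^ 3 * (\<Sum>k\<in>C. x k \<bullet> w k)"
proof -
  have "infsum (\<lambda>k. x k \<bullet> w k) UNIV = infsum (\<lambda>k. x k \<bullet> w k) C"
    using assms by (intro infsum_cong_neutral) auto
  then show ?thesis using assms by (simp add: pairing_def)
qed

text \<open>Resolving the triad condition for the first factor turns the triple sum into a
  convolution; divergence-freeness of u moves the derivative from the frequency of v to that of the
  output.\<close>

lemma b_trig_eq_pairing:
  assumes L: "L > 0" and uvw: "u \<in> trig_polys L" "v \<in> trig_polys L" "w \<in> trig_polys L"
  shows "b_trig L u v w = pairing L (Bf L u v) w"
proof -
  have fin: "finite {a. u a \<noteq> 0}" "finite {a. v a \<noteq> 0}" "finite {a. w a \<noteq> 0}"
    using trig_polys_support(1) uvw by auto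
  have sol: "zdot L k (u k) = 0" for k
    using uvw by (simp add: trig_polys_def solenoidal_iff)
  have inner: "(z *s a) \<bullet> b = Re (z * (\<Sum>i\<in>UNIV. a $ i * cnj (b $ i)))" for z and a b :: "complex^3"
    by (simp add: inner_vec_def inner_complex_def sum_distrib_left algebra_simps sum.distrib sum_subtractf)
  have Bf: "Bf L u v c = (\<Sum>b | v b \<noteq> 0. (\<i> * zdot L c (u (c - b))) *s v b)" for c
  proof -
    have sub: "{b. (\<i> * zdot L c (u (c - b))) *s v b \<noteq> 0} \<subseteq> {b. v b \<noteq> 0}"
      by auto
    have "Bf L u v c = (\<Sum>b | b \<in> UNIV \<and> (\<i> * zdot L c (u (c - b))) *s v b \<noteq> 0. (\<i> * zdot L c (u (c - b))) *s v b)"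
      unfolding Bf_def by (rule lebesgue_integral_count_space_finite_support) (use fin(2) sub in \<open>auto elim: finite_subset[rotated]\<close>)
    also have "\<dots> = (\<Sum>b | v b \<noteq> 0. (\<i> * zdot L c (u (c - b))) *s v b)"
      using fin(2) by (intro sum.mono_neutral_left) auto
    finally show ?thesis .
  qed
  have "complex_of_real (b_trig L u v w) = (\<Sum>i\<in>UNIV. \<Sum>j\<in>UNIV. \<Sum>a | u a \<noteq> 0. \<Sum>b | v b \<noteq> 0. \<Sum>c | w c \<noteq> 0.
       (if a + b = c then complex_of_real (L ^ 3) else 0) * (u a $ j * (\<i> * complex_of_real (freq L b $ j) * v b $ i) * cnj (w c $ i)))"
    unfolding b_trig_def of_real_sum b_trig_component[OF L uvw] ..
  also have "\<dots> = (\<Sum>i\<in>UNIV. \<Sum>j\<in>UNIV. \<Sum>c | w c \<noteq> 0. \<Sum>b | v b \<noteq> 0. \<Sum>a | u a \<noteq> 0.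
       (if a = c - b then complex_of_real (L ^ 3) * (u a $ j * (\<i> * complex_of_real (freq L b $ j) * v b $ i) * cnj (w c $ i)) else 0))"
    by (subst sum_swap3[where A = "{a. u a \<noteq> 0}"], intro sum.cong refl) (simp add: eq_diff_eq)
  \<comment> \<open>If \<open>c - b\<close> lies outside the support of u, the inner sum is empty of
    matching terms, and the new expression is 0 as well because
    \<open>u (c - b) = 0\<close>.\<close>
  also have "\<dots> = (\<Sum>i\<in>UNIV. \<Sum>j\<in>UNIV. \<Sum>c | w c \<noteq> 0. \<Sum>b | v b \<noteq> 0.
       complex_of_real (L ^ 3) * (u (c - b) $ j * (\<i> * complex_of_real (freq L b $ j) * v b $ i) * cnj (w c $ i)))"
    using fin(1) by (intro sum.cong refl) (auto simp: sum.delta)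
  also have "\<dots> = complex_of_real (L ^ 3) * (\<Sum>c | w c \<noteq> 0. \<Sum>b | v b \<noteq> 0.
       (\<Sum>i\<in>UNIV. \<Sum>j\<in>UNIV. (u (c - b) $ j * (\<i> * complex_of_real (freq L b $ j) * v b $ i) * cnj (w c $ i))))"
    unfolding sum_distrib_left by (rule sum_swap4)
  also have "\<dots> = complex_of_real (L ^ 3) * (\<Sum>c | w c \<noteq> 0. \<Sum>b | v b \<noteq> 0.
       \<i> * zdot L b (u (c - b)) * (\<Sum>i\<in>UNIV. v b $ i * cnj (w c $ i)))"
    by (intro arg_cong2[where f = "(*)"] sum.cong refl)
       (simp add: zdot_def sum_distrib_left sum_distrib_right algebra_simps, rule sum.swap)
  also have "\<dots> = complex_of_real (L ^ 3) * (\<Sum>c | w c \<noteq> 0. \<Sum>b | v b \<noteq> 0.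
       \<i> * zdot L c (u (c - b)) * (\<Sum>i\<in>UNIV. v b $ i * cnj (w c $ i)))"
  proof -
    \<comment> \<open>Since \<open>b = c - (c - b)\<close>, the difference of the two symbols is the
      divergence of u at its own frequency \<open>c - b\<close>, which is 0.\<close>
    have "zdot L b (u (c - b)) = zdot L c (u (c - b))" for b c
      using zdot_freq_diff[of L c b "u (c - b)"] sol[of "c - b"] by simp
    then show ?thesis by simp
  qed
  finally have "b_trig L u v w = Re \<dots>"
    by (metis Re_complex_of_real)
  also have "\<dots> = L ^ 3 * (\<Sum>c | w c \<noteq> 0. Bf L u v c \<bullet> w c)"
    unfolding Bf inner_sum_left inner by simp
  also have "\<dots> = pairing L (Bf L u v) w"
    using fin(3) by (subst pairing_finite) auto
  finally show ?thesis .
qed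

section \<open>Norms\<close>

lemma ennreal_power2_le_imp_le:
  fixes x y :: ennreal
  assumes "x\<^sup>2 \<le> y\<^sup>2"
  shows "x \<le> y"
  using assms
  by (cases x; cases y) (auto simp: ennreal_power power_eq_top_ennreal top_unique intro!: ennreal_leI power2_le_imp_le)

text \<open>Expansion of the square with Cauchy-Schwarz for the mixed term. Prescribing real bounds
  a and b instead of the integrals avoids square roots of extended reals.\<close>

lemma minkowski_nn_integral:
  fixes f g :: "'a \<Rightarrow> real"
  assumes [measurable]: "f \<in> borel_measurable M" "g \<in> borel_measurable M"
    and nn: "\<And>x. 0 \<le> f x" "\<And>x. 0 \<le> g x" "0 \<le> a" "0 \<le> b"
    and fa: "(\<integral>\<^sup>+x. ennreal ((f x)\<^sup>2) \<partial>M) \<le> ennreal (a\<^sup>2)"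
    and gb: "(\<integral>\<^sup>+x. ennreal ((g x)\<^sup>2) \<partial>M) \<le> ennreal (b\<^sup>2)"
  shows "(\<integral>\<^sup>+x. ennreal ((f x + g x)\<^sup>2) \<partial>M) \<le> ennreal ((a + b)\<^sup>2)"
proof -
  have "(\<integral>\<^sup>+x. ennreal (f x) * ennreal (g x) \<partial>M)\<^sup>2 \<le> (\<integral>\<^sup>+x. (ennreal (f x))\<^sup>2 \<partial>M) * (\<integral>\<^sup>+x. (ennreal (g x))\<^sup>2 \<partial>M)"
    by (rule Cauchy_Schwarz_nn_integral) auto
  also have "\<dots> \<le> ennreal (a\<^sup>2) * ennreal (b\<^sup>2)"
    using fa gb nn by (intro mult_mono) (auto simp: ennreal_power)
  also have "\<dots> = (ennreal (a * b))\<^sup>2"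
    using nn by (simp add: ennreal_power ennreal_mult[symmetric] power_mult_distrib)
  finally have ab: "(\<integral>\<^sup>+x. ennreal (f x) * ennreal (g x) \<partial>M) \<le> ennreal (a * b)"
    by (rule ennreal_power2_le_imp_le)
  have "(\<integral>\<^sup>+x. ennreal ((f x + g x)\<^sup>2) \<partial>M)
     = (\<integral>\<^sup>+x. ennreal ((f x)\<^sup>2) + 2 * (ennreal (f x) * ennreal (g x)) + ennreal ((g x)\<^sup>2) \<partial>M)"
    using nn by (intro nn_integral_cong) (simp add: power2_sum ennreal_plus ennreal_mult ac_simps)
  also have "\<dots> = (\<integral>\<^sup>+x. ennreal ((f x)\<^sup>2) \<partial>M) + 2 * (\<integral>\<^sup>+x. ennreal (f x) * ennreal (g x) \<partial>M) + (\<integral>\<^sup>+x. ennreal ((g x)\<^sup>2) \<partial>M)"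
    by (simp add: nn_integral_add nn_integral_cmult)
  also have "\<dots> \<le> ennreal (a\<^sup>2) + 2 * ennreal (a * b) + ennreal (b\<^sup>2)"
    by (intro add_mono mult_left_mono fa gb ab) auto
  also have "\<dots> = ennreal ((a + b)\<^sup>2)"
    using nn by (simp add: power2_sum ennreal_plus ennreal_mult ac_simps)
  finally show ?thesis .
qed

text \<open>Holds also for infinite energy: \<open>infsum\<close> and \<open>enn2real\<close> both
  send a divergent sum to 0. This is the reason why finiteness has to be tracked separately whenever
  \<open>vnorm\<close> is used.\<close>

lemma vnorm_sq:
  assumes L: "L > 0"
  shows "(vnorm L s u)\<^sup>2 = L ^ 3 * enn2real (en L s u)"
proof (cases "en L s u < \<infinity>")
  case True
  then have "ennreal ((vnorm L s u)\<^sup>2) = ennreal (L ^ 3) * ennreal (enn2real (en L s u))"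
    using vnorm_squared[OF L True] by simp
  then show ?thesis
    using L by (simp add: ennreal_mult[symmetric])
next
  case False
  then have "\<not> (\<lambda>k. norm (freq L k) powr (2 * s) * (norm (u k))\<^sup>2) summable_on (- {0})"
    by (subst summable_on_iff_nn_integral) (auto simp: en_eq_punctured)
  moreover have "en L s u = \<infinity>"
    using False by (simp add: not_less top_unique)
  ultimately show ?thesis
    by (simp add: vnorm_def infsum_not_exists)
qed

lemma en_eq_vnorm:
  assumes L: "L > 0" and "en L s u < \<infinity>"
  shows "en L s u = ennreal ((vnorm L s u)\<^sup>2 / L ^ 3)"
  using assms by (simp add: vnorm_sq)

lemma vnorm_triangle:
  assumes L: "L > 0" and fin: "en L s v < \<infinity>" "en L s w < \<infinity>"
    and le: "\<And>k. norm (u k) \<le> norm (v k) + norm (w k)"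
  shows "vnorm L s u \<le> vnorm L s v + vnorm L s w"
proof -
  define c where "c = sqrt (L ^ 3)"
  have c: "c > 0" "c\<^sup>2 = L ^ 3" using L by (auto simp: c_def)
  have *: "(\<integral>\<^sup>+k. ennreal ((wave L k powr s * norm (v k))\<^sup>2) \<partial>count_space UNIV) = ennreal ((vnorm L s v / c)\<^sup>2)"
    if "en L s v < \<infinity>" for v
  proof -
    have "(\<integral>\<^sup>+k. ennreal ((wave L k powr s * norm (v k))\<^sup>2) \<partial>count_space UNIV) = en L s v"
      unfolding en_def by (intro nn_integral_cong arg_cong[where f = ennreal])
        (simp add: power_mult_distrib power2_eq_square[of "_ powr _"] powr_add[symmetric])
    then show ?thesis
      using en_eq_vnorm[OF L that] c by (simp add: power_divide)
  qed
  have u: "en L s u < \<infinity>"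
    using en_add_le[of u v w L s, OF le] fin by (auto simp: ennreal_mult_less_top elim!: le_less_trans)
  have "ennreal ((vnorm L s u / c)\<^sup>2) \<le> (\<integral>\<^sup>+k. ennreal ((wave L k powr s * norm (v k) + wave L k powr s * norm (w k))\<^sup>2) \<partial>count_space UNIV)"
    unfolding *[OF u, symmetric]
    by (intro nn_integral_mono ennreal_leI power_mono) (auto simp: distrib_left[symmetric] intro!: mult_left_mono le)
  also have "\<dots> \<le> ennreal ((vnorm L s v / c + vnorm L s w / c)\<^sup>2)"
    using c(1) L by (intro minkowski_nn_integral *[OF fin(1), THEN eq_refl] *[OF fin(2), THEN eq_refl]) auto
  finally have "(vnorm L s u / c)\<^sup>2 \<le> (vnorm L s v / c + vnorm L s w / c)\<^sup>2"
    by simp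
  then have "vnorm L s u / c \<le> vnorm L s v / c + vnorm L s w / c"
    by (rule power2_le_imp_le) (use c(1) L in \<open>simp add: add_nonneg_nonneg\<close>)
  then have "vnorm L s u / c \<le> (vnorm L s v + vnorm L s w) / c"
    by (simp only: add_divide_distrib)
  then show ?thesis
    using c(1) by (simp add: divide_le_cancel)
qed

lemma en_diff_finite:
  fixes u v :: field
  assumes "en L s u < \<infinity>" "en L s v < \<infinity>"
  shows "en L s (\<lambda>k. u k - v k) < \<infinity>"
  using en_add_le[of "\<lambda>k. u k - v k" u v L s] assms
  by (auto simp: norm_triangle_ineq4 ennreal_mult_less_top elim!: le_less_trans)

lemma vnorm_le_vdist:
  assumes L: "L > 0" and "en L s u < \<infinity>" "en L s v < \<infinity>"
  shows "vnorm L s u \<le> vdist L s u v + vnorm L s v"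
proof -
  have "norm (u k) \<le> norm (u k - v k) + norm (v k)" for k
    using norm_triangle_ineq[of "u k - v k" "v k"] by simp
  then show ?thesis
    unfolding vdist_def using assms by (intro vnorm_triangle en_diff_finite) auto
qed

lemma vdist_commute: "vdist L s u v = vdist L s v u"
  by (simp add: vdist_def vnorm_def norm_minus_commute)

lemma vdist_triangle:
  assumes "L > 0" "en L s u < \<infinity>" "en L s v < \<infinity>" "en L s w < \<infinity>"
  shows "vdist L s u w \<le> vdist L s u v + vdist L s v w"
proof -
  have "norm (u k - w k) \<le> norm (u k - v k) + norm (v k - w k)" for k
    using norm_triangle_ineq[of "u k - v k" "v k - w k"] by simp
  then show ?thesis
    unfolding vdist_def using assms by (intro vnorm_triangle en_diff_finite) auto
qed

text \<open>The bridge between the real distances of the definitions and the energies of the proof.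
  Finiteness excludes that a divergent norm is read as 0.\<close>

lemma vdist_tendsto_iff:
  assumes L: "L > 0" and "\<And>n. en L s (us n) < \<infinity>" "en L s u < \<infinity>"
  shows "((\<lambda>n. vdist L s (us n) u) \<longlongrightarrow> 0) F \<longleftrightarrow> ((\<lambda>n. en L s (\<lambda>k. us n k - u k)) \<longlongrightarrow> 0) F"
proof -
  have fin: "en L s (\<lambda>k. us n k - u k) < \<infinity>" for n
    using assms by (intro en_diff_finite) auto
  have *: "en L s (\<lambda>k. us n k - u k) = ennreal ((vdist L s (us n) u)\<^sup>2 / L ^ 3)" for n
    unfolding vdist_def by (rule en_eq_vnorm[OF L fin])
  have "((\<lambda>n. en L s (\<lambda>k. us n k - u k)) \<longlongrightarrow> 0) F \<longleftrightarrow> ((\<lambda>n. (vdist L s (us n) u)\<^sup>2 / L ^ 3) \<longlongrightarrow> 0) F"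
    unfolding * using L by (subst ennreal_0[symmetric], subst tendsto_ennreal_iff) auto
  also have "\<dots> \<longleftrightarrow> ((\<lambda>n. vdist L s (us n) u) \<longlongrightarrow> 0) F"
  proof
    assume "((\<lambda>n. (vdist L s (us n) u)\<^sup>2 / L ^ 3) \<longlongrightarrow> 0) F"
    then have "((\<lambda>n. sqrt (L ^ 3 * ((vdist L s (us n) u)\<^sup>2 / L ^ 3))) \<longlongrightarrow> sqrt (L ^ 3 * 0)) F"
      by (intro tendsto_intros)
    then show "((\<lambda>n. vdist L s (us n) u) \<longlongrightarrow> 0) F"
      using L by (simp add: vdist_def)
  next
    assume "((\<lambda>n. vdist L s (us n) u) \<longlongrightarrow> 0) F"
    then have "((\<lambda>n. (vdist L s (us n) u)\<^sup>2 / L ^ 3) \<longlongrightarrow> 0\<^sup>2 / L ^ 3) F"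
      using L by (intro tendsto_intros) auto
    then show "((\<lambda>n. (vdist L s (us n) u)\<^sup>2 / L ^ 3) \<longlongrightarrow> 0) F" by simp
  qed
  finally show ?thesis ..
qed

section \<open>Truncation to finitely many modes\<close>

text \<open>The cube of retained indices is invariant under negation, so truncation respects the
  reality condition and produces trigonometric polynomials.\<close>

definition trunc :: "nat \<Rightarrow> field \<Rightarrow> field" where
  "trunc n u k = (if \<forall>i. \<bar>k $ i\<bar> \<le> int n then u k else 0)"

lemma finite_box: "finite {k::int^3. \<forall>i. \<bar>k $ i\<bar> \<le> int n}"
proof -
  have "{k::int^3. \<forall>i. \<bar>k $ i\<bar> \<le> int n} \<subseteq> (\<lambda>f. \<chi> i. f i) ` (UNIV \<rightarrow>\<^sub>E {- int n..int n})"
  proof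
    fix k :: "int^3" assume k: "k \<in> {k::int^3. \<forall>i. \<bar>k $ i\<bar> \<le> int n}"
    then have "k = (\<chi> i. (\<lambda>i. k $ i) i)" "(\<lambda>i. k $ i) \<in> UNIV \<rightarrow>\<^sub>E {- int n..int n}"
      by (auto simp: abs_le_iff minus_le_iff)
    then show "k \<in> (\<lambda>f. \<chi> i. f i) ` (UNIV \<rightarrow>\<^sub>E {- int n..int n})" by blast
  qed
  then show ?thesis
    by (rule finite_subset) (intro finite_imageI finite_PiE, auto)
qed

lemma trunc_eventually: "eventually (\<lambda>n. trunc n u k = u k) sequentially"
proof -
  obtain N where N: "\<And>i. \<bar>k $ i\<bar> \<le> int N"
  proof -
    have "finite (range (\<lambda>i. \<bar>k $ i\<bar>))" by simp
    then have "\<bar>k $ i\<bar> \<le> int (nat (Max (range (\<lambda>i. \<bar>k $ i\<bar>))))" for i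
      by (smt (verit) Max_ge int_nat_eq rangeI)
    then show ?thesis using that by blast
  qed
  then have "trunc n u k = u k" if "n \<ge> N" for n
  proof -
    have "\<bar>k $ i\<bar> \<le> int n" for i
      using N[of i] that by linarith
    then show ?thesis by (simp add: trunc_def)
  qed
  then show ?thesis unfolding eventually_sequentially by blast
qed

lemma trunc_trig_polys: "u \<in> solenoidal L \<Longrightarrow> trunc n u \<in> trig_polys L"
  using finite_box[of n]
  by (auto simp: trig_polys_def solenoidal_iff trunc_def vcnj_def vec_eq_iff elim!: finite_subset[rotated])

lemma trig_polys_en_finite:
  assumes "u \<in> trig_polys L"
  shows "en L s u < \<infinity>"
proof -
  have "en L s u = (\<integral>\<^sup>+k. ennreal (wave L k powr (2 * s) * (norm (u k))\<^sup>2) \<partial>count_space {k. u k \<noteq> 0})"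
    unfolding en_def by (subst (2) nn_integral_count_space_indicator) (auto intro!: nn_integral_cong simp: indicator_def)
  also have "\<dots> < \<infinity>"
    using assms by (simp add: nn_integral_count_space_finite trig_polys_def ennreal_sum_less_top)
  finally show ?thesis .
qed

lemma trig_polys_subset_Vsp: "trig_polys L \<subseteq> Vsp L s"
  using trig_polys_en_finite by (auto simp: Vsp_iff trig_polys_def)

text \<open>Dominated convergence over the lattice: convergence is known only mode by mode, and a
  fixed field of finite energy provides the majorant. It serves truncations, approximation by simple
  functions, and continuity in time.\<close>

lemma en_dominated:
  fixes us :: "nat \<Rightarrow> field"
  assumes "en L s w < \<infinity>" "\<And>n k. norm (us n k - u k) \<le> c * norm (w k)"
    and "\<And>k. (\<lambda>n. us n k) \<longlonglongrightarrow> u k"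
  shows "(\<lambda>n. en L s (\<lambda>k. us n k - u k)) \<longlonglongrightarrow> 0"
proof -
  have "(\<lambda>n. en L s (\<lambda>k. us n k - u k)) \<longlonglongrightarrow> (\<integral>\<^sup>+k. 0 \<partial>count_space (UNIV :: (int^3) set))"
    unfolding en_def
  proof (rule nn_integral_dominated_convergence[where w = "\<lambda>k. ennreal (c\<^sup>2) * ennreal (wave L k powr (2 * s) * (norm (w k))\<^sup>2)"])
    show "(\<integral>\<^sup>+k. ennreal (c\<^sup>2) * ennreal (wave L k powr (2 * s) * (norm (w k))\<^sup>2) \<partial>count_space UNIV) < \<infinity>"
      using assms(1) by (simp add: nn_integral_cmult en_def[symmetric] ennreal_mult_less_top)
    show "AE k in count_space UNIV. ennreal (wave L k powr (2 * s) * (norm (us n k - u k))\<^sup>2) \<le> ennreal (c\<^sup>2) * ennreal (wave L k powr (2 * s) * (norm (w k))\<^sup>2)" for n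
    proof (rule AE_I2)
      fix k
      have "(norm (us n k - u k))\<^sup>2 \<le> (c * norm (w k))\<^sup>2"
        using assms(2) by (intro power_mono) auto
      then have "wave L k powr (2 * s) * (norm (us n k - u k))\<^sup>2 \<le> wave L k powr (2 * s) * (c * norm (w k))\<^sup>2"
        by (intro mult_left_mono) auto
      then show "ennreal (wave L k powr (2 * s) * (norm (us n k - u k))\<^sup>2) \<le> ennreal (c\<^sup>2) * ennreal (wave L k powr (2 * s) * (norm (w k))\<^sup>2)"
        by (simp add: ennreal_mult[symmetric] power_mult_distrib ac_simps)
    qed
    show "AE k in count_space UNIV. (\<lambda>n. ennreal (wave L k powr (2 * s) * (norm (us n k - u k))\<^sup>2)) \<longlonglongrightarrow> 0"
    proof (rule AE_I2)
      fix k
      have "(\<lambda>n. wave L k powr (2 * s) * (norm (us n k - u k))\<^sup>2) \<longlonglongrightarrow> wave L k powr (2 * s) * (norm (u k - u k))\<^sup>2"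
        by (intro tendsto_intros assms(3))
      from tendsto_ennrealI[OF this]
      show "(\<lambda>n. ennreal (wave L k powr (2 * s) * (norm (us n k - u k))\<^sup>2)) \<longlonglongrightarrow> 0"
        by simp
    qed
  qed auto
  then show ?thesis by simp
qed

lemma trunc_tendsto:
  assumes L: "L > 0" and u: "u \<in> Vsp L s"
  shows "(\<lambda>n. vdist L s (trunc n u) u) \<longlonglongrightarrow> 0"
proof -
  have fin: "en L s u < \<infinity>" "en L s (trunc n u) < \<infinity>" for n
    using u trig_polys_en_finite[OF trunc_trig_polys] by (auto simp: Vsp_iff)
  show ?thesis
    unfolding vdist_tendsto_iff[OF L fin(2) fin(1)]
    by (rule en_dominated[where w = u and c = 1, OF fin(1)])
       (simp_all add: tendsto_eventually trunc_eventually, simp add: trunc_def)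
qed

section \<open>The trilinear form\<close>

definition tri :: "real \<Rightarrow> field \<Rightarrow> field \<Rightarrow> field \<Rightarrow> real" where
  "tri L u v w = pairing L (Bf L u v) w"

lemma pairing_diff_right:
  assumes L: "L > 0" and z: "x 0 = 0" and fin: "en L s x < \<infinity>" "en L (- s) y < \<infinity>" "en L (- s) z < \<infinity>"
  shows "pairing L x (\<lambda>k. y k - z k) = pairing L x y - pairing L x z"
proof -
  have "pairing L x (\<lambda>k. y k - z k) = L ^ 3 * (LINT k|count_space UNIV. x k \<bullet> (y k - z k))"
    using assms by (intro pairing_eq_integral[where s = s] en_diff_finite) auto
  also have "(LINT k|count_space UNIV. x k \<bullet> (y k - z k)) = (LINT k|count_space UNIV. x k \<bullet> y k) - (LINT k|count_space UNIV. x k \<bullet> z k)"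
    unfolding inner_diff_right using assms
    by (intro Bochner_Integration.integral_diff pairing_integrable[where s = s]) auto
  finally show ?thesis
    using pairing_eq_integral[of L x y s] pairing_eq_integral[of L x z s] assms by (simp add: algebra_simps)
qed

lemma pairing_diff_left:
  assumes L: "L > 0" and z: "z 0 = 0" and fin: "en L s x < \<infinity>" "en L s y < \<infinity>" "en L (- s) z < \<infinity>"
  shows "pairing L (\<lambda>k. x k - y k) z = pairing L x z - pairing L y z"
proof -
  have "pairing L (\<lambda>k. x k - y k) z = L ^ 3 * (LINT k|count_space UNIV. (x k - y k) \<bullet> z k)"
    using assms by (intro pairing_eq_integral[where s = s] en_diff_finite) auto
  also have "(LINT k|count_space UNIV. (x k - y k) \<bullet> z k) = (LINT k|count_space UNIV. x k \<bullet> z k) - (LINT k|count_space UNIV. y k \<bullet> z k)"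
    unfolding inner_diff_left using assms
    by (intro Bochner_Integration.integral_diff pairing_integrable[where s = s]) auto
  finally show ?thesis
    using pairing_eq_integral[of L x z s] pairing_eq_integral[of L y z s] assms by (simp add: algebra_simps)
qed

lemma en_finite_mono:
  assumes "L > 0" "s \<le> t" "en L t u < \<infinity>"
  shows "en L s u < \<infinity>"
proof -
  obtain C where "en L s u \<le> ennreal C * en L t u"
    using en_exponent_mono[OF assms(1,2)] by blast
  then show ?thesis
    using assms(3) by (auto simp: ennreal_mult_less_top elim!: le_less_trans)
qed

lemma en_Bf_finite:
  assumes "L > 0" "\<alpha> > 1/2" "u 0 = 0" "v 0 = 0" "en L (1 + \<alpha>) u < \<infinity>" "en L \<alpha> v < \<infinity>"
  shows "en L (\<alpha> - 1) (Bf L u v) < \<infinity>"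
proof -
  obtain C where "en L (\<alpha> - 1) (Bf L u v) \<le> ennreal C * (en L (1 + \<alpha>) u * en L \<alpha> v)"
    using en_Bf_le[OF assms(1,2)] assms(3,4) by blast
  then show ?thesis
    using assms by (auto simp: ennreal_mult_less_top elim!: le_less_trans)
qed

text \<open>The nonlinear term has exponent \<alpha> - 1 and is paired with w at exponent 1 -
  \<alpha>. Both this exponent and the exponent \<alpha> demanded of v lie below 1 + \<alpha>, so
  all three norms can be taken at 1 + \<alpha>.\<close>

lemma tri_bound:
  assumes L: "L > 0" and \<alpha>: "\<alpha> > 1/2"
  shows "\<exists>K\<ge>0. \<forall>u v w. u 0 = 0 \<longrightarrow> v 0 = 0 \<longrightarrow> en L (1 + \<alpha>) u < \<infinity> \<longrightarrow> en L (1 + \<alpha>) v < \<infinity> \<longrightarrow> en L (1 + \<alpha>) w < \<infinity> \<longrightarrow>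
    \<bar>tri L u v w\<bar> \<le> K * vnorm L (1 + \<alpha>) u * vnorm L (1 + \<alpha>) v * vnorm L (1 + \<alpha>) w"
proof -
  obtain C1 where C1: "C1 \<ge> 0" "\<And>u v. u 0 = 0 \<Longrightarrow> v 0 = 0 \<Longrightarrow> en L (\<alpha> - 1) (Bf L u v) \<le> ennreal C1 * (en L (1 + \<alpha>) u * en L \<alpha> v)"
    using en_Bf_le[OF L \<alpha>] by blast
  obtain C2 where C2: "C2 \<ge> 0" "\<And>v. en L \<alpha> v \<le> ennreal C2 * en L (1 + \<alpha>) v"
    using en_exponent_mono[OF L, of \<alpha> "1 + \<alpha>"] by auto
  obtain C3 where C3: "C3 \<ge> 0" "\<And>w. en L (- (\<alpha> - 1)) w \<le> ennreal C3 * en L (1 + \<alpha>) w"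
    using en_exponent_mono[OF L, of "- (\<alpha> - 1)" "1 + \<alpha>"] \<alpha> by auto
  \<comment> \<open>\<open>L ^ 6\<close> is the square of the factor in \<open>pairing\<close>; the
    divisor converts the three energies back to squared norms.\<close>
  define K where "K = sqrt (L ^ 6 * C1 * C2 * C3 / (L ^ 3 * L ^ 3 * L ^ 3))"
  have K: "K \<ge> 0" using C1 C2 C3 L by (simp add: K_def)
  have "\<bar>tri L u v w\<bar> \<le> K * vnorm L (1 + \<alpha>) u * vnorm L (1 + \<alpha>) v * vnorm L (1 + \<alpha>) w"
    if u: "u 0 = 0" "en L (1 + \<alpha>) u < \<infinity>" and v: "v 0 = 0" "en L (1 + \<alpha>) v < \<infinity>" and w: "en L (1 + \<alpha>) w < \<infinity>" for u v w
  proof -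
    let ?n = "vnorm L (1 + \<alpha>)"
    have fin: "en L \<alpha> v < \<infinity>" "en L (- (\<alpha> - 1)) w < \<infinity>"
      using en_finite_mono[OF L _ v(2), of \<alpha>] en_finite_mono[OF L _ w, of "- (\<alpha> - 1)"] \<alpha> by auto
    have "(ennreal \<bar>tri L u v w\<bar>)\<^sup>2 \<le> ennreal (L ^ 6) * (en L (\<alpha> - 1) (Bf L u v) * en L (- (\<alpha> - 1)) w)"
      unfolding tri_def using en_Bf_finite[OF L \<alpha> u(1) v(1) u(2) fin(1)] fin by (intro pairing_bound[OF L]) auto
    also have "\<dots> \<le> ennreal (L ^ 6) * ((ennreal C1 * (en L (1 + \<alpha>) u * (ennreal C2 * en L (1 + \<alpha>) v))) * (ennreal C3 * en L (1 + \<alpha>) w))"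
      by (intro mult_left_mono mult_mono C3 order_trans[OF C1(2)[of u v, OF u(1) v(1)]] C2) auto
    also have "\<dots> = ennreal (L ^ 6 * (C1 * ((?n u)\<^sup>2 / L ^ 3 * (C2 * ((?n v)\<^sup>2 / L ^ 3))) * (C3 * ((?n w)\<^sup>2 / L ^ 3))))"
      unfolding en_eq_vnorm[OF L u(2)] en_eq_vnorm[OF L v(2)] en_eq_vnorm[OF L w]
      using L C1(1) C2(1) C3(1) by (simp add: ennreal_mult[symmetric])
    also have "L ^ 6 * (C1 * ((?n u)\<^sup>2 / L ^ 3 * (C2 * ((?n v)\<^sup>2 / L ^ 3))) * (C3 * ((?n w)\<^sup>2 / L ^ 3))) = (K * ?n u * ?n v * ?n w)\<^sup>2"
      using L C1 C2 C3 by (simp add: K_def power_mult_distrib field_simps)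
    finally have "ennreal (\<bar>tri L u v w\<bar>\<^sup>2) \<le> ennreal ((K * ?n u * ?n v * ?n w)\<^sup>2)"
      by (simp only: ennreal_power[OF abs_ge_zero])
    then have "\<bar>tri L u v w\<bar>\<^sup>2 \<le> (K * ?n u * ?n v * ?n w)\<^sup>2"
      by (simp only: ennreal_le_iff[OF zero_le_power2])
    moreover have "0 \<le> K * ?n u * ?n v * ?n w"
      using K L by (intro mult_nonneg_nonneg vnorm_nonneg)
    ultimately show ?thesis
      by (rule power2_le_imp_le)
  qed
  then show ?thesis using K by blast
qed

text \<open>The description in \<open>b_form\<close> needs two things: trilinear continuity, which
  gives the limit along every approximating sequence, and density of trigonometric polynomials,
  without which every number would qualify.\<close>

lemma b_form_eq:
  assumes L: "L > 0" and \<alpha>: "\<alpha> > 1/2"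
    and u: "u \<in> Vsp L (1 + \<alpha>)" and v: "v \<in> Vsp L (1 + \<alpha>)" and w: "w \<in> Vsp L (1 + \<alpha>)"
  shows "b_form L (1 + \<alpha>) \<alpha> (1 + \<alpha>) u v w = tri L u v w"
proof -
  let ?n = "vnorm L (1 + \<alpha>)" and ?d = "vdist L (1 + \<alpha>)"
  obtain K where K: "K \<ge> 0" "\<And>u v w. u 0 = 0 \<Longrightarrow> v 0 = 0 \<Longrightarrow> en L (1 + \<alpha>) u < \<infinity> \<Longrightarrow> en L (1 + \<alpha>) v < \<infinity> \<Longrightarrow> en L (1 + \<alpha>) w < \<infinity> \<Longrightarrow>
    \<bar>tri L u v w\<bar> \<le> K * ?n u * ?n v * ?n w"
    using tri_bound[OF L \<alpha>] by blast
  have lim: "(\<lambda>n. b_trig L (us n) (vs n) (ws n)) \<longlonglongrightarrow> tri L u v w"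
    if tp: "\<And>n. us n \<in> trig_polys L \<and> vs n \<in> trig_polys L \<and> ws n \<in> trig_polys L"
      and cu: "(\<lambda>n. ?d (us n) u) \<longlonglongrightarrow> 0" and cv: "(\<lambda>n. ?d (vs n) v) \<longlonglongrightarrow> 0" and cw: "(\<lambda>n. ?d (ws n) w) \<longlonglongrightarrow> 0" for us vs ws
  proof -
    \<comment> \<open>One argument is changed at a time. Norms of approximants are estimated by
      their distance to the limit plus the norm of the limit, so that the bound visibly tends to
      0.\<close>
    let ?e = "\<lambda>n. K * ?d (us n) u * (?d (vs n) v + ?n v) * (?d (ws n) w + ?n w)
      + K * ?n u * ?d (vs n) v * (?d (ws n) w + ?n w) + K * ?n u * ?n v * ?d (ws n) w"
    have bound: "\<bar>b_trig L (us n) (vs n) (ws n) - tri L u v w\<bar> \<le> ?e n" for n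
    proof -
      have mem: "us n \<in> Vsp L (1 + \<alpha>)" "vs n \<in> Vsp L (1 + \<alpha>)" "ws n \<in> Vsp L (1 + \<alpha>)"
        using tp trig_polys_subset_Vsp by blast+
      have fin: "en L (1 + \<alpha>) x < \<infinity>" "en L \<alpha> x < \<infinity>" "en L (- (\<alpha> - 1)) x < \<infinity>" "x 0 = 0" if "x \<in> Vsp L (1 + \<alpha>)" for x
        using that en_finite_mono[OF L, of \<alpha> "1 + \<alpha>" x] en_finite_mono[OF L, of "- (\<alpha> - 1)" "1 + \<alpha>" x] \<alpha>
        by (auto simp: Vsp_iff solenoidal_iff)
      note fins = fin[OF u] fin[OF v] fin[OF w] fin[OF mem(1)] fin[OF mem(2)] fin[OF mem(3)]
      have "b_trig L (us n) (vs n) (ws n) = tri L (us n) (vs n) (ws n)"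
        using tp b_trig_eq_pairing[OF L] by (simp add: tri_def)
      moreover have "tri L (\<lambda>k. us n k - u k) (vs n) (ws n) = tri L (us n) (vs n) (ws n) - tri L u (vs n) (ws n)"
        unfolding tri_def
        by (rule trans[OF arg_cong2[where f = "pairing L", OF ext[OF Bf_diff_left[OF L \<alpha> fins(16) fins(4) fins(20) fins(13) fins(1) fins(18)]] refl]],
            rule pairing_diff_left[where s = "\<alpha> - 1"]) (intro L en_Bf_finite[OF L \<alpha>] Bf_zero fins)+
      moreover have "tri L u (\<lambda>k. vs n k - v k) (ws n) = tri L u (vs n) (ws n) - tri L u v (ws n)"
        unfolding tri_def
        by (rule trans[OF arg_cong2[where f = "pairing L", OF ext[OF Bf_diff_right[OF L \<alpha> fins(4) fins(20) fins(8) fins(1) fins(18) fins(6)]] refl]],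
            rule pairing_diff_left[where s = "\<alpha> - 1"]) (intro L en_Bf_finite[OF L \<alpha>] Bf_zero fins)+
      moreover have "tri L u v (\<lambda>k. ws n k - w k) = tri L u v (ws n) - tri L u v w"
        unfolding tri_def by (rule pairing_diff_right[where s = "\<alpha> - 1"]) (intro L en_Bf_finite[OF L \<alpha>] Bf_zero fins)+
      ultimately have "b_trig L (us n) (vs n) (ws n) - tri L u v w
         = tri L (\<lambda>k. us n k - u k) (vs n) (ws n) + tri L u (\<lambda>k. vs n k - v k) (ws n) + tri L u v (\<lambda>k. ws n k - w k)"
        by simp
      then have "\<bar>b_trig L (us n) (vs n) (ws n) - tri L u v w\<bar> \<le> \<bar>tri L (\<lambda>k. us n k - u k) (vs n) (ws n)\<bar> + \<bar>tri L u (\<lambda>k. vs n k - v k) (ws n)\<bar> + \<bar>tri L u v (\<lambda>k. ws n k - w k)\<bar>"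
        by linarith
      also have "\<dots> \<le> K * ?d (us n) u * ?n (vs n) * ?n (ws n) + K * ?n u * ?d (vs n) v * ?n (ws n) + K * ?n u * ?n v * ?d (ws n) w"
        unfolding vdist_def by (intro add_mono K) (simp_all only: fins diff_self en_diff_finite[OF fins(13) fins(1)]
            en_diff_finite[OF fins(17) fins(5)] en_diff_finite[OF fins(21) fins(9)])
      also have "\<dots> \<le> ?e n"
        using K(1) L fins by (intro add_mono mult_mono mult_left_mono vnorm_le_vdist) (auto simp: vdist_def intro!: mult_nonneg_nonneg add_nonneg_nonneg)
      finally show ?thesis .
    qed
    have "?e \<longlonglongrightarrow> K * 0 * (0 + ?n v) * (0 + ?n w) + K * ?n u * 0 * (0 + ?n w) + K * ?n u * ?n v * 0"
      by (intro tendsto_intros cu cv cw)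
    then have "?e \<longlonglongrightarrow> 0" by simp
    then have "(\<lambda>n. b_trig L (us n) (vs n) (ws n) - tri L u v w) \<longlonglongrightarrow> 0"
      by (rule Lim_null_comparison[rotated]) (use bound in \<open>auto intro!: always_eventually\<close>)
    then show ?thesis by (rule LIM_zero_cancel)
  qed
  show ?thesis
    unfolding b_form_def
  proof (rule the_equality)
    show "\<forall>us vs ws. (\<forall>n. us n \<in> trig_polys L \<and> vs n \<in> trig_polys L \<and> ws n \<in> trig_polys L) \<longrightarrow>
       (\<lambda>n. ?d (us n) u) \<longlonglongrightarrow> 0 \<longrightarrow> (\<lambda>n. vdist L (\<alpha> + 1) (vs n) v) \<longlonglongrightarrow> 0 \<longrightarrow> (\<lambda>n. ?d (ws n) w) \<longlonglongrightarrow> 0 \<longrightarrow>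
       (\<lambda>n. b_trig L (us n) (vs n) (ws n)) \<longlonglongrightarrow> tri L u v w"
      using lim by (simp add: add.commute)
  next
    fix \<beta>
    assume \<beta>: "\<forall>us vs ws. (\<forall>n. us n \<in> trig_polys L \<and> vs n \<in> trig_polys L \<and> ws n \<in> trig_polys L) \<longrightarrow>
       (\<lambda>n. ?d (us n) u) \<longlonglongrightarrow> 0 \<longrightarrow> (\<lambda>n. vdist L (\<alpha> + 1) (vs n) v) \<longlonglongrightarrow> 0 \<longrightarrow> (\<lambda>n. ?d (ws n) w) \<longlonglongrightarrow> 0 \<longrightarrow>
       (\<lambda>n. b_trig L (us n) (vs n) (ws n)) \<longlonglongrightarrow> \<beta>"
    have tp: "trunc n u \<in> trig_polys L \<and> trunc n v \<in> trig_polys L \<and> trunc n w \<in> trig_polys L" for n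
      using u v w by (simp add: trunc_trig_polys Vsp_iff)
    have "(\<lambda>n. b_trig L (trunc n u) (trunc n v) (trunc n w)) \<longlonglongrightarrow> \<beta>"
      using \<beta> tp trunc_tendsto[OF L u] trunc_tendsto[OF L v] trunc_tendsto[OF L w]
      by (simp add: add.commute)
    moreover have "(\<lambda>n. b_trig L (trunc n u) (trunc n v) (trunc n w)) \<longlonglongrightarrow> tri L u v w"
      by (intro lim tp trunc_tendsto L u v w)
    ultimately show "\<beta> = tri L u v w"
      by (rule LIMSEQ_unique)
  qed
qed

section \<open>Square-integrable trajectories\<close>

text \<open>The conditions hold at every time rather than almost every time and involve no energy.
  Coefficients can then be integrated and combined without exceptional sets, and finiteness is a
  separate statement about \<open>en\<close>.\<close>

definition traj :: "real \<Rightarrow> (real \<Rightarrow> field) \<Rightarrow> bool" where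
  "traj L u \<longleftrightarrow> (\<forall>t. u t \<in> solenoidal L) \<and> (\<forall>k. (\<lambda>t. u t k) \<in> borel_measurable borel)"

lemma nn_sum_measurable:
  fixes f :: "'a::countable \<Rightarrow> 'b \<Rightarrow> ennreal"
  assumes "\<And>j. f j \<in> borel_measurable N"
  shows "(\<lambda>x. \<integral>\<^sup>+j. f j x \<partial>count_space UNIV) \<in> borel_measurable N"
proof -
  interpret sigma_finite_measure "count_space (UNIV :: 'a set)"
    by (rule sigma_finite_measure_count_space_countable) simp
  show ?thesis
  proof (rule borel_measurable_nn_integral)
    show "(\<lambda>(x, j). f j x) \<in> borel_measurable (N \<Otimes>\<^sub>M count_space UNIV)"
      unfolding case_prod_unfold
      by (rule measurable_compose_countable[where f = "\<lambda>j p. f j (fst p)", OF measurable_compose[OF measurable_fst assms] measurable_snd])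
  qed
qed

lemma en_measurable:
  assumes "\<And>k. (\<lambda>t. u t k) \<in> borel_measurable M"
  shows "(\<lambda>t. en L s (u t)) \<in> borel_measurable M"
proof -
  have [measurable]: "(\<lambda>t. u t k) \<in> borel_measurable M" for k by (rule assms)
  show ?thesis
    unfolding en_def by (rule nn_sum_measurable) measurable
qed

section \<open>From Lebesgue measure on an interval to Borel functions on the line\<close>

lemma AE_lebesgue_on_iff:
  fixes I :: "real set"
  assumes "I \<in> sets borel"
  shows "(AE t in lebesgue_on I. P t) \<longleftrightarrow> (AE t in lborel. t \<in> I \<longrightarrow> P t)"
  using assms by (subst AE_restrict_space_iff) (auto simp: AE_completion_iff)

lemma nn_integral_lebesgue_on:
  fixes I :: "real set"
  assumes "I \<in> sets borel"
  shows "(\<integral>\<^sup>+t. f t \<partial>lebesgue_on I) = (\<integral>\<^sup>+t. f t * indicator I t \<partial>lborel)"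
  using assms by (subst nn_integral_restrict_space) (auto simp: nn_integral_completion)

text \<open>The definitions integrate over \<open>lebesgue_on\<close>, the estimates over
  \<open>lborel\<close> with an indicator. Completeness of Lebesgue measure makes any function that
  agrees almost everywhere with a Borel one measurable, so the integrals can be moved
  across.\<close>

lemma lebesgue_on_cong_AE:
  fixes f g :: "real \<Rightarrow> 'b::euclidean_space"
  assumes I: "I \<in> sets borel" and g: "g \<in> borel_measurable borel"
    and ae: "AE t in lborel. t \<in> I \<longrightarrow> f t = g t"
  shows "f \<in> borel_measurable (lebesgue_on I)"
    and "integral\<^sup>L (lebesgue_on I) f = (LINT t|lborel. indicator I t *\<^sub>R g t)"
    and "integrable (lebesgue_on I) f \<longleftrightarrow> integrable lborel (\<lambda>t. indicator I t *\<^sub>R g t)"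
proof -
  have gl: "(\<lambda>t. indicator I t *\<^sub>R g t) \<in> borel_measurable lborel"
    using I g by measurable
  have "AE t in lborel. indicator I t *\<^sub>R g t = (if t \<in> I then f t else 0)"
    using ae by eventually_elim (auto simp: indicator_def)
  then have "AE t in lebesgue. indicator I t *\<^sub>R g t = (if t \<in> I then f t else 0)"
    by (rule AE_completion)
  then have "(\<lambda>t. if t \<in> I then f t else 0) \<in> borel_measurable lebesgue"
    by (rule borel_measurable_AE[OF measurable_completion[OF gl]])
  then show f: "f \<in> borel_measurable (lebesgue_on I)"
    using I by (subst (asm) borel_measurable_if) auto
  have gm: "g \<in> borel_measurable (lebesgue_on I)"
    using g by (intro measurable_restrict_space1 measurable_completion) simp
  have ae': "AE t in lebesgue_on I. f t = g t"
    using ae I by (simp add: AE_lebesgue_on_iff)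
  have "integral\<^sup>L (lebesgue_on I) f = integral\<^sup>L (lebesgue_on I) g"
    by (rule integral_cong_AE[OF f gm ae'])
  also have "\<dots> = (LINT t|lebesgue. indicator I t *\<^sub>R g t)"
    using I by (subst integral_restrict_space) auto
  also have "\<dots> = (LINT t|lborel. indicator I t *\<^sub>R g t)"
    by (rule integral_completion[OF gl])
  finally show "integral\<^sup>L (lebesgue_on I) f = (LINT t|lborel. indicator I t *\<^sub>R g t)" .
  have "integrable (lebesgue_on I) f \<longleftrightarrow> integrable (lebesgue_on I) g"
    by (rule integrable_cong_AE[OF f gm ae'])
  also have "\<dots> \<longleftrightarrow> integrable lebesgue (\<lambda>t. indicator I t *\<^sub>R g t)"
    using I by (subst integrable_restrict_space) auto
  also have "\<dots> \<longleftrightarrow> integrable lborel (\<lambda>t. indicator I t *\<^sub>R g t)"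
    by (rule integrable_completion[OF gl])
  finally show "integrable (lebesgue_on I) f \<longleftrightarrow> integrable lborel (\<lambda>t. indicator I t *\<^sub>R g t)" .
qed

lemma lebesgue_ex_borel:
  fixes f :: "real \<Rightarrow> 'b::euclidean_space"
  assumes f: "f \<in> borel_measurable lebesgue"
  shows "\<exists>g\<in>borel_measurable borel. AE t in lborel. f t = g t"
proof -
  have "\<forall>b. \<exists>g\<in>borel_measurable lborel. AE t in lborel. f t \<bullet> b = g t"
    by (intro allI completion_ex_borel_measurable_real borel_measurable_inner f borel_measurable_const)
  then obtain g where g: "\<And>b. g b \<in> borel_measurable lborel" "\<And>b. AE t in lborel. f t \<bullet> b = g b t"
    by metis
  have [measurable]: "g b \<in> borel_measurable borel" for b
    using g(1) by simp
  have "AE t in lborel. \<forall>b\<in>Basis. f t \<bullet> b = g b t"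
    using g(2) by (intro AE_finite_allI) auto
  then have "AE t in lborel. f t = (\<Sum>b\<in>Basis. g b t *\<^sub>R b)"
    by eventually_elim (metis (no_types, lifting) euclidean_representation sum.cong)
  moreover have "(\<lambda>t. \<Sum>b\<in>Basis. g b t *\<^sub>R b) \<in> borel_measurable borel"
    by measurable
  ultimately show ?thesis by (rule bexI)
qed

lemma traj_en_measurable: "traj L u \<Longrightarrow> (\<lambda>t. en L s (u t)) \<in> borel_measurable borel"
  unfolding traj_def by (intro en_measurable) auto

lemma zero_solenoidal [simp]: "(\<lambda>_. 0) \<in> solenoidal L"
  by (simp add: solenoidal_iff vcnj_def vec_eq_iff)

lemma en_tendsto_mode:
  fixes x :: "nat \<Rightarrow> field"
  assumes L: "L > 0" and k: "k \<noteq> 0" and en0: "(\<lambda>n. en L s (x n)) \<longlonglongrightarrow> 0"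
  shows "(\<lambda>n. x n k) \<longlonglongrightarrow> 0"
proof -
  define c where "c = wave L k powr (2 * s)"
  have c: "c > 0" using wave_pos[OF L k] by (simp add: c_def)
  have "(\<lambda>n. ennreal (c * (norm (x n k))\<^sup>2)) \<longlonglongrightarrow> 0"
    by (rule tendsto_sandwich[OF _ _ tendsto_const en0])
       (auto simp: c_def intro!: always_eventually en_mode_le)
  then have "(\<lambda>n. c * (norm (x n k))\<^sup>2) \<longlonglongrightarrow> 0"
    using c by (subst (asm) ennreal_0[symmetric], subst (asm) tendsto_ennreal_iff) auto
  then have "(\<lambda>n. sqrt (inverse c * (c * (norm (x n k))\<^sup>2))) \<longlonglongrightarrow> sqrt (inverse c * 0)"
    by (intro tendsto_intros)
  moreover have "inverse c * (c * x) = x" for x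
    using c by (simp flip: mult.assoc)
  ultimately have "(\<lambda>n. norm (x n k)) \<longlonglongrightarrow> 0"
    by (simp only: real_sqrt_abs abs_norm_cancel mult_zero_right real_sqrt_zero)
  then show ?thesis by (rule tendsto_norm_zero_cancel)
qed

text \<open>Coefficients of a strongly measurable function are limits of coefficients of simple
  functions, hence measurable. After passing to Borel versions, the function is set to zero on a
  Borel null set and outside the interval; this makes it solenoidal at every time.\<close>

lemma L2_fun_clean:
  assumes L: "L > 0" and u: "u \<in> L2_fun L s a b"
  shows "\<exists>w. traj L w \<and> (\<forall>t. t \<notin> {a<..<b} \<longrightarrow> w t = (\<lambda>_. 0)) \<and>
    (AE t in lborel. t \<in> {a<..<b} \<longrightarrow> u t = w t) \<and> (\<integral>\<^sup>+t. en L s (w t) \<partial>lborel) < \<infinity>"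
proof -
  let ?I = "{a<..<b}" and ?M = "lebesgue_on {a<..<b}"
  have I: "?I \<in> sets borel" by simp
  have sm: "strongly_measurable L s a b u" and int: "integrable ?M (\<lambda>t. (vnorm L s (u t))\<^sup>2)"
    using u by (simp_all add: L2_fun_def)
  then have uV: "AE t in ?M. u t \<in> Vsp L s"
    by (simp add: strongly_measurable_def)
  from sm obtain g where gg: "\<forall>n::nat. simple_function ?M (g n) \<and> (\<forall>t\<in>?I. g n t \<in> Vsp L s)"
    and lim: "AE t in ?M. (\<lambda>n. vdist L s (g n t) (u t)) \<longlonglongrightarrow> 0"
    unfolding strongly_measurable_def by blast
  then have g: "\<And>n. simple_function ?M (g n)" "\<And>n t. t \<in> ?I \<Longrightarrow> g n t \<in> Vsp L s"
    by blast+
  \<comment> \<open>\<open>lim\<close> of measurable functions is measurable whether or not the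
    limit exists, and it equals the coefficient of u wherever the simple functions converge.\<close>
  define h where "h k t = lim (\<lambda>n. g n t k)" for k t
  have h[measurable]: "h k \<in> borel_measurable ?M" for k
    unfolding h_def
    by (intro borel_measurable_lim_metric borel_measurable_simple_function simple_function_compose1[OF g(1)])
  have uh: "AE t in ?M. \<forall>k. u t k = h k t"
    using uV lim AE_space
  proof eventually_elim
    case (elim t)
    have fin: "en L s (u t) < \<infinity>" "\<And>n. en L s (g n t) < \<infinity>"
      using elim g(2) by (auto simp: Vsp_iff)
    have en0: "(\<lambda>n. en L s (\<lambda>k. g n t k - u t k)) \<longlonglongrightarrow> 0"
      using elim(2) vdist_tendsto_iff[where us = "\<lambda>n. g n t" and s = s and F = sequentially, OF L fin(2) fin(1)] by simp
    have "(\<lambda>n. g n t k) \<longlonglongrightarrow> u t k" for k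
    proof (cases "k = 0")
      case True
      have "g n t 0 = 0" "u t 0 = 0" for n
        using elim g(2) by (auto simp: Vsp_iff solenoidal_iff)
      then show ?thesis using True by simp
    next
      case False
      have "(\<lambda>n. g n t k - u t k) \<longlonglongrightarrow> 0"
        by (rule en_tendsto_mode[OF L False en0])
      then show ?thesis
        by (simp add: LIM_zero_iff)
    qed
    then show ?case unfolding h_def by (intro allI limI[symmetric])
  qed
  have "(\<lambda>t. if t \<in> ?I then h k t else 0) \<in> borel_measurable lebesgue" for k
    using h[of k] by (subst borel_measurable_if) simp_all
  from lebesgue_ex_borel[OF this]
  have "\<forall>k. \<exists>h'. h' \<in> borel_measurable borel \<and> (AE t in lborel. (if t \<in> ?I then h k t else 0) = h' t)"
    by blast
  from choice[OF this] obtain h' where h'[measurable]: "\<And>k. h' k \<in> borel_measurable borel"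
    and hh': "\<And>k. AE t in lborel. (if t \<in> ?I then h k t else 0) = h' k t"
    by blast
  have "AE t in lborel. \<forall>k. (if t \<in> ?I then h k t else 0) = h' k t"
    using hh' by (subst AE_all_countable) auto
  moreover have "AE t in lborel. t \<in> ?I \<longrightarrow> u t \<in> Vsp L s" "AE t in lborel. t \<in> ?I \<longrightarrow> (\<forall>k. u t k = h k t)"
    using uV uh by (simp_all add: AE_lebesgue_on_iff)
  ultimately have "AE t in lborel. t \<in> ?I \<longrightarrow> u t \<in> Vsp L s \<and> (\<forall>k. u t k = h' k t)"
    by eventually_elim auto
  \<comment> \<open>One Borel null set covers the exceptional times of all coefficients, which is
    possible because the lattice is countable.\<close>
  from AE_E[OF this] obtain N where N: "N \<in> null_sets lborel" "{t \<in> space lborel. \<not> (t \<in> ?I \<longrightarrow> u t \<in> Vsp L s \<and> (\<forall>k. u t k = h' k t))} \<subseteq> N"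
    by (metis (no_types, lifting) null_setsI)
  have good: "u t \<in> Vsp L s" "u t = (\<lambda>k. h' k t)" if "t \<in> ?I - N" for t
    using that N(2) by auto
  define w where "w t = (if t \<in> ?I - N then (\<lambda>k. h' k t) else (\<lambda>_. 0))" for t
  have "N \<in> sets borel" using N(1) by auto
  then have [measurable]: "?I - N \<in> sets borel" by simp
  have "(\<lambda>t. w t k) \<in> borel_measurable borel" for k
  proof -
    have eq: "(\<lambda>t. w t k) = (\<lambda>t. if t \<in> ?I - N then h' k t else 0)"
      by (auto simp: w_def)
    show ?thesis unfolding eq by measurable
  qed
  moreover have "w t \<in> solenoidal L" for t
    using good[of t] by (auto simp: w_def Vsp_iff)
  ultimately have tw: "traj L w" by (simp add: traj_def)
  have uw: "AE t in lborel. t \<in> ?I \<longrightarrow> u t = w t"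
    using AE_not_in[OF N(1)] by eventually_elim (use good in \<open>auto simp: w_def\<close>)
  have "(\<integral>\<^sup>+t. en L s (w t) \<partial>lborel) < \<infinity>"
  proof -
    have "(\<integral>\<^sup>+t. en L s (w t) \<partial>lborel) = (\<integral>\<^sup>+t. en L s (w t) * indicator ?I t \<partial>lborel)"
      by (intro nn_integral_cong) (auto simp: w_def indicator_def en_def)
    also have "\<dots> = (\<integral>\<^sup>+t. en L s (u t) \<partial>?M)"
      unfolding nn_integral_lebesgue_on[OF I]
      by (intro nn_integral_cong_AE) (use uw in eventually_elim, auto simp: indicator_def)
    also have "\<dots> = (\<integral>\<^sup>+t. ennreal (inverse (L ^ 3)) * ennreal ((vnorm L s (u t))\<^sup>2) \<partial>?M)"
      using uV by (intro nn_integral_cong_AE, eventually_elim)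
        (use L in \<open>auto simp: Vsp_iff en_eq_vnorm ennreal_mult[symmetric] divide_inverse mult.commute\<close>)
    also have "\<dots> = ennreal (inverse (L ^ 3)) * (\<integral>\<^sup>+t. ennreal ((vnorm L s (u t))\<^sup>2) \<partial>?M)"
      using int by (intro nn_integral_cmult) auto
    also have "\<dots> < \<infinity>"
      using int by (simp add: integrable_iff_bounded ennreal_mult_less_top)
    finally show ?thesis .
  qed
  then show ?thesis using tw uw by (intro exI[of _ w]) (auto simp: w_def)
qed

lemma simple_function_finite_support:
  assumes "finite K" "\<And>k. k \<in> K \<Longrightarrow> simple_function M (F k)"
  shows "simple_function M (\<lambda>t. (\<lambda>k. if k \<in> K then F k t else 0) :: field)"
  using assms
proof (induction K)
  case empty
  then show ?case by simp
next
  case (insert x K)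
  have "simple_function M (\<lambda>t. (\<lambda>f c. f(x := c)) (\<lambda>k. if k \<in> K then F k t else (0 :: complex^3)) (F x t))"
    by (rule simple_function_compose2[where h = "\<lambda>f c. f(x := c)"]) (use insert in auto)
  moreover have "(\<lambda>f c. f(x := c)) (\<lambda>k. if k \<in> K then F k t else (0 :: complex^3)) (F x t) = (\<lambda>k. if k \<in> insert x K then F k t else 0)" for t
    by auto
  ultimately show ?case by simp
qed

text \<open>Approximating each coefficient by simple functions destroys both the reality condition
  and solenoidality. Averaging with the conjugate of the coefficient at -k and applying the Leray
  symbol restores them, and both operations fix the limit. One sequence serves all exponents
  s.\<close>

lemma simple_approximation:
  assumes L: "L > 0" and w: "traj L w"
  shows "\<exists>g. (\<forall>n::nat. simple_function lborel (g n) \<and> (\<forall>t. g n t \<in> trig_polys L)) \<and>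
    (\<forall>t s. en L s (w t) < \<infinity> \<longrightarrow> (\<lambda>n. en L s (\<lambda>k. g n t k - w t k)) \<longlonglongrightarrow> 0)"
proof -
  have "\<exists>F. (\<forall>n. simple_function lborel (F n)) \<and> (\<forall>t\<in>space lborel. (\<lambda>n. F n t) \<longlonglongrightarrow> w t k) \<and>
      (\<forall>n. \<forall>t\<in>space lborel. dist (F n t) 0 \<le> 2 * dist (w t k) 0)" for k
    using w by (intro borel_measurable_implies_sequence_metric) (auto simp: traj_def)
  then obtain F where F: "\<And>k n. simple_function lborel (F k n)" "\<And>k t. (\<lambda>n. F k n t) \<longlonglongrightarrow> w t k"
    "\<And>k n t. norm (F k n t) \<le> 2 * norm (w t k)"
    by (simp add: dist_norm) metis
  define box where "box n = {k::int^3. \<forall>i. \<bar>k $ i\<bar> \<le> int n}" for n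
  have box: "finite (box n)" "- k \<in> box n \<longleftrightarrow> k \<in> box n" for n k
    using finite_box by (auto simp: box_def)
  define p where "p k x y = leray L k ((1/2) *\<^sub>R (x + vcnj y))" for k x y
  define g where "g n t = (\<lambda>k. if k \<in> box n - {0} then p k (F k n t) (F (- k) n t) else 0)" for n t
  have simple: "simple_function lborel (g n)" for n
    unfolding g_def using box(1)[of n]
    by (intro simple_function_finite_support simple_function_compose2[OF F(1) F(1)]) auto
  have vadd: "vcnj (x + y) = vcnj x + vcnj y" "vcnj (c *\<^sub>R x) = c *\<^sub>R vcnj x" for x y c
    using bounded_linear.linear[OF bounded_linear_vcnj] by (auto simp: linear_add linear_cmul)
  have vnm: "norm (vcnj x) = norm x" for x
    by (simp add: vcnj_def norm_vec_def L2_set_def)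
  have "g n t \<in> solenoidal L" for n t
  proof -
    have "p (- k) (F (- k) n t) (F k n t) = vcnj (p k (F k n t) (F (- k) n t))" for k
      unfolding p_def leray_vcnj[symmetric] by (simp add: vadd add.commute)
    moreover have "vcnj 0 = 0" by (simp add: vcnj_def vec_eq_iff)
    moreover have "zdot L k (p k x y) = 0" for k x y
      unfolding p_def by (rule zdot_leray[OF L])
    ultimately show ?thesis
      using box(2) by (auto simp: solenoidal_iff g_def)
  qed
  moreover have "finite {k. g n t k \<noteq> 0}" for n t
    by (rule finite_subset[OF _ box(1)[of n]]) (auto simp: g_def)
  ultimately have tp: "g n t \<in> trig_polys L" for n t
    by (simp add: trig_polys_def)
  have conv: "(\<lambda>n. en L s (\<lambda>k. g n t k - w t k)) \<longlonglongrightarrow> 0" if fin: "en L s (w t) < \<infinity>" for t s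
  proof (rule en_dominated[where w = "w t" and c = 3, OF fin])
    have wm: "w t (- k) = vcnj (w t k)" "w t 0 = 0" "zdot L k (w t k) = 0" for k
      using w by (auto simp: traj_def solenoidal_iff)
    \<comment> \<open>The simple approximants have norm at most twice that of \<open>w t k\<close>;
      symmetrising and projecting keep this bound, and the subtracted limit adds one.\<close>
    show "norm (g n t k - w t k) \<le> 3 * norm (w t k)" for n k
    proof -
      have "norm (p k (F k n t) (F (- k) n t)) \<le> norm ((1/2) *\<^sub>R (F k n t + vcnj (F (- k) n t)))"
        unfolding p_def by (rule norm_leray[OF L])
      also have "\<dots> \<le> (1/2) * (norm (F k n t) + norm (F (- k) n t))"
        using norm_triangle_ineq[of "F k n t" "vcnj (F (- k) n t)"] by (simp add: vnm)
      also have "\<dots> \<le> 2 * norm (w t k)"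
        using F(3)[of k n t] F(3)[of "- k" n t] by (simp add: wm vnm)
      finally have "norm (g n t k) \<le> 2 * norm (w t k)"
        by (simp add: g_def)
      then show ?thesis
        using norm_triangle_ineq4[of "g n t k" "w t k"] by linarith
    qed
    show "(\<lambda>n. g n t k) \<longlonglongrightarrow> w t k" for k
    proof (cases "k = 0")
      case True
      then show ?thesis by (simp add: g_def wm)
    next
      case False
      have lim: "(\<lambda>n. p k (F k n t) (F (- k) n t)) \<longlonglongrightarrow> p k (w t k) (w t (- k))"
        unfolding p_def
        by (intro bounded_linear.tendsto[OF bounded_linear_leray] tendsto_intros F bounded_linear.tendsto[OF bounded_linear_vcnj])
      have "(1/2) *\<^sub>R (w t k + w t k) = w t k"
        by (simp flip: scaleR_2)
      then have eq: "p k (w t k) (w t (- k)) = w t k"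
        unfolding p_def wm(1) vcnj_vcnj by (simp only: leray_eq wm)
      have ev: "eventually (\<lambda>n. p k (F k n t) (F (- k) n t) = g n t k) sequentially"
        by (rule eventually_mono[OF trunc_eventually[of "\<lambda>_. 1" k]])
           (use False in \<open>auto simp: trunc_def g_def box_def split: if_splits\<close>)
      show ?thesis
        by (rule Lim_transform_eventually[OF lim[unfolded eq] ev])
    qed
  qed
  show ?thesis using simple tp conv by blast
qed

lemma vnorm_measurable:
  assumes "L > 0" "\<And>k. (\<lambda>t. u t k) \<in> borel_measurable M"
  shows "(\<lambda>t. (vnorm L s (u t))\<^sup>2) \<in> borel_measurable M"
  unfolding vnorm_sq[OF assms(1)] using en_measurable[OF assms(2)] by measurable

text \<open>Converse of \<open>L2_fun_clean\<close>: it puts the constructed trajectories into the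
  Bochner spaces of the definitions.\<close>

lemma L2_funI:
  assumes L: "L > 0" and w: "traj L w" and uw: "AE t in lborel. t \<in> {a<..<b} \<longrightarrow> u t = w t"
    and fin: "(\<integral>\<^sup>+t\<in>{a<..<b}. en L s (w t) \<partial>lborel) < \<infinity>"
  shows "u \<in> L2_fun L s a b"
proof -
  let ?I = "{a<..<b}" and ?M = "lebesgue_on {a<..<b}"
  have I: "?I \<in> sets borel" by simp
  have [measurable]: "(\<lambda>t. en L s (w t)) \<in> borel_measurable borel"
    by (rule traj_en_measurable[OF w])
  have "AE t in lborel. en L s (w t) * indicator ?I t \<noteq> \<infinity>"
    using fin by (intro nn_integral_PInf_AE) auto
  then have wV: "AE t in lborel. t \<in> ?I \<longrightarrow> w t \<in> Vsp L s"
    by eventually_elim (use w in \<open>auto simp: Vsp_iff traj_def less_top\<close>)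
  obtain g where g: "\<And>n::nat. simple_function lborel (g n)" "\<And>n t. g n t \<in> trig_polys L"
    and conv: "\<And>t. en L s (w t) < \<infinity> \<Longrightarrow> (\<lambda>n. en L s (\<lambda>k. g n t k - w t k)) \<longlonglongrightarrow> 0"
    using simple_approximation[OF L w] by blast
  have "strongly_measurable L s a b u"
    unfolding strongly_measurable_def
  proof (intro conjI exI[of _ g] allI ballI)
    show "AE t in ?M. u t \<in> Vsp L s"
      unfolding AE_lebesgue_on_iff[OF I] using wV uw by eventually_elim auto
    show "simple_function ?M (g n)" for n
    proof -
      have fin: "finite (range (g n))"
        using simple_functionD(1)[OF g(1)] by simp
      have pre: "g n -` {x} \<in> sets lebesgue" for x
        using simple_functionD(2)[OF g(1), of n "{x}"] by (auto intro: sets_completionI_sets)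
      have "finite (g n ` ?I)"
        by (rule finite_subset[OF image_mono fin]) simp
      moreover have "g n -` {x} \<inter> ?I \<in> sets ?M" for x
        unfolding sets_restrict_space using pre by (auto intro!: image_eqI[where x = "g n -` {x}"])
      ultimately show ?thesis
        by (simp add: simple_function_def)
    qed
    show "g n t \<in> Vsp L s" for n t
      using g(2) trig_polys_subset_Vsp by blast
    show "AE t in ?M. (\<lambda>n. vdist L s (g n t) (u t)) \<longlonglongrightarrow> 0"
      unfolding AE_lebesgue_on_iff[OF I] using wV uw
    proof eventually_elim
      case (elim t)
      show ?case
      proof
        assume t: "t \<in> ?I"
        then have f: "en L s (w t) < \<infinity>" using elim by (simp add: Vsp_iff)
        show "(\<lambda>n. vdist L s (g n t) (u t)) \<longlonglongrightarrow> 0"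
          using elim t conv[OF f] vdist_tendsto_iff[where us = "\<lambda>n. g n t" and F = sequentially, OF L trig_polys_en_finite[OF g(2)] f] by simp
      qed
    qed
  qed
  moreover have "integrable ?M (\<lambda>t. (vnorm L s (u t))\<^sup>2)"
  proof -
    have gm: "(\<lambda>t. (vnorm L s (w t))\<^sup>2) \<in> borel_measurable borel"
      using w by (intro vnorm_measurable L) (auto simp: traj_def)
    have "(\<integral>\<^sup>+t. ennreal (norm (indicator ?I t *\<^sub>R (vnorm L s (w t))\<^sup>2)) \<partial>lborel)
       \<le> (\<integral>\<^sup>+t. ennreal (L ^ 3) * (en L s (w t) * indicator ?I t) \<partial>lborel)"
    proof (intro nn_integral_mono_AE, use wV in eventually_elim)
      case (elim t)
      then show ?case
        using L by (auto simp: indicator_def Vsp_iff vnorm_squared)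
    qed
    also have "\<dots> < \<infinity>"
      using fin by (simp add: nn_integral_cmult ennreal_mult_less_top)
    finally have "integrable lborel (\<lambda>t. indicator ?I t *\<^sub>R (vnorm L s (w t))\<^sup>2)"
      using gm by (simp add: integrable_iff_bounded)
    moreover have "AE t in lborel. t \<in> ?I \<longrightarrow> (vnorm L s (u t))\<^sup>2 = (vnorm L s (w t))\<^sup>2"
      using uw by eventually_elim auto
    ultimately show ?thesis
      using lebesgue_on_cong_AE(3)[OF I gm] by simp
  qed
  ultimately show ?thesis by (simp add: L2_fun_def)
qed

section \<open>A Gronwall inequality with integrable kernel\<close>

text \<open>The primitive from 0. For \<open>t \<le> 0\<close> the interval is empty and the value
  is 0.\<close>

definition cumul :: "(real \<Rightarrow> ennreal) \<Rightarrow> real \<Rightarrow> ennreal" where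
  "cumul \<omega> t = (\<integral>\<^sup>+s. \<omega> s * indicator {0<..<t} s \<partial>lborel)"

lemma cumul_mono: "s \<le> t \<Longrightarrow> cumul \<omega> s \<le> cumul \<omega> t"
  unfolding cumul_def by (intro nn_integral_mono) (auto simp: indicator_def)

lemma cumul_measurable:
  assumes [measurable]: "\<omega> \<in> borel_measurable borel"
  shows "cumul \<omega> \<in> borel_measurable borel"
proof -
  have "cumul \<omega> = (\<lambda>t. \<integral>\<^sup>+s. (if 0 < s \<and> s < t then \<omega> s else 0) \<partial>lborel)"
    unfolding cumul_def by (intro ext nn_integral_cong) (auto simp: indicator_def)
  then show ?thesis by simp
qed

lemma nn_integral_triangle_swap:
  fixes f :: "real \<Rightarrow> real \<Rightarrow> ennreal"
  assumes [measurable]: "(\<lambda>(s, r). f s r) \<in> borel_measurable (borel \<Otimes>\<^sub>M borel)"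
  shows "(\<integral>\<^sup>+s. (\<integral>\<^sup>+r. f s r * indicator {0<..<s} r \<partial>lborel) * indicator {0<..<t} s \<partial>lborel)
    = (\<integral>\<^sup>+r. (\<integral>\<^sup>+s. f s r * indicator {r<..<t} s \<partial>lborel) * indicator {0<..<t} r \<partial>lborel)"
proof -
  let ?h = "\<lambda>s r. if 0 < r \<and> r < s \<and> s < t then f s r else 0"
  have l: "(\<integral>\<^sup>+r. f s r * indicator {0<..<s} r \<partial>lborel) * indicator {0<..<t} s = (\<integral>\<^sup>+r. ?h s r \<partial>lborel)" for s
  proof (cases "0 < s \<and> s < t")
    case True
    then show ?thesis by (auto simp: indicator_def intro!: nn_integral_cong)
  next
    case False
    then have "?h s = (\<lambda>r. 0)" by (auto simp: fun_eq_iff)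
    then show ?thesis using False by (auto simp: indicator_def)
  qed
  have r: "(\<integral>\<^sup>+s. f s r * indicator {r<..<t} s \<partial>lborel) * indicator {0<..<t} r = (\<integral>\<^sup>+s. ?h s r \<partial>lborel)" for r
  proof (cases "0 < r \<and> r < t")
    case True
    then show ?thesis by (auto simp: indicator_def intro!: nn_integral_cong)
  next
    case False
    then have "(\<lambda>s. ?h s r) = (\<lambda>s. 0)" by (auto simp: fun_eq_iff)
    then show ?thesis using False by (auto simp: indicator_def)
  qed
  show ?thesis
    unfolding l r by (rule lborel_pair.Fubini') measurable
qed

text \<open>Integration by parts for the powers of the primitive, by one application of Tonelli.\<close>

lemma cumul_power:
  assumes \<omega>[measurable]: "\<omega> \<in> borel_measurable borel"
  shows "of_nat (Suc n) * cumul (\<lambda>s. \<omega> s * cumul \<omega> s ^ n) t = cumul \<omega> t ^ Suc n"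
proof (induction n arbitrary: t)
  case 0
  then show ?case by simp
next
  case (Suc n)
  note [measurable] = cumul_measurable[OF \<omega>]
  have split: "cumul \<omega> t = cumul \<omega> s + (\<integral>\<^sup>+r. \<omega> r * indicator {s<..<t} r \<partial>lborel)" if "0 < s" "s < t" for s
  proof -
    have "cumul \<omega> t = (\<integral>\<^sup>+r. \<omega> r * indicator {0<..<s} r + \<omega> r * indicator {s<..<t} r \<partial>lborel)"
      unfolding cumul_def using that
      by (intro nn_integral_cong_AE, use AE_lborel_singleton[of s] in eventually_elim) (auto simp: indicator_def)
    then show ?thesis by (simp add: nn_integral_add cumul_def)
  qed
  have "cumul \<omega> t ^ Suc (Suc n) = cumul \<omega> t ^ Suc n * cumul \<omega> t"
    by (simp only: power_Suc2)
  also have "\<dots> = of_nat (Suc n) * (cumul (\<lambda>s. \<omega> s * cumul \<omega> s ^ n) t * cumul \<omega> t)"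
    by (simp only: Suc[of t, symmetric] mult.assoc)
  also have "cumul (\<lambda>s. \<omega> s * cumul \<omega> s ^ n) t * cumul \<omega> t = (\<integral>\<^sup>+s. \<omega> s * cumul \<omega> s ^ n * indicator {0<..<t} s * cumul \<omega> t \<partial>lborel)"
    unfolding cumul_def[of "\<lambda>s. \<omega> s * cumul \<omega> s ^ n"] by (rule nn_integral_multc[symmetric]) measurable
  also have "(\<integral>\<^sup>+s. \<omega> s * cumul \<omega> s ^ n * indicator {0<..<t} s * cumul \<omega> t \<partial>lborel)
    = (\<integral>\<^sup>+s. \<omega> s * cumul \<omega> s ^ Suc n * indicator {0<..<t} s
        + (\<integral>\<^sup>+r. (\<omega> s * cumul \<omega> s ^ n * \<omega> r) * indicator {s<..<t} r \<partial>lborel) * indicator {0<..<t} s \<partial>lborel)"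
  proof (intro nn_integral_cong)
    fix s
    show "\<omega> s * cumul \<omega> s ^ n * indicator {0<..<t} s * cumul \<omega> t = \<omega> s * cumul \<omega> s ^ Suc n * indicator {0<..<t} s
        + (\<integral>\<^sup>+r. (\<omega> s * cumul \<omega> s ^ n * \<omega> r) * indicator {s<..<t} r \<partial>lborel) * indicator {0<..<t} s"
    proof (cases "0 < s \<and> s < t")
      case True
      have "(\<integral>\<^sup>+r. (\<omega> s * cumul \<omega> s ^ n * \<omega> r) * indicator {s<..<t} r \<partial>lborel)
        = (\<omega> s * cumul \<omega> s ^ n) * (\<integral>\<^sup>+r. \<omega> r * indicator {s<..<t} r \<partial>lborel)"
        by (subst nn_integral_cmult[symmetric]) (simp_all add: mult.assoc)
      moreover have "cumul \<omega> t = cumul \<omega> s + (\<integral>\<^sup>+r. \<omega> r * indicator {s<..<t} r \<partial>lborel)"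
        using True split by simp
      moreover have "indicator {0<..<t} s = (1 :: ennreal)"
        using True by simp
      ultimately show ?thesis
        by (simp only: distrib_left mult.assoc power_Suc2 mult_1_right)
    qed simp
  qed
  also have "\<dots> = cumul (\<lambda>s. \<omega> s * cumul \<omega> s ^ Suc n) t
     + (\<integral>\<^sup>+s. (\<integral>\<^sup>+r. (\<omega> s * cumul \<omega> s ^ n * \<omega> r) * indicator {s<..<t} r \<partial>lborel) * indicator {0<..<t} s \<partial>lborel)"
    unfolding cumul_def[of "\<lambda>s. \<omega> s * cumul \<omega> s ^ Suc n"]
  proof (rule nn_integral_add)
    have "(\<lambda>s. \<integral>\<^sup>+r. (if s < r \<and> r < t then \<omega> s * cumul \<omega> s ^ n * \<omega> r else 0) \<partial>lborel) \<in> borel_measurable lborel"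
      by measurable
    moreover have "(\<integral>\<^sup>+r. (\<omega> s * cumul \<omega> s ^ n * \<omega> r) * indicator {s<..<t} r \<partial>lborel) = (\<integral>\<^sup>+r. (if s < r \<and> r < t then \<omega> s * cumul \<omega> s ^ n * \<omega> r else 0) \<partial>lborel)" for s
      by (intro nn_integral_cong) (auto simp: indicator_def)
    ultimately show "(\<lambda>s. (\<integral>\<^sup>+r. (\<omega> s * cumul \<omega> s ^ n * \<omega> r) * indicator {s<..<t} r \<partial>lborel) * indicator {0<..<t} s) \<in> borel_measurable lborel"
      by simp
  qed simp
  \<comment> \<open>After the exchange r is the larger variable, so the inner integral runs over
    \<open>(0, r)\<close> and is again a primitive.\<close>
  also have "(\<integral>\<^sup>+s. (\<integral>\<^sup>+r. (\<omega> s * cumul \<omega> s ^ n * \<omega> r) * indicator {s<..<t} r \<partial>lborel) * indicator {0<..<t} s \<partial>lborel)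
    = (\<integral>\<^sup>+r. (\<integral>\<^sup>+s. (\<omega> s * cumul \<omega> s ^ n * \<omega> r) * indicator {0<..<r} s \<partial>lborel) * indicator {0<..<t} r \<partial>lborel)"
    by (rule nn_integral_triangle_swap[symmetric]) measurable
  also have "\<dots> = (\<integral>\<^sup>+r. \<omega> r * cumul (\<lambda>s. \<omega> s * cumul \<omega> s ^ n) r * indicator {0<..<t} r \<partial>lborel)"
  proof (intro nn_integral_cong)
    fix r
    have "(\<integral>\<^sup>+s. (\<omega> s * cumul \<omega> s ^ n * \<omega> r) * indicator {0<..<r} s \<partial>lborel)
      = (\<integral>\<^sup>+s. \<omega> r * (\<omega> s * cumul \<omega> s ^ n * indicator {0<..<r} s) \<partial>lborel)"
      by (intro nn_integral_cong) (simp only: mult.commute mult.left_commute mult.assoc)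
    also have "\<dots> = \<omega> r * cumul (\<lambda>s. \<omega> s * cumul \<omega> s ^ n) r"
      unfolding cumul_def[of "\<lambda>s. \<omega> s * cumul \<omega> s ^ n"] by (rule nn_integral_cmult) measurable
    finally show "(\<integral>\<^sup>+s. (\<omega> s * cumul \<omega> s ^ n * \<omega> r) * indicator {0<..<r} s \<partial>lborel) * indicator {0<..<t} r
      = \<omega> r * cumul (\<lambda>s. \<omega> s * cumul \<omega> s ^ n) r * indicator {0<..<t} r"
      by simp
  qed
  also have "of_nat (Suc n) * (cumul (\<lambda>s. \<omega> s * cumul \<omega> s ^ Suc n) t + \<dots>)
     = of_nat (Suc n) * cumul (\<lambda>s. \<omega> s * cumul \<omega> s ^ Suc n) t
       + of_nat (Suc n) * (\<integral>\<^sup>+r. \<omega> r * cumul (\<lambda>s. \<omega> s * cumul \<omega> s ^ n) r * indicator {0<..<t} r \<partial>lborel)"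
    by (rule distrib_left)
  also have "of_nat (Suc n) * (\<integral>\<^sup>+r. \<omega> r * cumul (\<lambda>s. \<omega> s * cumul \<omega> s ^ n) r * indicator {0<..<t} r \<partial>lborel)
     = (\<integral>\<^sup>+r. of_nat (Suc n) * (\<omega> r * cumul (\<lambda>s. \<omega> s * cumul \<omega> s ^ n) r * indicator {0<..<t} r) \<partial>lborel)"
  proof (rule nn_integral_cmult[symmetric])
    have [measurable]: "cumul (\<lambda>s. \<omega> s * cumul \<omega> s ^ n) \<in> borel_measurable borel"
      by (rule cumul_measurable) measurable
    show "(\<lambda>r. \<omega> r * cumul (\<lambda>s. \<omega> s * cumul \<omega> s ^ n) r * indicator {0<..<t} r) \<in> borel_measurable lborel"
      by measurable
  qed
  also have "\<dots> = (\<integral>\<^sup>+r. \<omega> r * (of_nat (Suc n) * cumul (\<lambda>s. \<omega> s * cumul \<omega> s ^ n) r) * indicator {0<..<t} r \<partial>lborel)"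
    by (intro nn_integral_cong) (simp only: mult.left_commute mult.assoc)
  \<comment> \<open>The induction hypothesis at r replaces \<open>Suc n\<close> copies of the inner
    primitive by the next power, which makes both summands equal up to their coefficients.\<close>
  also have "\<dots> = cumul (\<lambda>s. \<omega> s * cumul \<omega> s ^ Suc n) t"
    unfolding Suc cumul_def[of "\<lambda>s. \<omega> s * cumul \<omega> s ^ Suc n"] ..
  also have "of_nat (Suc n) * cumul (\<lambda>s. \<omega> s * cumul \<omega> s ^ Suc n) t + cumul (\<lambda>s. \<omega> s * cumul \<omega> s ^ Suc n) t
     = of_nat (Suc (Suc n)) * cumul (\<lambda>s. \<omega> s * cumul \<omega> s ^ Suc n) t"
    by (simp only: of_nat_Suc[of "Suc n"] distrib_right mult_1_left add.commute)
  finally show ?case by (rule sym)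
qed

lemma cumul_cmult:
  assumes "\<omega> \<in> borel_measurable borel"
  shows "cumul (\<lambda>s. c * \<omega> s) t = c * cumul \<omega> t"
  unfolding cumul_def using assms by (simp add: mult.assoc nn_integral_cmult)

lemma cumul_add:
  assumes "\<omega> \<in> borel_measurable borel" "\<omega>' \<in> borel_measurable borel"
  shows "cumul (\<lambda>s. \<omega> s + \<omega>' s) t = cumul \<omega> t + cumul \<omega>' t"
  unfolding cumul_def using assms by (simp add: distrib_right nn_integral_add)

lemma cumul_mono_fun: "(\<And>s. 0 < s \<Longrightarrow> s < t \<Longrightarrow> f s \<le> g s) \<Longrightarrow> cumul f t \<le> cumul g t"
  unfolding cumul_def by (intro nn_integral_mono) (auto simp: indicator_def)

text \<open>The terms of the exponential series of \<open>c * cumul \<omega> t\<close>; they arise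
  by iterating the integral operator with kernel \<open>c * \<omega>\<close> on a constant.\<close>

definition gterm :: "(real \<Rightarrow> ennreal) \<Rightarrow> real \<Rightarrow> nat \<Rightarrow> real \<Rightarrow> ennreal" where
  "gterm \<omega> c n t = ennreal (c ^ n / fact n) * cumul \<omega> t ^ n"

lemma gterm_step:
  assumes "\<omega> \<in> borel_measurable borel" "c \<ge> 0"
  shows "ennreal c * cumul (\<lambda>s. \<omega> s * gterm \<omega> c n s) t = gterm \<omega> c (Suc n) t"
proof -
  have "ennreal c * cumul (\<lambda>s. \<omega> s * gterm \<omega> c n s) t = ennreal c * (ennreal (c ^ n / fact n) * cumul (\<lambda>s. \<omega> s * cumul \<omega> s ^ n) t)"
    unfolding gterm_def using assms cumul_measurable[OF assms(1)]
    by (subst cumul_cmult[symmetric]) (auto simp: ac_simps)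
  also have "\<dots> = ennreal (c ^ Suc n / fact (Suc n)) * (of_nat (Suc n) * cumul (\<lambda>s. \<omega> s * cumul \<omega> s ^ n) t)"
  proof -
    have "c * (c ^ n / fact n) = c ^ Suc n / fact (Suc n) * real (Suc n)"
      by (simp add: fact_Suc del: of_nat_Suc)
    then have "ennreal c * ennreal (c ^ n / fact n) = ennreal (c ^ Suc n / fact (Suc n)) * of_nat (Suc n)"
      using assms by (metis ennreal_mult ennreal_of_nat_eq_real_of_nat divide_nonneg_pos fact_gt_zero of_nat_0_le_iff zero_le_power)
    then show ?thesis by (simp only: mult.assoc[symmetric])
  qed
  also have "\<dots> = gterm \<omega> c (Suc n) t"
    unfolding gterm_def cumul_power[OF assms(1)] ..
  finally show ?thesis .
qed

lemma gterm_measurable: "\<omega> \<in> borel_measurable borel \<Longrightarrow> gterm \<omega> c n \<in> borel_measurable borel"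
  unfolding gterm_def[abs_def] using cumul_measurable by measurable

lemma gterm_mono: "s \<le> t \<Longrightarrow> gterm \<omega> c n s \<le> gterm \<omega> c n t"
  unfolding gterm_def by (intro mult_left_mono power_mono cumul_mono) auto

text \<open>A single term of the exponential series of \<open>q * c * x\<close> is at most its sum.
  The parameter q buys geometric decay: 2 is enough for Gronwall, while 4 is used for the Picard
  iterates, whose energies lose a factor 2 in each telescoping step.\<close>

lemma gterm_le_exp:
  assumes "c \<ge> 0" "cumul \<omega> t = ennreal x" "x \<ge> 0" "q > 0"
  shows "gterm \<omega> c n t \<le> ennreal (exp (q * c * x) / q ^ n)"
proof -
  have "(q * c * x) ^ n / fact n \<le> exp (q * c * x)"
  proof -
    have "(\<Sum>k\<in>{n}. inverse (fact k) * (q * c * x) ^ k) \<le> (\<Sum>k. inverse (fact k) * (q * c * x) ^ k)"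
      using summable_exp[of "q * c * x"] assms by (intro sum_le_suminf) auto
    then show ?thesis
      by (simp add: exp_def scaleR_conv_of_real field_simps)
  qed
  then have "c ^ n / fact n * x ^ n \<le> exp (q * c * x) / q ^ n"
    using assms by (simp add: power_mult_distrib field_simps)
  then have "ennreal (c ^ n / fact n * x ^ n) \<le> ennreal (exp (q * c * x) / q ^ n)"
    by (rule ennreal_leI)
  then show ?thesis
    unfolding gterm_def assms(2) using assms by (simp add: ennreal_power ennreal_mult[symmetric])
qed

text \<open>Stated for a sequence so that it has two uses: a constant sequence gives Gronwall's
  inequality, and differences of successive Picard iterates satisfy it with
  \<open>A = 0\<close>.\<close>

lemma gronwall_iteration:
  assumes \<omega>[measurable]: "\<omega> \<in> borel_measurable borel" and c: "c \<ge> 0"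
    and D0: "\<And>t. 0 \<le> t \<Longrightarrow> t \<le> T \<Longrightarrow> D 0 t \<le> M"
    and step: "\<And>n t. 0 \<le> t \<Longrightarrow> t \<le> T \<Longrightarrow> D (Suc n) t \<le> A + ennreal c * cumul (\<lambda>s. \<omega> s * D n s) t"
    and t: "0 \<le> t" "t \<le> T"
  shows "D n t \<le> A * (\<Sum>j<n. gterm \<omega> c j t) + M * gterm \<omega> c n t"
  using t
proof (induction n arbitrary: t)
  case 0
  then show ?case using D0 by (simp add: gterm_def)
next
  case (Suc n)
  note [measurable] = gterm_measurable[OF \<omega>]
  have "D (Suc n) t \<le> A + ennreal c * cumul (\<lambda>s. \<omega> s * D n s) t"
    using Suc step by simp
  also have "\<dots> \<le> A + ennreal c * cumul (\<lambda>s. \<omega> s * (A * (\<Sum>j<n. gterm \<omega> c j s) + M * gterm \<omega> c n s)) t"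
    using Suc by (intro add_left_mono mult_left_mono cumul_mono_fun) auto
  also have "cumul (\<lambda>s. \<omega> s * (A * (\<Sum>j<n. gterm \<omega> c j s) + M * gterm \<omega> c n s)) t
     = A * cumul (\<lambda>s. \<Sum>j<n. \<omega> s * gterm \<omega> c j s) t + M * cumul (\<lambda>s. \<omega> s * gterm \<omega> c n s) t"
    by (subst cumul_cmult[symmetric], measurable, subst cumul_cmult[symmetric], measurable, subst cumul_add[symmetric], measurable)
       (intro arg_cong2[where f = cumul] ext refl, simp add: distrib_left sum_distrib_left ac_simps)
  also have "cumul (\<lambda>s. \<Sum>j<n. \<omega> s * gterm \<omega> c j s) t = (\<Sum>j<n. cumul (\<lambda>s. \<omega> s * gterm \<omega> c j s) t)"
    unfolding cumul_def sum_distrib_right by (rule nn_integral_sum) measurable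
  also have "A + ennreal c * (A * (\<Sum>j<n. cumul (\<lambda>s. \<omega> s * gterm \<omega> c j s) t) + M * cumul (\<lambda>s. \<omega> s * gterm \<omega> c n s) t)
     = A + (A * (\<Sum>j<n. ennreal c * cumul (\<lambda>s. \<omega> s * gterm \<omega> c j s) t) + M * (ennreal c * cumul (\<lambda>s. \<omega> s * gterm \<omega> c n s) t))"
    by (simp add: distrib_left sum_distrib_left ac_simps)
  also have "\<dots> = A + (A * (\<Sum>j<n. gterm \<omega> c (Suc j) t) + M * gterm \<omega> c (Suc n) t)"
    by (simp only: gterm_step[OF \<omega> c])
  also have "\<dots> = A * (gterm \<omega> c 0 t + (\<Sum>j<n. gterm \<omega> c (Suc j) t)) + M * gterm \<omega> c (Suc n) t"
    by (simp add: gterm_def distrib_left add.assoc)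
  also have "gterm \<omega> c 0 t + (\<Sum>j<n. gterm \<omega> c (Suc j) t) = (\<Sum>j<Suc n. gterm \<omega> c j t)"
    by (subst sum.lessThan_Suc_shift) simp
  finally show ?case .
qed

text \<open>Iterating the inequality n times leaves a remainder of size \<open>M / 2 ^ n\<close> up
  to a constant, so the a priori bound M disappears in the limit. Summing the geometric bounds of
  the terms gives \<open>2 * exp (2 * c * x)\<close> in place of the sharp
  \<open>exp (c * x)\<close>.\<close>

lemma gronwall:
  assumes \<omega>: "\<omega> \<in> borel_measurable borel" and c: "c \<ge> 0"
    and W: "cumul \<omega> T = ennreal x" "x \<ge> 0"
    and M: "\<And>t. 0 \<le> t \<Longrightarrow> t \<le> T \<Longrightarrow> D t \<le> ennreal M"
    and step: "\<And>t. 0 \<le> t \<Longrightarrow> t \<le> T \<Longrightarrow> D t \<le> A + ennreal c * cumul (\<lambda>s. \<omega> s * D s) t"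
    and t: "0 \<le> t" "t \<le> T"
  shows "D t \<le> A * ennreal (2 * exp (2 * c * x))"
proof -
  let ?E = "exp (2 * c * x)"
  have g: "gterm \<omega> c n t \<le> ennreal (?E / 2 ^ n)" for n
    using order_trans[OF gterm_mono[OF t(2)] gterm_le_exp[OF c W, of 2 n]] by simp
  have bound: "D t \<le> A * ennreal (2 * ?E) + ennreal M * ennreal (?E / 2 ^ n)" for n
  proof -
    have "D t \<le> A * (\<Sum>j<n. gterm \<omega> c j t) + ennreal M * gterm \<omega> c n t"
      by (rule gronwall_iteration[where D = "\<lambda>_. D", OF \<omega> c M step t])
    also have "\<dots> \<le> A * ennreal (2 * ?E) + ennreal M * ennreal (?E / 2 ^ n)"
    proof (intro add_mono mult_left_mono g)
      have "(\<Sum>j<n. gterm \<omega> c j t) \<le> (\<Sum>j<n. ennreal (?E / 2 ^ j))"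
        by (intro sum_mono g)
      also have "\<dots> = ennreal (\<Sum>j<n. ?E / 2 ^ j)"
        by (rule sum_ennreal) simp
      also have "(\<Sum>j<n. ?E / 2 ^ j) = ?E * (\<Sum>j<n. (1 / 2) ^ j)"
        unfolding sum_distrib_left by (intro sum.cong refl) (simp only: power_divide power_one times_divide_eq_right mult_1_right)
      also have "(\<Sum>j<n. (1 / 2) ^ j) = 2 * (1 - (1 / 2 :: real) ^ n)"
        using geometric_sum[of "1 / 2 :: real" n] by simp
      also have "ennreal (?E * (2 * (1 - (1 / 2) ^ n))) \<le> ennreal (?E * (2 * 1))"
        by (intro ennreal_leI mult_left_mono) auto
      finally show "(\<Sum>j<n. gterm \<omega> c j t) \<le> ennreal (2 * ?E)"
        by (simp only: mult_1_right mult.commute[of ?E])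
    qed auto
    finally show ?thesis .
  qed
  have "(\<lambda>n. A * ennreal (2 * ?E) + ennreal M * ennreal (?E / 2 ^ n)) \<longlonglongrightarrow> A * ennreal (2 * ?E) + ennreal M * ennreal 0"
  proof (rule tendsto_add[OF tendsto_const])
    show "(\<lambda>n. ennreal M * ennreal (?E / 2 ^ n)) \<longlonglongrightarrow> ennreal M * ennreal 0"
    proof -
      have "(\<lambda>n. M * (?E * (1 / 2) ^ n)) \<longlonglongrightarrow> M * (?E * 0)"
        by (intro tendsto_intros LIMSEQ_power_zero) simp
      then have "(\<lambda>n. ennreal (max 0 M * (?E * (1 / 2) ^ n))) \<longlonglongrightarrow> ennreal (max 0 M * (?E * 0))"
        by (intro tendsto_ennrealI tendsto_intros LIMSEQ_power_zero) simp
      moreover have "ennreal M = ennreal (max 0 M)"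
        by (auto simp: max_def ennreal_neg)
      ultimately show ?thesis
        by (simp only: ennreal_mult[symmetric, of "max 0 M"] power_divide power_one times_divide_eq_right mult_1_right
            mult_zero_right max.cobounded1 zero_le_divide_iff zero_le_power exp_ge_zero zero_le_numeral simp_thms order_refl)
    qed
  qed
  then show ?thesis
    using bound by (intro LIMSEQ_le_const[of _ "A * ennreal (2 * ?E)"]) auto
qed

section \<open>The linearised equation in Duhamel form\<close>

lemma exp_kernel_left:
  assumes "a > 0"
  shows "(\<integral>\<^sup>+s. (if 0 < s \<and> s < t then ennreal (exp (- a * (t - s))) else 0) \<partial>lborel) \<le> ennreal (1 / a)"
proof (cases "0 \<le> t")
  case True
  have "(\<integral>\<^sup>+s. (if 0 < s \<and> s < t then ennreal (exp (- a * (t - s))) else 0) \<partial>lborel)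
     \<le> (\<integral>\<^sup>+s. ennreal (exp (- a * (t - s))) * indicator {0..t} s \<partial>lborel)"
    by (intro nn_integral_mono) (auto simp: indicator_def)
  also have "\<dots> = ennreal (exp (- a * (t - t)) / a - exp (- a * (t - 0)) / a)"
    using assms True by (intro nn_integral_FTC_Icc) (auto intro!: derivative_eq_intros)
  also have "\<dots> \<le> ennreal (1 / a)"
    using assms by (intro ennreal_leI) simp
  finally show ?thesis .
next
  case False
  then have "(\<lambda>s. if 0 < s \<and> s < t then ennreal (exp (- a * (t - s))) else 0) = (\<lambda>s. 0)"
    by (auto simp: fun_eq_iff)
  then show ?thesis by simp
qed

lemma exp_kernel_right:
  assumes "a > 0"
  shows "(\<integral>\<^sup>+t. (if s < t \<and> t < T then ennreal (exp (- a * (t - s))) else 0) \<partial>lborel) \<le> ennreal (1 / a)"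
proof (cases "s \<le> T")
  case True
  have "(\<integral>\<^sup>+t. (if s < t \<and> t < T then ennreal (exp (- a * (t - s))) else 0) \<partial>lborel)
     \<le> (\<integral>\<^sup>+t. ennreal (exp (- a * (t - s))) * indicator {s..T} t \<partial>lborel)"
    by (intro nn_integral_mono) (auto simp: indicator_def)
  also have "\<dots> = ennreal (- exp (- a * (T - s)) / a - (- exp (- a * (s - s)) / a))"
    using assms True by (intro nn_integral_FTC_Icc) (auto intro!: derivative_eq_intros)
  also have "\<dots> \<le> ennreal (1 / a)"
    using assms by (intro ennreal_leI) simp
  finally show ?thesis .
next
  case False
  then have "(\<lambda>t. if s < t \<and> t < T then ennreal (exp (- a * (t - s))) else 0) = (\<lambda>s. 0)"
    by (auto simp: fun_eq_iff)
  then show ?thesis by simp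
qed

definition expconv :: "real \<Rightarrow> (real \<Rightarrow> complex^3) \<Rightarrow> real \<Rightarrow> complex^3" where
  "expconv a h t = (LINT s|lborel. (if 0 < s \<and> s < t then exp (- a * (t - s)) *\<^sub>R h s else 0))"

lemma expconv_measurable:
  assumes [measurable]: "h \<in> borel_measurable borel"
  shows "expconv a h \<in> borel_measurable borel"
proof -
  have "(\<lambda>t. LINT s|lborel. (if 0 < s \<and> s < t then exp (- a * (t - s)) *\<^sub>R h s else 0)) \<in> borel_measurable lborel"
    by measurable
  then show ?thesis by (simp add: expconv_def[abs_def])
qed

text \<open>Cauchy-Schwarz with the kernel split into two equal halves. One factor integrates to at
  most \<open>1 / a\<close>; the other keeps the kernel next to the square of h, and both the
  supremum and the square-integrable bound start from there.\<close>

lemma expconv_sq_le: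
  assumes h[measurable]: "h \<in> borel_measurable borel" and a: "a > 0"
  shows "ennreal ((norm (expconv a h t))\<^sup>2)
    \<le> ennreal (1 / a) * (\<integral>\<^sup>+s. (if 0 < s \<and> s < t then ennreal (exp (- a * (t - s))) * ennreal ((norm (h s))\<^sup>2) else 0) \<partial>lborel)"
proof -
  define \<phi> where "\<phi> s = (if 0 < s \<and> s < t then ennreal (exp (- a * (t - s) / 2)) else 0)" for s
  define \<psi> where "\<psi> s = (if 0 < s \<and> s < t then ennreal (exp (- a * (t - s) / 2) * norm (h s)) else 0)" for s
  have [measurable]: "\<phi> \<in> borel_measurable borel" "\<psi> \<in> borel_measurable borel"
    unfolding \<phi>_def[abs_def] \<psi>_def[abs_def] by measurable
  have half: "exp (- a * (t - s) / 2) * exp (- a * (t - s) / 2) = exp (- a * (t - s))" for s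
    by (simp add: exp_add[symmetric])
  have "ennreal (norm (expconv a h t)) \<le> (\<integral>\<^sup>+s. ennreal (norm (if 0 < s \<and> s < t then exp (- a * (t - s)) *\<^sub>R h s else 0)) \<partial>lborel)"
    unfolding expconv_def by (rule ennreal_norm_integral_le)
  also have "\<dots> = (\<integral>\<^sup>+s. \<phi> s * \<psi> s \<partial>lborel)"
  proof (intro nn_integral_cong)
    fix s
    have "norm (exp (- a * (t - s)) *\<^sub>R h s) = exp (- a * (t - s) / 2) * (exp (- a * (t - s) / 2) * norm (h s))"
      unfolding mult.assoc[symmetric] half by simp
    moreover have "\<phi> s * \<psi> s = ennreal (exp (- a * (t - s) / 2) * (exp (- a * (t - s) / 2) * norm (h s)))" if "0 < s \<and> s < t"
      using that by (simp only: \<phi>_def \<psi>_def if_True simp_thms ennreal_mult exp_ge_zero mult_nonneg_nonneg norm_ge_zero)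
    moreover have "\<phi> s * \<psi> s = 0" if "\<not> (0 < s \<and> s < t)"
      using that by (simp only: \<phi>_def if_False mult_zero_left)
    ultimately show "ennreal (norm (if 0 < s \<and> s < t then exp (- a * (t - s)) *\<^sub>R h s else 0)) = \<phi> s * \<psi> s"
      by (cases "0 < s \<and> s < t") (simp_all only: if_True if_False simp_thms norm_zero ennreal_0)
  qed
  finally have "(ennreal (norm (expconv a h t)))\<^sup>2 \<le> (\<integral>\<^sup>+s. \<phi> s * \<psi> s \<partial>lborel)\<^sup>2"
    by (intro power_mono) auto
  also have "\<dots> \<le> (\<integral>\<^sup>+s. (\<phi> s)\<^sup>2 \<partial>lborel) * (\<integral>\<^sup>+s. (\<psi> s)\<^sup>2 \<partial>lborel)"
    by (rule Cauchy_Schwarz_nn_integral) auto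
  also have "(\<integral>\<^sup>+s. (\<phi> s)\<^sup>2 \<partial>lborel) = (\<integral>\<^sup>+s. (if 0 < s \<and> s < t then ennreal (exp (- a * (t - s))) else 0) \<partial>lborel)"
    by (intro nn_integral_cong) (auto simp: \<phi>_def power2_eq_square ennreal_mult[symmetric] exp_add[symmetric])
  also have "(\<integral>\<^sup>+s. (\<psi> s)\<^sup>2 \<partial>lborel) = (\<integral>\<^sup>+s. (if 0 < s \<and> s < t then ennreal (exp (- a * (t - s))) * ennreal ((norm (h s))\<^sup>2) else 0) \<partial>lborel)"
  proof (intro nn_integral_cong)
    fix s
    have "(exp (- a * (t - s) / 2) * norm (h s))\<^sup>2 = exp (- a * (t - s)) * (norm (h s))\<^sup>2"
      unfolding power_mult_distrib power2_eq_square[of "exp _"] half ..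
    then show "(\<psi> s)\<^sup>2 = (if 0 < s \<and> s < t then ennreal (exp (- a * (t - s))) * ennreal ((norm (h s))\<^sup>2) else 0)"
      using ennreal_power[of "exp (- a * (t - s) / 2) * norm (h s)" 2]
      by (simp add: \<psi>_def ennreal_mult)
  qed
  finally have "(ennreal (norm (expconv a h t)))\<^sup>2 \<le> (\<integral>\<^sup>+s. (if 0 < s \<and> s < t then ennreal (exp (- a * (t - s))) else 0) \<partial>lborel)
    * (\<integral>\<^sup>+s. (if 0 < s \<and> s < t then ennreal (exp (- a * (t - s))) * ennreal ((norm (h s))\<^sup>2) else 0) \<partial>lborel)" .
  also have "\<dots> \<le> ennreal (1 / a) * (\<integral>\<^sup>+s. (if 0 < s \<and> s < t then ennreal (exp (- a * (t - s))) * ennreal ((norm (h s))\<^sup>2) else 0) \<partial>lborel)"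
    by (intro mult_right_mono exp_kernel_left a) auto
  finally show ?thesis
    by (simp add: ennreal_power)
qed

lemma expconv_sup:
  assumes h[measurable]: "h \<in> borel_measurable borel" and a: "a > 0"
  shows "ennreal ((norm (expconv a h t))\<^sup>2) \<le> ennreal (1 / a) * cumul (\<lambda>s. ennreal ((norm (h s))\<^sup>2)) t"
proof (rule order_trans[OF expconv_sq_le[OF h a]])
  show "ennreal (1 / a) * (\<integral>\<^sup>+s. (if 0 < s \<and> s < t then ennreal (exp (- a * (t - s))) * ennreal ((norm (h s))\<^sup>2) else 0) \<partial>lborel)
    \<le> ennreal (1 / a) * cumul (\<lambda>s. ennreal ((norm (h s))\<^sup>2)) t"
    unfolding cumul_def
  proof (intro mult_left_mono nn_integral_mono)
    fix s
    have "ennreal (exp (- a * (t - s))) * ennreal ((norm (h s))\<^sup>2) \<le> 1 * ennreal ((norm (h s))\<^sup>2)" if "s < t"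
      using a that by (intro mult_right_mono) auto
    then show "(if 0 < s \<and> s < t then ennreal (exp (- a * (t - s))) * ennreal ((norm (h s))\<^sup>2) else 0)
        \<le> ennreal ((norm (h s))\<^sup>2) * indicator {0<..<t} s"
      by (auto simp: indicator_def)
  qed simp
qed

text \<open>After exchanging the integrals the remaining kernel is integrated in the outer time
  variable, which yields a second factor \<open>1 / a\<close>. With a proportional to the squared
  frequency, this is a gain of two derivatives.\<close>

lemma expconv_L2:
  assumes h[measurable]: "h \<in> borel_measurable borel" and a: "a > 0"
  shows "cumul (\<lambda>t. ennreal ((norm (expconv a h t))\<^sup>2)) T \<le> ennreal (1 / a\<^sup>2) * cumul (\<lambda>s. ennreal ((norm (h s))\<^sup>2)) T"
proof -
  let ?f = "\<lambda>t s. ennreal (exp (- a * (t - s))) * ennreal ((norm (h s))\<^sup>2)"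
  have "cumul (\<lambda>t. ennreal ((norm (expconv a h t))\<^sup>2)) T
    \<le> (\<integral>\<^sup>+t. ennreal (1 / a) * ((\<integral>\<^sup>+s. ?f t s * indicator {0<..<t} s \<partial>lborel) * indicator {0<..<T} t) \<partial>lborel)"
    unfolding cumul_def
  proof (intro nn_integral_mono)
    fix t
    have "(\<integral>\<^sup>+s. (if 0 < s \<and> s < t then ?f t s else 0) \<partial>lborel) = (\<integral>\<^sup>+s. ?f t s * indicator {0<..<t} s \<partial>lborel)"
      by (intro nn_integral_cong) (auto simp: indicator_def)
    then show "ennreal ((norm (expconv a h t))\<^sup>2) * indicator {0<..<T} t
      \<le> ennreal (1 / a) * ((\<integral>\<^sup>+s. ?f t s * indicator {0<..<t} s \<partial>lborel) * indicator {0<..<T} t)"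
      using expconv_sq_le[OF h a, of t] unfolding mult.assoc[symmetric] by (intro mult_right_mono) auto
  qed
  also have "\<dots> = ennreal (1 / a) * (\<integral>\<^sup>+t. (\<integral>\<^sup>+s. ?f t s * indicator {0<..<t} s \<partial>lborel) * indicator {0<..<T} t \<partial>lborel)"
  proof (rule nn_integral_cmult)
    have "(\<lambda>t. \<integral>\<^sup>+s. (if 0 < s \<and> s < t then ?f t s else 0) \<partial>lborel) \<in> borel_measurable lborel"
      by measurable
    moreover have "(\<integral>\<^sup>+s. (if 0 < s \<and> s < t then ?f t s else 0) \<partial>lborel) = (\<integral>\<^sup>+s. ?f t s * indicator {0<..<t} s \<partial>lborel)" for t
      by (intro nn_integral_cong) (auto simp: indicator_def)
    ultimately show "(\<lambda>t. (\<integral>\<^sup>+s. ?f t s * indicator {0<..<t} s \<partial>lborel) * indicator {0<..<T} t) \<in> borel_measurable lborel"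
      by simp
  qed
  also have "(\<integral>\<^sup>+t. (\<integral>\<^sup>+s. ?f t s * indicator {0<..<t} s \<partial>lborel) * indicator {0<..<T} t \<partial>lborel)
     = (\<integral>\<^sup>+s. (\<integral>\<^sup>+t. ?f t s * indicator {s<..<T} t \<partial>lborel) * indicator {0<..<T} s \<partial>lborel)"
    by (rule nn_integral_triangle_swap) measurable
  also have "\<dots> \<le> (\<integral>\<^sup>+s. ennreal (1 / a) * (ennreal ((norm (h s))\<^sup>2) * indicator {0<..<T} s) \<partial>lborel)"
  proof (intro nn_integral_mono)
    fix s
    have "(\<integral>\<^sup>+t. ?f t s * indicator {s<..<T} t \<partial>lborel)
      = (\<integral>\<^sup>+t. (if s < t \<and> t < T then ennreal (exp (- a * (t - s))) else 0) * ennreal ((norm (h s))\<^sup>2) \<partial>lborel)"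
      by (intro nn_integral_cong) (auto simp: indicator_def)
    also have "\<dots> = (\<integral>\<^sup>+t. (if s < t \<and> t < T then ennreal (exp (- a * (t - s))) else 0) \<partial>lborel) * ennreal ((norm (h s))\<^sup>2)"
      by (rule nn_integral_multc) measurable
    also have "\<dots> \<le> ennreal (1 / a) * ennreal ((norm (h s))\<^sup>2)"
      by (intro mult_right_mono exp_kernel_right a) auto
    finally show "(\<integral>\<^sup>+t. ?f t s * indicator {s<..<T} t \<partial>lborel) * indicator {0<..<T} s \<le> ennreal (1 / a) * (ennreal ((norm (h s))\<^sup>2) * indicator {0<..<T} s)"
      unfolding mult.assoc[symmetric] by (intro mult_right_mono) auto
  qed
  also have "\<dots> = ennreal (1 / a) * cumul (\<lambda>s. ennreal ((norm (h s))\<^sup>2)) T"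
    unfolding cumul_def by (rule nn_integral_cmult) measurable
  finally have "cumul (\<lambda>t. ennreal ((norm (expconv a h t))\<^sup>2)) T \<le> ennreal (1 / a) * (ennreal (1 / a) * cumul (\<lambda>s. ennreal ((norm (h s))\<^sup>2)) T)"
    by (simp add: mult_left_mono)
  also have "\<dots> = ennreal (1 / a\<^sup>2) * cumul (\<lambda>s. ennreal ((norm (h s))\<^sup>2)) T"
    using a by (simp add: mult.assoc[symmetric] ennreal_mult[symmetric] power2_eq_square)
  finally show ?thesis .
qed

lemma expconv_integrable:
  fixes h :: "real \<Rightarrow> complex^3"
  assumes "integrable lborel (\<lambda>s. indicator {0<..<T} s *\<^sub>R h s)" "h \<in> borel_measurable borel" "a \<ge> 0" "t \<le> T"
  shows "integrable lborel (\<lambda>s. if 0 < s \<and> s < t then exp (- a * (t - s)) *\<^sub>R h s else 0)"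
proof (rule Bochner_Integration.integrable_bound[OF assms(1)])
  show "(\<lambda>s. if 0 < s \<and> s < t then exp (- a * (t - s)) *\<^sub>R h s else 0) \<in> borel_measurable lborel"
    using assms(2) by measurable
  show "AE s in lborel. norm (if 0 < s \<and> s < t then exp (- a * (t - s)) *\<^sub>R h s else 0) \<le> norm (indicator {0<..<T} s *\<^sub>R h s)"
  proof (rule AE_I2)
    fix s
    have "exp (- a * (t - s)) * norm (h s) \<le> 1 * norm (h s)" if "s < t"
      using assms that by (intro mult_right_mono) auto
    then show "norm (if 0 < s \<and> s < t then exp (- a * (t - s)) *\<^sub>R h s else 0) \<le> norm (indicator {0<..<T} s *\<^sub>R h s)"
      using assms(4) by (auto simp: indicator_def)
  qed
qed

lemma expconv_continuous:
  assumes int: "integrable lborel (\<lambda>s. indicator {0<..<T} s *\<^sub>R h s)" and h[measurable]: "h \<in> borel_measurable borel"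
    and a: "a \<ge> 0" and t: "\<And>n. t n \<le> T" and lim: "t \<longlonglongrightarrow> t0"
  shows "(\<lambda>n. expconv a h (t n)) \<longlonglongrightarrow> expconv a h t0"
  unfolding expconv_def
proof (rule integral_dominated_convergence[where w = "\<lambda>s. norm (indicator {0<..<T} s *\<^sub>R h s)"])
  show "integrable lborel (\<lambda>s. norm (indicator {0<..<T} s *\<^sub>R h s))"
    using int by (rule integrable_norm)
  show "AE s in lborel. (\<lambda>n. if 0 < s \<and> s < t n then exp (- a * (t n - s)) *\<^sub>R h s else 0)
     \<longlonglongrightarrow> (if 0 < s \<and> s < t0 then exp (- a * (t0 - s)) *\<^sub>R h s else 0)"
    \<comment> \<open>Only at \<open>s = t0\<close> is the limit of the indicator undetermined, and
      this point is a null set.\<close>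
    using AE_lborel_singleton[of t0]
  proof eventually_elim
    case (elim s)
    have exp: "(\<lambda>n. exp (- a * (t n - s)) *\<^sub>R h s) \<longlonglongrightarrow> exp (- a * (t0 - s)) *\<^sub>R h s"
      by (intro tendsto_intros lim)
    consider "s < t0" | "t0 < s" using elim by linarith
    then show ?case
    proof cases
      case 1
      then have ev: "eventually (\<lambda>n. s < t n) sequentially"
        using lim by (rule order_tendstoD(1)[rotated])
      show ?thesis
      proof (cases "0 < s")
        case True
        have "eventually (\<lambda>n. exp (- a * (t n - s)) *\<^sub>R h s = (if 0 < s \<and> s < t n then exp (- a * (t n - s)) *\<^sub>R h s else 0)) sequentially"
          using ev by eventually_elim (use True in auto)
        from Lim_transform_eventually[OF exp this] show ?thesis
          using 1 True by simp
      qed simp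
    next
      case 2
      then have ev: "eventually (\<lambda>n. t n < s) sequentially"
        using lim by (rule order_tendstoD(2)[rotated])
      then have "eventually (\<lambda>n. (if 0 < s \<and> s < t n then exp (- a * (t n - s)) *\<^sub>R h s else 0) = 0) sequentially"
        by eventually_elim auto
      then show ?thesis using 2 by (simp add: tendsto_eventually)
    qed
  qed
  show "AE s in lborel. norm (if 0 < s \<and> s < t n then exp (- a * (t n - s)) *\<^sub>R h s else 0) \<le> norm (indicator {0<..<T} s *\<^sub>R h s)" for n
  proof (rule AE_I2)
    fix s
    have "exp (- a * (t n - s)) * norm (h s) \<le> 1 * norm (h s)" if "s < t n"
      using a that by (intro mult_right_mono) auto
    then show "norm (if 0 < s \<and> s < t n then exp (- a * (t n - s)) *\<^sub>R h s else 0) \<le> norm (indicator {0<..<T} s *\<^sub>R h s)"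
      using t[of n] by (auto simp: indicator_def)
  qed
qed measurable

locale viscous_torus =
  fixes L \<nu> \<alpha> :: real
  assumes L: "L > 0" and nu: "\<nu> > 0" and alpha: "\<alpha> > 1/2"
begin

definition rate :: "int^3 \<Rightarrow> real" where
  "rate k = \<nu> * (wave L k)\<^sup>2"

definition duh :: "(real \<Rightarrow> field) \<Rightarrow> real \<Rightarrow> field" where
  "duh g t k = expconv (rate k) (\<lambda>s. g s k) t"

lemma rate_nonneg [simp]: "0 \<le> rate k"
  using nu by (simp add: rate_def)

lemma rate_pos: "k \<noteq> 0 \<Longrightarrow> 0 < rate k"
  using nu wave_pos[OF L, of k] by (simp add: rate_def)

text \<open>Bookkeeping of the smoothing: in terms of energies, each factor
  \<open>1 / rate k\<close> lowers the exponent by one at the price of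
  \<open>1 / \<nu>\<close>.\<close>

lemma wave_powr_shift:
  assumes "k \<noteq> 0"
  shows "wave L k powr (2 * s) * (1 / rate k) = 1 / \<nu> * wave L k powr (2 * (s - 1))"
proof -
  have p: "wave L k > 0" by (rule wave_pos[OF L assms])
  have sq: "(wave L k)\<^sup>2 = wave L k powr 2"
    using p by (simp add: powr_numeral)
  have "wave L k powr (2 * s) = wave L k powr (2 * (s - 1)) * (wave L k)\<^sup>2"
    unfolding sq powr_add[symmetric] by simp
  then show ?thesis using p nu by (simp add: rate_def)
qed

text \<open>\<open>expconv_sup\<close> offers one factor \<open>1 / rate k\<close> per mode, which
  takes the exponent from \<alpha> to \<alpha> - 1; Tonelli then moves the sum over modes under the
  time integral.\<close>

lemma duh_sup:
  assumes g: "\<And>k. (\<lambda>s. g s k) \<in> borel_measurable borel"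
  shows "en L \<alpha> (duh g t) \<le> ennreal (1 / \<nu>) * cumul (\<lambda>s. en L (\<alpha> - 1) (g s)) t"
proof -
  note [measurable] = g
  have "ennreal (wave L k powr (2 * \<alpha>) * (norm (duh g t k))\<^sup>2)
     \<le> (\<integral>\<^sup>+s. ennreal (1 / \<nu>) * (ennreal (wave L k powr (2 * (\<alpha> - 1)) * (norm (g s k))\<^sup>2) * indicator {0<..<t} s) \<partial>lborel)" for k
  proof (cases "k = 0")
    case False
    have "ennreal (wave L k powr (2 * \<alpha>) * (norm (duh g t k))\<^sup>2)
      \<le> ennreal (wave L k powr (2 * \<alpha>)) * (ennreal (1 / rate k) * cumul (\<lambda>s. ennreal ((norm (g s k))\<^sup>2)) t)"
      using expconv_sup[OF g rate_pos[OF False], of k t] by (simp add: ennreal_mult duh_def mult_left_mono)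
    also have "\<dots> = ennreal (wave L k powr (2 * \<alpha>) * (1 / rate k)) * cumul (\<lambda>s. ennreal ((norm (g s k))\<^sup>2)) t"
      using rate_pos[OF False] by (simp add: mult.assoc[symmetric] ennreal_mult[symmetric])
    also have "\<dots> = ennreal (1 / \<nu>) * (ennreal (wave L k powr (2 * (\<alpha> - 1))) * cumul (\<lambda>s. ennreal ((norm (g s k))\<^sup>2)) t)"
      unfolding wave_powr_shift[OF False] using nu by (simp only: ennreal_mult[of "1 / \<nu>"] mult.assoc zero_le_divide_1_iff less_imp_le powr_ge_zero)
    also have "\<dots> = (\<integral>\<^sup>+s. ennreal (1 / \<nu>) * (ennreal (wave L k powr (2 * (\<alpha> - 1)) * (norm (g s k))\<^sup>2) * indicator {0<..<t} s) \<partial>lborel)"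
      unfolding cumul_def by (subst nn_integral_cmult[symmetric], measurable, subst nn_integral_cmult[symmetric], measurable)
        (intro nn_integral_cong, simp add: ennreal_mult mult.assoc)
    finally show ?thesis .
  qed simp
  then have "en L \<alpha> (duh g t) \<le> (\<integral>\<^sup>+k. (\<integral>\<^sup>+s. ennreal (1 / \<nu>) * (ennreal (wave L k powr (2 * (\<alpha> - 1)) * (norm (g s k))\<^sup>2) * indicator {0<..<t} s) \<partial>lborel) \<partial>count_space UNIV)"
    unfolding en_def by (intro nn_integral_mono)
  also have "\<dots> = (\<integral>\<^sup>+s. (\<integral>\<^sup>+k. ennreal (1 / \<nu>) * (ennreal (wave L k powr (2 * (\<alpha> - 1)) * (norm (g s k))\<^sup>2) * indicator {0<..<t} s) \<partial>count_space UNIV) \<partial>lborel)"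
    by (rule nn_integral_count_space_nn_integral[symmetric]) auto
  also have "\<dots> = (\<integral>\<^sup>+s. ennreal (1 / \<nu>) * (en L (\<alpha> - 1) (g s) * indicator {0<..<t} s) \<partial>lborel)"
    unfolding en_def by (simp add: nn_integral_cmult nn_integral_multc)
  also have "\<dots> = ennreal (1 / \<nu>) * cumul (\<lambda>s. en L (\<alpha> - 1) (g s)) t"
  proof -
    have [measurable]: "(\<lambda>s. en L (\<alpha> - 1) (g s)) \<in> borel_measurable borel"
      by (rule en_measurable[OF g])
    show ?thesis
      unfolding cumul_def by (rule nn_integral_cmult) measurable
  qed
  finally show ?thesis .
qed

lemma cumul_en:
  assumes g: "\<And>k. (\<lambda>s. g s k) \<in> borel_measurable borel"
  shows "cumul (\<lambda>t. en L s (g t)) T = (\<integral>\<^sup>+k. ennreal (wave L k powr (2 * s)) * cumul (\<lambda>t. ennreal ((norm (g t k))\<^sup>2)) T \<partial>count_space UNIV)"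
proof -
  note [measurable] = g
  have "cumul (\<lambda>t. en L s (g t)) T = (\<integral>\<^sup>+t. (\<integral>\<^sup>+k. ennreal (wave L k powr (2 * s)) * (ennreal ((norm (g t k))\<^sup>2) * indicator {0<..<T} t) \<partial>count_space UNIV) \<partial>lborel)"
    unfolding cumul_def en_def by (simp add: nn_integral_multc[symmetric] ennreal_mult mult.assoc)
  also have "\<dots> = (\<integral>\<^sup>+k. (\<integral>\<^sup>+t. ennreal (wave L k powr (2 * s)) * (ennreal ((norm (g t k))\<^sup>2) * indicator {0<..<T} t) \<partial>lborel) \<partial>count_space UNIV)"
    by (rule nn_integral_count_space_nn_integral) auto
  also have "\<dots> = (\<integral>\<^sup>+k. ennreal (wave L k powr (2 * s)) * cumul (\<lambda>t. ennreal ((norm (g t k))\<^sup>2)) T \<partial>count_space UNIV)"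
    unfolding cumul_def by (intro nn_integral_cong nn_integral_cmult) measurable
  finally show ?thesis .
qed

lemma duh_measurable: "(\<And>k. (\<lambda>s. g s k) \<in> borel_measurable borel) \<Longrightarrow> (\<lambda>t. duh g t k) \<in> borel_measurable borel"
  unfolding duh_def by (rule expconv_measurable)

text \<open>Two factors \<open>1 / rate k\<close> are available from \<open>expconv_L2\<close>, so
  the exponent drops from 1 + \<alpha> to \<alpha> - 1.\<close>

lemma duh_L2:
  assumes g: "\<And>k. (\<lambda>s. g s k) \<in> borel_measurable borel"
  shows "cumul (\<lambda>t. en L (1 + \<alpha>) (duh g t)) T \<le> ennreal (1 / \<nu>\<^sup>2) * cumul (\<lambda>s. en L (\<alpha> - 1) (g s)) T"
proof -
  have "cumul (\<lambda>t. en L (1 + \<alpha>) (duh g t)) T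
    = (\<integral>\<^sup>+k. ennreal (wave L k powr (2 * (1 + \<alpha>))) * cumul (\<lambda>t. ennreal ((norm (duh g t k))\<^sup>2)) T \<partial>count_space UNIV)"
    by (intro cumul_en duh_measurable g)
  also have "\<dots> \<le> (\<integral>\<^sup>+k. ennreal (1 / \<nu>\<^sup>2) * (ennreal (wave L k powr (2 * (\<alpha> - 1))) * cumul (\<lambda>t. ennreal ((norm (g t k))\<^sup>2)) T) \<partial>count_space UNIV)"
  proof (intro nn_integral_mono)
    fix k
    show "ennreal (wave L k powr (2 * (1 + \<alpha>))) * cumul (\<lambda>t. ennreal ((norm (duh g t k))\<^sup>2)) T
      \<le> ennreal (1 / \<nu>\<^sup>2) * (ennreal (wave L k powr (2 * (\<alpha> - 1))) * cumul (\<lambda>t. ennreal ((norm (g t k))\<^sup>2)) T)"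
    proof (cases "k = 0")
      case False
      have eq: "wave L k powr (2 * (1 + \<alpha>)) * (1 / (rate k)\<^sup>2) = 1 / \<nu>\<^sup>2 * wave L k powr (2 * (\<alpha> - 1))"
      proof -
        have "wave L k powr (2 * (1 + \<alpha>)) * (1 / (rate k)\<^sup>2) = (wave L k powr (2 * (1 + \<alpha>)) * (1 / rate k)) * (1 / rate k)"
          by (simp add: power2_eq_square)
        also have "\<dots> = 1 / \<nu> * (wave L k powr (2 * \<alpha>) * (1 / rate k))"
          unfolding wave_powr_shift[OF False, of "1 + \<alpha>"] by simp
        also have "\<dots> = 1 / \<nu> * (1 / \<nu> * wave L k powr (2 * (\<alpha> - 1)))"
          unfolding wave_powr_shift[OF False] ..
        also have "\<dots> = 1 / \<nu>\<^sup>2 * wave L k powr (2 * (\<alpha> - 1))"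
          by (simp add: power2_eq_square)
        finally show ?thesis .
      qed
      have "ennreal (wave L k powr (2 * (1 + \<alpha>))) * cumul (\<lambda>t. ennreal ((norm (duh g t k))\<^sup>2)) T
        \<le> ennreal (wave L k powr (2 * (1 + \<alpha>))) * (ennreal (1 / (rate k)\<^sup>2) * cumul (\<lambda>t. ennreal ((norm (g t k))\<^sup>2)) T)"
        unfolding duh_def by (intro mult_left_mono expconv_L2 g rate_pos False) auto
      also have "\<dots> = ennreal (wave L k powr (2 * (1 + \<alpha>)) * (1 / (rate k)\<^sup>2)) * cumul (\<lambda>t. ennreal ((norm (g t k))\<^sup>2)) T"
        by (simp add: mult.assoc[symmetric] ennreal_mult[symmetric])
      also have "\<dots> = ennreal (1 / \<nu>\<^sup>2) * (ennreal (wave L k powr (2 * (\<alpha> - 1))) * cumul (\<lambda>t. ennreal ((norm (g t k))\<^sup>2)) T)"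
        unfolding eq by (simp add: mult.assoc[symmetric] ennreal_mult[symmetric])
      finally show ?thesis .
    qed simp
  qed
  also have "\<dots> = ennreal (1 / \<nu>\<^sup>2) * cumul (\<lambda>s. en L (\<alpha> - 1) (g s)) T"
    unfolding cumul_en[OF g] by (simp add: nn_integral_cmult)
  finally show ?thesis .
qed

lemma hom_sup: "0 \<le> t \<Longrightarrow> en L s (\<lambda>k. exp (- rate k * t) *\<^sub>R u0 k) \<le> en L s u0"
  by (intro en_mono) (simp add: mult_left_le_one_le)

text \<open>The square of the decaying exponential is below the exponential itself, whose time
  integral is at most \<open>1 / rate k\<close>; this accounts for one derivative more than the
  initial value has.\<close>

lemma hom_L2:
  "cumul (\<lambda>t. en L (1 + \<alpha>) (\<lambda>k. exp (- rate k * t) *\<^sub>R u0 k)) T \<le> ennreal (1 / \<nu>) * en L \<alpha> u0"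
proof -
  have [measurable]: "(\<lambda>t. exp (- rate k * t) *\<^sub>R u0 k) \<in> borel_measurable borel" for k
    by measurable
  have "cumul (\<lambda>t. en L (1 + \<alpha>) (\<lambda>k. exp (- rate k * t) *\<^sub>R u0 k)) T
    = (\<integral>\<^sup>+k. ennreal (wave L k powr (2 * (1 + \<alpha>))) * cumul (\<lambda>t. ennreal ((norm (exp (- rate k * t) *\<^sub>R u0 k))\<^sup>2)) T \<partial>count_space UNIV)"
    by (rule cumul_en) measurable
  also have "\<dots> \<le> (\<integral>\<^sup>+k. ennreal (1 / \<nu>) * ennreal (wave L k powr (2 * \<alpha>) * (norm (u0 k))\<^sup>2) \<partial>count_space UNIV)"
  proof (intro nn_integral_mono)
    fix k
    show "ennreal (wave L k powr (2 * (1 + \<alpha>))) * cumul (\<lambda>t. ennreal ((norm (exp (- rate k * t) *\<^sub>R u0 k))\<^sup>2)) T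
      \<le> ennreal (1 / \<nu>) * ennreal (wave L k powr (2 * \<alpha>) * (norm (u0 k))\<^sup>2)"
    proof (cases "k = 0")
      case False
      have "cumul (\<lambda>t. ennreal ((norm (exp (- rate k * t) *\<^sub>R u0 k))\<^sup>2)) T
        \<le> (\<integral>\<^sup>+t. (if 0 < t \<and> t < T then ennreal (exp (- rate k * (t - 0))) else 0) * ennreal ((norm (u0 k))\<^sup>2) \<partial>lborel)"
        unfolding cumul_def
      proof (intro nn_integral_mono)
        fix t
        have "(exp (- rate k * t))\<^sup>2 \<le> exp (- rate k * t)" if "0 < t"
          using that by (simp add: power2_eq_square mult_left_le_one_le)
        then have "(norm (exp (- rate k * t) *\<^sub>R u0 k))\<^sup>2 \<le> exp (- rate k * t) * (norm (u0 k))\<^sup>2" if "0 < t"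
          using that by (simp add: power_mult_distrib mult_right_mono)
        then show "ennreal ((norm (exp (- rate k * t) *\<^sub>R u0 k))\<^sup>2) * indicator {0<..<T} t
          \<le> (if 0 < t \<and> t < T then ennreal (exp (- rate k * (t - 0))) else 0) * ennreal ((norm (u0 k))\<^sup>2)"
          by (auto simp: indicator_def ennreal_mult[symmetric] intro!: ennreal_leI)
      qed
      also have "\<dots> = (\<integral>\<^sup>+t. (if 0 < t \<and> t < T then ennreal (exp (- rate k * (t - 0))) else 0) \<partial>lborel) * ennreal ((norm (u0 k))\<^sup>2)"
        by (rule nn_integral_multc) measurable
      also have "\<dots> \<le> ennreal (1 / rate k) * ennreal ((norm (u0 k))\<^sup>2)"
        by (intro mult_right_mono exp_kernel_right rate_pos False) auto
      finally have "ennreal (wave L k powr (2 * (1 + \<alpha>))) * cumul (\<lambda>t. ennreal ((norm (exp (- rate k * t) *\<^sub>R u0 k))\<^sup>2)) T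
        \<le> ennreal (wave L k powr (2 * (1 + \<alpha>))) * (ennreal (1 / rate k) * ennreal ((norm (u0 k))\<^sup>2))"
        by (intro mult_left_mono) auto
      also have "\<dots> = ennreal ((wave L k powr (2 * (1 + \<alpha>)) * (1 / rate k)) * (norm (u0 k))\<^sup>2)"
        by (simp add: mult.assoc[symmetric] ennreal_mult[symmetric])
      also have "\<dots> = ennreal (1 / \<nu>) * ennreal (wave L k powr (2 * \<alpha>) * (norm (u0 k))\<^sup>2)"
        unfolding wave_powr_shift[OF False] using nu by (simp add: mult.assoc[symmetric] ennreal_mult[symmetric])
      finally show ?thesis .
    qed simp
  qed
  also have "\<dots> = ennreal (1 / \<nu>) * en L \<alpha> u0"
    by (simp add: nn_integral_cmult en_def)
  finally show ?thesis .
qed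

end

lemma traj_zero: "traj L u \<Longrightarrow> u t 0 = 0"
  by (simp add: traj_def solenoidal_iff)

lemma traj_measurable: "traj L u \<Longrightarrow> (\<lambda>t. u t k) \<in> borel_measurable borel"
  by (simp add: traj_def)

lemma solenoidal_diff:
  assumes "u \<in> solenoidal L" "v \<in> solenoidal L"
  shows "(\<lambda>k. u k - v k) \<in> solenoidal L"
  using assms by (auto simp: solenoidal_iff zdot_diff linear_diff[OF bounded_linear.linear[OF bounded_linear_vcnj]])

lemma traj_diff: "traj L u \<Longrightarrow> traj L v \<Longrightarrow> traj L (\<lambda>t k. u t k - v t k)"
  unfolding traj_def by (auto intro: solenoidal_diff borel_measurable_diff)

lemma traj_NB: "L > 0 \<Longrightarrow> traj L u \<Longrightarrow> traj L v \<Longrightarrow> traj L (\<lambda>t. NB L (u t) (v t))"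
  unfolding traj_def by (auto intro: NB_solenoidal NB_measurable)

lemma traj_const: "f \<in> solenoidal L \<Longrightarrow> traj L (\<lambda>_. f)"
  by (simp add: traj_def)

lemma expconv_diff:
  assumes "integrable lborel (\<lambda>s. indicator {0<..<T} s *\<^sub>R h s)" "integrable lborel (\<lambda>s. indicator {0<..<T} s *\<^sub>R h' s)"
    "h \<in> borel_measurable borel" "h' \<in> borel_measurable borel" "a \<ge> 0" "t \<le> T"
  shows "expconv a (\<lambda>s. h s - h' s) t = expconv a h t - expconv a h' t"
proof -
  have "expconv a (\<lambda>s. h s - h' s) t = (LINT s|lborel. (if 0 < s \<and> s < t then exp (- a * (t - s)) *\<^sub>R h s else 0) - (if 0 < s \<and> s < t then exp (- a * (t - s)) *\<^sub>R h' s else 0))"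
    unfolding expconv_def by (intro Bochner_Integration.integral_cong) (auto simp: scaleR_diff_right)
  also have "\<dots> = expconv a h t - expconv a h' t"
    unfolding expconv_def by (intro Bochner_Integration.integral_diff expconv_integrable[where T = T] assms)
  finally show ?thesis .
qed

lemma expconv_add:
  assumes "integrable lborel (\<lambda>s. indicator {0<..<T} s *\<^sub>R h s)" "integrable lborel (\<lambda>s. indicator {0<..<T} s *\<^sub>R h' s)"
    "h \<in> borel_measurable borel" "h' \<in> borel_measurable borel" "a \<ge> 0" "t \<le> T"
  shows "expconv a (\<lambda>s. h s + h' s) t = expconv a h t + expconv a h' t"
proof -
  have "expconv a (\<lambda>s. h s + h' s) t = (LINT s|lborel. (if 0 < s \<and> s < t then exp (- a * (t - s)) *\<^sub>R h s else 0) + (if 0 < s \<and> s < t then exp (- a * (t - s)) *\<^sub>R h' s else 0))"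
    unfolding expconv_def by (intro Bochner_Integration.integral_cong) (auto simp: scaleR_add_right)
  also have "\<dots> = expconv a h t + expconv a h' t"
    unfolding expconv_def by (intro Bochner_Integration.integral_add expconv_integrable[where T = T] assms)
  finally show ?thesis .
qed

lemma expconv_cong_AE:
  assumes [measurable]: "h \<in> borel_measurable borel" "h' \<in> borel_measurable borel"
    and "AE s in lborel. 0 < s \<and> s < t \<longrightarrow> h s = h' s"
  shows "expconv a h t = expconv a h' t"
  unfolding expconv_def
proof (rule integral_cong_AE)
  show "AE s in lborel. (if 0 < s \<and> s < t then exp (- a * (t - s)) *\<^sub>R h s else 0) = (if 0 < s \<and> s < t then exp (- a * (t - s)) *\<^sub>R h' s else 0)"
    using assms(3) by eventually_elim auto
qed measurable

lemma expconv_minus: "expconv a (\<lambda>s. - h s) t = - expconv a h t"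
proof -
  have "expconv a (\<lambda>s. - h s) t = (LINT s|lborel. - (if 0 < s \<and> s < t then exp (- a * (t - s)) *\<^sub>R h s else 0))"
    unfolding expconv_def by (intro Bochner_Integration.integral_cong) auto
  then show ?thesis by (simp add: expconv_def)
qed

lemma cumul_const: "cumul (\<lambda>_. c) T \<le> ennreal T * c"
proof (cases "T \<ge> 0")
  case True
  then show ?thesis by (simp add: cumul_def nn_integral_cmult mult.commute)
next
  case False
  then have "{0<..<T} = {}" by auto
  then show ?thesis by (simp add: cumul_def)
qed

section \<open>Energy of the nonlinear term along trajectories, mild solutions and their
  stability\<close>

context viscous_torus
begin

definition CB :: real where
  "CB = (SOME C. C \<ge> 0 \<and> (\<forall>u v. u 0 = 0 \<longrightarrow> v 0 = 0 \<longrightarrow> en L (\<alpha> - 1) (NB L u v) \<le> ennreal C * (en L (1 + \<alpha>) u * en L \<alpha> v)))"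

lemma CB: "CB \<ge> 0" "u 0 = 0 \<Longrightarrow> v 0 = 0 \<Longrightarrow> en L (\<alpha> - 1) (NB L u v) \<le> ennreal CB * (en L (1 + \<alpha>) u * en L \<alpha> v)"
proof -
  have "\<exists>C. C \<ge> 0 \<and> (\<forall>u v. u 0 = 0 \<longrightarrow> v 0 = 0 \<longrightarrow> en L (\<alpha> - 1) (NB L u v) \<le> ennreal C * (en L (1 + \<alpha>) u * en L \<alpha> v))"
    using en_NB_le[OF L alpha] by blast
  from someI_ex[OF this] show "CB \<ge> 0" "u 0 = 0 \<Longrightarrow> v 0 = 0 \<Longrightarrow> en L (\<alpha> - 1) (NB L u v) \<le> ennreal CB * (en L (1 + \<alpha>) u * en L \<alpha> v)"
    unfolding CB_def by blast+
qed

lemma cumul_NB: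
  assumes w: "traj L w" and u: "traj L u"
  shows "cumul (\<lambda>s. en L (\<alpha> - 1) (NB L (w s) (u s))) t \<le> ennreal CB * cumul (\<lambda>s. en L (1 + \<alpha>) (w s) * en L \<alpha> (u s)) t"
proof -
  have "cumul (\<lambda>s. en L (\<alpha> - 1) (NB L (w s) (u s))) t \<le> cumul (\<lambda>s. ennreal CB * (en L (1 + \<alpha>) (w s) * en L \<alpha> (u s))) t"
    by (intro cumul_mono_fun CB traj_zero[OF w] traj_zero[OF u])
  also have "\<dots> = ennreal CB * cumul (\<lambda>s. en L (1 + \<alpha>) (w s) * en L \<alpha> (u s)) t"
    using traj_en_measurable[OF w] traj_en_measurable[OF u] by (intro cumul_cmult borel_measurable_times_ennreal)
  finally show ?thesis .
qed

lemma cumul_times_le: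
  assumes w: "traj L w" and M: "\<And>s. 0 < s \<Longrightarrow> s < t \<Longrightarrow> X s \<le> M"
  shows "cumul (\<lambda>s. en L (1 + \<alpha>) (w s) * X s) t \<le> M * cumul (\<lambda>s. en L (1 + \<alpha>) (w s)) t"
proof -
  have "cumul (\<lambda>s. en L (1 + \<alpha>) (w s) * X s) t \<le> cumul (\<lambda>s. M * en L (1 + \<alpha>) (w s)) t"
    by (intro cumul_mono_fun) (auto simp: mult.commute[of M] intro!: mult_left_mono M)
  then show ?thesis
    using traj_en_measurable[OF w] by (simp add: cumul_cmult)
qed

definition bdd :: "(real \<Rightarrow> field) \<Rightarrow> real \<Rightarrow> bool" where
  "bdd u T \<longleftrightarrow> (\<exists>M\<ge>0. \<forall>t. 0 \<le> t \<longrightarrow> t \<le> T \<longrightarrow> en L \<alpha> (u t) \<le> ennreal M)"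

lemma bdd_finite:
  assumes "bdd u T" "0 \<le> t" "t \<le> T"
  shows "en L \<alpha> (u t) < \<infinity>"
proof -
  obtain M where "en L \<alpha> (u t) \<le> ennreal M"
    using assms unfolding bdd_def by blast
  then show ?thesis
    by (rule le_less_trans) simp
qed

lemma cumul_NB_finite:
  assumes w: "traj L w" and u: "traj L u" and W: "cumul (\<lambda>s. en L (1 + \<alpha>) (w s)) T < \<infinity>" and b: "bdd u T"
  shows "cumul (\<lambda>s. en L (\<alpha> - 1) (NB L (w s) (u s))) T < \<infinity>"
proof -
  obtain M where M: "\<And>t. 0 \<le> t \<Longrightarrow> t \<le> T \<Longrightarrow> en L \<alpha> (u t) \<le> ennreal M"
    using b by (auto simp: bdd_def)
  have "cumul (\<lambda>s. en L (\<alpha> - 1) (NB L (w s) (u s))) T \<le> ennreal CB * cumul (\<lambda>s. en L (1 + \<alpha>) (w s) * en L \<alpha> (u s)) T"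
    by (rule cumul_NB[OF w u])
  also have "\<dots> \<le> ennreal CB * (ennreal M * cumul (\<lambda>s. en L (1 + \<alpha>) (w s)) T)"
    by (intro mult_left_mono cumul_times_le w M) auto
  also have "\<dots> < \<infinity>"
    using W by (simp add: ennreal_mult_less_top)
  finally show ?thesis .
qed

lemma cumul_en_add_le:
  assumes "traj L u" "traj L v" "\<And>t k. norm (x t k) \<le> norm (u t k) + norm (v t k)"
  shows "cumul (\<lambda>t. en L s (x t)) T \<le> 2 * cumul (\<lambda>t. en L s (u t)) T + 2 * cumul (\<lambda>t. en L s (v t)) T"
proof -
  note [measurable] = traj_en_measurable[OF assms(1)] traj_en_measurable[OF assms(2)]
  have "cumul (\<lambda>t. en L s (x t)) T \<le> cumul (\<lambda>t. 2 * en L s (u t) + 2 * en L s (v t)) T"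
    by (intro cumul_mono_fun en_add_le assms)
  also have "\<dots> = 2 * cumul (\<lambda>t. en L s (u t)) T + 2 * cumul (\<lambda>t. en L s (v t)) T"
    by (subst cumul_add, measurable, subst cumul_cmult, measurable, subst cumul_cmult, measurable)
  finally show ?thesis .
qed

lemma cumul_force_finite:
  assumes "traj L w" "traj L u" "cumul (\<lambda>s. en L (1 + \<alpha>) (w s)) T < \<infinity>" "bdd u T"
    and f: "f \<in> Vsp L (\<alpha> - 1)"
  shows "cumul (\<lambda>s. en L (\<alpha> - 1) (\<lambda>k. f k - NB L (w s) (u s) k)) T < \<infinity>"
proof -
  have ft: "traj L (\<lambda>_. f)" and fe: "en L (\<alpha> - 1) f < \<infinity>"
    using f by (auto simp: Vsp_iff intro: traj_const)
  have "cumul (\<lambda>s. en L (\<alpha> - 1) (\<lambda>k. f k - NB L (w s) (u s) k)) T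
    \<le> 2 * cumul (\<lambda>s. en L (\<alpha> - 1) f) T + 2 * cumul (\<lambda>s. en L (\<alpha> - 1) (NB L (w s) (u s))) T"
    by (intro cumul_en_add_le[OF ft traj_NB[OF L assms(1,2)]] norm_triangle_ineq4)
  also have "\<dots> \<le> 2 * (ennreal T * en L (\<alpha> - 1) f) + 2 * cumul (\<lambda>s. en L (\<alpha> - 1) (NB L (w s) (u s))) T"
    by (intro add_right_mono mult_left_mono cumul_const) auto
  also have "\<dots> < \<infinity>"
    using fe cumul_NB_finite[OF assms(1-4)] by (simp add: ennreal_mult_less_top)
  finally show ?thesis .
qed

text \<open>The bound \<open>x \<le> 1 + x\<^sup>2\<close> turns the square integrability contained
  in the energy into integrability on a bounded interval. The weight of a nonzero mode is positive
  and can be divided out.\<close>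

lemma mode_integrable:
  assumes g: "traj L g" and fin: "cumul (\<lambda>s. en L r (g s)) T < \<infinity>"
  shows "integrable lborel (\<lambda>s. indicator {0<..<T} s *\<^sub>R g s k)"
proof (cases "k = 0")
  case True
  then show ?thesis by (simp add: traj_zero[OF g])
next
  case False
  note [measurable] = traj_measurable[OF g]
  define c where "c = wave L k powr (2 * r)"
  have c: "c > 0" using wave_pos[OF L False] by (simp add: c_def)
  have "ennreal (norm (indicator {0<..<T} s *\<^sub>R g s k)) \<le> indicator {0<..<T} s + ennreal (1 / c) * (en L r (g s) * indicator {0<..<T} s)" for s
  proof (cases "s \<in> {0<..<T}")
    case True
    have "norm (g s k) \<le> 1 + (norm (g s k))\<^sup>2"
      using zero_le_power2[of "norm (g s k) - 1"] by (simp add: power2_diff) (smt (verit) norm_ge_zero)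
    then have "norm (g s k) \<le> 1 + 1 / c * (c * (norm (g s k))\<^sup>2)"
      using c by simp
    then have "ennreal (norm (g s k)) \<le> ennreal (1 + 1 / c * (c * (norm (g s k))\<^sup>2))"
      by (rule ennreal_leI)
    also have "\<dots> = 1 + ennreal (1 / c) * ennreal (c * (norm (g s k))\<^sup>2)"
      using c by (simp only: ennreal_plus ennreal_mult ennreal_1 zero_le_one mult_nonneg_nonneg zero_le_divide_1_iff less_imp_le zero_le_power2)
    also have "\<dots> \<le> 1 + ennreal (1 / c) * en L r (g s)"
      unfolding c_def by (intro add_left_mono mult_left_mono en_mode_le) auto
    finally show ?thesis using True by simp
  qed simp
  then have "(\<integral>\<^sup>+s. ennreal (norm (indicator {0<..<T} s *\<^sub>R g s k)) \<partial>lborel)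
    \<le> (\<integral>\<^sup>+s. indicator {0<..<T} s + ennreal (1 / c) * (en L r (g s) * indicator {0<..<T} s) \<partial>lborel)"
    by (intro nn_integral_mono)
  also have "\<dots> = emeasure lborel {0<..<T} + ennreal (1 / c) * cumul (\<lambda>s. en L r (g s)) T"
    unfolding cumul_def using traj_en_measurable[OF g, of r] by (simp add: nn_integral_add nn_integral_cmult)
  also have "\<dots> < \<infinity>"
    using fin by (cases "0 \<le> T") (auto simp: ennreal_mult_less_top)
  finally show ?thesis
    by (simp add: integrable_iff_bounded)
qed

text \<open>Duhamel's formula with a prescribed drift w, hence linear in u up to the force. The
  initial value is read off from u itself, so that two solutions are compared through
  \<open>u 0\<close> and \<open>v 0\<close>.\<close>

definition mild :: "field \<Rightarrow> (real \<Rightarrow> field) \<Rightarrow> real \<Rightarrow> (real \<Rightarrow> field) \<Rightarrow> bool" where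
  "mild f w T u \<longleftrightarrow> (\<forall>t k. 0 \<le> t \<longrightarrow> t \<le> T \<longrightarrow>
     u t k = exp (- rate k * t) *\<^sub>R u 0 k + duh (\<lambda>s k. f k - NB L (w s) (u s) k) t k)"

lemma AE_finite:
  assumes "traj L w" "cumul (\<lambda>s. en L r (w s)) T < \<infinity>"
  shows "AE s in lborel. 0 < s \<and> s < T \<longrightarrow> en L r (w s) < \<infinity>"
proof -
  have "AE s in lborel. en L r (w s) * indicator {0<..<T} s \<noteq> \<infinity>"
    using assms traj_en_measurable[OF assms(1), of r]
    by (intro nn_integral_PInf_AE) (auto simp: cumul_def)
  then show ?thesis by eventually_elim (auto simp: less_top)
qed

text \<open>Bilinear splitting of the difference into \<open>w\<close> acting on
  \<open>u - v\<close>, the term for Gronwall, and \<open>w - w'\<close> acting on v, a source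
  controlled by the drifts and a bound for v. It holds only at times of finite drift energy, hence
  the comparison almost everywhere.\<close>

lemma duh_force_difference:
  assumes w: "traj L w" "traj L w'" and u: "traj L u" "traj L v" and f: "f \<in> Vsp L (\<alpha> - 1)"
    and W: "cumul (\<lambda>s. en L (1 + \<alpha>) (w s)) T < \<infinity>" "cumul (\<lambda>s. en L (1 + \<alpha>) (w' s)) T < \<infinity>"
    and b: "bdd u T" "bdd v T" and t: "t \<le> T"
  shows "duh (\<lambda>s k. f k - NB L (w s) (u s) k) t k - duh (\<lambda>s k. f k - NB L (w' s) (v s) k) t k
    = - (duh (\<lambda>s. NB L (w s) (\<lambda>k. u s k - v s k)) t k + duh (\<lambda>s. NB L (\<lambda>k. w s k - w' s k) (v s)) t k)"
proof -
  let ?F = "\<lambda>s k. f k - NB L (w s) (u s) k" and ?F' = "\<lambda>s k. f k - NB L (w' s) (v s) k"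
  let ?G = "\<lambda>s. NB L (w s) (\<lambda>k. u s k - v s k)" and ?G' = "\<lambda>s. NB L (\<lambda>k. w s k - w' s k) (v s)"
  have ft: "traj L (\<lambda>_. f)" using f by (auto simp: Vsp_iff intro: traj_const)
  have d: "traj L (\<lambda>s k. u s k - v s k)" "traj L (\<lambda>s k. w s k - w' s k)"
    by (intro traj_diff u w)+
  have tr: "traj L ?F" "traj L ?F'" "traj L ?G" "traj L ?G'"
    by (intro traj_diff traj_NB L ft u w d)+
  have bd: "bdd (\<lambda>s k. u s k - v s k) T"
  proof -
    obtain M1 M2 where "M1 \<ge> 0" "M2 \<ge> 0" "\<And>t. 0 \<le> t \<Longrightarrow> t \<le> T \<Longrightarrow> en L \<alpha> (u t) \<le> ennreal M1"
      "\<And>t. 0 \<le> t \<Longrightarrow> t \<le> T \<Longrightarrow> en L \<alpha> (v t) \<le> ennreal M2"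
      using b by (auto simp: bdd_def)
    then have "en L \<alpha> (\<lambda>k. u t k - v t k) \<le> ennreal (2 * M1 + 2 * M2)" if "0 \<le> t" "t \<le> T" for t
      using that order_trans[OF en_add_le[of "\<lambda>k. u t k - v t k" "u t" "v t" L \<alpha>, OF norm_triangle_ineq4] add_mono[OF mult_left_mono mult_left_mono], of "ennreal M1" "ennreal M2"]
      by (simp add: ennreal_plus ennreal_mult)
    then show ?thesis
      using \<open>M1 \<ge> 0\<close> \<open>M2 \<ge> 0\<close> unfolding bdd_def by (intro exI[of _ "2 * M1 + 2 * M2"]) auto
  qed
  have Wd: "cumul (\<lambda>s. en L (1 + \<alpha>) (\<lambda>k. w s k - w' s k)) T < \<infinity>"
    using cumul_en_add_le[OF w, of "\<lambda>s k. w s k - w' s k" "1 + \<alpha>" T] W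
    by (auto simp: norm_triangle_ineq4 ennreal_mult_less_top elim!: le_less_trans)
  have int: "integrable lborel (\<lambda>s. indicator {0<..<T} s *\<^sub>R ?F s k)" "integrable lborel (\<lambda>s. indicator {0<..<T} s *\<^sub>R ?F' s k)"
    "integrable lborel (\<lambda>s. indicator {0<..<T} s *\<^sub>R ?G s k)" "integrable lborel (\<lambda>s. indicator {0<..<T} s *\<^sub>R ?G' s k)"
    by (rule mode_integrable[OF tr(1) cumul_force_finite[OF w(1) u(1) W(1) b(1) f]]
        mode_integrable[OF tr(2) cumul_force_finite[OF w(2) u(2) W(2) b(2) f]]
        mode_integrable[OF tr(3) cumul_NB_finite[OF w(1) d(1) W(1) bd]]
        mode_integrable[OF tr(4) cumul_NB_finite[OF d(2) u(2) Wd b(2)]])+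
  have ms: "(\<lambda>s. ?F s k) \<in> borel_measurable borel" "(\<lambda>s. ?F' s k) \<in> borel_measurable borel"
    "(\<lambda>s. ?G s k) \<in> borel_measurable borel" "(\<lambda>s. ?G' s k) \<in> borel_measurable borel"
    using tr[THEN traj_measurable, of k] by blast+
  have "expconv (rate k) (\<lambda>s. ?F s k) t - expconv (rate k) (\<lambda>s. ?F' s k) t = expconv (rate k) (\<lambda>s. ?F s k - ?F' s k) t"
    by (rule expconv_diff[symmetric, where T = T]) (use int ms t in auto)
  also have "\<dots> = expconv (rate k) (\<lambda>s. - (?G s k + ?G' s k)) t"
  proof (rule expconv_cong_AE)
    show "AE s in lborel. 0 < s \<and> s < t \<longrightarrow> ?F s k - ?F' s k = - (?G s k + ?G' s k)"
      using AE_finite[OF w(1) W(1)] AE_finite[OF w(2) W(2)]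
    proof eventually_elim
      case (elim s)
      show ?case
      proof
        assume s: "0 < s \<and> s < t"
        then have fin: "en L (1 + \<alpha>) (w s) < \<infinity>" "en L (1 + \<alpha>) (w' s) < \<infinity>" "en L \<alpha> (u s) < \<infinity>" "en L \<alpha> (v s) < \<infinity>"
          using elim t bdd_finite[OF b(1), of s] bdd_finite[OF b(2), of s] by simp_all
        have "?G s k = NB L (w s) (u s) k - NB L (w s) (v s) k"
          by (intro NB_diff_right[OF L alpha] fin traj_zero[OF w(1)] traj_zero[OF w(2)] traj_zero[OF u(1)] traj_zero[OF u(2)])
        moreover have "?G' s k = NB L (w s) (v s) k - NB L (w' s) (v s) k"
          by (intro NB_diff_left[OF L alpha] fin traj_zero[OF w(1)] traj_zero[OF w(2)] traj_zero[OF u(1)] traj_zero[OF u(2)])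
        ultimately show "?F s k - ?F' s k = - (?G s k + ?G' s k)"
          by simp
      qed
    qed
  qed (use ms in measurable)
  also have "\<dots> = - (expconv (rate k) (\<lambda>s. ?G s k) t + expconv (rate k) (\<lambda>s. ?G' s k) t)"
    unfolding expconv_minus
    by (intro arg_cong[where f = uminus] expconv_add[where T = T]) (use int ms t in auto)
  finally show ?thesis
    by (simp add: duh_def)
qed

lemma mild_difference:
  assumes w: "traj L w" "traj L w'" and u: "traj L u" "traj L v" and f: "f \<in> Vsp L (\<alpha> - 1)"
    and W: "cumul (\<lambda>s. en L (1 + \<alpha>) (w s)) T < \<infinity>" "cumul (\<lambda>s. en L (1 + \<alpha>) (w' s)) T < \<infinity>"
    and b: "bdd u T" "bdd v T" and m: "mild f w T u" "mild f w' T v" and t: "0 \<le> t" "t \<le> T"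
  shows "u t k - v t k = exp (- rate k * t) *\<^sub>R (u 0 k - v 0 k)
    - (duh (\<lambda>s. NB L (w s) (\<lambda>k. u s k - v s k)) t k + duh (\<lambda>s. NB L (\<lambda>k. w s k - w' s k) (v s)) t k)"
proof -
  let ?F = "\<lambda>s k. f k - NB L (w s) (u s) k" and ?F' = "\<lambda>s k. f k - NB L (w' s) (v s) k"
  have "u t k = exp (- rate k * t) *\<^sub>R u 0 k + duh ?F t k" "v t k = exp (- rate k * t) *\<^sub>R v 0 k + duh ?F' t k"
    using m t unfolding mild_def by blast+
  then have "u t k - v t k = exp (- rate k * t) *\<^sub>R (u 0 k - v 0 k) + (duh ?F t k - duh ?F' t k)"
    by (simp only: scaleR_diff_right) simp
  then show ?thesis unfolding duh_force_difference[OF w u f W b t(2)] by simp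
qed

text \<open>The order of quantifiers is the point: K is fixed by the bound X for the first drift and
  the bound Mv for v, before the solutions are chosen, and the size of u does not influence it. This
  uniformity is what later allows a whole neighbourhood of v to be treated with one
  constant.\<close>

lemma stability:
  assumes X: "X \<ge> 0" and Mv: "Mv \<ge> 0"
  shows "\<exists>K\<ge>0. \<forall>f w w' u v. traj L w \<longrightarrow> traj L w' \<longrightarrow> traj L u \<longrightarrow> traj L v \<longrightarrow> f \<in> Vsp L (\<alpha> - 1) \<longrightarrow>
    cumul (\<lambda>s. en L (1 + \<alpha>) (w s)) T \<le> ennreal X \<longrightarrow> cumul (\<lambda>s. en L (1 + \<alpha>) (w' s)) T < \<infinity> \<longrightarrow> bdd u T \<longrightarrow>
    (\<forall>t. 0 \<le> t \<longrightarrow> t \<le> T \<longrightarrow> en L \<alpha> (v t) \<le> ennreal Mv) \<longrightarrow> mild f w T u \<longrightarrow> mild f w' T v \<longrightarrow>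
    (\<forall>t. 0 \<le> t \<longrightarrow> t \<le> T \<longrightarrow> en L \<alpha> (\<lambda>k. u t k - v t k) \<le> ennreal K * (en L \<alpha> (\<lambda>k. u 0 k - v 0 k) + cumul (\<lambda>s. en L (1 + \<alpha>) (\<lambda>k. w s k - w' s k)) T)) \<and>
    cumul (\<lambda>t. en L (1 + \<alpha>) (\<lambda>k. u t k - v t k)) T \<le> ennreal K * (en L \<alpha> (\<lambda>k. u 0 k - v 0 k) + cumul (\<lambda>s. en L (1 + \<alpha>) (\<lambda>k. w s k - w' s k)) T)"
proof -
  \<comment> \<open>The 4 comes from two applications of \<open>en_add_le\<close> to the three terms
    of \<open>mild_difference\<close>, CB from the nonlinear estimate, and \<nu> or its square from
    \<open>duh_sup\<close> or \<open>duh_L2\<close>.\<close>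
  define c where "c = 4 * CB / \<nu>"
  define c' where "c' = 4 * CB / \<nu>\<^sup>2"
  have c: "c \<ge> 0" "c' \<ge> 0" using CB(1) nu by (auto simp: c_def c'_def)
  \<comment> \<open>\<open>2 + c * Mv\<close> collects the initial difference and the drift source,
    the rest is the Gronwall factor. K adds the three contributions to the square-integrable bound:
    initial value, Gronwall term and source.\<close>
  define K1 where "K1 = (2 + c * Mv) * (2 * exp (2 * c * X))"
  define K where "K = K1 + (2 / \<nu> + c' * (K1 * X) + c' * Mv)"
  have K1: "K1 \<ge> 0" using c Mv by (simp add: K1_def)
  have K: "K \<ge> 0" "K1 \<le> K" using K1 c Mv X nu by (auto simp: K_def)
  have main: "(\<forall>t. 0 \<le> t \<longrightarrow> t \<le> T \<longrightarrow> en L \<alpha> (\<lambda>k. u t k - v t k) \<le> ennreal K * E) \<and>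
      cumul (\<lambda>t. en L (1 + \<alpha>) (\<lambda>k. u t k - v t k)) T \<le> ennreal K * E"
    if w: "traj L w" "traj L w'" and u: "traj L u" "traj L v" and f: "f \<in> Vsp L (\<alpha> - 1)"
      and W: "cumul (\<lambda>s. en L (1 + \<alpha>) (w s)) T \<le> ennreal X" "cumul (\<lambda>s. en L (1 + \<alpha>) (w' s)) T < \<infinity>"
      and bu: "bdd u T" and v: "\<And>t. 0 \<le> t \<Longrightarrow> t \<le> T \<Longrightarrow> en L \<alpha> (v t) \<le> ennreal Mv"
      and m: "mild f w T u" "mild f w' T v"
      and E: "E = en L \<alpha> (\<lambda>k. u 0 k - v 0 k) + cumul (\<lambda>s. en L (1 + \<alpha>) (\<lambda>k. w s k - w' s k)) T" for f w w' u v E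
  proof -
    let ?d = "\<lambda>t k. u t k - v t k" and ?dw = "\<lambda>s k. w s k - w' s k"
    let ?G = "\<lambda>s. NB L (w s) (?d s)" and ?G' = "\<lambda>s. NB L (?dw s) (v s)"
    let ?h = "\<lambda>t k. exp (- rate k * t) *\<^sub>R ?d 0 k"
    have d: "traj L ?d" "traj L ?dw" by (intro traj_diff u w)+
    have tG: "traj L ?G" "traj L ?G'" by (intro traj_NB L w u d)+
    have Wf: "cumul (\<lambda>s. en L (1 + \<alpha>) (w s)) T < \<infinity>"
      using W(1) by (auto elim!: le_less_trans)
    have bv: "bdd v T" using v Mv by (auto simp: bdd_def)
    have rep: "?d t k = ?h t k - (duh ?G t k + duh ?G' t k)" if "0 \<le> t" "t \<le> T" for t k
      by (rule mild_difference[OF w u f Wf W(2) bu bv m that])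
    have le: "en L s (?d t) \<le> 2 * en L s (?h t) + 2 * (2 * en L s (duh ?G t) + 2 * en L s (duh ?G' t))" if "0 \<le> t" "t \<le> T" for s t
    proof -
      have "en L s (?d t) \<le> 2 * en L s (?h t) + 2 * en L s (\<lambda>k. duh ?G t k + duh ?G' t k)"
        unfolding rep[OF that] by (intro en_add_le norm_triangle_ineq4)
      also have "\<dots> \<le> 2 * en L s (?h t) + 2 * (2 * en L s (duh ?G t) + 2 * en L s (duh ?G' t))"
        by (intro add_left_mono mult_left_mono en_add_le norm_triangle_ineq) auto
      finally show ?thesis .
    qed
    have mono_E: "en L \<alpha> (?d 0) \<le> E" "cumul (\<lambda>s. en L (1 + \<alpha>) (?dw s)) T \<le> E"
      by (simp_all add: E)
    have B': "cumul (\<lambda>s. en L (1 + \<alpha>) (?dw s) * en L \<alpha> (v s)) t \<le> ennreal Mv * E" if "t \<le> T" for t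
    proof -
      have "cumul (\<lambda>s. en L (1 + \<alpha>) (?dw s) * en L \<alpha> (v s)) t \<le> ennreal Mv * cumul (\<lambda>s. en L (1 + \<alpha>) (?dw s)) t"
        using that by (intro cumul_times_le d v) auto
      also have "\<dots> \<le> ennreal Mv * E"
        by (intro mult_left_mono order_trans[OF cumul_mono[OF that] mono_E(2)]) auto
      finally show ?thesis .
    qed
    have c4: "4 * (ennreal (1 / \<nu>) * (ennreal CB * x)) = ennreal c * x" "4 * (ennreal (1 / \<nu>\<^sup>2) * (ennreal CB * x)) = ennreal c' * x" for x
      using CB(1) nu unfolding c_def c'_def
      by (simp_all add: mult.assoc[symmetric] ennreal_mult[symmetric] flip: ennreal_numeral)
    have sup: "en L \<alpha> (?d t) \<le> ennreal (2 + c * Mv) * E + ennreal c * cumul (\<lambda>s. en L (1 + \<alpha>) (w s) * en L \<alpha> (?d s)) t"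
      if t: "0 \<le> t" "t \<le> T" for t
    proof -
      have "en L \<alpha> (?d t) \<le> 2 * en L \<alpha> (?h t) + (4 * en L \<alpha> (duh ?G t) + 4 * en L \<alpha> (duh ?G' t))"
        using le[OF t, of \<alpha>] by (simp add: distrib_left mult.assoc[symmetric])
      also have "\<dots> \<le> 2 * E + (4 * (ennreal (1 / \<nu>) * (ennreal CB * cumul (\<lambda>s. en L (1 + \<alpha>) (w s) * en L \<alpha> (?d s)) t))
          + 4 * (ennreal (1 / \<nu>) * (ennreal CB * (ennreal Mv * E))))"
        by (intro add_mono mult_left_mono order_trans[OF hom_sup[OF t(1)] mono_E(1)]
            order_trans[OF duh_sup[OF traj_measurable[OF tG(1)]]] order_trans[OF duh_sup[OF traj_measurable[OF tG(2)]]]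
            cumul_NB w u d order_trans[OF cumul_NB[OF d(2) u(2)]] B' t) auto
      also have "\<dots> = 2 * E + (ennreal c * cumul (\<lambda>s. en L (1 + \<alpha>) (w s) * en L \<alpha> (?d s)) t + ennreal c * (ennreal Mv * E))"
        unfolding c4 ..
      also have "\<dots> = ennreal (2 + c * Mv) * E + ennreal c * cumul (\<lambda>s. en L (1 + \<alpha>) (w s) * en L \<alpha> (?d s)) t"
        using c Mv by (simp add: ennreal_plus ennreal_mult distrib_right mult.assoc add.assoc add.commute add.left_commute)
      finally show ?thesis .
    qed
    \<comment> \<open>Gronwall requires some finite bound for the difference; its size is irrelevant
      and does not enter K1.\<close>
    obtain Md where Md: "\<And>t. 0 \<le> t \<Longrightarrow> t \<le> T \<Longrightarrow> en L \<alpha> (?d t) \<le> ennreal Md"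
    proof -
      obtain Mu where "Mu \<ge> 0" and Mu: "\<And>t. 0 \<le> t \<Longrightarrow> t \<le> T \<Longrightarrow> en L \<alpha> (u t) \<le> ennreal Mu"
        using bu by (auto simp: bdd_def)
      have "en L \<alpha> (?d t) \<le> ennreal (2 * Mu + 2 * Mv)" if "0 \<le> t" "t \<le> T" for t
      proof -
        have "en L \<alpha> (?d t) \<le> 2 * en L \<alpha> (u t) + 2 * en L \<alpha> (v t)"
          by (intro en_add_le norm_triangle_ineq4)
        also have "\<dots> \<le> 2 * ennreal Mu + 2 * ennreal Mv"
          by (intro add_mono mult_left_mono Mu v that) auto
        finally show ?thesis using \<open>Mu \<ge> 0\<close> Mv by (simp add: ennreal_plus ennreal_mult)
      qed
      then show ?thesis using that by blast
    qed
    obtain x where x: "x \<ge> 0" "cumul (\<lambda>s. en L (1 + \<alpha>) (w s)) T = ennreal x"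
      using Wf by (cases "cumul (\<lambda>s. en L (1 + \<alpha>) (w s)) T") auto
    have xX: "x \<le> X" using W(1) x X by simp
    have bound: "en L \<alpha> (?d t) \<le> ennreal K1 * E" if t: "0 \<le> t" "t \<le> T" for t
    proof -
      have "en L \<alpha> (?d t) \<le> ennreal (2 + c * Mv) * E * ennreal (2 * exp (2 * c * x))"
        by (rule gronwall[OF traj_en_measurable[OF w(1)] c(1) x(2) x(1) Md sup t])
      also have "\<dots> = ennreal ((2 + c * Mv) * (2 * exp (2 * c * x))) * E"
        using c Mv by (simp add: ennreal_mult ac_simps)
      also have "\<dots> \<le> ennreal K1 * E"
        unfolding K1_def using c Mv xX by (intro mult_right_mono ennreal_leI mult_left_mono) (auto simp: mult_left_mono)
      finally show ?thesis .
    qed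
    have Kmono: "ennreal K1 * E \<le> ennreal K * E"
      using K by (intro mult_right_mono ennreal_leI) auto
    \<comment> \<open>No second Gronwall argument is required: the supremum bound just obtained is
      inserted into the Duhamel term.\<close>
    have "cumul (\<lambda>t. en L (1 + \<alpha>) (?d t)) T \<le> cumul (\<lambda>t. 2 * en L (1 + \<alpha>) (?h t) + (4 * en L (1 + \<alpha>) (duh ?G t) + 4 * en L (1 + \<alpha>) (duh ?G' t))) T"
      using le[of _ "1 + \<alpha>"] by (intro cumul_mono_fun) (simp add: distrib_left mult.assoc[symmetric])
    also have "\<dots> = 2 * cumul (\<lambda>t. en L (1 + \<alpha>) (?h t)) T + (4 * cumul (\<lambda>t. en L (1 + \<alpha>) (duh ?G t)) T + 4 * cumul (\<lambda>t. en L (1 + \<alpha>) (duh ?G' t)) T)"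
    proof -
      have [measurable]: "(\<lambda>t. en L (1 + \<alpha>) (?h t)) \<in> borel_measurable borel" "(\<lambda>t. en L (1 + \<alpha>) (duh ?G t)) \<in> borel_measurable borel"
        "(\<lambda>t. en L (1 + \<alpha>) (duh ?G' t)) \<in> borel_measurable borel"
        by (intro en_measurable duh_measurable traj_measurable[OF tG(1)] traj_measurable[OF tG(2)]; measurable)+
      show ?thesis
        by (subst cumul_add, measurable, subst cumul_add, measurable, subst cumul_cmult, measurable,
            subst cumul_cmult, measurable, subst cumul_cmult, measurable)
    qed
    also have "\<dots> \<le> 2 * (ennreal (1 / \<nu>) * E) + (4 * (ennreal (1 / \<nu>\<^sup>2) * (ennreal CB * (ennreal K1 * E * ennreal X)))
        + 4 * (ennreal (1 / \<nu>\<^sup>2) * (ennreal CB * (ennreal Mv * E))))"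
    proof (intro add_mono mult_left_mono order_trans[OF hom_L2] order_trans[OF duh_L2[OF traj_measurable[OF tG(1)]]]
        order_trans[OF duh_L2[OF traj_measurable[OF tG(2)]]] order_trans[OF cumul_NB[OF w(1) d(1)]] order_trans[OF cumul_NB[OF d(2) u(2)]] B' mono_E)
      have "cumul (\<lambda>s. en L (1 + \<alpha>) (w s) * en L \<alpha> (?d s)) T \<le> (ennreal K1 * E) * cumul (\<lambda>s. en L (1 + \<alpha>) (w s)) T"
        by (intro cumul_times_le w bound) auto
      also have "\<dots> \<le> ennreal K1 * E * ennreal X"
        by (intro mult_left_mono W) auto
      finally show "cumul (\<lambda>s. en L (1 + \<alpha>) (w s) * en L \<alpha> (?d s)) T \<le> ennreal K1 * E * ennreal X" .
    qed auto
    also have "\<dots> = ennreal (2 / \<nu>) * E + (ennreal c' * (ennreal K1 * E * ennreal X) + ennreal c' * (ennreal Mv * E))"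
      unfolding c4 using nu by (simp add: mult.assoc[symmetric] ennreal_mult[symmetric] flip: ennreal_numeral)
    also have "\<dots> = ennreal (2 / \<nu> + c' * (K1 * X) + c' * Mv) * E"
      using nu c K1 X Mv by (simp add: ennreal_plus ennreal_mult distrib_right distrib_left mult.assoc mult.commute mult.left_commute add.assoc)
    also have "\<dots> \<le> ennreal K * E"
      using K1 by (intro mult_right_mono ennreal_leI) (auto simp: K_def)
    finally show ?thesis
      using order_trans[OF bound Kmono] by blast
  qed
  show ?thesis
  proof (intro exI[of _ K] conjI[OF K(1)] allI impI, goal_cases)
    case (1 f w w' u v)
    then show ?case
      using main[of w w' u v f, OF 1(1-8) _ 1(10,11) refl] by blast
  qed
qed

end

section \<open>Reality and solenoidality of Duhamel integrals\<close>

lemma vcnj_scaleR: "vcnj (c *\<^sub>R x) = c *\<^sub>R vcnj x"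
  by (simp add: vcnj_def vec_eq_iff)

lemma vcnj_zero [simp]: "vcnj 0 = 0"
  by (simp add: vcnj_def vec_eq_iff)

lemma zdot_scaleR: "zdot L k (c *\<^sub>R x) = c *\<^sub>R zdot L k x"
  by (rule linear_cmul[OF bounded_linear.linear[OF bounded_linear_zdot]])

lemma zdot_integral_eq_0:
  fixes h :: "'a \<Rightarrow> complex^3"
  assumes "\<And>s. zdot L k (h s) = 0"
  shows "zdot L k (integral\<^sup>L M h) = 0"
proof (cases "integrable M h")
  case True
  then show ?thesis
    using integral_bounded_linear[OF bounded_linear_zdot True, of L k] assms by simp
qed (simp add: not_integrable_integral_eq)

lemma expconv_vcnj: "expconv a (\<lambda>s. vcnj (h s)) t = vcnj (expconv a h t)"
  unfolding expconv_def vcnj_integral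
  by (intro Bochner_Integration.integral_cong refl) (simp add: vcnj_scaleR)

lemma expconv_zdot: "(\<And>s. zdot L k (h s) = 0) \<Longrightarrow> zdot L k (expconv a h t) = 0"
  unfolding expconv_def by (intro zdot_integral_eq_0) (simp add: zdot_scaleR)

lemma expconv_zero [simp]: "expconv a (\<lambda>s. 0) t = 0" "expconv a h 0 = 0"
proof -
  show "expconv a (\<lambda>s. 0) t = 0" by (simp add: expconv_def cong: if_cong)
  have "(\<lambda>s. if 0 < s \<and> s < 0 then exp (- a * (0 - s)) *\<^sub>R h s else 0) = (\<lambda>s::real. 0)"
    by (auto simp: fun_eq_iff)
  then show "expconv a h 0 = 0" by (simp add: expconv_def)
qed

lemma NB_zero_left [simp]: "NB L (\<lambda>k. 0) v = (\<lambda>k. 0)"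
  by (simp add: NB_def Bf_def leray_def fun_eq_iff)

lemma norm_axis_of_real: "norm (axis i (complex_of_real x) :: complex^3) = \<bar>x\<bar>"
proof -
  have "norm (axis i z :: complex^3) = norm z" for z
    by (simp only: norm_eq_sqrt_inner inner_axis_axis refl if_True)
  then show ?thesis by simp
qed

section \<open>Picard iteration for a prescribed drift\<close>

context viscous_torus
begin

lemma duh_solenoidal:
  assumes "traj L g"
  shows "duh g t \<in> solenoidal L"
proof -
  have g: "g s 0 = 0" "g s (- k) = vcnj (g s k)" "zdot L k (g s k) = 0" for s k
    using assms by (simp_all add: traj_def solenoidal_iff)
  show ?thesis
    unfolding solenoidal_iff duh_def
    by (auto simp: g rate_def expconv_vcnj expconv_zdot)
qed

text \<open>The right-hand side of Duhamel's formula as a map of u. The value 0 at negative times is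
  a convention that keeps the iterates solenoidal and Borel on the whole line.\<close>

definition picard :: "field \<Rightarrow> (real \<Rightarrow> field) \<Rightarrow> field \<Rightarrow> (real \<Rightarrow> field) \<Rightarrow> real \<Rightarrow> field" where
  "picard f w u0 u t k = (if t < 0 then 0 else exp (- rate k * t) *\<^sub>R u0 k + duh (\<lambda>s k. f k - NB L (w s) (u s) k) t k)"

lemma force_traj: "traj L w \<Longrightarrow> traj L u \<Longrightarrow> f \<in> solenoidal L \<Longrightarrow> traj L (\<lambda>s k. f k - NB L (w s) (u s) k)"
  by (intro traj_diff traj_NB L traj_const)

lemma picard_traj:
  assumes "traj L w" "traj L u" "f \<in> solenoidal L" "u0 \<in> solenoidal L"
  shows "traj L (picard f w u0 u)"
proof -
  let ?F = "\<lambda>s k. f k - NB L (w s) (u s) k"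
  have F: "traj L ?F" by (intro force_traj assms)
  have [measurable]: "(\<lambda>t. duh ?F t k) \<in> borel_measurable borel" for k
    by (intro duh_measurable traj_measurable[OF F])
  have "picard f w u0 u t \<in> solenoidal L" for t
  proof (cases "t < 0")
    case True
    then have "picard f w u0 u t = (\<lambda>_. 0)" by (auto simp: picard_def)
    then show ?thesis by simp
  next
    case False
    have d: "duh ?F t 0 = 0" "duh ?F t (- k) = vcnj (duh ?F t k)" "zdot L k (duh ?F t k) = 0" for k
      using duh_solenoidal[OF F, of t] unfolding solenoidal_iff by blast+
    have h: "u0 0 = 0" "u0 (- k) = vcnj (u0 k)" "zdot L k (u0 k) = 0" for k
      using assms(4) unfolding solenoidal_iff by blast+
    show ?thesis
      unfolding solenoidal_iff picard_def using False
      by (simp add: d h zdot_add zdot_scaleR rate_def linear_add[OF bounded_linear.linear[OF bounded_linear_vcnj]] vcnj_scaleR)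
  qed
  moreover have "(\<lambda>t. picard f w u0 u t k) \<in> borel_measurable borel" for k
    unfolding picard_def by measurable
  ultimately show ?thesis by (simp add: traj_def)
qed

lemma picard_bdd:
  assumes w: "traj L w" "cumul (\<lambda>s. en L (1 + \<alpha>) (w s)) T < \<infinity>" and u: "traj L u" "bdd u T"
    and f: "f \<in> Vsp L (\<alpha> - 1)" and u0: "u0 \<in> Vsp L \<alpha>"
  shows "bdd (picard f w u0 u) T"
proof -
  let ?F = "\<lambda>s k. f k - NB L (w s) (u s) k"
  let ?M = "2 * en L \<alpha> u0 + 2 * (ennreal (1 / \<nu>) * cumul (\<lambda>s. en L (\<alpha> - 1) (?F s)) T)"
  have "f \<in> solenoidal L" using f by (simp add: Vsp_iff)
  then have F: "traj L ?F" by (intro force_traj w u)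
  have "en L \<alpha> (picard f w u0 u t) \<le> ?M" if t: "0 \<le> t" "t \<le> T" for t
  proof -
    have eq: "picard f w u0 u t = (\<lambda>k. exp (- rate k * t) *\<^sub>R u0 k + duh ?F t k)"
      using t by (simp add: picard_def fun_eq_iff)
    have "en L \<alpha> (picard f w u0 u t) \<le> 2 * en L \<alpha> (\<lambda>k. exp (- rate k * t) *\<^sub>R u0 k) + 2 * en L \<alpha> (duh ?F t)"
      unfolding eq by (intro en_add_le norm_triangle_ineq)
    also have "\<dots> \<le> 2 * en L \<alpha> u0 + 2 * (ennreal (1 / \<nu>) * cumul (\<lambda>s. en L (\<alpha> - 1) (?F s)) t)"
      by (intro add_mono mult_left_mono hom_sup t duh_sup traj_measurable[OF F]) auto
    also have "\<dots> \<le> ?M"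
      by (intro add_left_mono mult_left_mono cumul_mono t) auto
    finally show ?thesis .
  qed
  moreover have "?M < \<infinity>"
    using u0 cumul_force_finite[OF w(1) u(1) w(2) u(2) f] by (simp add: Vsp_iff ennreal_mult_less_top)
  then have M: "ennreal (enn2real ?M) = ?M"
    by (intro ennreal_enn2real) simp
  ultimately show ?thesis
    unfolding bdd_def by (intro exI[of _ "enn2real ?M"] conjI allI impI) (simp_all only: M enn2real_nonneg)
qed

lemma picard_difference:
  assumes w: "traj L w" "cumul (\<lambda>s. en L (1 + \<alpha>) (w s)) T < \<infinity>" and u: "traj L u" "traj L v" "bdd u T" "bdd v T"
    and f: "f \<in> Vsp L (\<alpha> - 1)" and t: "0 \<le> t" "t \<le> T"
  shows "en L \<alpha> (\<lambda>k. picard f w u0 u t k - picard f w u0 v t k)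
    \<le> ennreal (CB / \<nu>) * cumul (\<lambda>s. en L (1 + \<alpha>) (w s) * en L \<alpha> (\<lambda>k. u s k - v s k)) t"
proof -
  have d: "traj L (\<lambda>s k. u s k - v s k)" by (intro traj_diff u)
  have "picard f w u0 u t k - picard f w u0 v t k = - duh (\<lambda>s. NB L (w s) (\<lambda>k. u s k - v s k)) t k" for k
    using duh_force_difference[OF w(1) w(1) u(1,2) f w(2) w(2) u(3,4) t(2), of k] t(1)
    by (simp add: picard_def duh_def)
  then have "en L \<alpha> (\<lambda>k. picard f w u0 u t k - picard f w u0 v t k) = en L \<alpha> (duh (\<lambda>s. NB L (w s) (\<lambda>k. u s k - v s k)) t)"
    by (intro en_cong_norm) simp
  also have "\<dots> \<le> ennreal (1 / \<nu>) * cumul (\<lambda>s. en L (\<alpha> - 1) (NB L (w s) (\<lambda>k. u s k - v s k))) t"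
    by (intro duh_sup traj_measurable[OF traj_NB[OF L w(1) d]])
  also have "\<dots> \<le> ennreal (1 / \<nu>) * (ennreal CB * cumul (\<lambda>s. en L (1 + \<alpha>) (w s) * en L \<alpha> (\<lambda>k. u s k - v s k)) t)"
    by (intro mult_left_mono cumul_NB w d) auto
  also have "\<dots> = ennreal (CB / \<nu>) * cumul (\<lambda>s. en L (1 + \<alpha>) (w s) * en L \<alpha> (\<lambda>k. u s k - v s k)) t"
    using CB(1) nu by (simp add: mult.assoc[symmetric] ennreal_mult[symmetric])
  finally show ?thesis .
qed

text \<open>\<open>en_add_le\<close> doubles at every step, so telescoping requires decay faster
  than that of \<open>1 / 2 ^ n\<close>. With ratio 4 the bound reproduces itself:
  \<open>2 * K / 4 ^ n + 2 * (4 * K / 4 ^ Suc n) = 4 * K / 4 ^ n\<close>.\<close>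

lemma en_geometric_telescope:
  fixes U :: "nat \<Rightarrow> field"
  assumes "K \<ge> 0" and step: "\<And>n. en L \<alpha> (\<lambda>k. U (Suc n) k - U n k) \<le> ennreal (K / 4 ^ n)"
  shows "en L \<alpha> (\<lambda>k. U (n + p) k - U n k) \<le> ennreal (4 * K / 4 ^ n)"
proof (induction p arbitrary: n)
  case 0
  then show ?case by (simp add: en_def)
next
  case (Suc p)
  have "norm (U (n + Suc p) k - U n k) \<le> norm (U (Suc n) k - U n k) + norm (U (Suc n + p) k - U (Suc n) k)" for k
    using norm_triangle_ineq[of "U (Suc n) k - U n k" "U (Suc n + p) k - U (Suc n) k"] by simp
  then have "en L \<alpha> (\<lambda>k. U (n + Suc p) k - U n k) \<le> 2 * en L \<alpha> (\<lambda>k. U (Suc n) k - U n k) + 2 * en L \<alpha> (\<lambda>k. U (Suc n + p) k - U (Suc n) k)"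
    by (rule en_add_le)
  also have "\<dots> \<le> 2 * ennreal (K / 4 ^ n) + 2 * ennreal (4 * K / 4 ^ Suc n)"
    by (intro add_mono mult_left_mono step Suc) auto
  also have "\<dots> = ennreal (2 * (K / 4 ^ n) + 2 * (4 * K / 4 ^ Suc n))"
  proof -
    have e: "2 * ennreal x + 2 * ennreal y = ennreal (2 * x + 2 * y)" if "x \<ge> 0" "y \<ge> 0" for x y
      using that by (simp add: ennreal_plus ennreal_mult)
    show ?thesis by (rule e) (use assms(1) in auto)
  qed
  also have "2 * (K / 4 ^ n) + 2 * (4 * K / 4 ^ Suc n) = 4 * K / 4 ^ n"
    by simp
  finally show ?case .
qed

text \<open>In each mode the increments are square roots of energies and decay like
  \<open>1 / 2 ^ n\<close>, hence are summable. The energy bound passes to the limit by Fatou's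
  lemma on the lattice.\<close>

lemma en_geometric_limit:
  fixes U :: "nat \<Rightarrow> field"
  assumes K: "K \<ge> 0" and step: "\<And>n. en L \<alpha> (\<lambda>k. U (Suc n) k - U n k) \<le> ennreal (K / 4 ^ n)" and z: "\<And>n. U n 0 = 0"
  shows "convergent (\<lambda>n. U n k)" "en L \<alpha> (\<lambda>k. lim (\<lambda>n. U n k) - U n k) \<le> ennreal (4 * K / 4 ^ n)"
proof -
  show conv: "convergent (\<lambda>n. U n k)" for k
  proof (cases "k = 0")
    case True
    then show ?thesis by (simp add: z convergent_const)
  next
    case False
    define c where "c = wave L k powr (2 * \<alpha>)"
    have c: "c > 0" using wave_pos[OF L False] by (simp add: c_def)
    have le: "norm (U (Suc n) k - U n k) \<le> sqrt (K / c) * (1 / 2) ^ n" for n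
    proof -
      have "ennreal (c * (norm (U (Suc n) k - U n k))\<^sup>2) \<le> ennreal (K / 4 ^ n)"
        unfolding c_def by (rule order_trans[OF en_mode_le step])
      then have "c * (norm (U (Suc n) k - U n k))\<^sup>2 \<le> K / 4 ^ n"
        using K by (simp add: ennreal_le_iff)
      then have "(norm (U (Suc n) k - U n k))\<^sup>2 \<le> K / 4 ^ n / c"
        by (simp only: pos_le_divide_eq[OF c] mult.commute)
      also have "\<dots> = (sqrt (K / c) * (1 / 2) ^ n)\<^sup>2"
      proof -
        have e1: "((1 / 2 :: real) ^ n)\<^sup>2 = (1 / 4) ^ n"
          using power_mult[of "1 / 2 :: real" 2 n] power_mult[of "1 / 2 :: real" n 2]
          by (simp add: mult.commute power2_eq_square)
        have e2: "(sqrt (K / c))\<^sup>2 = K / c"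
          by (rule real_sqrt_pow2) (use K c in simp)
        show ?thesis
          unfolding power_mult_distrib e1 e2
          by (simp only: power_divide power_one times_divide_eq_right mult_1_right divide_divide_eq_left mult.commute)
      qed
      finally show ?thesis
        by (rule power2_le_imp_le) (use K c in simp)
    qed
    have "summable (\<lambda>n. sqrt (K / c) * (1 / 2) ^ n)"
      by (intro summable_mult summable_geometric) simp
    then have "summable (\<lambda>n. U (Suc n) k - U n k)"
      by (rule summable_comparison_test') (rule le)
    then have "convergent (\<lambda>n. \<Sum>i<n. U (Suc i) k - U i k)"
      by (simp add: summable_iff_convergent)
    then have "convergent (\<lambda>n. U n k - U 0 k)"
      by (simp only: sum_lessThan_telescope[of "\<lambda>n. U n k"])
    then have "convergent (\<lambda>n. U n k - U 0 k + U 0 k)"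
      by (intro convergent_add convergent_const)
    then show ?thesis by simp
  qed
  show "en L \<alpha> (\<lambda>k. lim (\<lambda>n. U n k) - U n k) \<le> ennreal (4 * K / 4 ^ n)"
  proof -
    let ?x = "\<lambda>p k. wave L k powr (2 * \<alpha>) * (norm (U (n + p) k - U n k))\<^sup>2"
    have "(\<lambda>p. ennreal (?x p k)) \<longlonglongrightarrow> ennreal (wave L k powr (2 * \<alpha>) * (norm (lim (\<lambda>n. U n k) - U n k))\<^sup>2)" for k
    proof -
      have "(\<lambda>p. U (p + n) k) \<longlonglongrightarrow> lim (\<lambda>n. U n k)"
        using conv[of k] by (intro LIMSEQ_ignore_initial_segment) (simp add: convergent_LIMSEQ_iff)
      then have "(\<lambda>p. U (n + p) k) \<longlonglongrightarrow> lim (\<lambda>n. U n k)"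
        by (simp only: add.commute)
      then show ?thesis
        by (intro tendsto_ennrealI tendsto_intros)
    qed
    then have "en L \<alpha> (\<lambda>k. lim (\<lambda>n. U n k) - U n k) = (\<integral>\<^sup>+k. liminf (\<lambda>p. ennreal (?x p k)) \<partial>count_space UNIV)"
      unfolding en_def by (intro nn_integral_cong lim_imp_Liminf[symmetric]) auto
    also have "\<dots> \<le> liminf (\<lambda>p. \<integral>\<^sup>+k. ennreal (?x p k) \<partial>count_space UNIV)"
      by (rule nn_integral_liminf) simp
    also have "\<dots> \<le> limsup (\<lambda>p. \<integral>\<^sup>+k. ennreal (?x p k) \<partial>count_space UNIV)"
      by (rule Liminf_le_Limsup) simp
    also have "\<dots> \<le> ennreal (4 * K / 4 ^ n)"
      using en_geometric_telescope[OF K step] by (intro Limsup_bounded always_eventually allI) (simp add: en_def)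
    finally show ?thesis .
  qed
qed

text \<open>For a given drift the equation is linear, so the increments of the Picard iterates are
  dominated by terms of an exponential series. The iteration therefore converges on every bounded
  interval, with no smallness condition, and produces one solution for all times.\<close>

lemma linear_existence:
  assumes w: "traj L w" and W: "\<And>T. cumul (\<lambda>s. en L (1 + \<alpha>) (w s)) T < \<infinity>"
    and f: "f \<in> Vsp L (\<alpha> - 1)" and u0: "u0 \<in> Vsp L \<alpha>"
  shows "\<exists>u. traj L u \<and> u 0 = u0 \<and> (\<forall>T. mild f w T u \<and> bdd u T)"
proof -
  have fs: "f \<in> solenoidal L" and us: "u0 \<in> solenoidal L"
    using f u0 by (auto simp: Vsp_iff)
  define U where "U n = (picard f w u0 ^^ n) (\<lambda>t k. 0)" for n
  have U0: "U 0 = (\<lambda>t k. 0)" and USuc: "U (Suc n) = picard f w u0 (U n)" for n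
    by (simp_all add: U_def)
  have tU: "traj L (U n)" for n
    by (induction n) (simp_all add: U0 USuc traj_const picard_traj w fs us)
  have bU: "bdd (U n) T" for n T
  proof (induction n)
    case 0
    have "en L \<alpha> (\<lambda>k. 0) = 0" by (simp add: en_def)
    then show ?case unfolding U0 bdd_def by (intro exI[of _ 0]) simp
  next
    case (Suc n)
    then show ?case unfolding USuc by (intro picard_bdd w W tU f u0)
  qed
  have step: "\<exists>K\<ge>0. \<forall>n t. 0 \<le> t \<longrightarrow> t \<le> T \<longrightarrow> en L \<alpha> (\<lambda>k. U (Suc n) t k - U n t k) \<le> ennreal (K / 4 ^ n)" for T
  proof -
    \<comment> \<open>\<open>U 0\<close> vanishes, so a bound for \<open>U 1\<close> bounds the
      first increment.\<close>
    obtain M where M: "M \<ge> 0" "\<And>t. 0 \<le> t \<Longrightarrow> t \<le> T \<Longrightarrow> en L \<alpha> (U 1 t) \<le> ennreal M"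
      using bU[of 1 T] unfolding bdd_def by blast
    obtain x where x: "x \<ge> 0" "cumul (\<lambda>s. en L (1 + \<alpha>) (w s)) T = ennreal x"
      using W[of T] by (cases "cumul (\<lambda>s. en L (1 + \<alpha>) (w s)) T") auto
    have c: "CB / \<nu> \<ge> 0" using CB(1) nu by simp
    let ?E = "exp (4 * (CB / \<nu>) * x)"
    have "en L \<alpha> (\<lambda>k. U (Suc n) t k - U n t k) \<le> ennreal (M * ?E / 4 ^ n)" if t: "0 \<le> t" "t \<le> T" for n t
    proof -
      have "en L \<alpha> (\<lambda>k. U (Suc n) t k - U n t k) \<le> 0 * (\<Sum>j<n. gterm (\<lambda>s. en L (1 + \<alpha>) (w s)) (CB / \<nu>) j t) + ennreal M * gterm (\<lambda>s. en L (1 + \<alpha>) (w s)) (CB / \<nu>) n t"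
      proof (rule gronwall_iteration[where D = "\<lambda>n t. en L \<alpha> (\<lambda>k. U (Suc n) t k - U n t k)", OF traj_en_measurable[OF w] c _ _ t])
        show "en L \<alpha> (\<lambda>k. U (Suc 0) t k - U 0 t k) \<le> ennreal M" if "0 \<le> t" "t \<le> T" for t
          using M(2)[OF that] by (simp add: U0)
        show "en L \<alpha> (\<lambda>k. U (Suc (Suc n)) t k - U (Suc n) t k)
          \<le> 0 + ennreal (CB / \<nu>) * cumul (\<lambda>s. en L (1 + \<alpha>) (w s) * en L \<alpha> (\<lambda>k. U (Suc n) s k - U n s k)) t" if "0 \<le> t" "t \<le> T" for n t
          using picard_difference[OF w W tU tU bU bU f that, of u0 "Suc n" n] by (simp only: USuc[symmetric] add_0)
      qed
      also have "\<dots> \<le> ennreal M * ennreal (?E / 4 ^ n)"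
        using order_trans[OF gterm_mono[OF t(2)] gterm_le_exp[OF c x(2) x(1), of 4 n]] by (simp add: mult_left_mono)
      also have "\<dots> = ennreal (M * ?E / 4 ^ n)"
        using M(1) by (subst ennreal_mult[symmetric]) simp_all
      finally show ?thesis .
    qed
    then show ?thesis using M(1) by (intro exI[of _ "M * ?E"]) auto
  qed
  define u where "u t k = (if t < 0 then 0 else lim (\<lambda>n. U n t k))" for t k
  have lim: "(\<lambda>n. U n t k) \<longlonglongrightarrow> u t k" if "0 \<le> t" for t k
  proof -
    obtain K where "K \<ge> 0" "\<And>n. en L \<alpha> (\<lambda>k. U (Suc n) t k - U n t k) \<le> ennreal (K / 4 ^ n)"
      using step[of t] \<open>0 \<le> t\<close> by blast
    then have "convergent (\<lambda>n. U n t k)"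
      by (intro en_geometric_limit(1)[where U = "\<lambda>n. U n t"] traj_zero[OF tU])
    then show ?thesis using that by (simp add: u_def convergent_LIMSEQ_iff)
  qed
  have rate_conv: "\<exists>K\<ge>0. \<forall>n t. 0 \<le> t \<longrightarrow> t \<le> T \<longrightarrow> en L \<alpha> (\<lambda>k. u t k - U n t k) \<le> ennreal (4 * K / 4 ^ n)" for T
  proof -
    obtain K where K: "K \<ge> 0" "\<And>n t. 0 \<le> t \<Longrightarrow> t \<le> T \<Longrightarrow> en L \<alpha> (\<lambda>k. U (Suc n) t k - U n t k) \<le> ennreal (K / 4 ^ n)"
      using step[of T] by blast
    have "en L \<alpha> (\<lambda>k. u t k - U n t k) \<le> ennreal (4 * K / 4 ^ n)" if "0 \<le> t" "t \<le> T" for n t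
      using en_geometric_limit(2)[where U = "\<lambda>n. U n t", OF K(1) K(2)[OF that] traj_zero[OF tU]] that
      by (simp add: u_def)
    then show ?thesis using K(1) by blast
  qed
  have tu: "traj L u"
  proof -
    have "u t \<in> solenoidal L" for t
    proof (cases "t < 0")
      case True
      then have "u t = (\<lambda>_. 0)" by (auto simp: u_def)
      then show ?thesis by simp
    next
      case False
      then have l: "(\<lambda>n. U n t k) \<longlonglongrightarrow> u t k" for k by (intro lim) simp
      have Un: "U n t 0 = 0" "U n t (- k) = vcnj (U n t k)" "zdot L k (U n t k) = 0" for n k
        using tU[of n] by (simp_all add: traj_def solenoidal_iff)
      have "u t 0 = 0"
        using LIMSEQ_unique[OF l[of 0]] by (simp add: Un)
      moreover have "u t (- k) = vcnj (u t k)" for k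
        using LIMSEQ_unique[OF l[of "- k"]] bounded_linear.tendsto[OF bounded_linear_vcnj l[of k]] by (simp add: Un)
      moreover have "zdot L k (u t k) = 0" for k
        using bounded_linear.tendsto[OF bounded_linear_zdot l[of k], of L k] by (simp add: Un LIMSEQ_const_iff)
      ultimately show ?thesis by (simp add: solenoidal_iff)
    qed
    moreover have "(\<lambda>t. u t k) \<in> borel_measurable borel" for k
    proof -
      have [measurable]: "(\<lambda>t. lim (\<lambda>n. U n t k)) \<in> borel_measurable borel"
        by (intro borel_measurable_lim_metric traj_measurable[OF tU])
      show ?thesis unfolding u_def by measurable
    qed
    ultimately show ?thesis by (simp add: traj_def)
  qed
  have bu: "bdd u T" for T
  proof -
    obtain K where K: "K \<ge> 0" "\<And>n t. 0 \<le> t \<Longrightarrow> t \<le> T \<Longrightarrow> en L \<alpha> (\<lambda>k. u t k - U n t k) \<le> ennreal (4 * K / 4 ^ n)"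
      using rate_conv[of T] by blast
    then show ?thesis
      unfolding bdd_def using K(2)[where n = 0] by (intro exI[of _ "4 * K"]) (simp add: U0)
  qed
  \<comment> \<open>The iterates \<open>U (Suc n)\<close> converge to u and, by
    \<open>picard_difference\<close>, also to the image of u; uniqueness of limits in each mode
    identifies the two.\<close>
  have fix_pt: "picard f w u0 u t k = u t k" if t: "0 \<le> t" for t k
  proof (cases "k = 0")
    case True
    then show ?thesis
      using traj_zero[OF picard_traj[OF w tu fs us]] traj_zero[OF tu] by simp
  next
    case False
    obtain K where K: "K \<ge> 0" "\<And>n s. 0 \<le> s \<Longrightarrow> s \<le> t \<Longrightarrow> en L \<alpha> (\<lambda>k. u s k - U n s k) \<le> ennreal (4 * K / 4 ^ n)"
      using rate_conv[of t] by blast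
    obtain x where x: "x \<ge> 0" "cumul (\<lambda>s. en L (1 + \<alpha>) (w s)) t = ennreal x"
      using W[of t] by (cases "cumul (\<lambda>s. en L (1 + \<alpha>) (w s)) t") auto
    have le: "en L \<alpha> (\<lambda>k. picard f w u0 u t k - U (Suc n) t k) \<le> ennreal (CB / \<nu> * (4 * K * x) * (1 / 4) ^ n)" for n
    proof -
      have "en L \<alpha> (\<lambda>k. picard f w u0 u t k - U (Suc n) t k)
        \<le> ennreal (CB / \<nu>) * cumul (\<lambda>s. en L (1 + \<alpha>) (w s) * en L \<alpha> (\<lambda>k. u s k - U n s k)) t"
        unfolding USuc by (rule picard_difference[OF w W tu tU bu bU f t order_refl])
      also have "\<dots> \<le> ennreal (CB / \<nu>) * (ennreal (4 * K / 4 ^ n) * ennreal x)"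
        unfolding x(2)[symmetric] by (intro mult_left_mono cumul_times_le w K) auto
      also have "\<dots> = ennreal (CB / \<nu> * (4 * K * x) * (1 / 4) ^ n)"
        using CB(1) nu K(1) x(1) by (simp add: ennreal_mult[symmetric] power_divide)
      finally show ?thesis .
    qed
    have lim0: "(\<lambda>n. ennreal (CB / \<nu> * (4 * K * x) * (1 / 4) ^ n)) \<longlonglongrightarrow> 0"
    proof -
      have "(\<lambda>n. CB / \<nu> * (4 * K * x) * (1 / 4) ^ n) \<longlonglongrightarrow> CB / \<nu> * (4 * K * x) * 0"
        by (intro tendsto_intros LIMSEQ_power_zero) simp
      from tendsto_ennrealI[OF this] show ?thesis
        by (simp only: mult_zero_right ennreal_0)
    qed
    have "(\<lambda>n. en L \<alpha> (\<lambda>k. picard f w u0 u t k - U (Suc n) t k)) \<longlonglongrightarrow> 0"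
      by (rule tendsto_sandwich[OF always_eventually always_eventually tendsto_const lim0]) (simp_all only: le zero_le simp_thms)
    from en_tendsto_mode[OF L False this] have "(\<lambda>n. picard f w u0 u t k - U (Suc n) t k) \<longlonglongrightarrow> 0" .
    then have "(\<lambda>n. picard f w u0 u t k - (picard f w u0 u t k - U (Suc n) t k)) \<longlonglongrightarrow> picard f w u0 u t k - 0"
      by (intro tendsto_intros)
    then have "(\<lambda>n. U (Suc n) t k) \<longlonglongrightarrow> picard f w u0 u t k" by simp
    then show ?thesis
      using LIMSEQ_Suc[OF lim[OF t, of k]] by (rule LIMSEQ_unique)
  qed
  have u0': "u 0 = u0"
    using fix_pt[of 0] by (auto simp: picard_def duh_def fun_eq_iff)
  have "mild f w T u" for T
    unfolding mild_def using fix_pt by (simp add: picard_def u0')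
  then show ?thesis using tu bu u0' by blast
qed

section \<open>Regularity of mild solutions\<close>

text \<open>Boundedness at exponent \<alpha> already implies the square integrability at 1 +
  \<alpha> that the weak formulation demands; both terms of Duhamel's formula are smoothed.\<close>

lemma mild_L2:
  assumes w: "traj L w" "cumul (\<lambda>s. en L (1 + \<alpha>) (w s)) T < \<infinity>" and u: "traj L u" "bdd u T"
    and f: "f \<in> Vsp L (\<alpha> - 1)" and m: "mild f w T u" and T: "T \<ge> 0"
  shows "cumul (\<lambda>s. en L (1 + \<alpha>) (u s)) T < \<infinity>"
proof -
  let ?F = "\<lambda>s k. f k - NB L (w s) (u s) k" and ?h = "\<lambda>t k. exp (- rate k * t) *\<^sub>R u 0 k"
  have F: "traj L ?F" using f by (intro force_traj w u) (simp add: Vsp_iff)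
  have [measurable]: "(\<lambda>t. en L (1 + \<alpha>) (?h t)) \<in> borel_measurable borel" "(\<lambda>t. en L (1 + \<alpha>) (duh ?F t)) \<in> borel_measurable borel"
    by (intro en_measurable duh_measurable traj_measurable[OF F]; measurable)+
  have "en L (1 + \<alpha>) (u t) \<le> 2 * en L (1 + \<alpha>) (?h t) + 2 * en L (1 + \<alpha>) (duh ?F t)" if "0 < t" "t < T" for t
  proof -
    have eq: "u t = (\<lambda>k. ?h t k + duh ?F t k)"
      using m that unfolding mild_def by (intro ext) (meson less_imp_le)
    show ?thesis by (subst eq) (intro en_add_le norm_triangle_ineq)
  qed
  then have "cumul (\<lambda>s. en L (1 + \<alpha>) (u s)) T \<le> cumul (\<lambda>t. 2 * en L (1 + \<alpha>) (?h t) + 2 * en L (1 + \<alpha>) (duh ?F t)) T"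
    by (intro cumul_mono_fun)
  also have "\<dots> = 2 * cumul (\<lambda>t. en L (1 + \<alpha>) (?h t)) T + 2 * cumul (\<lambda>t. en L (1 + \<alpha>) (duh ?F t)) T"
    by (subst cumul_add, measurable, subst cumul_cmult, measurable, subst cumul_cmult, measurable)
  also have "\<dots> \<le> 2 * (ennreal (1 / \<nu>) * en L \<alpha> (u 0)) + 2 * (ennreal (1 / \<nu>\<^sup>2) * cumul (\<lambda>s. en L (\<alpha> - 1) (?F s)) T)"
    by (intro add_mono mult_left_mono hom_L2 duh_L2 traj_measurable[OF F]) auto
  also have "\<dots> < \<infinity>"
    using bdd_finite[OF u(2) order_refl T] cumul_force_finite[OF w(1) u(1) w(2) u(2) f] by (simp add: ennreal_mult_less_top)
  finally show ?thesis .
qed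

text \<open>Every mode is continuous in time, and each is bounded uniformly in time by the
  corresponding mode of a fixed field with finite energy at exponent \<alpha>. Dominated convergence
  over the modes then gives convergence in norm.\<close>

lemma mild_continuous:
  assumes w: "traj L w" "cumul (\<lambda>s. en L (1 + \<alpha>) (w s)) T < \<infinity>" and u: "traj L u" "bdd u T"
    and f: "f \<in> Vsp L (\<alpha> - 1)" and m: "mild f w T u"
    and t: "\<And>n. 0 \<le> t n" "\<And>n. t n \<le> T" and lim: "t \<longlonglongrightarrow> t0"
  shows "(\<lambda>n. en L \<alpha> (\<lambda>k. u (t n) k - u t0 k)) \<longlonglongrightarrow> 0"
proof -
  let ?F = "\<lambda>s k. f k - NB L (w s) (u s) k"
  let ?c = "\<lambda>k. cumul (\<lambda>s. ennreal ((norm (?F s k))\<^sup>2)) T"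
  have t0: "0 \<le> t0" "t0 \<le> T"
    using LIMSEQ_le_const[OF lim] LIMSEQ_le_const2[OF lim] t by blast+
  have F: "traj L ?F" using f by (intro force_traj w u) (simp add: Vsp_iff)
  have Ffin: "cumul (\<lambda>s. en L (\<alpha> - 1) (?F s)) T < \<infinity>"
    by (rule cumul_force_finite[OF w(1) u(1) w(2) u(2) f])
  then have sum: "(\<integral>\<^sup>+k. ennreal (wave L k powr (2 * (\<alpha> - 1))) * ?c k \<partial>count_space UNIV) < \<infinity>"
    by (simp only: cumul_en[OF traj_measurable[OF F], symmetric])
  have cfin: "?c k < \<infinity>" if "k \<noteq> 0" for k
  proof -
    have "ennreal (wave L k powr (2 * (\<alpha> - 1))) * ?c k \<le> (\<integral>\<^sup>+k. ennreal (wave L k powr (2 * (\<alpha> - 1))) * ?c k \<partial>count_space UNIV)"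
      by (rule nn_integral_ge_point) simp
    then have "ennreal (wave L k powr (2 * (\<alpha> - 1))) * ?c k < \<infinity>"
      using sum by (rule le_less_trans)
    then show ?thesis
      using wave_pos[OF L that] by (auto simp: ennreal_mult_less_top)
  qed
  define B where "B k = 1 / rate k * enn2real (?c k)" for k
  have B: "B k \<ge> 0" for k by (simp add: B_def)
  \<comment> \<open>The majorant is packed into a field because \<open>en_dominated\<close> compares
    with one; only its modewise norm matters, so the value is placed in the first
    coordinate.\<close>
  define W where "W k = (axis 1 (complex_of_real (norm (u 0 k) + sqrt (B k))) :: complex^3)" for k
  have nW: "norm (W k) = norm (u 0 k) + sqrt (B k)" for k
    using B[of k] unfolding W_def norm_axis_of_real by simp
  have bound: "norm (u s k) \<le> norm (W k)" if s: "0 \<le> s" "s \<le> T" for s k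
  proof (cases "k = 0")
    case True
    then show ?thesis by (simp add: traj_zero[OF u(1)])
  next
    case False
    have "ennreal ((norm (duh ?F s k))\<^sup>2) \<le> ennreal (1 / rate k) * ?c k"
      unfolding duh_def using expconv_sup[OF traj_measurable[OF F] rate_pos[OF False], of k s] cumul_mono[OF s(2)]
      by (rule order_trans[OF _ mult_left_mono]) auto
    also have "\<dots> = ennreal (B k)"
    proof -
      have "ennreal (enn2real (?c k)) = ?c k"
        using cfin[OF False] by simp
      moreover have "ennreal (B k) = ennreal (1 / rate k) * ennreal (enn2real (?c k))"
        unfolding B_def by (intro ennreal_mult) auto
      ultimately show ?thesis by (simp only:)
    qed
    finally have "(norm (duh ?F s k))\<^sup>2 \<le> B k"
      using B[of k] by (simp add: ennreal_le_iff)
    then have "norm (duh ?F s k) \<le> sqrt (B k)"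
      by (rule real_le_rsqrt)
    moreover have "norm (exp (- rate k * s) *\<^sub>R u 0 k) \<le> norm (u 0 k)"
      using s by (simp add: mult_left_le_one_le)
    ultimately have "norm (exp (- rate k * s) *\<^sub>R u 0 k) + norm (duh ?F s k) \<le> norm (W k)"
      unfolding nW by linarith
    moreover have "u s k = exp (- rate k * s) *\<^sub>R u 0 k + duh ?F s k"
      using m s unfolding mild_def by blast
    ultimately show ?thesis
      by (metis (no_types, lifting) norm_triangle_ineq order_trans)
  qed
  show ?thesis
  proof (rule en_dominated[where w = W and c = 2])
    define R where "R k = (axis 1 (complex_of_real (sqrt (B k))) :: complex^3)" for k
    have nR: "norm (R k) = sqrt (B k)" for k
      using B[of k] unfolding R_def norm_axis_of_real by simp
    have "en L \<alpha> W \<le> 2 * en L \<alpha> (u 0) + 2 * en L \<alpha> R"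
      by (rule en_add_le) (simp add: nW nR)
    also have "en L \<alpha> R \<le> (\<integral>\<^sup>+k. ennreal (1 / \<nu>) * (ennreal (wave L k powr (2 * (\<alpha> - 1))) * ?c k) \<partial>count_space UNIV)"
      unfolding en_def
    proof (intro nn_integral_mono)
      fix k
      show "ennreal (wave L k powr (2 * \<alpha>) * (norm (R k))\<^sup>2) \<le> ennreal (1 / \<nu>) * (ennreal (wave L k powr (2 * (\<alpha> - 1))) * ?c k)"
      proof (cases "k = 0")
        case False
        have "wave L k powr (2 * \<alpha>) * (norm (R k))\<^sup>2 = (wave L k powr (2 * \<alpha>) * (1 / rate k)) * enn2real (?c k)"
          unfolding nR using B[of k] by (simp add: B_def)
        also have "\<dots> = 1 / \<nu> * wave L k powr (2 * (\<alpha> - 1)) * enn2real (?c k)"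
          unfolding wave_powr_shift[OF False] ..
        finally have "ennreal (wave L k powr (2 * \<alpha>) * (norm (R k))\<^sup>2)
          = ennreal (1 / \<nu>) * (ennreal (wave L k powr (2 * (\<alpha> - 1))) * ennreal (enn2real (?c k)))"
          using nu by (simp only: ennreal_mult mult.assoc zero_le_divide_1_iff less_imp_le powr_ge_zero enn2real_nonneg mult_nonneg_nonneg)
        moreover have "ennreal (enn2real (?c k)) = ?c k"
          using cfin[OF False] by simp
        ultimately show ?thesis by (simp only: order_refl)
      qed simp
    qed
    also have "\<dots> = ennreal (1 / \<nu>) * (\<integral>\<^sup>+k. ennreal (wave L k powr (2 * (\<alpha> - 1))) * ?c k \<partial>count_space UNIV)"
      by (simp add: nn_integral_cmult)
    finally have "en L \<alpha> W \<le> 2 * en L \<alpha> (u 0) + 2 * (ennreal (1 / \<nu>) * (\<integral>\<^sup>+k. ennreal (wave L k powr (2 * (\<alpha> - 1))) * ?c k \<partial>count_space UNIV))"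
      by (simp add: mult_left_mono)
    also have "\<dots> < \<infinity>"
      using sum bdd_finite[OF u(2), of 0] t0 by (simp add: ennreal_mult_less_top)
    finally show "en L \<alpha> W < \<infinity>" .
    show "norm (u (t n) k - u t0 k) \<le> 2 * norm (W k)" for n k
      using norm_triangle_ineq4[of "u (t n) k" "u t0 k"] bound[OF t(1,2), of n k] bound[OF t0, of k] by linarith
    show "(\<lambda>n. u (t n) k) \<longlonglongrightarrow> u t0 k" for k
    proof -
      have "(\<lambda>n. duh ?F (t n) k) \<longlonglongrightarrow> duh ?F t0 k"
        unfolding duh_def
        by (rule expconv_continuous[OF mode_integrable[OF F Ffin] traj_measurable[OF F] rate_nonneg t(2) lim])
      then have l: "(\<lambda>n. exp (- rate k * t n) *\<^sub>R u 0 k + duh ?F (t n) k) \<longlonglongrightarrow> exp (- rate k * t0) *\<^sub>R u 0 k + duh ?F t0 k"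
        by (intro tendsto_intros lim)
      have e: "u s k = exp (- rate k * s) *\<^sub>R u 0 k + duh ?F s k" if "0 \<le> s" "s \<le> T" for s
        using m that unfolding mild_def by blast
      show ?thesis
        using l by (simp only: e[OF t] e[OF t0])
    qed
  qed
qed

end

section \<open>Test functions\<close>

definition smooth :: "(real \<Rightarrow> real) \<Rightarrow> bool" where
  "smooth f \<longleftrightarrow> (\<forall>n. (deriv ^^ n) f differentiable_on UNIV)"

text \<open>Smoothness by coinduction: in a set of functions closed under differentiation every
  member has derivatives of all orders. Exhibiting such a set avoids formulas for higher
  derivatives.\<close>

lemma smooth_coinduct:
  assumes "f \<in> S" and S: "\<And>g. g \<in> S \<Longrightarrow> \<exists>h\<in>S. \<forall>x. (g has_real_derivative h x) (at x)"
  shows "smooth f"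
proof -
  have der: "deriv g \<in> S \<and> g differentiable_on UNIV" if g: "g \<in> S" for g
  proof -
    obtain h where h: "h \<in> S" "\<And>x. (g has_real_derivative h x) (at x)"
      using S[OF g] by blast
    have "deriv g = h" by (intro ext DERIV_imp_deriv h)
    moreover have "g differentiable_on UNIV"
      unfolding differentiable_on_def using h(2) by (meson has_field_derivative_at_within has_field_derivative_imp_has_derivative differentiable_def)
    ultimately show ?thesis using h by simp
  qed
  have "(deriv ^^ n) f \<in> S" for n
    by (induction n) (simp_all add: assms(1) der)
  then show ?thesis
    unfolding smooth_def using der by blast
qed

lemma smooth_DERIV:
  assumes "smooth f"
  shows "(f has_real_derivative deriv f x) (at x)"
proof -
  have "(deriv ^^ 0) f differentiable_on UNIV"
    using assms unfolding smooth_def by blast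
  then have "f differentiable at x"
    by (simp add: differentiable_on_def)
  then show ?thesis
    by (simp add: DERIV_deriv_iff_real_differentiable)
qed

lemma smooth_deriv: "smooth f \<Longrightarrow> smooth (deriv f)"
  unfolding smooth_def by (metis comp_apply funpow_Suc_right)

lemma smooth_continuous: "smooth f \<Longrightarrow> continuous_on S f"
  by (meson DERIV_isCont continuous_at_imp_continuous_on smooth_DERIV)

lemma smooth_measurable: "smooth f \<Longrightarrow> f \<in> borel_measurable borel"
  by (intro borel_measurable_continuous_onI smooth_continuous)

lemma smooth_linear:
  assumes "smooth f" "smooth g"
  shows "smooth (\<lambda>x. c * f x + d * g x)"
proof (rule smooth_coinduct[where S = "{\<lambda>x. c * f x + d * g x | f g. smooth f \<and> smooth g}"])
  show "(\<lambda>x. c * f x + d * g x) \<in> {\<lambda>x. c * f x + d * g x | f g. smooth f \<and> smooth g}"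
    using assms by blast
  fix u assume "u \<in> {\<lambda>x. c * f x + d * g x | f g. smooth f \<and> smooth g}"
  then obtain f g where u: "u = (\<lambda>x. c * f x + d * g x)" "smooth f" "smooth g" by blast
  have "(u has_real_derivative c * deriv f x + d * deriv g x) (at x)" for x
    unfolding u(1) by (intro DERIV_add DERIV_cmult smooth_DERIV u)
  then show "\<exists>h\<in>{\<lambda>x. c * f x + d * g x | f g. smooth f \<and> smooth g}. \<forall>x. (u has_real_derivative h x) (at x)"
    using smooth_deriv[OF u(2)] smooth_deriv[OF u(3)] by (intro bexI[of _ "\<lambda>x. c * deriv f x + d * deriv g x"]) blast+
qed

lemma DERIV_exp_mult:
  assumes "smooth f"
  shows "((\<lambda>x. exp (a * x) * f x) has_real_derivative exp (a * x) * (a * f x + deriv f x)) (at x)"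
proof -
  have "((\<lambda>x. exp (a * x)) has_real_derivative exp (a * x) * a) (at x)"
    by (auto intro!: derivative_eq_intros)
  from DERIV_mult[OF this smooth_DERIV[OF assms]] show ?thesis
    by (simp add: algebra_simps)
qed

lemma smooth_exp_mult:
  assumes "smooth f"
  shows "smooth (\<lambda>x. exp (a * x) * f x)"
proof (rule smooth_coinduct[where S = "{\<lambda>x. exp (a * x) * f x | f. smooth f}"])
  show "(\<lambda>x. exp (a * x) * f x) \<in> {\<lambda>x. exp (a * x) * f x | f. smooth f}"
    using assms by blast
  fix u assume "u \<in> {\<lambda>x. exp (a * x) * f x | f. smooth f}"
  then obtain f where u: "u = (\<lambda>x. exp (a * x) * f x)" "smooth f" by blast
  have "smooth (\<lambda>x. a * f x + deriv f x)"
    using smooth_linear[OF u(2) smooth_deriv[OF u(2)], of a 1] by simp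
  then show "\<exists>h\<in>{\<lambda>x. exp (a * x) * f x | f. smooth f}. \<forall>x. (u has_real_derivative h x) (at x)"
    using DERIV_exp_mult[OF u(2), of a] unfolding u(1)
    by (intro bexI[of _ "\<lambda>x. exp (a * x) * (a * f x + deriv f x)"] CollectI exI[of _ "\<lambda>x. a * f x + deriv f x"]) blast+
qed

lemma smooth_primitive:
  assumes "\<And>x. (F has_real_derivative g x) (at x)" "smooth g"
  shows "smooth F"
proof (rule smooth_coinduct[where S = "insert F (Collect smooth)"])
  fix u assume "u \<in> insert F (Collect smooth)"
  then consider "u = F" | "smooth u" by blast
  then show "\<exists>h\<in>insert F (Collect smooth). \<forall>x. (u has_real_derivative h x) (at x)"
  proof cases
    case 1
    then show ?thesis using assms by (intro bexI[of _ g]) auto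
  next
    case 2
    then show ?thesis using smooth_DERIV smooth_deriv by (intro bexI[of _ "deriv u"]) auto
  qed
qed simp

text \<open>Serves the two end points of a bump, where the defining formula changes and the
  derivative cannot be computed from either side's expression alone.\<close>

lemma DERIV_zero_quadratic:
  fixes f :: "real \<Rightarrow> real"
  assumes "\<And>x. \<bar>f x\<bar> \<le> K * (x - c)\<^sup>2"
  shows "(f has_real_derivative 0) (at c)"
proof -
  have "f c = 0" using assms[of c] by simp
  have "((\<lambda>x. K * \<bar>x - c\<bar>) \<longlongrightarrow> K * \<bar>c - c\<bar>) (at c)"
    by (intro tendsto_intros)
  then have lim: "((\<lambda>x. K * \<bar>x - c\<bar>) \<longlongrightarrow> 0) (at c)" by simp
  have "((\<lambda>x. (f x - f c) / (x - c)) \<longlongrightarrow> 0) (at c)"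
  proof (rule Lim_null_comparison[OF _ lim])
    show "eventually (\<lambda>x. norm ((f x - f c) / (x - c)) \<le> K * \<bar>x - c\<bar>) (at c)"
      unfolding eventually_at_filter
    proof (rule always_eventually, intro allI impI)
      fix x assume "x \<noteq> c"
      then have p: "\<bar>x - c\<bar> > 0" by simp
      have "\<bar>f x\<bar> \<le> (K * \<bar>x - c\<bar>) * \<bar>x - c\<bar>"
        using assms[of x] by (simp add: power2_eq_square mult.assoc abs_mult_self_eq)
      then show "norm ((f x - f c) / (x - c)) \<le> K * \<bar>x - c\<bar>"
        using p by (simp add: \<open>f c = 0\<close> abs_divide pos_divide_le_eq)
    qed
  qed
  then show ?thesis
    by (simp add: has_field_derivative_iff)
qed

text \<open>The functions \<open>p (1/q)^m exp (-1/q)\<close> on \<open>(a,b)\<close>, with \<open>q = (x - a)(b - x)\<close> and \<open>p\<close> a polynomial, are closed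
  under differentiation.\<close>

definition bump :: "real \<Rightarrow> real \<Rightarrow> real poly \<Rightarrow> nat \<Rightarrow> real \<Rightarrow> real" where
  "bump a b p m x = (if a < x \<and> x < b then poly p x * inverse ((x - a) * (b - x)) ^ m * exp (- inverse ((x - a) * (b - x))) else 0)"

lemma power_exp_le:
  assumes "(r::real) \<ge> 0"
  shows "r ^ n * exp (- r) \<le> fact n"
proof -
  have "(\<Sum>k\<in>{n}. inverse (fact k) * r ^ k) \<le> (\<Sum>k. inverse (fact k) * r ^ k)"
    using summable_exp[of r] assms by (intro sum_le_suminf) auto
  then have "r ^ n / fact n \<le> exp r"
    by (simp add: exp_def scaleR_conv_of_real field_simps)
  then show ?thesis
    by (simp add: exp_minus field_simps)
qed

text \<open>The exponential dominates \<open>r ^ (m + 2)\<close> for \<open>r = 1 / q\<close>, so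
  two powers of q are left over, and \<open>q\<^sup>2\<close> vanishes quadratically at both end
  points.\<close>

lemma bump_bound:
  "\<exists>K. \<forall>x. \<bar>bump a b p m x\<bar> \<le> K * (x - a)\<^sup>2 \<and> \<bar>bump a b p m x\<bar> \<le> K * (x - b)\<^sup>2"
proof -
  have "bounded (poly p ` {a..b})"
    by (intro compact_imp_bounded compact_continuous_image continuous_intros) auto
  then obtain P where P: "\<And>x. a \<le> x \<Longrightarrow> x \<le> b \<Longrightarrow> \<bar>poly p x\<bar> \<le> P" "P > 0"
    unfolding bounded_pos by force
  define K where "K = P * fact (m + 2) * (b - a)\<^sup>2"
  have K: "K \<ge> 0" using P(2) by (simp add: K_def)
  have "\<bar>bump a b p m x\<bar> \<le> K * (x - a)\<^sup>2 \<and> \<bar>bump a b p m x\<bar> \<le> K * (x - b)\<^sup>2" for x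
  proof (cases "a < x \<and> x < b")
    case True
    define q where "q = (x - a) * (b - x)"
    define r where "r = inverse q"
    have q: "q > 0" using True by (simp add: q_def)
    then have r: "r > 0" "r * q = 1" by (simp_all add: r_def)
    have "r ^ m = r ^ (m + 2) * q\<^sup>2"
      using r(2) by (simp add: power_add power2_eq_square) (metis mult.assoc mult.commute mult.left_neutral)
    then have "r ^ m * exp (- r) = (r ^ (m + 2) * exp (- r)) * q\<^sup>2"
      by (simp only: mult.assoc mult.commute mult.left_commute)
    also have "\<dots> \<le> fact (m + 2) * q\<^sup>2"
      by (intro mult_right_mono power_exp_le) (use r in auto)
    finally have e: "r ^ m * exp (- r) \<le> fact (m + 2) * q\<^sup>2" .
    have "\<bar>bump a b p m x\<bar> = \<bar>poly p x\<bar> * (r ^ m * exp (- r))"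
      using True r by (simp add: bump_def abs_mult q_def r_def mult.assoc)
    also have "\<dots> \<le> P * (fact (m + 2) * q\<^sup>2)"
      by (rule mult_mono[OF P(1) e]) (use True r P(2) in auto)
    finally have b: "\<bar>bump a b p m x\<bar> \<le> P * fact (m + 2) * q\<^sup>2" by (simp only: mult.assoc)
    have qq: "q\<^sup>2 = (x - a)\<^sup>2 * (b - x)\<^sup>2" by (simp add: q_def power_mult_distrib)
    have "q\<^sup>2 \<le> (b - a)\<^sup>2 * (x - a)\<^sup>2"
    proof -
      have "(b - x)\<^sup>2 \<le> (b - a)\<^sup>2" using True by (intro power_mono) auto
      then show ?thesis unfolding qq by (subst mult.commute) (intro mult_right_mono, auto)
    qed
    moreover have "q\<^sup>2 \<le> (b - a)\<^sup>2 * (x - b)\<^sup>2"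
    proof -
      have "(x - a)\<^sup>2 \<le> (b - a)\<^sup>2" using True by (intro power_mono) auto
      then show ?thesis unfolding qq power2_commute[of x b] by (intro mult_right_mono) auto
    qed
    ultimately show ?thesis
      using order_trans[OF b mult_left_mono] P(2) unfolding K_def by (simp add: mult.assoc)
  next
    case False
    then have "bump a b p m x = 0" by (simp only: bump_def if_False)
    then show ?thesis using K by simp
  qed
  then show ?thesis by blast
qed

lemma bump_DERIV:
  "\<exists>p'. \<forall>x. (bump a b p m has_real_derivative bump a b p' (m + 2) x) (at x)"
proof -
  define Q where "Q = [:- a, 1:] * [:b, - 1:]"
  have Q: "poly Q x = (x - a) * (b - x)" for x
    by (simp add: Q_def algebra_simps)
  \<comment> \<open>The derivatives of p, of the power of \<open>1 / Q\<close> and of the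
    exponential, brought to the common denominator \<open>Q ^ (m + 2)\<close>.\<close>
  define p' where "p' = pderiv p * Q\<^sup>2 - of_nat m * p * pderiv Q * Q + p * pderiv Q"
  obtain K where K: "\<And>x. \<bar>bump a b p m x\<bar> \<le> K * (x - a)\<^sup>2" "\<And>x. \<bar>bump a b p m x\<bar> \<le> K * (x - b)\<^sup>2"
    using bump_bound by blast
  have "(bump a b p m has_real_derivative bump a b p' (m + 2) x) (at x)" for x
  proof -
    consider "a < x" "x < b" | "x < a \<or> x > b" | "x = a" | "x = b" by linarith
    then show ?thesis
    proof cases
      case 1
      define r where "r = inverse (poly Q x)"
      have "poly Q x \<noteq> 0" using 1 by (simp add: Q)
      then have rQ: "r * poly Q x = 1" by (simp add: r_def)
      have d: "((\<lambda>x. inverse (poly Q x)) has_real_derivative - (poly (pderiv Q) x * r\<^sup>2)) (at x)"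
        using DERIV_inverse_fun[OF poly_DERIV[of Q x] \<open>poly Q x \<noteq> 0\<close>] by (simp add: r_def power_inverse numeral_2_eq_2)
      have pw: "((\<lambda>x. inverse (poly Q x) ^ m) has_real_derivative - (of_nat m * poly (pderiv Q) x * r ^ (m + 1))) (at x)"
      proof (cases m)
        case (Suc j)
        from DERIV_power[OF d, of m] show ?thesis
          by (simp add: Suc r_def[symmetric] power2_eq_square algebra_simps)
      qed simp
      have ex: "((\<lambda>x. exp (- inverse (poly Q x))) has_real_derivative exp (- r) * (poly (pderiv Q) x * r\<^sup>2)) (at x)"
        using DERIV_fun_exp[OF DERIV_minus[OF d]] by (simp add: r_def)
      have q2: "(poly Q x)\<^sup>2 * r ^ (m + 2) = r ^ m" and q1: "poly Q x * r ^ (m + 2) = r ^ (m + 1)"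
        using rQ by (simp_all add: power_add power2_eq_square) (metis mult.assoc mult.commute mult.left_neutral)+
      have "((\<lambda>x. poly p x * inverse (poly Q x) ^ m * exp (- inverse (poly Q x))) has_real_derivative
          poly p' x * r ^ (m + 2) * exp (- r)) (at x)"
      proof (rule DERIV_cong[OF DERIV_mult[OF DERIV_mult[OF poly_DERIV pw] ex]])
        have "poly p' x * r ^ (m + 2) = poly (pderiv p) x * ((poly Q x)\<^sup>2 * r ^ (m + 2))
            - of_nat m * poly p x * poly (pderiv Q) x * (poly Q x * r ^ (m + 2)) + poly p x * poly (pderiv Q) x * r ^ (m + 2)"
          by (simp add: p'_def algebra_simps)
        also have "\<dots> = poly (pderiv p) x * r ^ m - of_nat m * poly p x * poly (pderiv Q) x * r ^ (m + 1) + poly p x * poly (pderiv Q) x * r ^ (m + 2)"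
          unfolding q2 q1 ..
        finally have E: "poly p' x * r ^ (m + 2) = \<dots>" .
        show "(poly (pderiv p) x * inverse (poly Q x) ^ m + - (of_nat m * poly (pderiv Q) x * r ^ (m + 1)) * poly p x) * exp (- inverse (poly Q x))
            + exp (- r) * (poly (pderiv Q) x * r\<^sup>2) * (poly p x * inverse (poly Q x) ^ m) = poly p' x * r ^ (m + 2) * exp (- r)"
          unfolding r_def[symmetric] E by (simp add: power_add power2_eq_square algebra_simps)
      qed
      then have "(bump a b p m has_real_derivative poly p' x * r ^ (m + 2) * exp (- r)) (at x)"
        by (rule has_field_derivative_transform_within_open[where S = "{a<..<b}"]) (use 1 in \<open>auto simp: bump_def Q\<close>)
      then show ?thesis using 1 by (simp add: bump_def r_def Q)
    next
      case 2
      have "((\<lambda>x. 0) has_real_derivative 0) (at x)" by simp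
      then have "(bump a b p m has_real_derivative 0) (at x)"
        by (rule has_field_derivative_transform_within_open[where S = "{..<a} \<union> {b<..}"]) (use 2 in \<open>auto simp: bump_def\<close>)
      then show ?thesis using 2 by (auto simp: bump_def)
    next
      case 3
      then show ?thesis using DERIV_zero_quadratic[of "bump a b p m" K a] K(1) by (simp add: bump_def)
    next
      case 4
      then show ?thesis using DERIV_zero_quadratic[of "bump a b p m" K b] K(2) by (simp add: bump_def)
    qed
  qed
  then show ?thesis by blast
qed

lemma smooth_bump: "smooth (bump a b p m)"
proof (rule smooth_coinduct[where S = "{bump a b p m | p m. True}"])
  fix g assume "g \<in> {bump a b p m | p m. True}"
  then obtain p m where g: "g = bump a b p m" by blast
  show "\<exists>h\<in>{bump a b p m | p m. True}. \<forall>x. (g has_real_derivative h x) (at x)"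
    unfolding g using bump_DERIV[of a b p m] by blast
qed blast

text \<open>A normalised primitive of a bump on \<open>(c, c + h)\<close>. As h shrinks it
  approximates a jump at c, and its derivative is an approximate identity concentrating at c from
  the right.\<close>

lemma smooth_step_exists:
  assumes c: "0 < c" and h: "0 < h"
  shows "\<exists>s. smooth s \<and> (\<forall>x. 0 \<le> s x \<and> s x \<le> 1) \<and> (\<forall>x\<le>c. s x = 0) \<and> (\<forall>x\<ge>c + h. s x = 1) \<and> (\<forall>x. 0 \<le> deriv s x)"
proof -
  define \<beta> where "\<beta> = bump c (c + h) 1 0"
  have sm: "smooth \<beta>" unfolding \<beta>_def by (rule smooth_bump)
  have \<beta>0: "0 \<le> \<beta> x" "x \<le> c \<Longrightarrow> \<beta> x = 0" "x \<ge> c + h \<Longrightarrow> \<beta> x = 0" for x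
    by (auto simp: \<beta>_def bump_def)
  have int: "\<beta> integrable_on {x..y}" for x y
    by (intro integrable_continuous_interval smooth_continuous sm)
  \<comment> \<open>Starting at 0 is the same as starting at c because the bump vanishes below c;
    for negative x the interval is empty and the value 0 is again correct.\<close>
  define F where "F x = integral {0..x} \<beta>" for x
  have zero: "F x = 0" if "x \<le> c" for x
    unfolding F_def by (rule integral_eq_0_iff[THEN iffD2] integral_cong[THEN trans, of _ _ "\<lambda>_. 0"])
      (use that \<beta>0 in \<open>auto simp: smooth_continuous sm\<close>)
  have DF: "(F has_real_derivative \<beta> x) (at x)" for x
  proof (cases "x < c")
    case True
    have "((\<lambda>x. 0) has_real_derivative 0) (at x)" by simp
    then have "(F has_real_derivative 0) (at x)"
      by (rule has_field_derivative_transform_within_open[where S = "{..<c}"]) (use True zero in auto)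
    then show ?thesis using \<beta>0(2)[of x] True by simp
  next
    case False
    then have x: "x \<in> {0<..<x + 1}" using c by auto
    have "(F has_real_derivative \<beta> x) (at x within {0..x + 1})"
      unfolding F_def by (rule integral_has_real_derivative[OF smooth_continuous[OF sm]]) (use x in auto)
    then have "(F has_real_derivative \<beta> x) (at x within {0<..<x + 1})"
      by (rule DERIV_subset) (rule greaterThanLessThan_subseteq_atLeastAtMost_iff[THEN iffD2], simp)
    then show ?thesis
      by (simp only: at_within_open[OF x open_greaterThanLessThan])
  qed
  have smF: "smooth F" by (rule smooth_primitive[OF DF sm])
  have mono: "F x \<le> F y" if "x \<le> y" for x y
    by (rule DERIV_nonneg_imp_nondecreasing[OF that]) (use DF \<beta>0(1) in blast)
  have const: "F x = F (c + h)" if "x \<ge> c + h" for x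
  proof (cases "x = c + h")
    case False
    have "F x = F (c + h)"
    proof (rule DERIV_isconst2[of "c + h" x])
      show "continuous_on {c + h..x} F" by (intro smooth_continuous smF)
      show "(F has_real_derivative 0) (at y)" if "c + h < y" "y < x" for y
        using DF[of y] \<beta>0(3)[of y] that by simp
    qed (use that False in auto)
    then show ?thesis .
  qed simp
  define J where "J = F (c + h)"
  have J: "J > 0"
  proof -
    have pos: "\<exists>y. DERIV F x :> y \<and> 0 < y" if "c < x" "x < c + h" for x
    proof -
      have "0 < \<beta> x" using that by (simp add: \<beta>_def bump_def)
      then show ?thesis using DF by blast
    qed
    have "c < c + h" using h by simp
    from DERIV_pos_imp_increasing_open[OF this pos smooth_continuous[OF smF]]
    have "F c < F (c + h)" by blast
    then show ?thesis using zero by (simp add: J_def)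
  qed
  define s where "s x = F x / J" for x
  have s: "smooth s"
    using smooth_linear[OF smF smF, of "1 / J" 0] by (simp add: s_def[abs_def])
  have Ds: "deriv s x = \<beta> x / J" for x
    unfolding s_def[abs_def] by (intro DERIV_imp_deriv DERIV_cdivide DF)
  have "0 \<le> s x \<and> s x \<le> 1" for x
  proof -
    have "0 \<le> F x" using mono[of "min x 0" x] zero[of "min x 0"] c by simp
    moreover have "F x \<le> J" using mono[of x "max x (c + h)"] const[of "max x (c + h)"] by (simp add: J_def)
    ultimately show ?thesis using J by (simp add: s_def)
  qed
  moreover have "s x = 0" if "x \<le> c" for x using zero[OF that] by (simp add: s_def)
  moreover have "s x = 1" if "x \<ge> c + h" for x using const[OF that] J by (simp add: s_def J_def)
  moreover have "0 \<le> deriv s x" for x using \<beta>0(1)[of x] J by (simp add: Ds)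
  ultimately show ?thesis using s by blast
qed

lemma test_functions_iff: "\<psi> \<in> test_functions T \<longleftrightarrow> smooth \<psi> \<and> compact (closure {x. \<psi> x \<noteq> 0}) \<and> closure {x. \<psi> x \<noteq> 0} \<subseteq> {0<..<T}"
  by (simp add: test_functions_def smooth_def)

lemma test_functionsI:
  assumes "smooth \<psi>" "0 < c" "d < T" "\<And>x. x \<notin> {c..d} \<Longrightarrow> \<psi> x = 0"
  shows "\<psi> \<in> test_functions T"
proof -
  have "x \<in> {c..d}" if "\<psi> x \<noteq> 0" for x
    using assms(4)[of x] that by blast
  then have sub: "closure {x. \<psi> x \<noteq> 0} \<subseteq> {c..d}"
    by (intro closure_minimal) auto
  have "bounded (closure {x. \<psi> x \<noteq> 0})"
    by (rule bounded_subset[OF _ sub]) simp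
  then have "compact (closure {x. \<psi> x \<noteq> 0})"
    by (simp add: compact_eq_bounded_closed)
  then show ?thesis
    unfolding test_functions_iff using assms(1-3) sub by (auto dest!: subsetD)
qed

lemma test_function_outside: "\<psi> \<in> test_functions T \<Longrightarrow> x \<notin> {0<..<T} \<Longrightarrow> \<psi> x = 0"
  unfolding test_functions_iff using closure_subset[of "{x. \<psi> x \<noteq> 0}"] by blast

section \<open>The weak and the Duhamel form of a scalar equation\<close>

lemma continuous_set_integrable:
  fixes y :: "real \<Rightarrow> real"
  assumes "continuous_on {0..T} y"
  shows "integrable lborel (\<lambda>r. indicator {0<..<T} r * y r)"
proof -
  have "set_integrable lborel {0..T} y"
    by (rule borel_integrable_atLeastAtMost'[OF assms])
  then have "set_integrable lborel {0<..<T} y"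
    by (rule set_integrable_subset) auto
  then show ?thesis by (simp add: set_integrable_def)
qed

lemma integrable_mult_continuous:
  fixes g y :: "real \<Rightarrow> real"
  assumes g: "integrable lborel (\<lambda>r. indicator {0<..<T} r * g r)" and y: "continuous_on UNIV y"
  shows "integrable lborel (\<lambda>r. indicator {0<..<T} r * (g r * y r))"
proof -
  have "bounded (y ` {0..T})"
    by (intro compact_imp_bounded compact_continuous_image continuous_on_subset[OF y]) auto
  then obtain B where B: "\<And>x. 0 \<le> x \<Longrightarrow> x \<le> T \<Longrightarrow> \<bar>y x\<bar> \<le> B"
    unfolding bounded_iff by force
  have ym[measurable]: "y \<in> borel_measurable borel" by (rule borel_measurable_continuous_onI[OF y])
  have gm[measurable]: "(\<lambda>r. indicator {0<..<T} r * g r) \<in> borel_measurable borel"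
    using borel_measurable_integrable[OF g] by simp
  show ?thesis
  proof (rule Bochner_Integration.integrable_bound[OF integrable_mult_right[OF g, of B]])
    have "(\<lambda>r. (indicator {0<..<T} r * g r) * y r) \<in> borel_measurable borel" by measurable
    then show "(\<lambda>r. indicator {0<..<T} r * (g r * y r)) \<in> borel_measurable lborel" by (simp add: mult.assoc)
    show "AE r in lborel. norm (indicator {0<..<T} r * (g r * y r)) \<le> norm (B * (indicator {0<..<T} r * g r))"
    proof (rule AE_I2)
      fix r
      show "norm (indicator {0<..<T} r * (g r * y r)) \<le> norm (B * (indicator {0<..<T} r * g r))"
      proof (cases "r \<in> {0<..<T}")
        case True
        then have "\<bar>g r\<bar> * \<bar>y r\<bar> \<le> \<bar>g r\<bar> * \<bar>B\<bar>"
          using B[of r] by (intro mult_left_mono) auto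
        then show ?thesis using True by (simp add: abs_mult mult.commute)
      qed simp
    qed
  qed
qed

lemma smooth_FTC:
  assumes s: "smooth s" and ab: "a \<le> b"
  shows "(LINT r|lborel. indicator {a<..<b} r * deriv s r) = s b - s a"
proof -
  have "(LINT r|lborel. indicator {a<..<b} r * deriv s r) = (LINT r|lborel. indicator {a..b} r *\<^sub>R deriv s r)"
  proof (rule integral_cong_AE)
    have [measurable]: "deriv s \<in> borel_measurable borel" by (intro smooth_measurable smooth_deriv s)
    show "(\<lambda>r. indicator {a<..<b} r * deriv s r) \<in> borel_measurable lborel" "(\<lambda>r. indicator {a..b} r *\<^sub>R deriv s r) \<in> borel_measurable lborel"
      by measurable
    show "AE r in lborel. indicator {a<..<b} r * deriv s r = indicator {a..b} r *\<^sub>R deriv s r"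
      using AE_lborel_singleton[of a] AE_lborel_singleton[of b] by eventually_elim (auto simp: indicator_def)
  qed
  also have "\<dots> = s b - s a"
  proof (rule integral_FTC_Icc[OF ab])
    show "(s has_vector_derivative deriv s x) (at x within {a..b})" for x
      using smooth_DERIV[OF s, of x] by (simp add: has_real_derivative_iff_has_vector_derivative has_vector_derivative_at_within)
    show "continuous_on {a..b} (deriv s)" by (intro smooth_continuous smooth_deriv s)
  qed
  finally show ?thesis .
qed

text \<open>The multiplier \<open>exp (a t)\<close> in the test function turns the weak equation into the integrated Duhamel formula.\<close>

lemma weak_scalar:
  fixes y g :: "real \<Rightarrow> real"
  assumes y: "continuous_on {0..T} y" and g: "integrable lborel (\<lambda>r. indicator {0<..<T} r * g r)"
    and weak: "\<And>\<psi>. \<psi> \<in> test_functions T \<Longrightarrow>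
      - (LINT r|lborel. indicator {0<..<T} r * (y r * deriv \<psi> r)) + a * (LINT r|lborel. indicator {0<..<T} r * (y r * \<psi> r))
      = (LINT r|lborel. indicator {0<..<T} r * (g r * \<psi> r))"
    and cd: "0 < c" "c < d" "d < T"
  shows "exp (a * d) * y d - exp (a * c) * y c = (LINT r|lborel. indicator {c<..<d} r * (exp (a * r) * g r))"
proof -
  let ?I = "\<lambda>r. indicator {0<..<T} r :: real"
  define Y where "Y r = exp (a * r) * y r" for r
  have Y: "continuous_on {0..T} Y" unfolding Y_def by (intro continuous_intros y)
  \<comment> \<open>The widths h start late enough for the two transition zones
    \<open>(c, c + h n)\<close> and \<open>(d, d + h n)\<close> to end before d and before
    T.\<close>
  obtain N :: nat where N: "1 / real (Suc N) < min (d - c) (T - d)"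
    using nat_approx_posE[of "min (d - c) (T - d)"] cd by auto
  define h where "h n = 1 / real (Suc (N + n))" for n
  have h: "0 < h n" "c + h n < d" "d + h n < T" for n
  proof -
    have "h n \<le> 1 / real (Suc N)" unfolding h_def by (intro divide_left_mono) auto
    then show "0 < h n" "c + h n < d" "d + h n < T" using N by (auto simp: h_def)
  qed
  have h0: "h \<longlonglongrightarrow> 0"
    unfolding h_def using LIMSEQ_ignore_initial_segment[OF LIMSEQ_inverse_real_of_nat, of N]
    by (simp add: inverse_eq_divide add.commute)
  have steps: "\<exists>s. \<forall>n. smooth (s n) \<and> (\<forall>x. 0 \<le> s n x \<and> s n x \<le> 1) \<and> (\<forall>x\<le>e. s n x = 0) \<and> (\<forall>x\<ge>e + h n. s n x = 1) \<and> (\<forall>x. 0 \<le> deriv (s n) x)" if "0 < e" for e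
    using choice[of "\<lambda>n s. smooth s \<and> (\<forall>x. 0 \<le> s x \<and> s x \<le> 1) \<and> (\<forall>x\<le>e. s x = 0) \<and> (\<forall>x\<ge>e + h n. s x = 1) \<and> (\<forall>x. 0 \<le> deriv s x)"]
      smooth_step_exists[OF that h(1)] by blast
  \<comment> \<open>The derivative of a step is nonnegative, has integral 1 and lives on
    \<open>{e..e + h n}\<close>. Continuity of Y at e is therefore enough for the limit.\<close>
  have mass: "(\<lambda>n. LINT r|lborel. ?I r * (Y r * deriv (s n) r)) \<longlonglongrightarrow> Y e"
    if e: "0 < e" "\<And>n. e + h n < T" and s: "\<And>n. smooth (s n) \<and> (\<forall>x. 0 \<le> s n x \<and> s n x \<le> 1) \<and> (\<forall>x\<le>e. s n x = 0) \<and> (\<forall>x\<ge>e + h n. s n x = 1) \<and> (\<forall>x. 0 \<le> deriv (s n) x)" for e s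
  proof -
    have sd: "smooth (s n)" "continuous_on A (deriv (s n))" "0 \<le> deriv (s n) x" for n A x
      using s[of n] smooth_continuous[OF smooth_deriv] by blast+
    have supp: "deriv (s n) x = 0" if "x \<notin> {e..e + h n}" for n x
    proof -
      have "((\<lambda>x. s n x) has_real_derivative 0) (at x)"
      proof (cases "x < e")
        case True
        have "((\<lambda>x. 0) has_real_derivative 0) (at x)" by simp
        then show ?thesis
          by (rule has_field_derivative_transform_within_open[where S = "{..<e}"]) (use True s[of n] in auto)
      next
        case False
        have "((\<lambda>x. 1) has_real_derivative 0) (at x)" by simp
        then show ?thesis
          by (rule has_field_derivative_transform_within_open[where S = "{e + h n<..}"]) (use False that s[of n] in auto)
      qed
      then show ?thesis by (rule DERIV_imp_deriv)
    qed
    have one: "(LINT r|lborel. ?I r * deriv (s n) r) = 1" for n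
    proof -
      have "s n T = 1" "s n 0 = 0" using s[of n] e(1) e(2)[of n] by auto
      then show ?thesis using smooth_FTC[OF sd(1), of 0 T n] cd by simp
    qed
    have int1: "integrable lborel (\<lambda>r. ?I r * deriv (s n) r)" for n
      by (intro continuous_set_integrable sd)
    have int2: "integrable lborel (\<lambda>r. ?I r * (Y r * deriv (s n) r))" for n
      by (intro continuous_set_integrable continuous_intros Y sd)
    have eT: "e \<in> {0..T}" using e(1) e(2)[of 0] h(1)[of 0] by auto
    show ?thesis
    proof (rule LIMSEQ_I)
      fix \<epsilon> :: real assume \<epsilon>: "0 < \<epsilon>"
      obtain \<delta> where \<delta>: "\<delta> > 0" "\<And>r. r \<in> {0..T} \<Longrightarrow> dist r e < \<delta> \<Longrightarrow> dist (Y r) (Y e) < \<epsilon> / 2"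
        using Y[unfolded continuous_on_iff, rule_format, OF eT, of "\<epsilon> / 2"] \<epsilon> by auto
      obtain n0 where n0: "\<And>n. n \<ge> n0 \<Longrightarrow> h n < \<delta>"
        using order_tendstoD(2)[OF h0 \<delta>(1)] unfolding eventually_sequentially by blast
      have "norm ((LINT r|lborel. ?I r * (Y r * deriv (s n) r)) - Y e) < \<epsilon>" if "n \<ge> n0" for n
      proof -
        have "(LINT r|lborel. ?I r * (Y r * deriv (s n) r)) - Y e = (LINT r|lborel. ?I r * (Y r * deriv (s n) r)) - (LINT r|lborel. Y e * (?I r * deriv (s n) r))"
          using one by simp
        also have "\<dots> = (LINT r|lborel. ?I r * (Y r * deriv (s n) r) - Y e * (?I r * deriv (s n) r))"
          by (intro Bochner_Integration.integral_diff[symmetric] int2 integrable_mult_right int1)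
        finally have "norm ((LINT r|lborel. ?I r * (Y r * deriv (s n) r)) - Y e) \<le> (LINT r|lborel. norm (?I r * (Y r * deriv (s n) r) - Y e * (?I r * deriv (s n) r)))"
          using integral_norm_bound by simp
        also have "\<dots> \<le> (LINT r|lborel. \<epsilon> / 2 * (?I r * deriv (s n) r))"
        proof (rule integral_mono)
          show "integrable lborel (\<lambda>r. norm (?I r * (Y r * deriv (s n) r) - Y e * (?I r * deriv (s n) r)))"
            by (intro integrable_norm Bochner_Integration.integrable_diff int2 integrable_mult_right int1)
          show "integrable lborel (\<lambda>r. \<epsilon> / 2 * (?I r * deriv (s n) r))"
            by (intro integrable_mult_right int1)
          fix r
          show "norm (?I r * (Y r * deriv (s n) r) - Y e * (?I r * deriv (s n) r)) \<le> \<epsilon> / 2 * (?I r * deriv (s n) r)"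
          proof (cases "r \<in> {0<..<T} \<and> r \<in> {e..e + h n}")
            case True
            have "\<bar>Y r - Y e\<bar> \<le> \<epsilon> / 2"
              using \<delta>(2)[of r] True n0[OF that] by (auto simp: dist_real_def)
            then have "\<bar>Y r - Y e\<bar> * deriv (s n) r \<le> \<epsilon> / 2 * deriv (s n) r"
              by (intro mult_right_mono sd)
            moreover have "?I r * (Y r * deriv (s n) r) - Y e * (?I r * deriv (s n) r) = (Y r - Y e) * deriv (s n) r"
              using True by (simp add: algebra_simps)
            moreover have "norm ((Y r - Y e) * deriv (s n) r) = \<bar>Y r - Y e\<bar> * deriv (s n) r"
              using sd(3)[of n r] by (simp add: abs_mult)
            moreover have "?I r = 1" using True by simp
            ultimately show ?thesis by (simp only: mult_1_left)
          next
            case False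
            then have "?I r * deriv (s n) r = 0" using supp[of r n] by auto
            moreover from this have "?I r * (Y r * deriv (s n) r) = 0" by auto
            ultimately show ?thesis by (simp only: mult_zero_right diff_self norm_zero order_refl)
          qed
        qed
        also have "\<dots> = \<epsilon> / 2" using one[of n] by simp
        finally show ?thesis using \<epsilon> by linarith
      qed
      then show "\<exists>no. \<forall>n\<ge>no. norm ((LINT r|lborel. ?I r * (Y r * deriv (s n) r)) - Y e) < \<epsilon>" by blast
    qed
  qed
  obtain s where s: "\<And>n. smooth (s n) \<and> (\<forall>x. 0 \<le> s n x \<and> s n x \<le> 1) \<and> (\<forall>x\<le>c. s n x = 0) \<and> (\<forall>x\<ge>c + h n. s n x = 1) \<and> (\<forall>x. 0 \<le> deriv (s n) x)"
    using steps[of c] cd by blast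
  obtain s' where s': "\<And>n. smooth (s' n) \<and> (\<forall>x. 0 \<le> s' n x \<and> s' n x \<le> 1) \<and> (\<forall>x\<le>d. s' n x = 0) \<and> (\<forall>x\<ge>d + h n. s' n x = 1) \<and> (\<forall>x. 0 \<le> deriv (s' n) x)"
    using steps[of d] cd by auto
  \<comment> \<open>A smooth approximation of the indicator of \<open>(c, d)\<close>, rising just
    after c and falling just after d.\<close>
  define cut where "cut n x = s n x - s' n x" for n x
  have sm: "smooth (s n)" "smooth (s' n)" for n using s s' by blast+
  have cuts: "smooth (cut n)" for n
    using smooth_linear[OF sm(1)[of n] sm(2)[of n], of 1 "- 1"] by (simp add: cut_def[abs_def])
  have cutd: "deriv (cut n) x = deriv (s n) x - deriv (s' n) x" for n x
    unfolding cut_def[abs_def] by (intro DERIV_imp_deriv DERIV_diff smooth_DERIV sm)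
  have cutout: "cut n x = 0" if "x \<notin> {c..d + h n}" for n x
    using that s[of n] s'[of n] h(1)[of n] h(2)[of n] by (cases "x < c") (auto simp: cut_def)
  have cut1: "\<bar>cut n x\<bar> \<le> 1" for n x
  proof -
    have "0 \<le> s n x" "s n x \<le> 1" "0 \<le> s' n x" "s' n x \<le> 1" using s[of n] s'[of n] by blast+
    then show ?thesis unfolding cut_def by linarith
  qed
  define G where "G r = exp (a * r) * g r" for r
  have G: "integrable lborel (\<lambda>r. ?I r * G r)"
  proof -
    have "integrable lborel (\<lambda>r. ?I r * (g r * exp (a * r)))"
      by (intro integrable_mult_continuous g continuous_intros)
    then show ?thesis by (simp add: G_def mult.commute)
  qed
  \<comment> \<open>Differentiating the exponential factor of the test function produces exactly the
    zeroth-order term of the weak equation. The two cancel, and only the derivative of the cutoff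
    acts on Y.\<close>
  have key: "- (LINT r|lborel. ?I r * (Y r * deriv (cut n) r)) = (LINT r|lborel. ?I r * G r * cut n r)" for n
  proof -
    define \<psi> where "\<psi> x = exp (a * x) * cut n x" for x
    have "\<psi> \<in> test_functions T"
    proof (rule test_functionsI[of _ c "d + h n"])
      show "smooth \<psi>" unfolding \<psi>_def[abs_def] by (intro smooth_exp_mult cuts)
    qed (use cd h cutout in \<open>auto simp: \<psi>_def\<close>)
    note w = weak[OF this]
    have D: "deriv \<psi> x = exp (a * x) * (a * cut n x + deriv (cut n) x)" for x
      unfolding \<psi>_def[abs_def] by (intro DERIV_imp_deriv DERIV_exp_mult cuts)
    have i1: "integrable lborel (\<lambda>r. ?I r * (y r * \<psi> r))"
      unfolding \<psi>_def by (intro continuous_set_integrable continuous_intros y smooth_continuous cuts)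
    have i2: "integrable lborel (\<lambda>r. ?I r * (Y r * deriv (cut n) r))"
      by (intro continuous_set_integrable continuous_intros Y smooth_continuous smooth_deriv cuts)
    have "(LINT r|lborel. ?I r * (y r * deriv \<psi> r)) = (LINT r|lborel. a * (?I r * (y r * \<psi> r)) + ?I r * (Y r * deriv (cut n) r))"
      by (intro Bochner_Integration.integral_cong refl) (simp add: D Y_def \<psi>_def algebra_simps)
    also have "\<dots> = a * (LINT r|lborel. ?I r * (y r * \<psi> r)) + (LINT r|lborel. ?I r * (Y r * deriv (cut n) r))"
      using i1 i2 by simp
    finally have "- (LINT r|lborel. ?I r * (Y r * deriv (cut n) r)) = (LINT r|lborel. ?I r * (g r * \<psi> r))"
      using w by linarith
    also have "\<dots> = (LINT r|lborel. ?I r * G r * cut n r)"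
      by (intro Bochner_Integration.integral_cong refl) (simp add: G_def \<psi>_def algebra_simps)
    finally show ?thesis .
  qed
  have "(\<lambda>n. LINT r|lborel. ?I r * G r * cut n r) \<longlonglongrightarrow> (LINT r|lborel. indicator {c<..<d} r * G r)"
  proof (rule integral_dominated_convergence[where w = "\<lambda>r. norm (?I r * G r)"])
    have Gm[measurable]: "(\<lambda>r. ?I r * G r) \<in> borel_measurable borel"
      using borel_measurable_integrable[OF G] by simp
    have "(\<lambda>r. indicator {c<..<d} r * (?I r * G r)) \<in> borel_measurable borel" by measurable
    moreover have "indicator {c<..<d} r * (?I r * G r) = indicator {c<..<d} r * G r" for r
      using cd by (auto simp: indicator_def)
    ultimately show "(\<lambda>r. indicator {c<..<d} r * G r) \<in> borel_measurable lborel" by simp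
    have [measurable]: "cut n \<in> borel_measurable borel" for n by (rule smooth_measurable[OF cuts])
    show "(\<lambda>r. ?I r * G r * cut n r) \<in> borel_measurable lborel" for n by measurable
    show "integrable lborel (\<lambda>r. norm (?I r * G r))" by (rule integrable_norm[OF G])
    show "AE r in lborel. norm (?I r * G r * cut n r) \<le> norm (?I r * G r)" for n
      using mult_left_le[OF cut1] by (intro AE_I2) (simp add: abs_mult)
    show "AE r in lborel. (\<lambda>n. ?I r * G r * cut n r) \<longlonglongrightarrow> indicator {c<..<d} r * G r"
      using AE_lborel_singleton[of c] AE_lborel_singleton[of d]
    proof eventually_elim
      case (elim r)
      have "eventually (\<lambda>n. cut n r = indicator {c<..<d} r) sequentially"
      proof -
        have "eventually (\<lambda>n. h n < \<bar>r - c\<bar>) sequentially" "eventually (\<lambda>n. h n < \<bar>r - d\<bar>) sequentially"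
          using order_tendstoD(2)[OF h0] elim by auto
        then show ?thesis
        proof eventually_elim
          case (elim n)
          consider "r < c" | "c < r" "r < d" | "d < r"
            using \<open>r \<noteq> c\<close> \<open>r \<noteq> d\<close> by linarith
          then show ?case
          proof cases
            case 1
            then have "s n r = 0" "s' n r = 0" using s[of n] s'[of n] cd by auto
            then show ?thesis using 1 by (simp add: cut_def)
          next
            case 2
            then have "s n r = 1" "s' n r = 0" using s[of n] s'[of n] elim by auto
            then show ?thesis using 2 by (simp add: cut_def)
          next
            case 3
            then have "s n r = 1" "s' n r = 1" using s[of n] s'[of n] elim h(2)[of n] by auto
            then show ?thesis using 3 by (simp add: cut_def)
          qed
        qed
      qed
      then have "eventually (\<lambda>n. ?I r * G r * cut n r = indicator {c<..<d} r * G r) sequentially"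
        by eventually_elim (use cd in \<open>auto simp: indicator_def\<close>)
      then show ?case by (rule tendsto_eventually)
    qed
  qed
  moreover have "(\<lambda>n. - (LINT r|lborel. ?I r * (Y r * deriv (cut n) r))) \<longlonglongrightarrow> - (Y c - Y d)"
  proof -
    have "(LINT r|lborel. ?I r * (Y r * deriv (cut n) r)) = (LINT r|lborel. ?I r * (Y r * deriv (s n) r)) - (LINT r|lborel. ?I r * (Y r * deriv (s' n) r))" for n
    proof -
      have i: "integrable lborel (\<lambda>r. ?I r * (Y r * deriv (s n) r))" "integrable lborel (\<lambda>r. ?I r * (Y r * deriv (s' n) r))"
        by (intro continuous_set_integrable continuous_intros Y smooth_continuous smooth_deriv sm)+
      show ?thesis
        unfolding cutd Bochner_Integration.integral_diff[OF i, symmetric] by (simp add: algebra_simps)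
    qed
    moreover have "(\<lambda>n. LINT r|lborel. ?I r * (Y r * deriv (s n) r)) \<longlonglongrightarrow> Y c"
      by (rule mass[OF cd(1) _ s]) (use cd h in \<open>smt (verit)\<close>)
    moreover have "(\<lambda>n. LINT r|lborel. ?I r * (Y r * deriv (s' n) r)) \<longlonglongrightarrow> Y d"
      by (rule mass[OF _ h(3) s']) (use cd in linarith)
    ultimately show ?thesis by (simp only:) (intro tendsto_intros)
  qed
  ultimately have "- (Y c - Y d) = (LINT r|lborel. indicator {c<..<d} r * G r)"
    unfolding key by (metis LIMSEQ_unique)
  then show ?thesis by (simp add: Y_def G_def)
qed

section \<open>Weak solutions and mild solutions\<close>

lemma sum_integral_swap:
  fixes F :: "real \<Rightarrow> int^3 \<Rightarrow> real"
  assumes F: "\<And>k. (\<lambda>r. F r k) \<in> borel_measurable borel"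
    and fin: "(\<integral>\<^sup>+r. (\<integral>\<^sup>+k. ennreal \<bar>F r k\<bar> \<partial>count_space UNIV) \<partial>lborel) < \<infinity>"
  shows "(LINT r|lborel. LINT k|count_space UNIV. F r k) = (LINT k|count_space UNIV. LINT r|lborel. F r k)"
    and "integrable (count_space UNIV) (\<lambda>k. LINT r|lborel. F r k)"
proof -
  interpret C: sigma_finite_measure "count_space (UNIV :: (int^3) set)"
    by (rule sigma_finite_measure_count_space_countable) simp
  interpret pair_sigma_finite lborel "count_space (UNIV :: (int^3) set)" ..
  have m: "(\<lambda>(r, k). F r k) \<in> borel_measurable (lborel \<Otimes>\<^sub>M count_space UNIV)"
    unfolding case_prod_beta
  proof (rule measurable_compose_countable)
    show "(\<lambda>z. F (fst z) i) \<in> borel_measurable (lborel \<Otimes>\<^sub>M count_space UNIV)" for i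
      using F[of i] by measurable
    show "snd \<in> lborel \<Otimes>\<^sub>M count_space UNIV \<rightarrow>\<^sub>M count_space UNIV" by measurable
  qed
  have int: "integrable (lborel \<Otimes>\<^sub>M count_space UNIV) (\<lambda>(r, k). F r k)"
  proof (rule integrableI_bounded[OF m])
    have "(\<integral>\<^sup>+z. ennreal (norm (case z of (r, k) \<Rightarrow> F r k)) \<partial>(lborel \<Otimes>\<^sub>M count_space UNIV))
      = (\<integral>\<^sup>+r. (\<integral>\<^sup>+k. ennreal (norm (F r k)) \<partial>count_space UNIV) \<partial>lborel)"
      using m by (subst C.nn_integral_fst[symmetric]) auto
    then show "(\<integral>\<^sup>+z. ennreal (norm (case z of (r, k) \<Rightarrow> F r k)) \<partial>(lborel \<Otimes>\<^sub>M count_space UNIV)) < \<infinity>"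
      using fin by simp
  qed
  show "(LINT r|lborel. LINT k|count_space UNIV. F r k) = (LINT k|count_space UNIV. LINT r|lborel. F r k)"
    using Fubini_integral[OF int] by simp
  show "integrable (count_space UNIV) (\<lambda>k. LINT r|lborel. F r k)"
    using integrable_snd[OF int] by simp
qed

text \<open>Writes a time integral of a pairing as a sum over modes of scalar time integrals; all
  four terms of the weak identity have this form. P only has to agree with the pairing almost
  everywhere, which accommodates \<open>b_form\<close> and unmodified Bochner functions.\<close>

lemma time_pairing:
  fixes x :: "real \<Rightarrow> field" and \<phi> :: "real \<Rightarrow> real"
  assumes L: "L > 0" and x: "\<And>k. (\<lambda>r. x r k) \<in> borel_measurable borel" and x0: "\<And>r. x r 0 = 0"
    and fin: "cumul (\<lambda>r. en L s (x r)) T < \<infinity>" and v: "en L (- s) v < \<infinity>" and \<phi>: "continuous_on UNIV \<phi>"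
    and P: "AE r in lborel. 0 < r \<and> r < T \<longrightarrow> P r = pairing L (x r) v"
  shows "(LINT r|lebesgue_on {0<..<T}. P r * \<phi> r)
      = L ^ 3 * (LINT k|count_space UNIV. LINT r|lborel. indicator {0<..<T} r * (x r k \<bullet> v k * \<phi> r))"
    and "integrable (count_space UNIV) (\<lambda>k. LINT r|lborel. indicator {0<..<T} r * (x r k \<bullet> v k * \<phi> r))"
proof -
  note [measurable] = x
  have [measurable]: "\<phi> \<in> borel_measurable borel" by (rule borel_measurable_continuous_onI[OF \<phi>])
  have [measurable]: "(\<lambda>r. en L s (x r)) \<in> borel_measurable borel" by (intro en_measurable x)
  have "bounded (\<phi> ` {0..T})"
    by (intro compact_imp_bounded compact_continuous_image continuous_on_subset[OF \<phi>]) auto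
  then obtain B0 where B0: "\<And>r. 0 \<le> r \<Longrightarrow> r \<le> T \<Longrightarrow> \<bar>\<phi> r\<bar> \<le> B0"
    unfolding bounded_iff by force
  define B where "B = max B0 0"
  have B: "B \<ge> 0" "\<And>r. 0 \<le> r \<Longrightarrow> r \<le> T \<Longrightarrow> \<bar>\<phi> r\<bar> \<le> B"
    using B0 by (auto simp: B_def max.coboundedI1)
  define F where "F r k = indicator {0<..<T} r * (x r k \<bullet> v k * \<phi> r)" for r k
  have Fm: "(\<lambda>r. F r k) \<in> borel_measurable borel" for k unfolding F_def by measurable
  \<comment> \<open>Weighted by p and \<open>1 / p\<close>, the product of norms is at most the sum
    of two energy densities. This gives absolute integrability jointly in time and mode, hence
    Fubini.\<close>
  have prod_le: "\<bar>x r k \<bullet> v k\<bar> \<le> wave L k powr (2 * s) * (norm (x r k))\<^sup>2 + wave L k powr (2 * (- s)) * (norm (v k))\<^sup>2" for r k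
  proof (cases "k = 0")
    case False
    define p where "p = wave L k powr s"
    have p: "p > 0" using wave_pos[OF L False] by (simp add: p_def)
    have q: "1 / p = wave L k powr (- s)" by (simp add: p_def powr_minus_divide)
    have e: "wave L k powr (2 * s) = p\<^sup>2" "wave L k powr (2 * (- s)) = (1 / p)\<^sup>2"
      unfolding q by (simp_all only: p_def power2_eq_square powr_add[symmetric] mult_2)
    have gen: "X * Y \<le> X\<^sup>2 + Y\<^sup>2" if "X \<ge> 0" "Y \<ge> 0" for X Y :: real
      using sum_squares_bound[of X Y] mult_nonneg_nonneg[OF that] by linarith
    have "\<bar>x r k \<bullet> v k\<bar> \<le> norm (x r k) * norm (v k)" by (rule Cauchy_Schwarz_ineq2)
    also have "\<dots> = (p * norm (x r k)) * (1 / p * norm (v k))" using p by simp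
    also have "\<dots> \<le> (p * norm (x r k))\<^sup>2 + (1 / p * norm (v k))\<^sup>2"
      using p by (intro gen) auto
    finally show ?thesis unfolding e power_mult_distrib .
  qed (simp add: x0)
  have en_comb: "ennreal B * (ennreal p + ennreal q) = ennreal (B * (p + q))" if "p \<ge> 0" "q \<ge> 0" for p q
    using that B(1) by (simp add: ennreal_mult)
  have Fle: "(\<integral>\<^sup>+k. ennreal \<bar>F r k\<bar> \<partial>count_space UNIV) \<le> ennreal B * (en L s (x r) * indicator {0<..<T} r + en L (- s) v * indicator {0<..<T} r)" for r
  proof (cases "r \<in> {0<..<T}")
    case True
    have "(\<integral>\<^sup>+k. ennreal \<bar>F r k\<bar> \<partial>count_space UNIV)
      \<le> (\<integral>\<^sup>+k. ennreal B * (ennreal (wave L k powr (2 * s) * (norm (x r k))\<^sup>2) + ennreal (wave L k powr (2 * (- s)) * (norm (v k))\<^sup>2)) \<partial>count_space UNIV)"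
    proof (intro nn_integral_mono)
      fix k
      have "\<bar>F r k\<bar> \<le> B * (wave L k powr (2 * s) * (norm (x r k))\<^sup>2 + wave L k powr (2 * (- s)) * (norm (v k))\<^sup>2)"
        using mult_mono[OF B(2)[of r] prod_le[of r k]] True B(1) by (simp add: F_def abs_mult mult.commute)
      then show "ennreal \<bar>F r k\<bar> \<le> ennreal B * (ennreal (wave L k powr (2 * s) * (norm (x r k))\<^sup>2) + ennreal (wave L k powr (2 * (- s)) * (norm (v k))\<^sup>2))"
        unfolding en_comb[OF zero_le_power2[of "norm (x r k)", THEN mult_nonneg_nonneg[OF powr_ge_zero]] zero_le_power2[of "norm (v k)", THEN mult_nonneg_nonneg[OF powr_ge_zero]]]
        by (rule ennreal_leI)
    qed
    also have "\<dots> = ennreal B * (en L s (x r) + en L (- s) v)"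
      unfolding en_def by (simp add: nn_integral_cmult nn_integral_add)
    finally show ?thesis using True by simp
  qed (simp add: F_def)
  have "(\<integral>\<^sup>+r. (\<integral>\<^sup>+k. ennreal \<bar>F r k\<bar> \<partial>count_space UNIV) \<partial>lborel)
    \<le> (\<integral>\<^sup>+r. ennreal B * (en L s (x r) * indicator {0<..<T} r + en L (- s) v * indicator {0<..<T} r) \<partial>lborel)"
    by (intro nn_integral_mono Fle)
  also have "\<dots> = ennreal B * (cumul (\<lambda>r. en L s (x r)) T + cumul (\<lambda>r. en L (- s) v) T)"
    unfolding cumul_def by (subst nn_integral_cmult, measurable, subst nn_integral_add, measurable)
  also have "\<dots> \<le> ennreal B * (cumul (\<lambda>r. en L s (x r)) T + ennreal T * en L (- s) v)"
    by (intro mult_left_mono add_left_mono cumul_const) auto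
  also have "\<dots> < \<infinity>" using fin v by (simp add: ennreal_mult_less_top)
  finally have Ffin: "(\<integral>\<^sup>+r. (\<integral>\<^sup>+k. ennreal \<bar>F r k\<bar> \<partial>count_space UNIV) \<partial>lborel) < \<infinity>" .
  show "integrable (count_space UNIV) (\<lambda>k. LINT r|lborel. indicator {0<..<T} r * (x r k \<bullet> v k * \<phi> r))"
    using sum_integral_swap(2)[OF Fm Ffin] by (simp only: F_def)
  define g where "g r = L ^ 3 * (LINT k|count_space UNIV. x r k \<bullet> v k) * \<phi> r" for r
  have gm: "g \<in> borel_measurable borel"
  proof -
    have "(\<lambda>r. LINT k|count_space UNIV. x r k \<bullet> v k) \<in> borel_measurable borel"
      by (intro sum_measurable) measurable
    then show ?thesis unfolding g_def[abs_def] by measurable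
  qed
  have "AE r in lborel. en L s (x r) * indicator {0<..<T} r \<noteq> \<infinity>"
    using fin by (intro nn_integral_PInf_AE) (auto simp: cumul_def)
  then have ae: "AE r in lborel. r \<in> {0<..<T} \<longrightarrow> P r * \<phi> r = g r"
    using P
  proof eventually_elim
    case (elim r)
    show ?case
    proof
      assume r: "r \<in> {0<..<T}"
      then have xf: "en L s (x r) < \<infinity>" using elim(1) by (simp add: less_top)
      have "pairing L (x r) v = L ^ 3 * (LINT k|count_space UNIV. x r k \<bullet> v k)"
        by (rule pairing_eq_integral[OF L disjI1[OF x0] xf v])
      then show "P r * \<phi> r = g r" using elim(2) r by (simp add: g_def)
    qed
  qed
  have Fsum: "(LINT k|count_space UNIV. F r k) = indicator {0<..<T} r * (LINT k|count_space UNIV. x r k \<bullet> v k) * \<phi> r" for r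
  proof -
    have "(LINT k|count_space UNIV. F r k) = (LINT k|count_space UNIV. (indicator {0<..<T} r * \<phi> r) * (x r k \<bullet> v k))"
      by (intro Bochner_Integration.integral_cong) (auto simp: F_def)
    also have "\<dots> = (indicator {0<..<T} r * \<phi> r) * (LINT k|count_space UNIV. x r k \<bullet> v k)"
      by (rule integral_mult_right_zero)
    finally show ?thesis by simp
  qed
  have "(LINT r|lebesgue_on {0<..<T}. P r * \<phi> r) = (LINT r|lborel. indicator {0<..<T} r *\<^sub>R g r)"
    by (rule lebesgue_on_cong_AE(2)[OF _ gm ae]) simp
  also have "\<dots> = (LINT r|lborel. L ^ 3 * (LINT k|count_space UNIV. F r k))"
    unfolding Fsum by (intro Bochner_Integration.integral_cong) (auto simp: g_def)
  also have "\<dots> = L ^ 3 * (LINT r|lborel. LINT k|count_space UNIV. F r k)"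
    by (rule integral_mult_right_zero)
  also have "(LINT r|lborel. LINT k|count_space UNIV. F r k) = (LINT k|count_space UNIV. LINT r|lborel. F r k)"
    by (rule sum_integral_swap(1)[OF Fm Ffin])
  finally show "(LINT r|lebesgue_on {0<..<T}. P r * \<phi> r)
      = L ^ 3 * (LINT k|count_space UNIV. LINT r|lborel. indicator {0<..<T} r * (x r k \<bullet> v k * \<phi> r))"
    by (simp only: F_def)
qed

lemma integrable_inner_mult:
  fixes h :: "real \<Rightarrow> complex^3"
  assumes h: "integrable lborel (\<lambda>r. indicator {0<..<T} r *\<^sub>R h r)" and \<phi>: "continuous_on UNIV \<phi>"
  shows "integrable lborel (\<lambda>r. indicator {0<..<T} r * (h r \<bullet> c * \<phi> r))"
proof (rule integrable_mult_continuous[OF _ \<phi>])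
  have "integrable lborel (\<lambda>r. (indicator {0<..<T} r *\<^sub>R h r) \<bullet> c)"
    by (rule integrable_inner_left) (rule h)
  then show "integrable lborel (\<lambda>r. indicator {0<..<T} r * (h r \<bullet> c))"
    by (simp only: inner_scaleR_left)
qed

text \<open>With \<open>\<theta> t = exp (- a * t) * \<psi> t\<close>, the combination
  \<open>deriv \<psi> - a * \<psi>\<close> equals \<open>exp (a * t) * deriv \<theta>\<close>, and
  the exponential cancels against Duhamel's formula. Fubini on the triangle \<open>s < t\<close>
  leaves the integral of \<open>deriv \<theta>\<close> from s to T, which is minus \<theta> at
  s.\<close>

lemma duhamel_imp_weak:
  fixes h y :: "real \<Rightarrow> complex^3"
  assumes y: "\<And>t. 0 \<le> t \<Longrightarrow> t \<le> T \<Longrightarrow> y t = exp (- a * t) *\<^sub>R y0 + expconv a h t"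
    and h[measurable]: "h \<in> borel_measurable borel" and hi: "integrable lborel (\<lambda>r. indicator {0<..<T} r *\<^sub>R h r)"
    and yi: "integrable lborel (\<lambda>r. indicator {0<..<T} r *\<^sub>R y r)"
    and a: "a \<ge> 0" and \<psi>: "\<psi> \<in> test_functions T" and T: "T > 0"
  shows "- (LINT r|lborel. indicator {0<..<T} r * (y r \<bullet> c * deriv \<psi> r)) + a * (LINT r|lborel. indicator {0<..<T} r * (y r \<bullet> c * \<psi> r))
    = (LINT r|lborel. indicator {0<..<T} r * (h r \<bullet> c * \<psi> r))"
proof -
  let ?I = "\<lambda>r. indicator {0<..<T} r :: real"
  have sm: "smooth \<psi>" using \<psi> by (simp add: test_functions_iff)
  have sd: "smooth (deriv \<psi>)" by (rule smooth_deriv[OF sm])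
  define \<theta> where "\<theta> t = exp (- a * t) * \<psi> t" for t
  have s\<theta>: "smooth \<theta>" unfolding \<theta>_def[abs_def] by (rule smooth_exp_mult[OF sm])
  have d\<theta>: "deriv \<theta> t = exp (- a * t) * (- a * \<psi> t + deriv \<psi> t)" for t
    unfolding \<theta>_def[abs_def] by (rule DERIV_imp_deriv[OF DERIV_exp_mult[OF sm]])
  have [measurable]: "\<theta> \<in> borel_measurable borel" "deriv \<theta> \<in> borel_measurable borel"
    by (intro smooth_measurable smooth_deriv s\<theta>)+
  define G where "G s = exp (a * s) * (h s \<bullet> c)" for s
  have [measurable]: "G \<in> borel_measurable borel" unfolding G_def[abs_def] by measurable
  have Gi: "integrable lborel (\<lambda>s. ?I s * G s)"
    using integrable_inner_mult[OF hi, of "\<lambda>s. exp (a * s)" c] by (simp add: G_def mult.commute continuous_intros)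
  have Gi0: "integrable lborel (\<lambda>s. if 0 < s \<and> s < t then G s else 0)" if "t \<le> T" for t
    by (rule Bochner_Integration.integrable_bound[OF Gi]) (measurable, use that in \<open>auto simp: indicator_def\<close>)
  have ec: "exp (a * t) * (expconv a h t \<bullet> c) = (LINT s|lborel. (if 0 < s \<and> s < t then G s else 0))" if t: "t \<le> T" for t
  proof -
    have "expconv a h t \<bullet> c = (LINT s|lborel. (if 0 < s \<and> s < t then exp (- a * (t - s)) *\<^sub>R h s else 0) \<bullet> c)"
      unfolding expconv_def by (intro integral_inner_left[symmetric] expconv_integrable[OF hi h a t])
    then have "exp (a * t) * (expconv a h t \<bullet> c) = (LINT s|lborel. exp (a * t) * ((if 0 < s \<and> s < t then exp (- a * (t - s)) *\<^sub>R h s else 0) \<bullet> c))"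
      by simp
    also have "\<dots> = (LINT s|lborel. (if 0 < s \<and> s < t then G s else 0))"
    proof (intro Bochner_Integration.integral_cong refl)
      fix s
      have "exp (a * t) * (exp (- a * (t - s)) * (h s \<bullet> c)) = G s"
        unfolding G_def mult.assoc[symmetric] exp_add[symmetric] by (simp add: algebra_simps)
      then show "exp (a * t) * ((if 0 < s \<and> s < t then exp (- a * (t - s)) *\<^sub>R h s else 0) \<bullet> c) = (if 0 < s \<and> s < t then G s else 0)"
        by simp
    qed
    finally show ?thesis .
  qed
  have pt: "?I t * (y t \<bullet> c * (deriv \<psi> t - a * \<psi> t))
      = (y0 \<bullet> c) * (?I t * deriv \<theta> t) + (LINT s|lborel. ?I t * deriv \<theta> t * (if 0 < s \<and> s < t then G s else 0))" for t
  proof (cases "t \<in> {0<..<T}")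
    case True
    have e: "exp (a * t) * exp (- a * t) = 1" by (simp add: exp_add[symmetric])
    have "deriv \<psi> t - a * \<psi> t = exp (a * t) * deriv \<theta> t"
      unfolding d\<theta> mult.assoc[symmetric] e by simp
    then have "y t \<bullet> c * (deriv \<psi> t - a * \<psi> t) = deriv \<theta> t * (exp (a * t) * (y t \<bullet> c))" by simp
    also have "exp (a * t) * (y t \<bullet> c) = (exp (a * t) * exp (- a * t)) * (y0 \<bullet> c) + exp (a * t) * (expconv a h t \<bullet> c)"
      using True by (simp add: y inner_add_left distrib_left)
    also have "\<dots> = y0 \<bullet> c + (LINT s|lborel. (if 0 < s \<and> s < t then G s else 0))"
      unfolding e using ec[of t] True by simp
    finally have "y t \<bullet> c * (deriv \<psi> t - a * \<psi> t) = (y0 \<bullet> c) * deriv \<theta> t + deriv \<theta> t * (LINT s|lborel. (if 0 < s \<and> s < t then G s else 0))"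
      by (simp add: distrib_left mult.commute)
    then show ?thesis using True by (simp del: integral_mult_right)
  qed simp
  have "bounded (deriv \<theta> ` {0..T})"
    by (intro compact_imp_bounded compact_continuous_image smooth_continuous smooth_deriv s\<theta>) auto
  then obtain B where B: "\<And>r. 0 \<le> r \<Longrightarrow> r \<le> T \<Longrightarrow> \<bar>deriv \<theta> r\<bar> \<le> B"
    unfolding bounded_iff by force
  have Ii: "integrable lborel (\<lambda>t. ?I t)" using T by (intro integrable_real_indicator) auto
  have prod: "integrable (lborel \<Otimes>\<^sub>M lborel) (\<lambda>(t, s). ?I t * (B * (?I s * G s)))"
  proof (rule lborel_pair.Fubini_integrable)
    show "(\<lambda>(t, s). ?I t * (B * (?I s * G s))) \<in> borel_measurable (lborel \<Otimes>\<^sub>M lborel)" by measurable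
    have "(LINT s|lborel. norm (?I t * (B * (?I s * G s)))) = ?I t * (\<bar>B\<bar> * (LINT s|lborel. \<bar>?I s * G s\<bar>))" for t
      by (simp only: real_norm_def abs_mult[of "?I t"] abs_mult[of B] integral_mult_right_zero) simp
    then show "integrable lborel (\<lambda>t. LINT s|lborel. norm (case (t, s) of (t, s) \<Rightarrow> ?I t * (B * (?I s * G s))))"
      using integrable_mult_left[OF Ii] by simp
    show "AE t in lborel. integrable lborel (\<lambda>s. case (t, s) of (t, s) \<Rightarrow> ?I t * (B * (?I s * G s)))"
      unfolding prod.case by (intro AE_I2 integrable_mult_right Gi)
  qed
  have pi: "integrable (lborel \<Otimes>\<^sub>M lborel) (\<lambda>(t, s). ?I t * deriv \<theta> t * (if 0 < s \<and> s < t then G s else 0))"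
  proof (rule Bochner_Integration.integrable_bound[OF prod])
    show "(\<lambda>(t, s). ?I t * deriv \<theta> t * (if 0 < s \<and> s < t then G s else 0)) \<in> borel_measurable (lborel \<Otimes>\<^sub>M lborel)"
      by measurable
    have "norm (?I t * deriv \<theta> t * (if 0 < s \<and> s < t then G s else 0)) \<le> norm (?I t * (B * (?I s * G s)))" for t s
    proof (cases "0 < s \<and> s < t \<and> t < T")
      case True
      then have "\<bar>deriv \<theta> t\<bar> * \<bar>G s\<bar> \<le> \<bar>B\<bar> * \<bar>G s\<bar>"
        using B[of t] by (intro mult_right_mono) auto
      then show ?thesis using True by (simp add: abs_mult)
    qed (auto simp: indicator_def)
    then show "AE z in lborel \<Otimes>\<^sub>M lborel. norm (case z of (t, s) \<Rightarrow> ?I t * deriv \<theta> t * (if 0 < s \<and> s < t then G s else 0))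
       \<le> norm (case z of (t, s) \<Rightarrow> ?I t * (B * (?I s * G s)))"
      by (intro AE_I2) (simp only: case_prod_beta)
  qed
  have inner: "(LINT t|lborel. ?I t * deriv \<theta> t * (if 0 < s \<and> s < t then G s else 0)) = - (?I s * (h s \<bullet> c * \<psi> s))" for s
  proof (cases "0 < s \<and> s < T")
    case True
    have "(LINT t|lborel. ?I t * deriv \<theta> t * (if 0 < s \<and> s < t then G s else 0)) = (LINT t|lborel. G s * (indicator {s<..<T} t * deriv \<theta> t))"
      using True by (intro Bochner_Integration.integral_cong) (auto simp: indicator_def)
    also have "\<dots> = G s * (\<theta> T - \<theta> s)"
      using smooth_FTC[OF s\<theta>, of s T] True by (simp add: integral_mult_right_zero)
    also have "\<dots> = - (exp (a * s) * exp (- a * s)) * (h s \<bullet> c * \<psi> s)"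
      using test_function_outside[OF \<psi>, of T] by (simp add: G_def \<theta>_def)
    also have "\<dots> = - (?I s * (h s \<bullet> c * \<psi> s))"
      using True by (simp add: exp_add[symmetric])
    finally show ?thesis .
  next
    case False
    then have z: "(\<lambda>t. ?I t * deriv \<theta> t * (if 0 < s \<and> s < t then G s else 0)) = (\<lambda>t. 0)"
      by (auto simp: indicator_def)
    show ?thesis unfolding z using False by (auto simp: indicator_def)
  qed
  have \<theta>i: "integrable lborel (\<lambda>t. ?I t * deriv \<theta> t)"
    by (intro continuous_set_integrable smooth_continuous smooth_deriv s\<theta>)
  have i1: "integrable lborel (\<lambda>r. ?I r * (y r \<bullet> c * deriv \<psi> r))" and i2: "integrable lborel (\<lambda>r. ?I r * (y r \<bullet> c * \<psi> r))"
    by (intro integrable_inner_mult[OF yi] smooth_continuous sm sd)+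
  have "(LINT r|lborel. ?I r * (y r \<bullet> c * deriv \<psi> r)) - a * (LINT r|lborel. ?I r * (y r \<bullet> c * \<psi> r))
    = (LINT r|lborel. ?I r * (y r \<bullet> c * deriv \<psi> r)) - (LINT r|lborel. a * (?I r * (y r \<bullet> c * \<psi> r)))"
    by (simp only: integral_mult_right_zero)
  also have "\<dots> = (LINT r|lborel. ?I r * (y r \<bullet> c * deriv \<psi> r) - a * (?I r * (y r \<bullet> c * \<psi> r)))"
    by (intro Bochner_Integration.integral_diff[symmetric] i1 integrable_mult_right i2)
  also have "\<dots> = (LINT r|lborel. ?I r * (y r \<bullet> c * (deriv \<psi> r - a * \<psi> r)))"
    by (intro Bochner_Integration.integral_cong) (auto simp: algebra_simps)
  also have "\<dots> = (LINT t|lborel. (y0 \<bullet> c) * (?I t * deriv \<theta> t) + (LINT s|lborel. ?I t * deriv \<theta> t * (if 0 < s \<and> s < t then G s else 0)))"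
    by (simp only: pt)
  also have "\<dots> = (LINT t|lborel. (y0 \<bullet> c) * (?I t * deriv \<theta> t)) + (LINT t|lborel. LINT s|lborel. ?I t * deriv \<theta> t * (if 0 < s \<and> s < t then G s else 0))"
    using lborel_pair.integrable_fst'[OF pi] by (intro Bochner_Integration.integral_add integrable_mult_right \<theta>i) simp
  \<comment> \<open>The initial value drops out because \<psi>, and with it \<theta>, vanishes at
    both ends of the interval.\<close>
  also have "(LINT t|lborel. (y0 \<bullet> c) * (?I t * deriv \<theta> t)) = 0"
    using smooth_FTC[OF s\<theta>, of 0 T] T test_function_outside[OF \<psi>, of T] test_function_outside[OF \<psi>, of 0]
    by (simp add: integral_mult_right_zero \<theta>_def)
  also have "(LINT t|lborel. LINT s|lborel. ?I t * deriv \<theta> t * (if 0 < s \<and> s < t then G s else 0))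
    = (LINT s|lborel. LINT t|lborel. ?I t * deriv \<theta> t * (if 0 < s \<and> s < t then G s else 0))"
    using lborel_pair.Fubini_integral[OF pi] by simp
  also have "\<dots> = - (LINT s|lborel. ?I s * (h s \<bullet> c * \<psi> s))"
    by (simp only: inner integral_minus)
  finally show ?thesis by simp
qed

text \<open>\<open>weak_scalar\<close> works between positive times. Letting the left end tend to 0
  uses continuity of y at 0 on one side and dominated convergence on the other. A single direction c
  is kept, since the weak equation offers only divergence-free directions.\<close>

lemma weak_imp_duhamel:
  fixes h y :: "real \<Rightarrow> complex^3"
  assumes y: "continuous_on {0..T} y"
    and h[measurable]: "h \<in> borel_measurable borel" and hi: "integrable lborel (\<lambda>r. indicator {0<..<T} r *\<^sub>R h r)"
    and a: "a \<ge> 0" and t: "0 < t" "t < T"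
    and weak: "\<And>\<psi>. \<psi> \<in> test_functions T \<Longrightarrow> 
      - (LINT r|lborel. indicator {0<..<T} r * (y r \<bullet> c * deriv \<psi> r)) + a * (LINT r|lborel. indicator {0<..<T} r * (y r \<bullet> c * \<psi> r))
      = (LINT r|lborel. indicator {0<..<T} r * (h r \<bullet> c * \<psi> r))"
  shows "(y t - (exp (- a * t) *\<^sub>R y 0 + expconv a h t)) \<bullet> c = 0"
proof -
  define c' where "c' n = t * inverse (real (Suc (Suc n)))" for n
  have "(\<lambda>n. inverse (real (Suc (Suc n)))) \<longlonglongrightarrow> 0"
    by (rule LIMSEQ_Suc[OF LIMSEQ_inverse_real_of_nat])
  then have c'0: "c' \<longlonglongrightarrow> 0" unfolding c'_def[abs_def] by (rule tendsto_mult_right_zero)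
  have c': "0 < c' n" "c' n < t" for n
  proof -
    have "inverse (real (Suc (Suc n))) < 1" by (intro inverse_less_1_iff[THEN iffD2] disjI2) simp
    then show "c' n < t" using mult_strict_left_mono[of "inverse (real (Suc (Suc n)))" 1 t] t by (simp add: c'_def)
    show "0 < c' n" using t by (simp add: c'_def)
  qed
  have hc: "integrable lborel (\<lambda>r. indicator {0<..<T} r * (h r \<bullet> c))"
    using integrable_inner_mult[OF hi, of "\<lambda>_. 1" c] by simp
  have hce: "integrable lborel (\<lambda>r. indicator {0<..<T} r * (h r \<bullet> c * exp (a * r)))"
    by (intro integrable_inner_mult[OF hi] continuous_intros)
  have yc: "continuous_on {0..T} (\<lambda>r. y r \<bullet> c)" by (intro continuous_on_inner y continuous_on_const)
  have eq: "exp (a * t) * (y t \<bullet> c) - exp (a * c' n) * (y (c' n) \<bullet> c) = (LINT r|lborel. indicator {c' n<..<t} r * (exp (a * r) * (h r \<bullet> c)))" for n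
    by (rule weak_scalar[of T "\<lambda>r. y r \<bullet> c" "\<lambda>r. h r \<bullet> c", OF yc hc weak c' t(2)])
  have ly: "(\<lambda>n. y (c' n)) \<longlonglongrightarrow> y 0"
  proof (rule continuous_on_tendsto_compose[OF y c'0])
    have "c' n \<in> {0..T}" for n using c'[of n] t by simp
    then show "\<forall>\<^sub>F n in sequentially. c' n \<in> {0..T}" by simp
    show "0 \<in> {0..T}" using t by simp
  qed
  have le: "(\<lambda>n. exp (a * c' n)) \<longlonglongrightarrow> exp (a * 0)"
    by (rule tendsto_exp[OF tendsto_mult[OF tendsto_const c'0]])
  note lim1 = tendsto_diff[OF tendsto_const tendsto_mult[OF le tendsto_inner[OF ly tendsto_const]], of "exp (a * t) * (y t \<bullet> c)" c]
  have lim2: "(\<lambda>n. LINT r|lborel. indicator {c' n<..<t} r * (exp (a * r) * (h r \<bullet> c))) \<longlonglongrightarrow> (LINT r|lborel. indicator {0<..<t} r * (exp (a * r) * (h r \<bullet> c)))"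
  proof (rule integral_dominated_convergence[where w = "\<lambda>r. \<bar>indicator {0<..<T} r * (h r \<bullet> c * exp (a * r))\<bar>"])
    show "integrable lborel (\<lambda>r. \<bar>indicator {0<..<T} r * (h r \<bullet> c * exp (a * r))\<bar>)"
      by (rule integrable_abs[OF hce])
    show "AE r in lborel. (\<lambda>n. indicator {c' n<..<t} r * (exp (a * r) * (h r \<bullet> c))) \<longlonglongrightarrow> indicator {0<..<t} r * (exp (a * r) * (h r \<bullet> c))"
    proof (intro AE_I2 tendsto_mult tendsto_const)
      fix r :: real
      have "\<forall>\<^sub>F n in sequentially. indicator {c' n<..<t} r = (indicator {0<..<t} r :: real)"
      proof (cases "0 < r")
        case True
        from order_tendstoD(2)[OF c'0 True] show ?thesis by eventually_elim (auto simp: indicator_def True)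
      next
        case False
        then show ?thesis using c'(1) by (intro always_eventually allI) (auto simp: indicator_def, meson less_trans)
      qed
      then show "(\<lambda>n. indicator {c' n<..<t} r :: real) \<longlonglongrightarrow> indicator {0<..<t} r"
        by (rule tendsto_eventually)
    qed
    show "AE r in lborel. norm (indicator {c' n<..<t} r * (exp (a * r) * (h r \<bullet> c))) \<le> \<bar>indicator {0<..<T} r * (h r \<bullet> c * exp (a * r))\<bar>" for n
    proof (rule AE_I2)
      fix r
      show "norm (indicator {c' n<..<t} r * (exp (a * r) * (h r \<bullet> c))) \<le> \<bar>indicator {0<..<T} r * (h r \<bullet> c * exp (a * r))\<bar>"
      proof (cases "c' n < r \<and> r < t")
        case True
        then have "0 < r" "r < T" using c'(1)[of n] t by auto
        then show ?thesis using True by (simp add: abs_mult)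
      qed (auto simp: indicator_def)
    qed
  qed measurable
  have main: "exp (a * t) * (y t \<bullet> c) - y 0 \<bullet> c = (LINT r|lborel. indicator {0<..<t} r * (exp (a * r) * (h r \<bullet> c)))"
    using LIMSEQ_unique[OF lim1[unfolded eq] lim2] by simp
  have "expconv a h t \<bullet> c = (LINT s|lborel. (if 0 < s \<and> s < t then exp (- a * (t - s)) *\<^sub>R h s else 0) \<bullet> c)"
    unfolding expconv_def using t by (intro integral_inner_left[symmetric] expconv_integrable[OF hi h a]) simp
  also have "\<dots> = (LINT s|lborel. exp (- a * t) * (indicator {0<..<t} s * (exp (a * s) * (h s \<bullet> c))))"
  proof (intro Bochner_Integration.integral_cong refl)
    fix s
    have "exp (- a * (t - s)) = exp (- a * t) * exp (a * s)"
      unfolding exp_add[symmetric] by (simp add: algebra_simps)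
    then show "(if 0 < s \<and> s < t then exp (- a * (t - s)) *\<^sub>R h s else 0) \<bullet> c = exp (- a * t) * (indicator {0<..<t} s * (exp (a * s) * (h s \<bullet> c)))"
      by (auto simp: indicator_def)
  qed
  also have "\<dots> = exp (- a * t) * (exp (a * t) * (y t \<bullet> c) - y 0 \<bullet> c)"
    unfolding main by (rule integral_mult_right_zero)
  also have "\<dots> = (exp (- a * t) * exp (a * t)) * (y t \<bullet> c) - exp (- a * t) * (y 0 \<bullet> c)"
    by (simp add: algebra_simps)
  also have "\<dots> = y t \<bullet> c - exp (- a * t) * (y 0 \<bullet> c)"
    by (simp add: exp_add[symmetric])
  finally show ?thesis by (simp add: inner_diff_left inner_add_left)
qed

context viscous_torus
begin

text \<open>The weak identity with the delayed field replaced by an arbitrary drift \<open>w\<close>.\<close>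

definition weak_id :: "field \<Rightarrow> (real \<Rightarrow> field) \<Rightarrow> real \<Rightarrow> (real \<Rightarrow> field) \<Rightarrow> field \<Rightarrow> (real \<Rightarrow> real) \<Rightarrow> bool" where
  "weak_id f w T u v \<psi> \<longleftrightarrow>
        - (LINT r|lebesgue_on {0<..<T}. pairing L (u r) v * deriv \<psi> r)
        + \<nu> * (LINT r|lebesgue_on {0<..<T}.
                 pairing L (stokes_pow L (1/2) (u r)) (stokes_pow L (1/2) v) * \<psi> r)
        + (LINT r|lebesgue_on {0<..<T}. b_form L (1 + \<alpha>) \<alpha> (1 + \<alpha>) (w r) (u r) v * \<psi> r)
        = (LINT r|lebesgue_on {0<..<T}. pairing L f v * \<psi> r)"

text \<open>The residual of the scalar weak equation of mode k in direction c. Up to the factor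
  \<open>L ^ 3\<close>, the weak identity says that these residuals sum to 0 over all modes.\<close>

definition defect :: "real \<Rightarrow> (real \<Rightarrow> real) \<Rightarrow> (real \<Rightarrow> field) \<Rightarrow> (real \<Rightarrow> field) \<Rightarrow> int^3 \<Rightarrow> complex^3 \<Rightarrow> real" where
  "defect T \<psi> u g k c = - (LINT r|lborel. indicator {0<..<T} r * (u r k \<bullet> c * deriv \<psi> r))
     + rate k * (LINT r|lborel. indicator {0<..<T} r * (u r k \<bullet> c * \<psi> r))
     - (LINT r|lborel. indicator {0<..<T} r * (g r k \<bullet> c * \<psi> r))"

text \<open>\<open>time_pairing\<close> is applied to each of the four terms at suitable dual
  exponents. Since v is divergence-free, \<open>b_form\<close> may be replaced by the pairing with
  the projected term \<open>NB\<close>. The pairs ww, w and uu, u separate the functions in the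
  definition from their Borel versions.\<close>

lemma weak_id_iff:
  assumes w: "traj L w" and W: "cumul (\<lambda>s. en L (1 + \<alpha>) (w s)) T < \<infinity>"
    and u: "traj L u" and U: "cumul (\<lambda>s. en L (1 + \<alpha>) (u s)) T < \<infinity>" and b: "bdd u T"
    and ww: "AE r in lborel. 0 < r \<and> r < T \<longrightarrow> ww r = w r" and uu: "AE r in lborel. 0 < r \<and> r < T \<longrightarrow> uu r = u r"
    and f: "f \<in> Vsp L (\<alpha> - 1)" and v: "v \<in> Vsp L (\<alpha> + 1)" and \<psi>: "\<psi> \<in> test_functions T"
  shows "weak_id f ww T uu v \<psi> \<longleftrightarrow> (LINT k|count_space UNIV. defect T \<psi> u (\<lambda>s k. f k - NB L (w s) (u s) k) k (v k)) = 0"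
proof -
  let ?J = "\<lambda>x. LINT r|lborel. indicator {0<..<T} r * (x r :: real)"
  have sm: "smooth \<psi>" using \<psi> by (simp add: test_functions_iff)
  have cont: "continuous_on UNIV \<psi>" "continuous_on UNIV (deriv \<psi>)"
    by (intro smooth_continuous smooth_deriv sm)+
  have vs: "v \<in> solenoidal L" and vfin: "en L (\<alpha> + 1) v < \<infinity>" using v by (auto simp: Vsp_iff)
  have v_en: "en L s v < \<infinity>" if "s \<le> \<alpha> + 1" for s
    by (rule en_finite_mono[OF L that vfin])
  have fs: "f \<in> solenoidal L" and ffin: "en L (\<alpha> - 1) f < \<infinity>" using f by (auto simp: Vsp_iff)
  have NBt: "traj L (\<lambda>s. NB L (w s) (u s))" by (intro traj_NB L w u)
  have NBfin: "cumul (\<lambda>s. en L (\<alpha> - 1) (NB L (w s) (u s))) T < \<infinity>" by (rule cumul_NB_finite[OF w u W b])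
  have ft: "traj L (\<lambda>_. f)" by (rule traj_const[OF fs])
  have fc: "cumul (\<lambda>s. en L (\<alpha> - 1) f) T < \<infinity>"
    using cumul_const[of "en L (\<alpha> - 1) f" T] ffin by (auto simp: ennreal_mult_less_top elim!: le_less_trans)
  have un: "AE r in lborel. 0 < r \<and> r < T \<longrightarrow> en L (1 + \<alpha>) (u r) < \<infinity>" by (rule AE_finite[OF u U])
  have wn: "AE r in lborel. 0 < r \<and> r < T \<longrightarrow> en L (1 + \<alpha>) (w r) < \<infinity>" by (rule AE_finite[OF w W])
  define A where "A k = ?J (\<lambda>r. u r k \<bullet> v k * deriv \<psi> r)" for k
  define B where "B k = ?J (\<lambda>r. stokes_pow L (1/2) (u r) k \<bullet> stokes_pow L (1/2) v k * \<psi> r)" for k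
  define C where "C k = ?J (\<lambda>r. NB L (w r) (u r) k \<bullet> v k * \<psi> r)" for k
  define E where "E k = ?J (\<lambda>r. f k \<bullet> v k * \<psi> r)" for k
  have stokes_en: "en L s (stokes_pow L (1/2) x) = en L (s + 1) x" for s x
    unfolding en_def
  proof (intro nn_integral_cong arg_cong[where f = ennreal])
    fix k
    show "wave L k powr (2 * s) * (norm (stokes_pow L (1/2) x k))\<^sup>2 = wave L k powr (2 * (s + 1)) * (norm (x k))\<^sup>2"
    proof (cases "k = 0")
      case False
      then have p: "wave L k > 0" by (rule wave_pos[OF L])
      have "wave L k powr (2 * (s + 1)) = wave L k powr (2 * s) * (wave L k)\<^sup>2"
        using p by (simp add: distrib_left powr_add powr_numeral)
      then show ?thesis using p
        by (simp add: stokes_pow_def wave_def[symmetric] power_mult_distrib)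
    qed simp
  qed
  have stokes_meas: "(\<lambda>r. stokes_pow L (1/2) (u r) k) \<in> borel_measurable borel" for k
    using traj_measurable[OF u, of k] unfolding stokes_pow_def by measurable
  have A: "(LINT r|lebesgue_on {0<..<T}. pairing L (uu r) v * deriv \<psi> r) = L ^ 3 * (LINT k|count_space UNIV. A k)"
    "integrable (count_space UNIV) A"
  proof -
    have P: "AE r in lborel. 0 < r \<and> r < T \<longrightarrow> pairing L (uu r) v = pairing L (u r) v"
      using uu by eventually_elim auto
    note tp = time_pairing[OF L traj_measurable[OF u] traj_zero[OF u] U v_en cont(2) P]
    have le: "- (1 + \<alpha>) \<le> \<alpha> + 1" using alpha by simp
    show "(LINT r|lebesgue_on {0<..<T}. pairing L (uu r) v * deriv \<psi> r) = L ^ 3 * (LINT k|count_space UNIV. A k)"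
      "integrable (count_space UNIV) A"
      using tp[OF le] by (simp_all only: A_def[abs_def])
  qed
  have B: "(LINT r|lebesgue_on {0<..<T}. pairing L (stokes_pow L (1/2) (uu r)) (stokes_pow L (1/2) v) * \<psi> r) = L ^ 3 * (LINT k|count_space UNIV. B k)"
    "integrable (count_space UNIV) B"
  proof -
    have P: "AE r in lborel. 0 < r \<and> r < T \<longrightarrow> pairing L (stokes_pow L (1/2) (uu r)) (stokes_pow L (1/2) v) = pairing L (stokes_pow L (1/2) (u r)) (stokes_pow L (1/2) v)"
      using uu by eventually_elim auto
    have fin: "cumul (\<lambda>r. en L \<alpha> (stokes_pow L (1/2) (u r))) T < \<infinity>"
      using U unfolding stokes_en by (simp add: add.commute)
    have ve: "en L (- \<alpha>) (stokes_pow L (1/2) v) < \<infinity>"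
      unfolding stokes_en using alpha by (intro v_en) simp
    have z: "stokes_pow L (1/2) (u r) 0 = 0" for r by (simp add: stokes_pow_def traj_zero[OF u])
    show "(LINT r|lebesgue_on {0<..<T}. pairing L (stokes_pow L (1/2) (uu r)) (stokes_pow L (1/2) v) * \<psi> r) = L ^ 3 * (LINT k|count_space UNIV. B k)"
      "integrable (count_space UNIV) B"
      using time_pairing[OF L stokes_meas z fin ve cont(1) P] by (simp_all only: B_def[abs_def])
  qed
  have C: "(LINT r|lebesgue_on {0<..<T}. b_form L (1 + \<alpha>) \<alpha> (1 + \<alpha>) (ww r) (uu r) v * \<psi> r) = L ^ 3 * (LINT k|count_space UNIV. C k)"
    "integrable (count_space UNIV) C"
  proof -
    have P: "AE r in lborel. 0 < r \<and> r < T \<longrightarrow> b_form L (1 + \<alpha>) \<alpha> (1 + \<alpha>) (ww r) (uu r) v = pairing L (NB L (w r) (u r)) v"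
      using uu ww un wn
    proof eventually_elim
      case (elim r)
      show ?case
      proof
        assume r: "0 < r \<and> r < T"
        have us: "u r \<in> solenoidal L" and ws: "w r \<in> solenoidal L" using u w by (auto simp: traj_def)
        have "b_form L (1 + \<alpha>) \<alpha> (1 + \<alpha>) (w r) (u r) v = tri L (w r) (u r) v"
          using elim(3,4) r us ws v by (intro b_form_eq L alpha) (simp_all add: Vsp_iff add.commute)
        also have "\<dots> = pairing L (NB L (w r) (u r)) v"
          using vs unfolding tri_def pairing_def NB_def by (simp add: inner_leray_left solenoidal_iff)
        finally show "b_form L (1 + \<alpha>) \<alpha> (1 + \<alpha>) (ww r) (uu r) v = pairing L (NB L (w r) (u r)) v"
          using elim(1,2) r by simp
      qed
    qed
    have ve: "en L (- (\<alpha> - 1)) v < \<infinity>" using alpha by (intro v_en) simp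
    show "(LINT r|lebesgue_on {0<..<T}. b_form L (1 + \<alpha>) \<alpha> (1 + \<alpha>) (ww r) (uu r) v * \<psi> r) = L ^ 3 * (LINT k|count_space UNIV. C k)"
      "integrable (count_space UNIV) C"
      using time_pairing[OF L traj_measurable[OF NBt] traj_zero[OF NBt] NBfin ve cont(1) P] by (simp_all only: C_def[abs_def])
  qed
  have E: "(LINT r|lebesgue_on {0<..<T}. pairing L f v * \<psi> r) = L ^ 3 * (LINT k|count_space UNIV. E k)"
    "integrable (count_space UNIV) E"
  proof -
    have P: "AE r in lborel. 0 < r \<and> r < T \<longrightarrow> pairing L f v = pairing L f v" by simp
    have ve: "en L (- (\<alpha> - 1)) v < \<infinity>" using alpha by (intro v_en) simp
    show "(LINT r|lebesgue_on {0<..<T}. pairing L f v * \<psi> r) = L ^ 3 * (LINT k|count_space UNIV. E k)"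
      "integrable (count_space UNIV) E"
      using time_pairing[OF L traj_measurable[OF ft] traj_zero[OF ft] fc ve cont(1) P] by (simp_all only: E_def[abs_def])
  qed
  have D: "defect T \<psi> u (\<lambda>s k. f k - NB L (w s) (u s) k) k (v k) = - A k + \<nu> * B k + C k - E k" for k
  proof -
    have "stokes_pow L (1/2) (u r) k \<bullet> stokes_pow L (1/2) v k * \<psi> r = (wave L k)\<^sup>2 * (u r k \<bullet> v k * \<psi> r)" for r
    proof -
      have "stokes_pow L (1/2) (u r) k = wave L k *\<^sub>R u r k" "stokes_pow L (1/2) v k = wave L k *\<^sub>R v k"
        by (simp_all add: stokes_pow_def wave_def[symmetric])
      then show ?thesis by (simp add: power2_eq_square)
    qed
    then have "B k = ?J (\<lambda>r. (wave L k)\<^sup>2 * (u r k \<bullet> v k * \<psi> r))"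
      unfolding B_def by (simp only:)
    also have "\<dots> = (LINT r|lborel. (wave L k)\<^sup>2 * (indicator {0<..<T} r * (u r k \<bullet> v k * \<psi> r)))"
      by (intro Bochner_Integration.integral_cong) auto
    also have "\<dots> = (wave L k)\<^sup>2 * ?J (\<lambda>r. u r k \<bullet> v k * \<psi> r)"
      by (rule integral_mult_right_zero)
    finally have 1: "\<nu> * B k = rate k * ?J (\<lambda>r. u r k \<bullet> v k * \<psi> r)" by (simp add: rate_def)
    have "?J (\<lambda>r. (f k - NB L (w r) (u r) k) \<bullet> v k * \<psi> r)
      = (LINT r|lborel. indicator {0<..<T} r * (f k \<bullet> v k * \<psi> r) - indicator {0<..<T} r * (NB L (w r) (u r) k \<bullet> v k * \<psi> r))"
      by (intro Bochner_Integration.integral_cong) (auto simp: inner_diff_left algebra_simps)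
    also have "\<dots> = E k - C k"
      unfolding E_def C_def
      by (intro Bochner_Integration.integral_diff integrable_inner_mult cont(1) mode_integrable[OF ft fc] mode_integrable[OF NBt NBfin])
    finally show ?thesis unfolding defect_def 1[symmetric] A_def[symmetric] by simp
  qed
  have "(LINT k|count_space UNIV. defect T \<psi> u (\<lambda>s k. f k - NB L (w s) (u s) k) k (v k))
     = - (LINT k|count_space UNIV. A k) + \<nu> * (LINT k|count_space UNIV. B k) + (LINT k|count_space UNIV. C k) - (LINT k|count_space UNIV. E k)"
    unfolding D using A(2) B(2) C(2) E(2) by (simp add: integral_mult_right_zero)
  moreover have "weak_id f ww T uu v \<psi> \<longleftrightarrow> L ^ 3 * (- (LINT k|count_space UNIV. A k) + \<nu> * (LINT k|count_space UNIV. B k) + (LINT k|count_space UNIV. C k) - (LINT k|count_space UNIV. E k)) = 0"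
    unfolding weak_id_def A(1) B(1) C(1) E(1) by (simp add: algebra_simps)
  ultimately show ?thesis using L by simp
qed

text \<open>In this direction every mode satisfies its scalar weak equation, so each residual
  vanishes separately for every direction.\<close>

lemma mild_imp_weak:
  assumes w: "traj L w" and W: "cumul (\<lambda>s. en L (1 + \<alpha>) (w s)) T < \<infinity>"
    and u: "traj L u" and b: "bdd u T" and m: "mild f w T u" and T: "T > 0"
    and ww: "AE r in lborel. 0 < r \<and> r < T \<longrightarrow> ww r = w r" and uu: "AE r in lborel. 0 < r \<and> r < T \<longrightarrow> uu r = u r"
    and f: "f \<in> Vsp L (\<alpha> - 1)" and v: "v \<in> Vsp L (\<alpha> + 1)" and \<psi>: "\<psi> \<in> test_functions T"
  shows "weak_id f ww T uu v \<psi>"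
proof -
  let ?F = "\<lambda>s k. f k - NB L (w s) (u s) k"
  have U: "cumul (\<lambda>s. en L (1 + \<alpha>) (u s)) T < \<infinity>" using T by (intro mild_L2[OF w W u b f m]) simp
  have F: "traj L ?F" using f by (intro force_traj w u) (simp add: Vsp_iff)
  have Ffin: "cumul (\<lambda>s. en L (\<alpha> - 1) (?F s)) T < \<infinity>" by (rule cumul_force_finite[OF w u W b f])
  have "defect T \<psi> u ?F k (v k) = 0" for k
  proof -
    have "u t k = exp (- rate k * t) *\<^sub>R u 0 k + expconv (rate k) (\<lambda>s. ?F s k) t" if "0 \<le> t" "t \<le> T" for t
      using m that unfolding mild_def duh_def by blast
    from duhamel_imp_weak[OF this traj_measurable[OF F] mode_integrable[OF F Ffin] mode_integrable[OF u U] rate_nonneg \<psi> T]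
    show ?thesis unfolding defect_def by simp
  qed
  then show ?thesis using weak_id_iff[OF w W u U b ww uu f v \<psi>] by simp
qed

lemma inner_vcnj: "vcnj a \<bullet> vcnj b = a \<bullet> b"
  by (simp add: vcnj_def inner_vec_def inner_complex_def)

text \<open>A real test field has to carry the modes k and -k together. By conjugation symmetry the
  two residuals coincide, so the vanishing of their sum isolates one mode. The end time shrinks from
  T to T' because the scalar argument reaches only interior times.\<close>

lemma weak_imp_mild:
  assumes w: "traj L w" and W: "cumul (\<lambda>s. en L (1 + \<alpha>) (w s)) T < \<infinity>"
    and u: "traj L u" and U: "cumul (\<lambda>s. en L (1 + \<alpha>) (u s)) T < \<infinity>" and b: "bdd u T"
    and ww: "AE r in lborel. 0 < r \<and> r < T \<longrightarrow> ww r = w r" and uu: "AE r in lborel. 0 < r \<and> r < T \<longrightarrow> uu r = u r"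
    and f: "f \<in> Vsp L (\<alpha> - 1)" and cont: "\<And>k. continuous_on {0..T} (\<lambda>t. u t k)"
    and weak: "\<And>v \<psi>. v \<in> Vsp L (\<alpha> + 1) \<Longrightarrow> \<psi> \<in> test_functions T \<Longrightarrow> weak_id f ww T uu v \<psi>"
    and T': "T' < T"
  shows "mild f w T' u"
  unfolding mild_def
proof (intro allI impI)
  fix t k assume t: "0 \<le> t" "t \<le> T'"
  let ?F = "\<lambda>s k. f k - NB L (w s) (u s) k"
  have F: "traj L ?F" using f by (intro force_traj w u) (simp add: Vsp_iff)
  have Ffin: "cumul (\<lambda>s. en L (\<alpha> - 1) (?F s)) T < \<infinity>" by (rule cumul_force_finite[OF w u W b f])
  have Fs: "F' s k = vcnj (F' s (- k))" "zdot L k (F' s k) = 0" if "traj L F'" for F' :: "real \<Rightarrow> field" and s k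
    using that[unfolded traj_def solenoidal_iff] by (metis minus_minus)+
  show "u t k = exp (- rate k * t) *\<^sub>R u 0 k + duh ?F t k"
  proof (cases "k = 0 \<or> t = 0")
    case True
    then show ?thesis
      by (auto simp: duh_def traj_zero[OF u] traj_zero[OF F])
  next
    case False
    then have k: "k \<noteq> 0" and t0: "t > 0" using t by auto
    \<comment> \<open>The two modes must be distinct for the test field to be well defined; an
      integer vector equal to its negative is 0.\<close>
    have kk: "k \<noteq> - k"
    proof
      assume e: "k = - k"
      have "k $ i = 0" for i
        using arg_cong[OF e, of "\<lambda>x. x $ i"] unfolding vector_uminus_component by linarith
      then have "k = 0" unfolding vec_eq_iff by simp
      then show False using k by contradiction
    qed
    have D0: "defect T \<psi> u ?F k c = 0" if c: "zdot L k c = 0" and \<psi>: "\<psi> \<in> test_functions T" for c \<psi>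
    proof -
      define v where "v j = (if j = k then c else if j = - k then vcnj c else 0)" for j
      have supp: "{j. v j \<noteq> 0} \<subseteq> {k, - k}" by (auto simp: v_def)
      have "v \<in> solenoidal L"
        unfolding solenoidal_iff
      proof (intro conjI allI)
        show "v 0 = 0" using k by (auto simp: v_def)
        show "v (- j) = vcnj (v j)" for j
          using kk by (auto simp: v_def minus_equation_iff[of j])
        show "zdot L j (v j) = 0" for j
          using c by (simp add: v_def zdot_minus_freq zdot_vcnj)
      qed
      then have "v \<in> trig_polys L"
        using finite_subset[OF supp] by (simp add: trig_polys_def)
      then have v: "v \<in> Vsp L (\<alpha> + 1)" using trig_polys_subset_Vsp by blast
      have "(LINT j|count_space UNIV. defect T \<psi> u ?F j (v j)) = 0"
        using weak_id_iff[OF w W u U b ww uu f v \<psi>] weak[OF v \<psi>] by simp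
      moreover have "(LINT j|count_space UNIV. defect T \<psi> u ?F j (v j)) = (\<Sum>j\<in>{k, - k}. defect T \<psi> u ?F j (v j))"
      proof -
        have z: "defect T \<psi> u ?F j (v j) = 0" if "j \<notin> {k, - k}" for j
          using that by (simp add: v_def defect_def)
        then have sub: "{j\<in>UNIV. defect T \<psi> u ?F j (v j) \<noteq> 0} \<subseteq> {k, - k}" by blast
        then have "(LINT j|count_space UNIV. defect T \<psi> u ?F j (v j)) = (\<Sum>j | j \<in> UNIV \<and> defect T \<psi> u ?F j (v j) \<noteq> 0. defect T \<psi> u ?F j (v j))"
          by (intro lebesgue_integral_count_space_finite_support finite_subset[OF sub]) simp
        also have "\<dots> = (\<Sum>j\<in>{k, - k}. defect T \<psi> u ?F j (v j))"
          using sub by (intro sum.mono_neutral_left) auto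
        finally show ?thesis .
      qed
      moreover have "defect T \<psi> u ?F (- k) (v (- k)) = defect T \<psi> u ?F k c"
      proof -
        have vk: "v (- k) = vcnj c" using kk by (auto simp: v_def)
        have e: "u r (- k) = vcnj (u r k)" "?F r (- k) = vcnj (?F r k)" for r
          using Fs(1)[OF u, where s = r and k = "- k"] Fs(1)[OF F, where s = r and k = "- k"] by simp_all
        have r: "rate (- k) = rate k" by (simp add: rate_def)
        show ?thesis unfolding defect_def vk e r inner_vcnj ..
      qed
      ultimately show ?thesis using kk by (simp add: v_def)
    qed
    define y where "y = exp (- rate k * t) *\<^sub>R u 0 k + expconv (rate k) (\<lambda>s. ?F s k) t"
    \<comment> \<open>Only divergence-free directions can be tested, and the error in Duhamel's
      formula is itself divergence-free; tested against itself it vanishes.\<close>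
    define c where "c = u t k - y"
    have "zdot L k (expconv (rate k) (\<lambda>s. ?F s k) t) = 0"
      unfolding expconv_def using Fs(2)[OF F, where k = k]
      by (intro zdot_integral_eq_0) (simp add: zdot_scaleR)
    then have zc: "zdot L k c = 0"
      unfolding c_def y_def by (simp only: zdot_diff zdot_add zdot_scaleR Fs(2)[OF u] scaleR_zero_right add_0 diff_0_right)
    have "c \<bullet> c = 0"
    proof -
      have tT: "t < T" using t T' by simp
      have "(u t k - (exp (- rate k * t) *\<^sub>R u 0 k + expconv (rate k) (\<lambda>s. ?F s k) t)) \<bullet> c = 0"
      proof (rule weak_imp_duhamel[OF cont traj_measurable[OF F] mode_integrable[OF F Ffin] rate_nonneg t0 tT])
        fix \<psi> assume "\<psi> \<in> test_functions T"
        from D0[OF zc this] show "- (LINT r|lborel. indicator {0<..<T} r * (u r k \<bullet> c * deriv \<psi> r)) + rate k * (LINT r|lborel. indicator {0<..<T} r * (u r k \<bullet> c * \<psi> r))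
           = (LINT r|lborel. indicator {0<..<T} r * (?F r k \<bullet> c * \<psi> r))"
          unfolding defect_def by simp
      qed
      then show ?thesis by (simp add: c_def y_def)
    qed
    then show ?thesis by (simp add: c_def y_def duh_def)
  qed
qed

end

section \<open>Mild solutions of the delay equation\<close>

lemma traj_compose:
  assumes "traj L u" "g \<in> borel_measurable borel"
  shows "traj L (\<lambda>s. u (g s))"
  using assms measurable_compose[OF assms(2)] unfolding traj_def by blast

lemma nn_integral_window:
  fixes h :: "real \<Rightarrow> ennreal"
  assumes [measurable]: "h \<in> borel_measurable borel"
  shows "(\<integral>\<^sup>+s. h (c + s) * indicator {a<..<b} s \<partial>lborel) = (\<integral>\<^sup>+r. h r * indicator {c + a<..<c + b} r \<partial>lborel)"
proof -
  have "(\<integral>\<^sup>+r. h r * indicator {c + a<..<c + b} r \<partial>lborel) = ennreal \<bar>1\<bar> * (\<integral>\<^sup>+s. h (c + 1 * s) * indicator {c + a<..<c + b} (c + 1 * s) \<partial>lborel)"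
    by (rule nn_integral_real_affine) measurable
  also have "\<dots> = (\<integral>\<^sup>+s. h (c + s) * indicator {a<..<b} s \<partial>lborel)"
    by (simp add: indicator_def)
  finally show ?thesis by simp
qed

lemma (in viscous_torus) mild_cong:
  assumes m: "mild f w T u" and u: "\<And>s. 0 \<le> s \<Longrightarrow> s \<le> T \<Longrightarrow> u' s = u s" and w: "\<And>s. 0 < s \<Longrightarrow> s < T \<Longrightarrow> w' s = w s"
  shows "mild f w' T u'"
  unfolding mild_def
proof (intro allI impI)
  fix t k assume t: "0 \<le> t" "t \<le> T"
  have d: "duh (\<lambda>s k. f k - NB L (w' s) (u' s) k) t k = duh (\<lambda>s k. f k - NB L (w s) (u s) k) t k"
    unfolding duh_def expconv_def using t by (intro Bochner_Integration.integral_cong refl if_cong) (simp_all add: u w)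
  then show "u' t k = exp (- rate k * t) *\<^sub>R u' 0 k + duh (\<lambda>s k. f k - NB L (w' s) (u' s) k) t k"
    unfolding d u[OF t] u[OF order_refl order_trans[OF t]] using m t unfolding mild_def by blast
qed

lemma (in viscous_torus) en_diff_eq_0:
  assumes "traj L u" "traj L v" "en L s (\<lambda>k. u t k - v t k) = 0"
  shows "u t = v t"
proof
  fix k
  show "u t k = v t k"
    using assms(3) traj_zero[OF assms(1)] traj_zero[OF assms(2)] by (cases "k = 0") (auto simp: en_zero_iff[OF L])
qed

lemma (in viscous_torus) linear_unique:
  assumes w: "traj L w" "cumul (\<lambda>s. en L (1 + \<alpha>) (w s)) T < \<infinity>" and w': "traj L w'" "cumul (\<lambda>s. en L (1 + \<alpha>) (w' s)) T < \<infinity>"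
    and u: "traj L u" "bdd u T" "mild f w T u" and v: "traj L v" "bdd v T" "mild f w' T v" and f: "f \<in> Vsp L (\<alpha> - 1)"
    and 0: "u 0 = v 0" and ww: "\<And>s. 0 < s \<Longrightarrow> s < T \<Longrightarrow> w s = w' s" and t: "0 \<le> t" "t \<le> T"
  shows "u t = v t"
proof -
  obtain M where M: "M \<ge> 0" "\<And>t. 0 \<le> t \<Longrightarrow> t \<le> T \<Longrightarrow> en L \<alpha> (v t) \<le> ennreal M"
    using v(2) unfolding bdd_def by blast
  define X where "X = enn2real (cumul (\<lambda>s. en L (1 + \<alpha>) (w s)) T)"
  have X: "X \<ge> 0" "cumul (\<lambda>s. en L (1 + \<alpha>) (w s)) T \<le> ennreal X"
    using w(2) by (simp_all add: X_def)
  obtain K where st: "\<forall>f w w' u v. traj L w \<longrightarrow> traj L w' \<longrightarrow> traj L u \<longrightarrow> traj L v \<longrightarrow> f \<in> Vsp L (\<alpha> - 1) \<longrightarrow>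
    cumul (\<lambda>s. en L (1 + \<alpha>) (w s)) T \<le> ennreal X \<longrightarrow> cumul (\<lambda>s. en L (1 + \<alpha>) (w' s)) T < \<infinity> \<longrightarrow> bdd u T \<longrightarrow>
    (\<forall>t. 0 \<le> t \<longrightarrow> t \<le> T \<longrightarrow> en L \<alpha> (v t) \<le> ennreal M) \<longrightarrow> mild f w T u \<longrightarrow> mild f w' T v \<longrightarrow>
    (\<forall>t. 0 \<le> t \<longrightarrow> t \<le> T \<longrightarrow> en L \<alpha> (\<lambda>k. u t k - v t k) \<le> ennreal K * (en L \<alpha> (\<lambda>k. u 0 k - v 0 k) + cumul (\<lambda>s. en L (1 + \<alpha>) (\<lambda>k. w s k - w' s k)) T)) \<and>
    cumul (\<lambda>t. en L (1 + \<alpha>) (\<lambda>k. u t k - v t k)) T \<le> ennreal K * (en L \<alpha> (\<lambda>k. u 0 k - v 0 k) + cumul (\<lambda>s. en L (1 + \<alpha>) (\<lambda>k. w s k - w' s k)) T)"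
    using stability[OF X(1) M(1), of T] by (elim exE conjE that)
  have M2: "\<forall>t. 0 \<le> t \<longrightarrow> t \<le> T \<longrightarrow> en L \<alpha> (v t) \<le> ennreal M" using M(2) by blast
  note K = st[THEN spec, THEN spec, THEN spec, THEN spec, THEN spec, THEN mp, OF w(1), THEN mp, OF w'(1), THEN mp, OF u(1), THEN mp, OF v(1), THEN mp, OF f, THEN mp, OF X(2), THEN mp, OF w'(2), THEN mp, OF u(2), THEN mp, OF M2, THEN mp, OF u(3), THEN mp, OF v(3), THEN conjunct1, rule_format, OF t]
  have z: "en L s (\<lambda>k. 0) = 0" for s by (simp add: en_zero_iff[OF L])
  have "cumul (\<lambda>s. en L (1 + \<alpha>) (\<lambda>k. w s k - w' s k)) T \<le> cumul (\<lambda>s. 0) T"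
    by (intro cumul_mono_fun) (simp add: ww z)
  also have "\<dots> = 0" by (simp add: cumul_def)
  finally have "en L \<alpha> (\<lambda>k. u t k - v t k) = 0"
    using K by (simp add: 0 z)
  then show ?thesis by (rule en_diff_eq_0[OF u(1) v(1)])
qed

locale delayed_torus = viscous_torus +
  fixes \<mu> :: real and f :: field
  assumes mu: "\<mu> > 0" and f: "f \<in> Vsp L (\<alpha> - 1)"
begin

definition past :: "(real \<Rightarrow> ennreal) \<Rightarrow> ennreal" where
  "past h = (\<integral>\<^sup>+s. h s * indicator {- \<mu><..<0} s \<partial>lborel)"

text \<open>Here u lives on the whole line and equals \<phi> at every negative time, so the drift is
  a plain shift of u. The almost-everywhere clause of the weak formulation is confined to the
  passage from representatives to \<phi>.\<close>

definition sol :: "(real \<Rightarrow> field) \<Rightarrow> field \<Rightarrow> (real \<Rightarrow> field) \<Rightarrow> bool" where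
  "sol \<phi> u0 u \<longleftrightarrow> traj L u \<and> (\<forall>t<0. u t = \<phi> t) \<and> u 0 = u0 \<and> past (\<lambda>s. en L (1 + \<alpha>) (u s)) < \<infinity> \<and>
     (\<forall>T. bdd u T \<and> cumul (\<lambda>s. en L (1 + \<alpha>) (u s)) T < \<infinity> \<and> mild f (\<lambda>s. u (s - \<mu>)) T u)"

lemma window_le:
  assumes [measurable]: "h \<in> borel_measurable borel" and a: "- \<mu> \<le> a"
  shows "(\<integral>\<^sup>+r. h r * indicator {a<..<b} r \<partial>lborel) \<le> past h + cumul h b"
proof -
  have "(\<integral>\<^sup>+r. h r * indicator {a<..<b} r \<partial>lborel) \<le> (\<integral>\<^sup>+r. h r * indicator {- \<mu><..<0} r + h r * indicator {0<..<b} r \<partial>lborel)"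
  proof (rule nn_integral_mono_AE)
    show "AE r in lborel. h r * indicator {a<..<b} r \<le> h r * indicator {- \<mu><..<0} r + h r * indicator {0<..<b} r"
      using AE_lborel_singleton[of 0] by eventually_elim (use a in \<open>auto simp: indicator_def\<close>)
  qed
  also have "\<dots> = past h + cumul h b"
    unfolding past_def cumul_def by (rule nn_integral_add) measurable
  finally show ?thesis .
qed

text \<open>Up to time T the drift sees the history and the solution up to \<open>T - \<mu>\<close>
  only; this is what makes the equation linear on each delay interval.\<close>

lemma drift_le:
  assumes "h \<in> borel_measurable borel"
  shows "cumul (\<lambda>s. h (s - \<mu>)) T \<le> past h + cumul h (T - \<mu>)"
proof -
  have "cumul (\<lambda>s. h (s - \<mu>)) T = (\<integral>\<^sup>+s. h (- \<mu> + s) * indicator {0<..<T} s \<partial>lborel)"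
    by (simp add: cumul_def)
  also have "\<dots> = (\<integral>\<^sup>+r. h r * indicator {- \<mu> + 0<..<- \<mu> + T} r \<partial>lborel)"
    by (rule nn_integral_window[OF assms])
  also have "\<dots> \<le> past h + cumul h (- \<mu> + T)"
    by (rule window_le[OF assms]) simp
  finally show ?thesis by simp
qed

lemma drift_traj: "traj L u \<Longrightarrow> traj L (\<lambda>s. u (s - \<mu>))"
  by (rule traj_compose) measurable

lemma drift_finite:
  assumes "traj L u" "past (\<lambda>s. en L (1 + \<alpha>) (u s)) < \<infinity>" "cumul (\<lambda>s. en L (1 + \<alpha>) (u s)) (T - \<mu>) < \<infinity>"
  shows "cumul (\<lambda>s. en L (1 + \<alpha>) (u (s - \<mu>))) T < \<infinity>"
  using drift_le[OF traj_en_measurable[OF assms(1)], of "1 + \<alpha>" T] assms(2,3)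
  by (simp add: le_less_trans)

text \<open>The squared distance of the two initial states in \<open>Y_dist\<close>, without the
  factor \<open>L ^ 3\<close>.\<close>

definition diff_energy :: "(real \<Rightarrow> field) \<Rightarrow> (real \<Rightarrow> field) \<Rightarrow> ennreal" where
  "diff_energy u v = past (\<lambda>s. en L (1 + \<alpha>) (\<lambda>k. u s k - v s k)) + en L \<alpha> (\<lambda>k. u 0 k - v 0 k)"

text \<open>Induction over delay intervals: on each one the drift is the solution on the previous one.\<close>

lemma delay_stability:
  assumes v: "sol \<phi>' v0 v"
  shows "\<exists>K\<ge>0. \<forall>\<phi> u0 u. sol \<phi> u0 u \<longrightarrow> diff_energy u v \<le> 1 \<longrightarrow>
     (\<forall>t. 0 \<le> t \<longrightarrow> t \<le> real m * \<mu> \<longrightarrow> en L \<alpha> (\<lambda>k. u t k - v t k) \<le> ennreal K * diff_energy u v) \<and>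
     cumul (\<lambda>s. en L (1 + \<alpha>) (\<lambda>k. u s k - v s k)) (real m * \<mu>) \<le> ennreal K * diff_energy u v"
proof (induction m)
  case 0
  have "en L \<alpha> (\<lambda>k. u t k - v t k) \<le> ennreal 1 * diff_energy u v" if "0 \<le> t" "t \<le> real 0 * \<mu>" for u t
  proof -
    have "t = 0" using that by simp
    then show ?thesis by (simp add: diff_energy_def)
  qed
  moreover have "cumul h (real 0 * \<mu>) \<le> x" for h x by (simp add: cumul_def)
  ultimately show ?case by (intro exI[of _ 1]) simp
next
  case (Suc m)
  then obtain K where K: "K \<ge> 0" and IH: "\<And>\<phi> u0 u. sol \<phi> u0 u \<Longrightarrow> diff_energy u v \<le> 1 \<Longrightarrow>
     cumul (\<lambda>s. en L (1 + \<alpha>) (\<lambda>k. u s k - v s k)) (real m * \<mu>) \<le> ennreal K * diff_energy u v"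
    by blast
  define T where "T = real (Suc m) * \<mu>"
  have T: "T - \<mu> = real m * \<mu>" by (simp add: T_def algebra_simps)
  have vt: "traj L v" and vp: "past (\<lambda>s. en L (1 + \<alpha>) (v s)) < \<infinity>" and vb: "bdd v T"
    and vc: "\<And>T. cumul (\<lambda>s. en L (1 + \<alpha>) (v s)) T < \<infinity>" and vm: "mild f (\<lambda>s. v (s - \<mu>)) T v"
    using v unfolding sol_def by blast+
  define Xv where "Xv = cumul (\<lambda>s. en L (1 + \<alpha>) (v (s - \<mu>))) T"
  have Xv: "Xv < \<infinity>" unfolding Xv_def by (rule drift_finite[OF vt vp vc])
  \<comment> \<open>A bound for the energy of the perturbed drift: twice the reference drift plus
    twice the difference, which is at most \<open>1 + K\<close> by the induction hypothesis and the
    assumption \<open>diff_energy u v \<le> 1\<close>. Without that assumption X would depend on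
    u.\<close>
  define X where "X = 2 * enn2real Xv + 2 * (1 + K)"
  have X: "X \<ge> 0" "ennreal X = 2 * Xv + 2 * (1 + ennreal K)"
    using K Xv by (simp_all add: X_def ennreal_plus ennreal_mult)
  obtain M where M: "M \<ge> 0" "\<And>t. 0 \<le> t \<Longrightarrow> t \<le> T \<Longrightarrow> en L \<alpha> (v t) \<le> ennreal M"
    using vb unfolding bdd_def by blast
  obtain K' where K': "K' \<ge> 0" and st: "\<forall>f w w' u v. traj L w \<longrightarrow> traj L w' \<longrightarrow> traj L u \<longrightarrow> traj L v \<longrightarrow> f \<in> Vsp L (\<alpha> - 1) \<longrightarrow>
    cumul (\<lambda>s. en L (1 + \<alpha>) (w s)) T \<le> ennreal X \<longrightarrow> cumul (\<lambda>s. en L (1 + \<alpha>) (w' s)) T < \<infinity> \<longrightarrow> bdd u T \<longrightarrow>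
    (\<forall>t. 0 \<le> t \<longrightarrow> t \<le> T \<longrightarrow> en L \<alpha> (v t) \<le> ennreal M) \<longrightarrow> mild f w T u \<longrightarrow> mild f w' T v \<longrightarrow>
    (\<forall>t. 0 \<le> t \<longrightarrow> t \<le> T \<longrightarrow> en L \<alpha> (\<lambda>k. u t k - v t k) \<le> ennreal K' * (en L \<alpha> (\<lambda>k. u 0 k - v 0 k) + cumul (\<lambda>s. en L (1 + \<alpha>) (\<lambda>k. w s k - w' s k)) T)) \<and>
    cumul (\<lambda>t. en L (1 + \<alpha>) (\<lambda>k. u t k - v t k)) T \<le> ennreal K' * (en L \<alpha> (\<lambda>k. u 0 k - v 0 k) + cumul (\<lambda>s. en L (1 + \<alpha>) (\<lambda>k. w s k - w' s k)) T)"
    using stability[OF X(1) M(1), of T] by (elim exE conjE that)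
  have "(\<forall>t. 0 \<le> t \<longrightarrow> t \<le> T \<longrightarrow> en L \<alpha> (\<lambda>k. u t k - v t k) \<le> ennreal (K' * (2 + K)) * diff_energy u v) \<and>
     cumul (\<lambda>s. en L (1 + \<alpha>) (\<lambda>k. u s k - v s k)) T \<le> ennreal (K' * (2 + K)) * diff_energy u v"
    if u: "sol \<phi> u0 u" and small: "diff_energy u v \<le> 1" for \<phi> u0 u
  proof -
    let ?E = "diff_energy u v" and ?D = "cumul (\<lambda>s. en L (1 + \<alpha>) (\<lambda>k. u (s - \<mu>) k - v (s - \<mu>) k)) T"
    have ut: "traj L u" and ub: "bdd u T" and um: "mild f (\<lambda>s. u (s - \<mu>)) T u"
      using u unfolding sol_def by blast+
    note wt = drift_traj[OF ut] and wt' = drift_traj[OF vt]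
    have "?D \<le> past (\<lambda>s. en L (1 + \<alpha>) (\<lambda>k. u s k - v s k)) + cumul (\<lambda>s. en L (1 + \<alpha>) (\<lambda>k. u s k - v s k)) (real m * \<mu>)"
      using drift_le[OF traj_en_measurable[OF traj_diff[OF ut vt]], of "1 + \<alpha>" T] unfolding T .
    also have "\<dots> \<le> ?E + ennreal K * ?E"
      by (intro add_mono IH[OF u small]) (simp add: diff_energy_def)
    finally have D: "?D \<le> ?E + ennreal K * ?E" .
    have "cumul (\<lambda>s. en L (1 + \<alpha>) (u (s - \<mu>))) T \<le> 2 * Xv + 2 * ?D"
      unfolding Xv_def
    proof (rule cumul_en_add_le[OF wt' traj_diff[OF wt wt']])
      show "norm (u (t - \<mu>) k) \<le> norm (v (t - \<mu>) k) + norm (u (t - \<mu>) k - v (t - \<mu>) k)" for t k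
        using norm_triangle_ineq[of "v (t - \<mu>) k" "u (t - \<mu>) k - v (t - \<mu>) k"] by simp
    qed
    also have "\<dots> \<le> 2 * Xv + 2 * (1 + ennreal K * 1)"
      by (intro add_left_mono mult_left_mono order_trans[OF D] add_mono small) auto
    also have "\<dots> = ennreal X" by (simp add: X(2))
    finally have W: "cumul (\<lambda>s. en L (1 + \<alpha>) (u (s - \<mu>))) T \<le> ennreal X" .
    \<comment> \<open>The factor \<open>2 + K\<close> consists of 1 for the initial values and
      \<open>1 + K\<close> for the drift, of which 1 is the history and K the previous
      intervals.\<close>
    have "en L \<alpha> (\<lambda>k. u 0 k - v 0 k) + ?D \<le> ?E + (?E + ennreal K * ?E)"
      by (intro add_mono D) (simp add: diff_energy_def)
    also have "\<dots> = (2 + ennreal K) * ?E" by (simp add: distrib_right mult_2 add.assoc)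
    finally have "ennreal K' * (en L \<alpha> (\<lambda>k. u 0 k - v 0 k) + ?D) \<le> ennreal K' * ((2 + ennreal K) * ?E)"
      by (rule mult_left_mono) simp
    also have "\<dots> = ennreal (K' * (2 + K)) * ?E"
      using K K' by (simp add: ennreal_mult ennreal_plus mult.assoc)
    finally have fin: "ennreal K' * (en L \<alpha> (\<lambda>k. u 0 k - v 0 k) + ?D) \<le> ennreal (K' * (2 + K)) * ?E" .
    have M2: "\<forall>t. 0 \<le> t \<longrightarrow> t \<le> T \<longrightarrow> en L \<alpha> (v t) \<le> ennreal M" using M(2) by blast
    note res = st[THEN spec, THEN spec, THEN spec, THEN spec, THEN spec, THEN mp, OF wt, THEN mp, OF wt', THEN mp, OF ut, THEN mp, OF vt, THEN mp, OF f, THEN mp, OF W, THEN mp, OF Xv[unfolded Xv_def], THEN mp, OF ub, THEN mp, OF M2, THEN mp, OF um, THEN mp, OF vm]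
    show ?thesis
    proof (intro conjI allI impI)
      fix t assume t: "0 \<le> t" "t \<le> T"
      show "en L \<alpha> (\<lambda>k. u t k - v t k) \<le> ennreal (K' * (2 + K)) * ?E"
        using res[THEN conjunct1, rule_format, OF t] fin by (rule order_trans)
    next
      show "cumul (\<lambda>s. en L (1 + \<alpha>) (\<lambda>k. u s k - v s k)) T \<le> ennreal (K' * (2 + K)) * ?E"
        using res[THEN conjunct2] fin by (rule order_trans)
    qed
  qed
  then show ?case unfolding T_def[symmetric] using K K' by (intro exI[of _ "K' * (2 + K)"]) auto
qed

text \<open>Histories that agree almost everywhere have \<open>diff_energy\<close> 0, which meets
  the smallness condition of \<open>delay_stability\<close> and makes its bound 0.\<close>

lemma sol_unique:
  assumes u: "sol \<phi> u0 u" and v: "sol \<phi>' u0 v" and ae: "AE t in lborel. t \<in> {- \<mu><..<0} \<longrightarrow> \<phi> t = \<phi>' t" and t: "0 \<le> t"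
  shows "u t = v t"
proof -
  have ut: "traj L u" and vt: "traj L v" using u v unfolding sol_def by blast+
  have z: "en L s (\<lambda>k. 0) = 0" for s by (simp add: en_zero_iff[OF L])
  have "past (\<lambda>s. en L (1 + \<alpha>) (\<lambda>k. u s k - v s k)) = (\<integral>\<^sup>+s. 0 \<partial>(lborel :: real measure))"
    unfolding past_def
  proof (rule nn_integral_cong_AE)
    show "AE s in lborel. en L (1 + \<alpha>) (\<lambda>k. u s k - v s k) * indicator {- \<mu><..<0} s = 0"
      using ae
    proof eventually_elim
      case (elim s)
      then show ?case using u v unfolding sol_def by (cases "s \<in> {- \<mu><..<0}") (auto simp: z)
    qed
  qed
  then have e: "diff_energy u v = 0"
    using u v unfolding diff_energy_def sol_def by (simp add: z)
  obtain m where "t / \<mu> \<le> real m" using real_arch_simple by blast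
  then have m: "t \<le> real m * \<mu>" using mu by (simp add: pos_divide_le_eq)
  obtain K where K: "\<And>\<phi> u0 u. sol \<phi> u0 u \<Longrightarrow> diff_energy u v \<le> 1 \<Longrightarrow>
     (\<forall>t. 0 \<le> t \<longrightarrow> t \<le> real m * \<mu> \<longrightarrow> en L \<alpha> (\<lambda>k. u t k - v t k) \<le> ennreal K * diff_energy u v)"
    using delay_stability[OF v, of m] by blast
  have "en L \<alpha> (\<lambda>k. u t k - v t k) = 0"
    using K[OF u] t m by (simp add: e)
  then show ?thesis by (rule en_diff_eq_0[OF ut vt])
qed

text \<open>The method of steps is carried out without gluing intervals: the map sending x to the
  solution with drift \<open>x (s - \<mu>)\<close> is iterated on the whole half-line, and the n-th
  iterate is final for \<open>t < real n * \<mu>\<close>.\<close>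

lemma sol_exists:
  assumes \<phi>: "traj L \<phi>" "(\<integral>\<^sup>+t. en L (1 + \<alpha>) (\<phi> t) \<partial>lborel) < \<infinity>" and u0: "u0 \<in> Vsp L \<alpha>"
  shows "\<exists>u. sol \<phi> u0 u"
proof -
  let ?e = "\<lambda>x s. en L (1 + \<alpha>) (x s)"
  define good where "good x \<longleftrightarrow> traj L x \<and> past (?e x) < \<infinity> \<and> (\<forall>T. cumul (?e x) T < \<infinity>)" for x
  define P where "P x X \<longleftrightarrow> good X \<and> X 0 = u0 \<and> (\<forall>t<0. X t = \<phi> t) \<and> (\<forall>T. mild f (\<lambda>s. x (s - \<mu>)) T X \<and> bdd X T)" for x X
  have le: "(\<integral>\<^sup>+t. ?e \<phi> t * indicator A t \<partial>lborel) < \<infinity>" for A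
    using \<phi>(2) by (rule le_less_trans[rotated]) (intro nn_integral_mono, auto simp: indicator_def)
  have past\<phi>: "past (?e x) < \<infinity>" if "\<forall>t<0. x t = \<phi> t" for x
  proof -
    have "past (?e x) = past (?e \<phi>)"
      unfolding past_def using that by (intro nn_integral_cong) (auto simp: indicator_def)
    then show ?thesis using le by (simp add: past_def)
  qed
  have good\<phi>: "good \<phi>"
    using \<phi>(1) le past\<phi>[of \<phi>] by (simp add: good_def cumul_def)
  have step: "\<exists>X. P x X" if x: "good x" for x
  proof -
    have xt: "traj L x" and xp: "past (?e x) < \<infinity>" and xc: "\<And>T. cumul (?e x) T < \<infinity>"
      using x by (auto simp: good_def)
    note wt = drift_traj[OF xt] and wf = drift_finite[OF xt xp xc]
    obtain y where y: "traj L y" "y 0 = u0" "\<And>T. mild f (\<lambda>s. x (s - \<mu>)) T y" "\<And>T. bdd y T"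
      using linear_existence[OF wt wf f u0] by blast
    define X where "X t = (if t < 0 then \<phi> t else y t)" for t
    have Xt: "traj L X"
      unfolding traj_def
    proof (intro conjI allI)
      show "X t \<in> solenoidal L" for t using \<phi>(1) y(1) by (auto simp: X_def traj_def)
      fix k
      note [measurable] = traj_measurable[OF \<phi>(1), of k] traj_measurable[OF y(1), of k]
      have "(\<lambda>t. if t < 0 then \<phi> t k else y t k) \<in> borel_measurable borel" by measurable
      then show "(\<lambda>t. X t k) \<in> borel_measurable borel" by (simp add: X_def if_distrib[of "\<lambda>g. g k"])
    qed
    have Xm: "mild f (\<lambda>s. x (s - \<mu>)) T X" for T
      by (rule mild_cong[OF y(3)]) (simp_all add: X_def)
    have Xb: "bdd X T" for T using y(4)[of T] by (simp add: bdd_def X_def)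
    have Xc: "cumul (?e X) T < \<infinity>" for T
    proof (cases "T \<ge> 0")
      case True
      then show ?thesis by (rule mild_L2[OF wt wf Xt Xb f Xm])
    next
      case False
      then have "{0<..<T} = {}" by auto
      then show ?thesis by (simp add: cumul_def)
    qed
    have "P x X"
      unfolding P_def good_def using Xt Xm Xb Xc past\<phi>[of X] y(2) by (simp add: X_def)
    then show ?thesis by blast
  qed
  define G where "G x = (SOME X. P x X)" for x
  define U where "U n = (G ^^ n) \<phi>" for n
  have U0: "U 0 = \<phi>" and USuc: "U (Suc n) = G (U n)" for n by (simp_all add: U_def)
  have GP: "P x (G x)" if "good x" for x unfolding G_def by (rule someI_ex[OF step[OF that]])
  have gU: "good (U n)" for n
  proof (induction n)
    case (Suc n)
    then show ?case using GP[OF Suc] by (simp add: USuc P_def)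
  qed (simp add: U0 good\<phi>)
  have PU: "P (U n) (U (Suc n))" for n unfolding USuc by (rule GP[OF gU])
  have U\<phi>: "U n t = \<phi> t" if "t < 0" for n t
    using PU[of "n - 1"] that by (cases n) (auto simp: U0 P_def)
  \<comment> \<open>Two successive iterates agreeing up to \<open>real n * \<mu>\<close> provide
    equal drifts one delay longer, so \<open>linear_unique\<close> extends the agreement by one
    interval.\<close>
  have agree: "U (Suc n) t = U n t" if "t < real n * \<mu>" for n t
    using that
  proof (induction n arbitrary: t)
    case 0
    then show ?case by (simp add: U\<phi>)
  next
    case (Suc n)
    show ?case
    proof (cases "t < 0")
      case True
      then show ?thesis by (simp add: U\<phi>)
    next
      case False
      let ?T = "real (Suc n) * \<mu>"
      have gt: "traj L (U m)" and gp: "past (?e (U m)) < \<infinity>" and gc: "cumul (?e (U m)) T < \<infinity>" for m T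
        using gU[of m] unfolding good_def by blast+
      have Pm: "mild f (\<lambda>s. U m (s - \<mu>)) T (U (Suc m))" and Pb: "bdd (U (Suc m)) T" and P0: "U (Suc m) 0 = u0" for m T
        using PU[of m] unfolding P_def by blast+
      have ww: "U (Suc n) (s - \<mu>) = U n (s - \<mu>)" if "0 < s" "s < ?T" for s
        using that(2) by (intro Suc.IH) (simp add: algebra_simps)
      have 0: "U (Suc (Suc n)) 0 = U (Suc n) 0" by (simp only: P0)
      have t: "0 \<le> t" "t \<le> ?T" using False Suc.prems by auto
      show ?thesis
        by (rule linear_unique[OF drift_traj[OF gt] drift_finite[OF gt gp gc] drift_traj[OF gt] drift_finite[OF gt gp gc] gt Pb Pm gt Pb Pm f 0 ww t])
    qed
  qed
  have agree': "U m t = U n t" if "n \<le> m" "t < real n * \<mu>" for m n t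
    using that(1)
  proof (induction m rule: dec_induct)
    case (step m)
    have "real n * \<mu> \<le> real m * \<mu>" using step.hyps mu by (intro mult_right_mono) auto
    then have "U (Suc m) t = U m t" using that(2) by (intro agree) linarith
    then show ?case using step.IH by simp
  qed simp
  \<comment> \<open>A number of steps after which the value at t no longer changes; the successor
    makes \<open>t < real (N t) * \<mu>\<close> strict.\<close>
  define N where "N t = Suc (nat \<lceil>t / \<mu>\<rceil>)" for t
  have N: "t < real (N t) * \<mu>" for t
  proof -
    have "t / \<mu> < real (N t)" unfolding N_def by linarith
    then show ?thesis using mu by (simp add: pos_divide_less_eq)
  qed
  define u where "u t = U (N t) t" for t
  have Uu: "U m t = u t" if "t < real m * \<mu>" for m t
    unfolding u_def using agree'[OF _ that, of "N t"] agree'[OF _ N, of t m] by (cases "m \<le> N t") simp_all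
  have ut: "traj L u"
    unfolding traj_def
  proof (intro conjI allI)
    show "u t \<in> solenoidal L" for t using gU[of "N t"] by (simp add: u_def good_def traj_def)
    fix k
    have lim: "(\<lambda>n. U n t k) \<longlonglongrightarrow> u t k" for t
    proof (rule tendsto_eventually)
      have "U n t k = u t k" if "n \<ge> N t" for n
        unfolding u_def using agree'[OF that N] by simp
      then show "\<forall>\<^sub>F n in sequentially. U n t k = u t k"
        unfolding eventually_sequentially by blast
    qed
    have meas: "(\<lambda>t. U n t k) \<in> borel_measurable borel" for n
      using gU[of n] by (simp add: good_def traj_def)
    show "(\<lambda>t. u t k) \<in> borel_measurable borel"
      by (rule borel_measurable_LIMSEQ_metric[OF meas lim])
  qed
  have u\<phi>: "\<forall>t<0. u t = \<phi> t" by (simp add: u_def U\<phi>)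
  have u00: "u 0 = u0" using PU[of "nat \<lceil>0 / \<mu>\<rceil>"] by (simp add: u_def N_def P_def)
  have "bdd u T \<and> cumul (?e u) T < \<infinity> \<and> mild f (\<lambda>s. u (s - \<mu>)) T u" for T
  proof -
    \<comment> \<open>On \<open>[0, T]\<close> the limit equals iterate \<open>Suc ?n\<close>, while
      its shift equals that of iterate \<open>?n\<close>. These two are linked by the defining
      equation of the iteration.\<close>
    let ?n = "N T"
    have uS: "u s = U (Suc ?n) s" if "s \<le> T" for s
    proof -
      have "s < real (Suc ?n) * \<mu>" using that N[of T] mu by (simp add: algebra_simps)
      from Uu[OF this] show ?thesis by simp
    qed
    have uw: "u (s - \<mu>) = U ?n (s - \<mu>)" if "s \<le> T" for s
    proof -
      have "s - \<mu> < real ?n * \<mu>" using that N[of T] mu by linarith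
      from Uu[OF this] show ?thesis by simp
    qed
    have Pm: "mild f (\<lambda>s. U ?n (s - \<mu>)) T (U (Suc ?n))" and Pb: "bdd (U (Suc ?n)) T" and Pc: "cumul (?e (U (Suc ?n))) T < \<infinity>"
      using PU[of ?n] unfolding P_def good_def by blast+
    have "mild f (\<lambda>s. u (s - \<mu>)) T u" by (rule mild_cong[OF Pm]) (simp_all add: uS uw)
    moreover have "bdd u T" using Pb by (simp add: bdd_def uS)
    moreover have "cumul (?e u) T \<le> cumul (?e (U (Suc ?n))) T" by (intro cumul_mono_fun) (simp add: uS)
    ultimately show ?thesis using Pc by (auto elim: le_less_trans)
  qed
  then have "sol \<phi> u0 u" unfolding sol_def using ut u\<phi> u00 past\<phi>[OF u\<phi>] by blast
  then show ?thesis by blast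
qed

end

section \<open>Weak solutions of the delay equation\<close>

lemma AE_lborel_translate:
  fixes c :: real
  assumes "AE t in lborel. P t"
  shows "AE r in lborel. P (c + r)"
proof -
  have m: "(+) c \<in> lborel \<rightarrow>\<^sub>M borel" by simp
  have "AE t in distr lborel borel ((+) c). P t"
    using assms unfolding lborel_distr_plus .
  from AE_distrD[OF m this] show ?thesis .
qed

lemma L2_rel_image:
  "L2_rel L s a b `` {p} = {c \<in> L2_fun L s a b. p \<in> L2_fun L s a b \<and> (AE t in lborel. t \<in> {a<..<b} \<longrightarrow> p t = c t)}"
  by (auto simp: L2_rel_def AE_lebesgue_on_iff)

lemma L2_class_eq:
  assumes "p \<in> L2_fun L s a b" "q \<in> L2_fun L s a b" and ae: "AE t in lborel. t \<in> {a<..<b} \<longrightarrow> p t = q t"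
  shows "L2_rel L s a b `` {p} = L2_rel L s a b `` {q}"
proof -
  have "(AE t in lborel. t \<in> {a<..<b} \<longrightarrow> p t = c t) \<longleftrightarrow> (AE t in lborel. t \<in> {a<..<b} \<longrightarrow> q t = c t)" for c
  proof
    assume "AE t in lborel. t \<in> {a<..<b} \<longrightarrow> p t = c t"
    with ae show "AE t in lborel. t \<in> {a<..<b} \<longrightarrow> q t = c t" by eventually_elim auto
  next
    assume "AE t in lborel. t \<in> {a<..<b} \<longrightarrow> q t = c t"
    with ae show "AE t in lborel. t \<in> {a<..<b} \<longrightarrow> p t = c t" by eventually_elim auto
  qed
  then show ?thesis unfolding L2_rel_image using assms(1,2) by blast
qed

lemma L2_class_rep:
  assumes "p \<in> L2_fun L s a b"
  shows "rep (L2_rel L s a b `` {p}) \<in> L2_fun L s a b"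
    and "AE t in lborel. t \<in> {a<..<b} \<longrightarrow> rep (L2_rel L s a b `` {p}) t = p t"
proof -
  have "p \<in> L2_rel L s a b `` {p}" using assms by (simp add: L2_rel_image)
  then have "rep (L2_rel L s a b `` {p}) \<in> L2_rel L s a b `` {p}"
    unfolding rep_def by (rule someI[of "\<lambda>\<phi>. \<phi> \<in> L2_rel L s a b `` {p}" p])
  then have r: "rep (L2_rel L s a b `` {p}) \<in> L2_fun L s a b"
    "AE t in lborel. t \<in> {a<..<b} \<longrightarrow> p t = rep (L2_rel L s a b `` {p}) t"
    unfolding L2_rel_image[of L s a b p] by blast+
  show "rep (L2_rel L s a b `` {p}) \<in> L2_fun L s a b" by (rule r(1))
  show "AE t in lborel. t \<in> {a<..<b} \<longrightarrow> rep (L2_rel L s a b `` {p}) t = p t"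
    using r(2) by eventually_elim simp
qed

context delayed_torus
begin

text \<open>Links an arbitrary representative, as picked by \<open>rep\<close>, to a trajectory that
  agrees with it almost everywhere on the delay interval.\<close>

definition clean :: "(real \<Rightarrow> field) \<Rightarrow> (real \<Rightarrow> field) \<Rightarrow> bool" where
  "clean p \<phi> \<longleftrightarrow> traj L \<phi> \<and> past (\<lambda>s. en L (1 + \<alpha>) (\<phi> s)) < \<infinity> \<and>
     (AE t in lborel. t \<in> {- \<mu><..<0} \<longrightarrow> p t = \<phi> t)"

lemma sol_L2:
  assumes u: "sol \<phi> u0 u" and t: "0 \<le> t" and p: "AE s in lborel. s \<in> {- \<mu><..<b} \<longrightarrow> p s = u (t + s)"
  shows "p \<in> L2_fun L (1 + \<alpha>) (- \<mu>) b"
proof (rule L2_funI[OF L _ p])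
  have ut: "traj L u" and up: "past (\<lambda>s. en L (1 + \<alpha>) (u s)) < \<infinity>" and uc: "\<And>T. cumul (\<lambda>s. en L (1 + \<alpha>) (u s)) T < \<infinity>"
    using u unfolding sol_def by blast+
  show "traj L (\<lambda>s. u (t + s))" by (rule traj_compose[OF ut]) measurable
  have "(\<integral>\<^sup>+s. en L (1 + \<alpha>) (u (t + s)) * indicator {- \<mu><..<b} s \<partial>lborel)
    = (\<integral>\<^sup>+r. en L (1 + \<alpha>) (u r) * indicator {t + - \<mu><..<t + b} r \<partial>lborel)"
    by (rule nn_integral_window[OF traj_en_measurable[OF ut]])
  also have "\<dots> \<le> past (\<lambda>s. en L (1 + \<alpha>) (u s)) + cumul (\<lambda>s. en L (1 + \<alpha>) (u s)) (t + b)"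
    by (rule window_le[OF traj_en_measurable[OF ut]]) (use t in simp)
  also have "\<dots> < \<infinity>" using up uc by simp
  finally show "(\<integral>\<^sup>+s\<in>{- \<mu><..<b}. en L (1 + \<alpha>) (u (t + s)) \<partial>lborel) < \<infinity>" .
qed

lemma sol_imp_weak:
  assumes u: "sol \<phi> u0 u" and p: "clean p \<phi>"
  shows "weak_solution L \<mu> \<nu> \<alpha> f p u0 u"
proof -
  have ut: "traj L u" and up: "past (\<lambda>s. en L (1 + \<alpha>) (u s)) < \<infinity>" and uc: "\<And>T. cumul (\<lambda>s. en L (1 + \<alpha>) (u s)) T < \<infinity>"
    and um: "\<And>T. mild f (\<lambda>s. u (s - \<mu>)) T u" and ub: "\<And>T. bdd u T" and u0: "u 0 = u0" and u\<phi>: "\<And>t. t < 0 \<Longrightarrow> u t = \<phi> t"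
    using u unfolding sol_def by blast+
  have wt: "traj L (\<lambda>s. u (s - \<mu>))" by (rule drift_traj[OF ut])
  have wf: "cumul (\<lambda>s. en L (1 + \<alpha>) (u (s - \<mu>))) T < \<infinity>" for T by (rule drift_finite[OF ut up uc])
  have fin: "en L \<alpha> (u t) < \<infinity>" if "t \<ge> 0" for t by (rule bdd_finite[OF ub that order_refl])
  have upto: "weak_solution_upto L \<mu> \<nu> \<alpha> f p u0 T u" if T: "T > 0" for T
    unfolding weak_solution_upto_def
  proof (intro conjI ballI)
    show "u \<in> L2_fun L (1 + \<alpha>) (- \<mu>) T" by (rule sol_L2[OF u order_refl]) simp
    show "u 0 = u0" by (rule u0)
    have "AE t in lborel. t \<in> {- \<mu><..<0} \<longrightarrow> p t = \<phi> t" using p by (simp add: clean_def)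
    then have "AE t in lborel. t \<in> {- \<mu><..<0} \<longrightarrow> u t = p t"
      by eventually_elim (simp add: u\<phi>)
    then show "AE t in lebesgue_on {- \<mu><..<0}. u t = p t" by (simp add: AE_lebesgue_on_iff)
    fix v \<psi> assume v: "v \<in> Vsp L (\<alpha> + 1)" and \<psi>: "\<psi> \<in> test_functions T"
    have "weak_id f (\<lambda>s. u (s - \<mu>)) T u v \<psi>"
      by (rule mild_imp_weak[OF wt wf ut ub um T _ _ f v \<psi>]) simp_all
    then show "- (LINT r|lebesgue_on {0<..<T}. pairing L (u r) v * deriv \<psi> r)
        + \<nu> * (LINT r|lebesgue_on {0<..<T}. pairing L (stokes_pow L (1/2) (u r)) (stokes_pow L (1/2) v) * \<psi> r)
        + (LINT r|lebesgue_on {0<..<T}. b_form L (1 + \<alpha>) \<alpha> (1 + \<alpha>) (u (r - \<mu>)) (u r) v * \<psi> r)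
        = (LINT r|lebesgue_on {0<..<T}. pairing L f v * \<psi> r)"
      unfolding weak_id_def .
  qed
  have cont: "((\<lambda>r. vdist L \<alpha> (u r) (u t)) \<longlongrightarrow> 0) (at t within {0..})" if t: "t \<ge> 0" for t
    unfolding tendsto_at_iff_sequentially
  proof (intro allI impI)
    fix X :: "nat \<Rightarrow> real" assume X: "\<forall>i. X i \<in> {0..} - {t}" and lim: "X \<longlonglongrightarrow> t"
    obtain B where B: "\<And>n. norm (X n) \<le> B"
      using convergent_imp_Bseq[OF convergentI[OF lim]] unfolding Bseq_def by blast
    have X0: "0 \<le> X n" and XB: "X n \<le> B" for n using X B[of n] by auto
    have "(\<lambda>n. en L \<alpha> (\<lambda>k. u (X n) k - u t k)) \<longlonglongrightarrow> 0"
      by (rule mild_continuous[OF wt wf ut ub f um X0 XB lim])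
    then show "((\<lambda>r. vdist L \<alpha> (u r) (u t)) \<circ> X) \<longlonglongrightarrow> 0"
      unfolding comp_def by (rule iffD2[OF vdist_tendsto_iff[OF L fin[OF X0] fin[OF t]]])
  qed
  have "u t \<in> Vsp L \<alpha>" if "t \<ge> 0" for t
    using ut fin[OF that] by (simp add: Vsp_iff traj_def)
  with upto cont show ?thesis unfolding weak_solution_def by blast
qed

text \<open>At nonnegative times a weak solution needs no modification, because continuity in norm
  makes every coefficient continuous. Replacing it by \<phi> at negative times alters the drift only
  on a null set and leaves the weak identity intact.\<close>

lemma weak_imp_sol:
  assumes u: "weak_solution L \<mu> \<nu> \<alpha> f p u0 u" and p: "clean p \<phi>"
  shows "sol \<phi> u0 (\<lambda>t. if t < 0 then \<phi> t else u t)"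
proof -
  define x where "x t = (if t < 0 then \<phi> t else u t)" for t
  have \<phi>t: "traj L \<phi>" and \<phi>p: "past (\<lambda>s. en L (1 + \<alpha>) (\<phi> s)) < \<infinity>" and \<phi>ae: "AE t in lborel. t \<in> {- \<mu><..<0} \<longrightarrow> p t = \<phi> t"
    using p by (auto simp: clean_def)
  have upto: "\<And>T. T > 0 \<Longrightarrow> weak_solution_upto L \<mu> \<nu> \<alpha> f p u0 T u"
    and uV: "\<And>t. t \<ge> 0 \<Longrightarrow> u t \<in> Vsp L \<alpha>" and uc: "\<And>t. t \<ge> 0 \<Longrightarrow> ((\<lambda>r. vdist L \<alpha> (u r) (u t)) \<longlongrightarrow> 0) (at t within {0..})"
    using u unfolding weak_solution_def by blast+
  have fin: "en L \<alpha> (u t) < \<infinity>" and us: "u t \<in> solenoidal L" if "t \<ge> 0" for t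
    using uV[OF that] by (auto simp: Vsp_iff)
  have uz: "u t 0 = 0" if "t \<ge> 0" for t using us[OF that] by (simp add: solenoidal_iff)
  have modes: "continuous_on {0..} (\<lambda>t. u t k)" for k
    unfolding continuous_on_def tendsto_at_iff_sequentially
  proof (intro ballI allI impI)
    fix t :: real and X :: "nat \<Rightarrow> real" assume t: "t \<in> {0..}" and X: "\<forall>i. X i \<in> {0..} - {t}" and lim: "X \<longlonglongrightarrow> t"
    have t0: "t \<ge> 0" and X0: "X n \<ge> 0" for n using t X by auto
    have "((\<lambda>r. vdist L \<alpha> (u r) (u t)) \<circ> X) \<longlonglongrightarrow> 0"
      using uc[OF t0] X lim unfolding tendsto_at_iff_sequentially by blast
    then have e: "(\<lambda>n. en L \<alpha> (\<lambda>k. u (X n) k - u t k)) \<longlonglongrightarrow> 0"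
      unfolding comp_def by (rule iffD1[OF vdist_tendsto_iff[OF L fin[OF X0] fin[OF t0]]])
    show "((\<lambda>t. u t k) \<circ> X) \<longlonglongrightarrow> u t k"
    proof (cases "k = 0")
      case True
      then show ?thesis by (simp add: comp_def uz[OF X0] uz[OF t0])
    next
      case False
      from en_tendsto_mode[OF L False e] show ?thesis unfolding comp_def by (rule LIM_zero_cancel)
    qed
  qed
  have xt: "traj L x"
    unfolding traj_def
  proof (intro conjI allI)
    show "x t \<in> solenoidal L" for t using us \<phi>t by (auto simp: x_def traj_def)
    fix k
    \<comment> \<open>Freezing time at 0 extends the continuous coefficient to the whole line, which
      makes it Borel.\<close>
    have "continuous_on UNIV ((\<lambda>t. u t k) \<circ> (\<lambda>t. max 0 t))"
      by (intro continuous_on_compose continuous_intros continuous_on_subset[OF modes]) auto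
    then have [measurable]: "(\<lambda>t. u (max 0 t) k) \<in> borel_measurable borel"
      unfolding comp_def by (rule borel_measurable_continuous_onI)
    note [measurable] = traj_measurable[OF \<phi>t, of k]
    have "(\<lambda>t. if t < 0 then \<phi> t k else u (max 0 t) k) \<in> borel_measurable borel" by measurable
    moreover have "(\<lambda>t. if t < 0 then \<phi> t k else u (max 0 t) k) = (\<lambda>t. x t k)"
      by (auto simp: x_def max_def)
    ultimately show "(\<lambda>t. x t k) \<in> borel_measurable borel" by simp
  qed
  have xb: "bdd x T" for T
  proof -
    \<comment> \<open>The norm is continuous by the reverse triangle inequality, hence bounded on
      compact intervals, as \<open>bdd\<close> requires.\<close>
    have "continuous_on {0..} (\<lambda>t. vnorm L \<alpha> (u t))"
      unfolding continuous_on_def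
    proof
      fix t :: real assume "t \<in> {0..}"
      then have t: "t \<ge> 0" by simp
      have "norm (vnorm L \<alpha> (u r) - vnorm L \<alpha> (u t)) \<le> vdist L \<alpha> (u r) (u t)" if "r \<ge> 0" for r
        using vnorm_le_vdist[OF L fin[OF that] fin[OF t]] vnorm_le_vdist[OF L fin[OF t] fin[OF that]]
        by (simp add: vdist_commute[of L \<alpha> "u t"])
      then have "\<forall>\<^sub>F r in at t within {0..}. norm (vnorm L \<alpha> (u r) - vnorm L \<alpha> (u t)) \<le> vdist L \<alpha> (u r) (u t)"
        by (simp add: eventually_at_filter)
      then have "((\<lambda>r. vnorm L \<alpha> (u r) - vnorm L \<alpha> (u t)) \<longlongrightarrow> 0) (at t within {0..})"
        by (rule Lim_null_comparison) (rule uc[OF t])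
      then show "((\<lambda>t. vnorm L \<alpha> (u t)) \<longlongrightarrow> vnorm L \<alpha> (u t)) (at t within {0..})"
        by (rule LIM_zero_cancel)
    qed
    then have "continuous_on {0..T} (\<lambda>t. vnorm L \<alpha> (u t))"
      by (rule continuous_on_subset) auto
    then have "bounded ((\<lambda>t. vnorm L \<alpha> (u t)) ` {0..T})"
      by (intro compact_imp_bounded compact_continuous_image) auto
    then obtain B where B: "\<And>t. 0 \<le> t \<Longrightarrow> t \<le> T \<Longrightarrow> \<bar>vnorm L \<alpha> (u t)\<bar> \<le> B"
      unfolding bounded_iff by force
    have "en L \<alpha> (x t) \<le> ennreal (B\<^sup>2 / L ^ 3)" if t: "0 \<le> t" "t \<le> T" for t
    proof -
      have "(vnorm L \<alpha> (u t))\<^sup>2 \<le> B\<^sup>2" using B[OF t] by (intro abs_le_square_iff[THEN iffD1]) linarith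
      then have "en L \<alpha> (u t) \<le> ennreal (B\<^sup>2 / L ^ 3)"
        unfolding en_eq_vnorm[OF L fin[OF t(1)]] using L by (intro ennreal_leI divide_right_mono) auto
      then show ?thesis using t by (simp add: x_def)
    qed
    moreover have "0 \<le> B\<^sup>2 / L ^ 3" using L by simp
    ultimately show ?thesis unfolding bdd_def by blast
  qed
  have xc: "cumul (\<lambda>s. en L (1 + \<alpha>) (x s)) T < \<infinity>" for T
  proof -
    define S where "S = max T 1"
    have "u \<in> L2_fun L (1 + \<alpha>) (- \<mu>) S"
      using upto[of S] unfolding weak_solution_upto_def S_def by simp
    from L2_fun_clean[OF L this] obtain w where w: "AE t in lborel. t \<in> {- \<mu><..<S} \<longrightarrow> u t = w t"
      "(\<integral>\<^sup>+t. en L (1 + \<alpha>) (w t) \<partial>lborel) < \<infinity>" by blast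
    have "cumul (\<lambda>s. en L (1 + \<alpha>) (x s)) T \<le> (\<integral>\<^sup>+t. en L (1 + \<alpha>) (w t) \<partial>lborel)"
      unfolding cumul_def
    proof (rule nn_integral_mono_AE)
      show "AE s in lborel. en L (1 + \<alpha>) (x s) * indicator {0<..<T} s \<le> en L (1 + \<alpha>) (w s)"
        using w(1) by eventually_elim (use mu in \<open>auto simp: indicator_def x_def S_def\<close>)
    qed
    then show ?thesis using w(2) by (rule le_less_trans)
  qed
  have xp: "past (\<lambda>s. en L (1 + \<alpha>) (x s)) < \<infinity>"
  proof -
    have "past (\<lambda>s. en L (1 + \<alpha>) (x s)) = past (\<lambda>s. en L (1 + \<alpha>) (\<phi> s))"
      unfolding past_def by (intro nn_integral_cong) (auto simp: indicator_def x_def)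
    then show ?thesis using \<phi>p by simp
  qed
  have x0: "x 0 = u0"
    using upto[of 1] by (simp add: weak_solution_upto_def x_def)
  have drift: "AE r in lborel. 0 < r \<longrightarrow> u (r - \<mu>) = x (r - \<mu>)"
  proof -
    have "AE t in lborel. t \<in> {- \<mu><..<0} \<longrightarrow> u t = p t"
      using upto[of 1] by (simp add: weak_solution_upto_def AE_lebesgue_on_iff)
    then have "AE t in lborel. t \<in> {- \<mu><..<0} \<longrightarrow> u t = x t"
      using \<phi>ae by eventually_elim (auto simp: x_def)
    from AE_lborel_translate[OF this, of "- \<mu>"] show ?thesis
    proof eventually_elim
      case (elim r)
      have e: "- \<mu> + r = r - \<mu>" by simp
      show ?case using elim unfolding e by (cases "r < \<mu>") (auto simp: x_def)
    qed
  qed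
  have xm: "mild f (\<lambda>s. x (s - \<mu>)) T x" for T
  proof -
    \<comment> \<open>\<open>weak_imp_mild\<close> reaches only times below the end of the interval
      carrying the weak identity, so a longer interval is taken.\<close>
    define S where "S = max T 0 + 1"
    have S: "S > 0" "T < S" by (auto simp: S_def)
    note wt = drift_traj[OF xt] and wf = drift_finite[OF xt xp xc]
    have ww: "AE r in lborel. 0 < r \<and> r < S \<longrightarrow> u (r - \<mu>) = x (r - \<mu>)"
      using drift by eventually_elim simp
    have uu: "AE r in lborel. 0 < r \<and> r < S \<longrightarrow> u r = x r"
      by (simp add: x_def)
    have cont: "continuous_on {0..S} (\<lambda>t. x t k)" for k
    proof -
      have "continuous_on {0..S} (\<lambda>t. u t k)" by (rule continuous_on_subset[OF modes]) auto
      then show ?thesis by (rule continuous_on_eq) (simp add: x_def)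
    qed
    have weak: "weak_id f (\<lambda>r. u (r - \<mu>)) S u v \<psi>" if "v \<in> Vsp L (\<alpha> + 1)" "\<psi> \<in> test_functions S" for v \<psi>
      using upto[OF S(1)] that unfolding weak_solution_upto_def weak_id_def by blast
    show ?thesis by (rule weak_imp_mild[OF wt wf xt xc xb ww uu f cont weak S(2)])
  qed
  have "sol \<phi> u0 x"
    unfolding sol_def using xt xp x0 xb xc xm by (simp add: x_def)
  then show ?thesis unfolding x_def[abs_def] .
qed

text \<open>Any weak solution for the same data agrees with u at all nonnegative times and almost
  everywhere on the history. Its segment may differ on a null set, but the equivalence class is the
  same, so the description in \<open>solution_map\<close> has a unique value.\<close>

lemma solution_map_eq:
  assumes u: "sol \<phi> u0 u" and p: "clean (rep \<Phi>) \<phi>" and t: "0 \<le> t"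
  shows "solution_map L \<mu> \<nu> \<alpha> f t (\<Phi>, u0) = (L2_rel L (1 + \<alpha>) (- \<mu>) 0 `` {\<lambda>s. u (t + s)}, u t)"
  unfolding solution_map_def fst_conv snd_conv
proof (rule the_equality)
  show "\<exists>v. weak_solution L \<mu> \<nu> \<alpha> f (rep \<Phi>) u0 v \<and>
     (L2_rel L (1 + \<alpha>) (- \<mu>) 0 `` {\<lambda>s. u (t + s)}, u t) = (L2_rel L (1 + \<alpha>) (- \<mu>) 0 `` {\<lambda>s. v (t + s)}, v t)"
    using sol_imp_weak[OF u p] by blast
  fix z assume "\<exists>v. weak_solution L \<mu> \<nu> \<alpha> f (rep \<Phi>) u0 v \<and> z = (L2_rel L (1 + \<alpha>) (- \<mu>) 0 `` {\<lambda>s. v (t + s)}, v t)"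
  then obtain v where v: "weak_solution L \<mu> \<nu> \<alpha> f (rep \<Phi>) u0 v" and z: "z = (L2_rel L (1 + \<alpha>) (- \<mu>) 0 `` {\<lambda>s. v (t + s)}, v t)"
    by blast
  have eq: "v s = u s" if "0 \<le> s" for s
    using sol_unique[OF weak_imp_sol[OF v p] u _ that] that by simp
  have "AE s in lborel. s \<in> {- \<mu><..<0} \<longrightarrow> v s = rep \<Phi> s"
    using v unfolding weak_solution_def weak_solution_upto_def by (auto simp: AE_lebesgue_on_iff dest!: spec[of _ 1])
  moreover have "AE s in lborel. s \<in> {- \<mu><..<0} \<longrightarrow> rep \<Phi> s = \<phi> s" using p by (simp add: clean_def)
  ultimately have "AE s in lborel. s \<in> {- \<mu><..<0} \<longrightarrow> v s = u s"
    by eventually_elim (use u in \<open>auto simp: sol_def\<close>)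
  from AE_lborel_translate[OF this, of t] have ae: "AE s in lborel. s \<in> {- \<mu><..<0} \<longrightarrow> v (t + s) = u (t + s)"
  proof eventually_elim
    case (elim s)
    show ?case using elim t by (cases "t + s < 0") (auto simp: eq)
  qed
  have "L2_rel L (1 + \<alpha>) (- \<mu>) 0 `` {\<lambda>s. v (t + s)} = L2_rel L (1 + \<alpha>) (- \<mu>) 0 `` {\<lambda>s. u (t + s)}"
    by (rule L2_class_eq[OF sol_L2[OF u t ae] sol_L2[OF u t] ae]) simp
  then show "z = (L2_rel L (1 + \<alpha>) (- \<mu>) 0 `` {\<lambda>s. u (t + s)}, u t)"
    unfolding z eq[OF t] by simp
qed

end

section \<open>The phase space and continuity of the solution map\<close>

context delayed_torus
begin

lemma vdist_nonneg: "0 \<le> vdist L s x y"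
  using L by (simp add: vdist_def vnorm_nonneg)

lemma past_diff_finite:
  assumes a: "clean p a" and b: "clean q b"
  shows "past (\<lambda>s. en L (1 + \<alpha>) (\<lambda>k. a s k - b s k)) < \<infinity>"
proof -
  have at: "traj L a" and bt: "traj L b" and ap: "past (\<lambda>s. en L (1 + \<alpha>) (a s)) < \<infinity>" and bp: "past (\<lambda>s. en L (1 + \<alpha>) (b s)) < \<infinity>"
    using a b by (auto simp: clean_def)
  note [measurable] = traj_en_measurable[OF at, of "1 + \<alpha>"] traj_en_measurable[OF bt, of "1 + \<alpha>"]
  let ?I = "\<lambda>s. indicator {- \<mu><..<0} s :: ennreal"
  have "past (\<lambda>s. en L (1 + \<alpha>) (\<lambda>k. a s k - b s k))
    \<le> (\<integral>\<^sup>+s. 2 * (en L (1 + \<alpha>) (a s) * ?I s) + 2 * (en L (1 + \<alpha>) (b s) * ?I s) \<partial>lborel)"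
    unfolding past_def
  proof (rule nn_integral_mono)
    fix s
    have "en L (1 + \<alpha>) (\<lambda>k. a s k - b s k) \<le> 2 * en L (1 + \<alpha>) (a s) + 2 * en L (1 + \<alpha>) (b s)"
      by (rule en_add_le) (rule norm_triangle_ineq4)
    then show "en L (1 + \<alpha>) (\<lambda>k. a s k - b s k) * ?I s \<le> 2 * (en L (1 + \<alpha>) (a s) * ?I s) + 2 * (en L (1 + \<alpha>) (b s) * ?I s)"
      by (cases "s \<in> {- \<mu><..<0}") simp_all
  qed
  also have "\<dots> = 2 * past (\<lambda>s. en L (1 + \<alpha>) (a s)) + 2 * past (\<lambda>s. en L (1 + \<alpha>) (b s))"
    unfolding past_def by (subst nn_integral_add, measurable, subst nn_integral_cmult, measurable, subst nn_integral_cmult, measurable)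
  also have "\<dots> < \<infinity>" using ap bp by (simp add: ennreal_mult_less_top)
  finally show ?thesis .
qed

text \<open>The distance between classes does not depend on the choice made by \<open>rep\<close>,
  since it can be computed from trajectories. The first form suits Minkowski's inequality, the
  second comparison with \<open>diff_energy\<close>.\<close>

lemma L2_dist_clean:
  assumes a: "clean (rep \<Phi>) a" and b: "clean (rep \<Psi>) b"
  shows "(\<integral>\<^sup>+t. ennreal ((indicator {- \<mu><..<0} t * vdist L (1 + \<alpha>) (a t) (b t))\<^sup>2) \<partial>lborel)
      = ennreal ((L2_dist L (1 + \<alpha>) (- \<mu>) 0 \<Phi> \<Psi>)\<^sup>2)"
    and "ennreal ((L2_dist L (1 + \<alpha>) (- \<mu>) 0 \<Phi> \<Psi>)\<^sup>2) = ennreal (L ^ 3) * past (\<lambda>s. en L (1 + \<alpha>) (\<lambda>k. a s k - b s k))"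
proof -
  let ?g = "\<lambda>t. (vdist L (1 + \<alpha>) (a t) (b t))\<^sup>2" and ?I = "\<lambda>t. indicator {- \<mu><..<0} t :: real"
  let ?e = "\<lambda>s. en L (1 + \<alpha>) (\<lambda>k. a s k - b s k)"
  have at: "traj L a" and bt: "traj L b" and aa: "AE t in lborel. t \<in> {- \<mu><..<0} \<longrightarrow> rep \<Phi> t = a t" and ab: "AE t in lborel. t \<in> {- \<mu><..<0} \<longrightarrow> rep \<Psi> t = b t"
    using a b by (auto simp: clean_def)
  note tab = traj_diff[OF at bt]
  have gm: "?g \<in> borel_measurable borel"
    unfolding vdist_def by (rule vnorm_measurable[OF L traj_measurable[OF tab]])
  note em = traj_en_measurable[OF tab, of "1 + \<alpha>"]
  note pf = past_diff_finite[OF a b]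
  have ae: "AE t in lborel. t \<in> {- \<mu><..<0} \<longrightarrow> (vdist L (1 + \<alpha>) (rep \<Phi> t) (rep \<Psi> t))\<^sup>2 = ?g t"
    using aa ab by eventually_elim simp
  have LI: "(LINT t|lebesgue_on {- \<mu><..<0}. (vdist L (1 + \<alpha>) (rep \<Phi> t) (rep \<Psi> t))\<^sup>2) = (LINT t|lborel. ?I t *\<^sub>R ?g t)"
    by (rule lebesgue_on_cong_AE(2)[OF _ gm ae]) simp
  have g0: "0 \<le> ?I t *\<^sub>R ?g t" for t by simp
  have Igm: "(\<lambda>t. ?I t *\<^sub>R ?g t) \<in> borel_measurable lborel" using gm by measurable
  have sq: "(L2_dist L (1 + \<alpha>) (- \<mu>) 0 \<Phi> \<Psi>)\<^sup>2 = (LINT t|lborel. ?I t *\<^sub>R ?g t)"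
    unfolding L2_dist_def LI by (rule real_sqrt_pow2) (rule Bochner_Integration.integral_nonneg[OF g0])
  have "AE t in lborel. ?e t * indicator {- \<mu><..<0} t \<noteq> \<infinity>"
    using pf em by (intro nn_integral_PInf_AE) (auto simp: past_def)
  then have ae2: "AE t in lborel. ennreal (?I t *\<^sub>R ?g t) = ennreal (L ^ 3) * (?e t * indicator {- \<mu><..<0} t)"
  proof eventually_elim
    case (elim t)
    show ?case
    proof (cases "t \<in> {- \<mu><..<0}")
      case True
      then have fin: "?e t < \<infinity>" using elim by (simp add: less_top)
      have "ennreal (L ^ 3) * ?e t = ennreal (?g t)"
        unfolding en_eq_vnorm[OF L fin] vdist_def using L by (subst ennreal_mult[symmetric]) auto
      then show ?thesis using True by simp
    qed simp
  qed
  have N: "(\<integral>\<^sup>+t. ennreal (?I t *\<^sub>R ?g t) \<partial>lborel) = ennreal (L ^ 3) * past ?e"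
  proof -
    have "(\<integral>\<^sup>+t. ennreal (?I t *\<^sub>R ?g t) \<partial>lborel) = (\<integral>\<^sup>+t. ennreal (L ^ 3) * (?e t * indicator {- \<mu><..<0} t) \<partial>lborel)"
      by (rule nn_integral_cong_AE[OF ae2])
    also have "\<dots> = ennreal (L ^ 3) * past ?e"
      unfolding past_def using em by (intro nn_integral_cmult borel_measurable_times_ennreal borel_measurable_indicator) simp_all
    finally show ?thesis .
  qed
  have Nf: "ennreal (L ^ 3) * past ?e < top" using pf by (simp add: ennreal_mult_less_top)
  have "(LINT t|lborel. ?I t *\<^sub>R ?g t) = enn2real (\<integral>\<^sup>+t. ennreal (?I t *\<^sub>R ?g t) \<partial>lborel)"
    by (rule integral_eq_nn_integral[OF Igm AE_I2[OF g0]])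
  then show 2: "ennreal ((L2_dist L (1 + \<alpha>) (- \<mu>) 0 \<Phi> \<Psi>)\<^sup>2) = ennreal (L ^ 3) * past ?e"
    unfolding sq N using ennreal_enn2real[OF Nf] by simp
  have "(?I t * vdist L (1 + \<alpha>) (a t) (b t))\<^sup>2 = ?I t *\<^sub>R ?g t" for t
    by (simp add: indicator_def)
  then show "(\<integral>\<^sup>+t. ennreal ((?I t * vdist L (1 + \<alpha>) (a t) (b t))\<^sup>2) \<partial>lborel) = ennreal ((L2_dist L (1 + \<alpha>) (- \<mu>) 0 \<Phi> \<Psi>)\<^sup>2)"
    unfolding 2 N[symmetric] by simp
qed

lemma L2_dist_nonneg: "0 \<le> L2_dist L s a b \<Phi> \<Psi>"
  by (simp add: L2_dist_def)

lemma L2_dist_commute: "L2_dist L s a b \<Phi> \<Psi> = L2_dist L s a b \<Psi> \<Phi>"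
  by (simp add: L2_dist_def vdist_commute)

lemma clean_AE_finite:
  assumes "clean p a"
  shows "AE t in lborel. t \<in> {- \<mu><..<0} \<longrightarrow> en L (1 + \<alpha>) (a t) < \<infinity>"
proof -
  have "AE t in lborel. en L (1 + \<alpha>) (a t) * indicator {- \<mu><..<0} t \<noteq> \<infinity>"
    using assms traj_en_measurable[of L a "1 + \<alpha>"] by (intro nn_integral_PInf_AE) (auto simp: past_def clean_def)
  then show ?thesis by eventually_elim (auto simp: less_top)
qed

lemma L2_dist_triangle:
  assumes a: "clean (rep \<Phi>) a" and b: "clean (rep \<Psi>) b" and c: "clean (rep \<Xi>) c"
  shows "L2_dist L (1 + \<alpha>) (- \<mu>) 0 \<Phi> \<Xi> \<le> L2_dist L (1 + \<alpha>) (- \<mu>) 0 \<Phi> \<Psi> + L2_dist L (1 + \<alpha>) (- \<mu>) 0 \<Psi> \<Xi>"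
proof -
  let ?d = "L2_dist L (1 + \<alpha>) (- \<mu>) 0"
  let ?v = "\<lambda>a b t. indicator {- \<mu><..<0} t * vdist L (1 + \<alpha>) (a t) (b t)"
  have vm: "?v x y \<in> borel_measurable lborel" if "clean p x" "clean q y" for p q x y
  proof -
    have "traj L (\<lambda>t k. x t k - y t k)" using that by (intro traj_diff) (auto simp: clean_def)
    then have [measurable]: "(\<lambda>t. (vnorm L (1 + \<alpha>) (\<lambda>k. x t k - y t k))\<^sup>2) \<in> borel_measurable borel"
      by (intro vnorm_measurable L traj_measurable)
    have "(\<lambda>t. indicator {- \<mu><..<0} t * sqrt ((vnorm L (1 + \<alpha>) (\<lambda>k. x t k - y t k))\<^sup>2)) \<in> borel_measurable borel"
      by measurable
    then show ?thesis using vdist_nonneg unfolding vdist_def by simp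
  qed
  have v0: "0 \<le> ?v x y t" for x y t by (simp add: vdist_nonneg)
  have "ennreal ((?d \<Phi> \<Xi>)\<^sup>2) = (\<integral>\<^sup>+t. ennreal ((?v a c t)\<^sup>2) \<partial>lborel)"
    by (rule L2_dist_clean(1)[OF a c, symmetric])
  also have "\<dots> \<le> (\<integral>\<^sup>+t. ennreal ((?v a b t + ?v b c t)\<^sup>2) \<partial>lborel)"
  proof (rule nn_integral_mono_AE)
    show "AE t in lborel. ennreal ((?v a c t)\<^sup>2) \<le> ennreal ((?v a b t + ?v b c t)\<^sup>2)"
      \<comment> \<open>The triangle inequality of \<open>vdist\<close> requires finite energies,
        which hold at almost every time.\<close>
      using clean_AE_finite[OF a] clean_AE_finite[OF b] clean_AE_finite[OF c]
    proof eventually_elim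
      case (elim t)
      have "?v a c t \<le> ?v a b t + ?v b c t"
      proof (cases "t \<in> {- \<mu><..<0}")
        case True
        then show ?thesis using vdist_triangle[OF L, of "1 + \<alpha>" "a t" "b t" "c t"] elim by simp
      qed simp
      then show ?case by (intro ennreal_leI power_mono v0)
    qed
  qed
  also have "\<dots> \<le> ennreal ((?d \<Phi> \<Psi> + ?d \<Psi> \<Xi>)\<^sup>2)"
    by (intro minkowski_nn_integral vm[OF a b] vm[OF b c] v0 L2_dist_nonneg
      eq_refl[OF L2_dist_clean(1)[OF a b]] eq_refl[OF L2_dist_clean(1)[OF b c]])
  finally have "(?d \<Phi> \<Xi>)\<^sup>2 \<le> (?d \<Phi> \<Psi> + ?d \<Psi> \<Xi>)\<^sup>2" by simp
  then show ?thesis by (rule power2_le_imp_le) (intro add_nonneg_nonneg L2_dist_nonneg)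
qed

lemma Y_dist_clean:
  assumes a: "clean (rep (fst y)) a" and b: "clean (rep (fst z)) b" and V: "snd y \<in> Vsp L \<alpha>" "snd z \<in> Vsp L \<alpha>"
  shows "ennreal ((Y_dist L \<mu> \<alpha> y z)\<^sup>2)
    = ennreal (L ^ 3) * (past (\<lambda>s. en L (1 + \<alpha>) (\<lambda>k. a s k - b s k)) + en L \<alpha> (\<lambda>k. snd y k - snd z k))"
proof -
  have fin: "en L \<alpha> (\<lambda>k. snd y k - snd z k) < \<infinity>"
    using V by (intro en_diff_finite) (auto simp: Vsp_iff)
  have 1: "ennreal ((vdist L \<alpha> (snd y) (snd z))\<^sup>2) = ennreal (L ^ 3) * en L \<alpha> (\<lambda>k. snd y k - snd z k)"
    unfolding en_eq_vnorm[OF L fin] vdist_def using L by (subst ennreal_mult[symmetric]) auto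
  have "(Y_dist L \<mu> \<alpha> y z)\<^sup>2 = (L2_dist L (1 + \<alpha>) (- \<mu>) 0 (fst y) (fst z))\<^sup>2 + (vdist L \<alpha> (snd y) (snd z))\<^sup>2"
    unfolding Y_dist_def by (rule real_sqrt_pow2) simp
  then have "ennreal ((Y_dist L \<mu> \<alpha> y z)\<^sup>2) = ennreal ((L2_dist L (1 + \<alpha>) (- \<mu>) 0 (fst y) (fst z))\<^sup>2) + ennreal ((vdist L \<alpha> (snd y) (snd z))\<^sup>2)"
    by (simp only: ennreal_plus zero_le_power2)
  then show ?thesis unfolding L2_dist_clean(2)[OF a b] 1 by (simp add: distrib_left)
qed

lemma Y_clean:
  assumes "y \<in> Y_space L \<mu> \<alpha>"
  shows "snd y \<in> Vsp L \<alpha>"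
    and "\<exists>p\<in>L2_fun L (1 + \<alpha>) (- \<mu>) 0. fst y = L2_rel L (1 + \<alpha>) (- \<mu>) 0 `` {p}"
    and "\<exists>\<phi>. traj L \<phi> \<and> (\<integral>\<^sup>+t. en L (1 + \<alpha>) (\<phi> t) \<partial>lborel) < \<infinity> \<and> clean (rep (fst y)) \<phi>"
proof -
  have y: "fst y \<in> L2_fun L (1 + \<alpha>) (- \<mu>) 0 // L2_rel L (1 + \<alpha>) (- \<mu>) 0" "snd y \<in> Vsp L \<alpha>"
    using assms unfolding Y_space_def L2_space_def by (simp_all add: mem_Times_iff)
  show "snd y \<in> Vsp L \<alpha>" by (rule y(2))
  from y(1) obtain p where p: "p \<in> L2_fun L (1 + \<alpha>) (- \<mu>) 0" "fst y = L2_rel L (1 + \<alpha>) (- \<mu>) 0 `` {p}"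
    by (rule quotientE)
  then show "\<exists>p\<in>L2_fun L (1 + \<alpha>) (- \<mu>) 0. fst y = L2_rel L (1 + \<alpha>) (- \<mu>) 0 `` {p}" by blast
  have "rep (fst y) \<in> L2_fun L (1 + \<alpha>) (- \<mu>) 0" unfolding p(2) by (rule L2_class_rep(1)[OF p(1)])
  from L2_fun_clean[OF L this] obtain \<phi> where \<phi>: "traj L \<phi>" "AE t in lborel. t \<in> {- \<mu><..<0} \<longrightarrow> rep (fst y) t = \<phi> t"
    "(\<integral>\<^sup>+t. en L (1 + \<alpha>) (\<phi> t) \<partial>lborel) < \<infinity>" by blast
  have "past (\<lambda>s. en L (1 + \<alpha>) (\<phi> s)) \<le> (\<integral>\<^sup>+t. en L (1 + \<alpha>) (\<phi> t) \<partial>lborel)"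
    unfolding past_def by (intro nn_integral_mono) (auto simp: indicator_def)
  then have "clean (rep (fst y)) \<phi>" unfolding clean_def using \<phi> by (auto elim: le_less_trans)
  then show "\<exists>\<phi>. traj L \<phi> \<and> (\<integral>\<^sup>+t. en L (1 + \<alpha>) (\<phi> t) \<partial>lborel) < \<infinity> \<and> clean (rep (fst y)) \<phi>" using \<phi> by blast
qed

text \<open>Justifies reading \<open>Y_topology\<close> through distances. Separation is the
  delicate axiom: zero distance gives representatives equal almost everywhere, from which equality
  of the classes is recovered.\<close>

lemma Y_metric: "Metric_space (Y_space L \<mu> \<alpha>) (Y_dist L \<mu> \<alpha>)"
proof
  let ?Y = "Y_space L \<mu> \<alpha>" and ?d = "Y_dist L \<mu> \<alpha>"
  have z: "en L s (\<lambda>k. 0) = 0" for s by (simp add: en_zero_iff[OF L])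
  show "0 \<le> ?d x y" for x y by (simp add: Y_dist_def)
  show "?d x y = ?d y x" for x y
    unfolding Y_dist_def L2_dist_commute[of _ _ _ "fst x"] vdist_commute[of _ _ "snd x"] ..
  show "?d x y = 0 \<longleftrightarrow> x = y" if x: "x \<in> ?Y" and y: "y \<in> ?Y" for x y
  proof
    obtain a b where a: "clean (rep (fst x)) a" and b: "clean (rep (fst y)) b" using Y_clean(3)[OF x] Y_clean(3)[OF y] by blast
    have at: "traj L a" and bt: "traj L b" and aa: "AE t in lborel. t \<in> {- \<mu><..<0} \<longrightarrow> rep (fst x) t = a t" and ab: "AE t in lborel. t \<in> {- \<mu><..<0} \<longrightarrow> rep (fst y) t = b t"
      using a b by (auto simp: clean_def)
    assume "?d x y = 0"
    then have "ennreal (L ^ 3) * (past (\<lambda>s. en L (1 + \<alpha>) (\<lambda>k. a s k - b s k)) + en L \<alpha> (\<lambda>k. snd x k - snd y k)) = 0"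
      using Y_dist_clean[OF a b Y_clean(1)[OF x] Y_clean(1)[OF y]] by simp
    then have e: "past (\<lambda>s. en L (1 + \<alpha>) (\<lambda>k. a s k - b s k)) = 0" "en L \<alpha> (\<lambda>k. snd x k - snd y k) = 0"
      using L by simp_all
    have sx: "snd x \<in> solenoidal L" and sy: "snd y \<in> solenoidal L" using Y_clean(1)[OF x] Y_clean(1)[OF y] by (auto simp: Vsp_iff)
    have s: "snd x = snd y"
      using en_diff_eq_0[OF traj_const[OF sx] traj_const[OF sy] e(2)] .
    have "AE t in lborel. en L (1 + \<alpha>) (\<lambda>k. a t k - b t k) * indicator {- \<mu><..<0} t = 0"
      using e(1) traj_en_measurable[OF traj_diff[OF at bt], of "1 + \<alpha>"] unfolding past_def
      by (subst (asm) nn_integral_0_iff_AE) auto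
    then have ae: "AE t in lborel. t \<in> {- \<mu><..<0} \<longrightarrow> rep (fst x) t = rep (fst y) t"
      using aa ab
    proof eventually_elim
      case (elim t)
      then show ?case using en_diff_eq_0[OF at bt, of "1 + \<alpha>" t] by auto
    qed
    obtain p q where p: "p \<in> L2_fun L (1 + \<alpha>) (- \<mu>) 0" "fst x = L2_rel L (1 + \<alpha>) (- \<mu>) 0 `` {p}"
      and q: "q \<in> L2_fun L (1 + \<alpha>) (- \<mu>) 0" "fst y = L2_rel L (1 + \<alpha>) (- \<mu>) 0 `` {q}"
      using Y_clean(2)[OF x] Y_clean(2)[OF y] by blast
    have "AE t in lborel. t \<in> {- \<mu><..<0} \<longrightarrow> p t = q t"
      using ae L2_class_rep(2)[OF p(1)] L2_class_rep(2)[OF q(1)] unfolding p(2) q(2) by eventually_elim auto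
    from L2_class_eq[OF p(1) q(1) this] have "fst x = fst y" unfolding p(2) q(2) .
    with s show "x = y" by (simp add: prod_eq_iff)
  next
    assume xy: "x = y"
    obtain a where a: "clean (rep (fst x)) a" using Y_clean(3)[OF x] by blast
    have "ennreal ((?d x x)\<^sup>2) = 0"
      using Y_dist_clean[OF a a Y_clean(1)[OF x] Y_clean(1)[OF x]] by (simp add: z past_def)
    then have "(?d x x)\<^sup>2 \<le> 0" by (simp only: ennreal_eq_0_iff)
    then show "?d x y = 0" unfolding xy[symmetric] by simp
  qed
  show "?d x w \<le> ?d x y + ?d y w" if x: "x \<in> ?Y" and y: "y \<in> ?Y" and w: "w \<in> ?Y" for x y w
  proof -
    obtain a b c where a: "clean (rep (fst x)) a" and b: "clean (rep (fst y)) b" and c: "clean (rep (fst w)) c"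
      using Y_clean(3)[OF x] Y_clean(3)[OF y] Y_clean(3)[OF w] by blast
    note V = Y_clean(1)[OF x] Y_clean(1)[OF y] Y_clean(1)[OF w]
    have v: "vdist L \<alpha> (snd x) (snd w) \<le> vdist L \<alpha> (snd x) (snd y) + vdist L \<alpha> (snd y) (snd w)"
      using V by (intro vdist_triangle L) (auto simp: Vsp_iff)
    show ?thesis
      unfolding Y_dist_def
      by (rule order_trans[OF real_sqrt_le_mono real_sqrt_sum_squares_triangle_ineq])
        (intro add_mono power_mono L2_dist_triangle[OF a b c] v L2_dist_nonneg vdist_nonneg)
  qed
qed

lemma solution_state:
  assumes y: "y \<in> Y_space L \<mu> \<alpha>" and t: "0 \<le> t"
  shows "\<exists>\<phi> u. clean (rep (fst y)) \<phi> \<and> sol \<phi> (snd y) u \<and> solution_map L \<mu> \<nu> \<alpha> f t y \<in> Y_space L \<mu> \<alpha> \<and>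
    clean (rep (fst (solution_map L \<mu> \<nu> \<alpha> f t y))) (\<lambda>s. u (t + s)) \<and> snd (solution_map L \<mu> \<nu> \<alpha> f t y) = u t"
proof -
  obtain \<phi> where \<phi>: "traj L \<phi>" "(\<integral>\<^sup>+t. en L (1 + \<alpha>) (\<phi> t) \<partial>lborel) < \<infinity>" and c: "clean (rep (fst y)) \<phi>"
    using Y_clean(3)[OF y] by blast
  obtain u where u: "sol \<phi> (snd y) u" using sol_exists[OF \<phi> Y_clean(1)[OF y]] by blast
  have ut: "traj L u" and up: "past (\<lambda>s. en L (1 + \<alpha>) (u s)) < \<infinity>" and uc: "\<And>T. cumul (\<lambda>s. en L (1 + \<alpha>) (u s)) T < \<infinity>" and ub: "bdd u t"
    using u unfolding sol_def by blast+
  let ?c = "L2_rel L (1 + \<alpha>) (- \<mu>) 0 `` {\<lambda>s. u (t + s)}"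
  have S: "solution_map L \<mu> \<nu> \<alpha> f t y = (?c, u t)"
    using solution_map_eq[of \<phi> "snd y" u "fst y" t, OF u c t] by simp
  have L2: "(\<lambda>s. u (t + s)) \<in> L2_fun L (1 + \<alpha>) (- \<mu>) 0" by (rule sol_L2[OF u t]) simp
  have V: "u t \<in> Vsp L \<alpha>" using ut bdd_finite[OF ub t order_refl] by (simp add: Vsp_iff traj_def)
  have "past (\<lambda>s. en L (1 + \<alpha>) (u (t + s))) = (\<integral>\<^sup>+r. en L (1 + \<alpha>) (u r) * indicator {t + - \<mu><..<t + 0} r \<partial>lborel)"
    unfolding past_def by (rule nn_integral_window[OF traj_en_measurable[OF ut]])
  also have "\<dots> \<le> past (\<lambda>s. en L (1 + \<alpha>) (u s)) + cumul (\<lambda>s. en L (1 + \<alpha>) (u s)) (t + 0)"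
    by (rule window_le[OF traj_en_measurable[OF ut]]) (use t in simp)
  also have "\<dots> < \<infinity>" using up uc by simp
  finally have P: "past (\<lambda>s. en L (1 + \<alpha>) (u (t + s))) < \<infinity>" .
  have tt: "traj L (\<lambda>s. u (t + s))" by (rule traj_compose[OF ut]) measurable
  have "clean (rep ?c) (\<lambda>s. u (t + s))"
    unfolding clean_def using tt P L2_class_rep(2)[OF L2] by blast
  moreover have "(?c, u t) \<in> Y_space L \<mu> \<alpha>"
    unfolding Y_space_def L2_space_def using quotientI[OF L2] V by blast
  ultimately show ?thesis using u c unfolding S by auto
qed

text \<open>The map is shown to be Lipschitz near each state z, with a constant taken from
  \<open>delay_stability\<close> for the solution starting at z.\<close>

lemma solution_map_continuous:
  assumes t: "0 \<le> t"
  shows "continuous_map (Y_topology L \<mu> \<alpha>) (Y_topology L \<mu> \<alpha>) (solution_map L \<mu> \<nu> \<alpha> f t)"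
  unfolding Y_topology_def
proof (rule iffD2[OF Metric_space.metric_continuous_map[OF Y_metric Y_metric]], intro conjI ballI allI impI)
  let ?Y = "Y_space L \<mu> \<alpha>" and ?d = "Y_dist L \<mu> \<alpha>" and ?S = "solution_map L \<mu> \<nu> \<alpha> f t"
  show "?S ` ?Y \<subseteq> ?Y" using solution_state[OF _ t] by blast
  fix z and \<epsilon> :: real assume z: "z \<in> ?Y" and \<epsilon>: "\<epsilon> > 0"
  obtain \<psi> v where c\<psi>: "clean (rep (fst z)) \<psi>" and v: "sol \<psi> (snd z) v" and Sz: "?S z \<in> ?Y"
    and cv: "clean (rep (fst (?S z))) (\<lambda>s. v (t + s))" and sv: "snd (?S z) = v t"
    using solution_state[OF z t] by blast
  obtain m where "t / \<mu> \<le> real m" using real_arch_simple by blast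
  then have m: "t \<le> real m * \<mu>" using mu by (simp add: pos_divide_le_eq)
  obtain K where K: "K \<ge> 0" and st: "\<And>\<phi> u0 u. sol \<phi> u0 u \<Longrightarrow> diff_energy u v \<le> 1 \<Longrightarrow>
     (\<forall>t. 0 \<le> t \<longrightarrow> t \<le> real m * \<mu> \<longrightarrow> en L \<alpha> (\<lambda>k. u t k - v t k) \<le> ennreal K * diff_energy u v) \<and>
     cumul (\<lambda>s. en L (1 + \<alpha>) (\<lambda>k. u s k - v s k)) (real m * \<mu>) \<le> ennreal K * diff_energy u v"
    using delay_stability[OF v, of m] by blast
  have kk: "ennreal (1 + 2 * K) = 1 + (ennreal K + ennreal K)"
  proof -
    have e: "1 + 2 * K = 1 + (K + K)" by simp
    show ?thesis unfolding e using K by (simp only: ennreal_plus add_nonneg_nonneg zero_le_one ennreal_1)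
  qed
  \<comment> \<open>In squared distances the final segment contributes \<open>1 + K\<close>, history
    included, and the final value contributes K.\<close>
  define Q where "Q = sqrt (1 + 2 * K)"
  have Q: "Q > 0" "Q\<^sup>2 = 1 + 2 * K" using K by (simp_all add: Q_def)
  \<comment> \<open>Distance at most \<open>sqrt (L ^ 3)\<close> means \<open>diff_energy\<close> at
    most 1, the range in which K is valid; the second entry is \<epsilon> divided by the Lipschitz
    constant.\<close>
  define \<delta> where "\<delta> = min (sqrt (L ^ 3)) (\<epsilon> / Q)"
  have lip: "?d (?S z) (?S y) < \<epsilon>" if y: "y \<in> ?Y" and small: "?d z y < \<delta>" for y
  proof -
    obtain \<phi> u where c\<phi>: "clean (rep (fst y)) \<phi>" and u: "sol \<phi> (snd y) u" and Sy: "?S y \<in> ?Y"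
      and cu: "clean (rep (fst (?S y))) (\<lambda>s. u (t + s))" and su: "snd (?S y) = u t"
      using solution_state[OF y t] by blast
    let ?h = "\<lambda>s. en L (1 + \<alpha>) (\<lambda>k. u s k - v s k)" and ?E = "diff_energy u v"
    have d0: "0 \<le> ?d x w" for x w by (rule Metric_space.nonneg[OF Y_metric])
    have dc: "?d x w = ?d w x" for x w by (rule Metric_space.commute[OF Y_metric])
    have ut: "traj L u" and vt: "traj L v" using u v unfolding sol_def by blast+
    have hm: "?h \<in> borel_measurable borel" by (rule traj_en_measurable[OF traj_diff[OF ut vt]])
    have neg: "u s = \<phi> s" "v s = \<psi> s" if "s < 0" for s using u v that unfolding sol_def by blast+
    have u0: "u 0 = snd y" "v 0 = snd z" using u v unfolding sol_def by blast+
    have pe: "past (\<lambda>s. en L (1 + \<alpha>) (\<lambda>k. \<phi> s k - \<psi> s k)) = past ?h"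
      unfolding past_def by (intro nn_integral_cong) (auto simp: indicator_def neg)
    have dE: "ennreal ((?d y z)\<^sup>2) = ennreal (L ^ 3) * ?E"
      unfolding diff_energy_def u0 pe[symmetric] by (rule Y_dist_clean[OF c\<phi> c\<psi> Y_clean(1)[OF y] Y_clean(1)[OF z]])
    have "?d y z \<le> sqrt (L ^ 3)" using small dc[of z y] by (simp add: \<delta>_def)
    then have "(?d y z)\<^sup>2 \<le> (sqrt (L ^ 3))\<^sup>2" by (rule power_mono) (rule d0)
    also have "\<dots> = L ^ 3" using L by simp
    finally have "ennreal (L ^ 3) * ?E \<le> ennreal (L ^ 3) * 1"
      unfolding dE[symmetric] by (simp add: ennreal_leI)
    moreover have "ennreal (L ^ 3) \<noteq> 0" "ennreal (L ^ 3) \<noteq> top" using L by simp_all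
    ultimately have E1: "?E \<le> 1" using ennreal_mult_le_mult_iff by blast
    have s1: "en L \<alpha> (\<lambda>k. u t k - v t k) \<le> ennreal K * ?E" and s2: "cumul ?h (real m * \<mu>) \<le> ennreal K * ?E"
      using st[OF u E1] t m by blast+
    have "past (\<lambda>s. ?h (t + s)) = (\<integral>\<^sup>+r. ?h r * indicator {t + - \<mu><..<t + 0} r \<partial>lborel)"
      unfolding past_def by (rule nn_integral_window[OF hm])
    \<comment> \<open>The window \<open>(t - \<mu>, t)\<close> is covered, up to the single point 0,
      by the old history and \<open>(0, t)\<close>. For t below the delay the new segment still
      contains a piece of the old one.\<close>
    also have "\<dots> \<le> past ?h + cumul ?h (t + 0)" by (rule window_le[OF hm]) (use t in simp)
    also have "\<dots> \<le> ?E + ennreal K * ?E"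
      using m by (intro add_mono order_trans[OF cumul_mono s2]) (simp_all add: diff_energy_def)
    finally have p: "past (\<lambda>s. ?h (t + s)) \<le> ?E + ennreal K * ?E" .
    have "ennreal ((?d (?S y) (?S z))\<^sup>2) = ennreal (L ^ 3) * (past (\<lambda>s. ?h (t + s)) + en L \<alpha> (\<lambda>k. u t k - v t k))"
      using Y_dist_clean[OF cu cv Y_clean(1)[OF Sy] Y_clean(1)[OF Sz]] by (simp only: su sv)
    also have "\<dots> \<le> ennreal (L ^ 3) * ((?E + ennreal K * ?E) + ennreal K * ?E)"
      by (intro mult_left_mono add_mono p s1) simp
    also have "(?E + ennreal K * ?E) + ennreal K * ?E = ennreal (1 + 2 * K) * ?E"
      unfolding kk by (simp only: distrib_right mult_1 add.assoc)
    also have "ennreal (L ^ 3) * (ennreal (1 + 2 * K) * ?E) = ennreal (1 + 2 * K) * ennreal ((?d y z)\<^sup>2)"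
      unfolding dE by (rule mult.left_commute)
    also have "\<dots> = ennreal ((1 + 2 * K) * (?d y z)\<^sup>2)"
      using K by (intro ennreal_mult[symmetric]) simp_all
    finally have "(?d (?S y) (?S z))\<^sup>2 \<le> (1 + 2 * K) * (?d y z)\<^sup>2"
      using K by (subst (asm) ennreal_le_iff) simp_all
    then have "(?d (?S y) (?S z))\<^sup>2 \<le> (Q * ?d y z)\<^sup>2" by (simp only: power_mult_distrib Q(2))
    then have "?d (?S y) (?S z) \<le> Q * ?d y z"
      by (rule power2_le_imp_le) (intro mult_nonneg_nonneg d0 less_imp_le Q(1))
    also have "\<dots> < \<epsilon>"
    proof -
      have "?d y z < \<epsilon> / Q" using small dc[of z y] by (simp add: \<delta>_def)
      then show ?thesis using Q(1) by (simp add: pos_less_divide_eq mult.commute)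
    qed
    finally show ?thesis using dc[of "?S z"] by simp
  qed
  have "\<delta> > 0" using L \<epsilon> Q(1) by (simp add: \<delta>_def)
  then show "\<exists>\<delta>>0. \<forall>y. y \<in> ?Y \<and> ?d z y < \<delta> \<longrightarrow> ?d (?S z) (?S y) < \<epsilon>"
    using lip by blast
qed

end

theorem lemma5p3:
  fixes L \<mu> \<nu> \<alpha> :: real and f :: field
  assumes "L > 0" and "\<mu> > 0" and "\<nu> > 0" and "\<alpha> > 1/2"
    and "f \<in> Vsp L (\<alpha> - 1)"
  shows "\<forall>t\<ge>0. continuous_map (Y_topology L \<mu> \<alpha>) (Y_topology L \<mu> \<alpha>)
           (solution_map L \<mu> \<nu> \<alpha> f t)"
proof (intro allI impI)
  fix t :: real assume t: "0 \<le> t"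
  interpret delayed_torus L \<nu> \<alpha> \<mu> f
    by unfold_locales (use assms in simp_all)
  show "continuous_map (Y_topology L \<mu> \<alpha>) (Y_topology L \<mu> \<alpha>) (solution_map L \<mu> \<nu> \<alpha> f t)"
    by (rule solution_map_continuous[OF t])
qed

end
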